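(* Let $b\ge 0$ and $\rho\in(0,1)$. For all $x<b$ and all $\delta\in\mathbb{C}_+\setminus Sp(-Q)$, $$\sum_{i=1}^m\eta_{\delta,i}\,\Phi_i(x)=h_\delta(x),$$ where $\Phi_i(x)=E_x(\rho^{\tau}\mathbf 1_{G_i})$ with $\tau=\tau_b=\inf\{k\in\mathbb{N}_0:X_k\ge b\}$ (the integrand being $0$ on $\{\tau=\infty\}$), and where, with $\alpha_\delta=\rho\,\alpha(-\delta I-Q)^{-1}e^{(\delta I+Q)b+\psi_2(-Q)}$, $$h_\delta(x)=e^{\delta x}\mathbf 1_{\{x\ge b\}}+\alpha_\delta e^{\phi(-\lambda Q)}\sum_{n=1}^\infty e^{-x\lambda^nQ-\phi(-\lambda^nQ)}\rho^{n-1}\,q,$$ $$\eta_{\delta,i}=e^{\delta b}\Big(e_i+\alpha\, e^{Qb+\psi_2(-Q)+\phi(-\lambda Q)}\sum_{n=1}^\infty e^{-b\lambda^nQ-\phi(-\lambda^nQ)+\psi^i(-\lambda^nQ)}\rho^n\Big)(-\delta I-Q)^{-1}q .$$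
   Context: $\mathbb{N}=\{1,2,\dots\}$, $\mathbb{N}_0=\mathbb{N}\cup\{0\}$, $\mathbb{C}_+=\{z\in\mathbb{C}:\Re z\ge0\}$, $Sp(\cdot)$ is the spectrum (set of eigenvalues) of a matrix, $I$ the $m\times m$ identity, $e_i$ the $i$-th unit (row) vector. Phasetype distributions: let $m\in\mathbb{N}$, $E=\{1,\dots,m\}$, $\Delta=m+1$, and consider continuous-time Markov chains on $E\cup\{\Delta\}$ in which $1,\dots,m$ are transient and $\Delta$ is absorbing, with generator $\hat Q=\begin{pmatrix}Q&-Q\mathbf 1\\0&0\end{pmatrix}$, where $Q$ is an $m\times m$ matrix and $\mathbf 1$ is the all-ones column vector; put $q=-Q\mathbf 1$. For a probability row vector $\alpha$, $PH(Q,\alpha)$ denotes the distribution of the absorption time $\inf\{t\ge0:J_t=\Delta\}$ of such a chain started with initial distribution $(\alpha,0)$. Process: let $0<\lambda<1$ and $X_n=\lambda X_{n-1}+Z_n$, $n\in\mathbb{N}$, where the innovations $Z_n=S_n-T_n$ are i.i.d., $S_n,T_n\ge 0$ are independent, $S_n$ is $PH(Q,\alpha)$-distributed and $T_n$ has an arbitrary distribution on $[0,\infty)$ subject to $E(\log(1+|Z_1|))<\infty$. $P_x,E_x$ refer to $X_0=x$. For each $n$ let $S_n$ be realized as the absorption time of a Markov chain $(J^{(n)}_t)_{t\ge0}$ with generator $\hat Q$ and initial distribution $(\alpha,0)$; the chains $J^{(n)}$ and the variables $T_n$, $n\in\mathbb{N}$, are all independent, the $J^{(n)}$ being identically distributed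 and the $T_n$ being identically distributed. Embedding: for $t\ge0$ put $n_t=\max\{n\in\mathbb{N}_0:\sum_{k=1}^nS_k\le t\}$, $J_t=J^{(n_t+1)}_{t-\sum_{k=1}^{n_t}S_k}$, $Y_t=\lambda X_{n_t}-T_{n_t+1}+t-\sum_{k=1}^{n_t}S_k$, $\hat\tau=\inf\{t\ge0:Y_t\ge b\}$, and $G_i=\{\hat\tau<\infty,\ J_{\hat\tau}=i\}$ for $i\in E$. Standing assumption: $Sp(\lambda^nQ)\cap Sp(Q)=\emptyset$ for all $n\in\mathbb{N}$. Transforms: $e^{\psi_1(u)}=\alpha(-uI-Q)^{-1}q$ (the rational extension of $E(e^{uS_1})$), $e^{\psi_2(u)}=E(e^{-uT_1})$ for $u\in\mathbb{C}_+$, $\psi=\psi_1+\psi_2$ on $\mathbb{C}_+\setminus Sp(-Q)$, $\phi(u)=\sum_{k=0}^\infty\psi(\lambda^ku)$, i.e. $e^{\phi(u)}=\prod_{k=0}^\infty e^{\psi_1(\lambda^ku)}e^{\psi_2(\lambda^ku)}$, for $u\in\mathbb{C}_+\setminus\bigcup_{n\in\mathbb{N}_0}Sp(-\lambda^{-n}Q)$, and $e^{\psi^i(u)}=e_i(-uI-Q)^{-1}q$ (the extension of the transform of $PH(Q,e_i)$). Functions of matrices are understood via the holomorphic functional calculus; e.g. $e^{\psi_2(-Q)}=E(e^{QT_1})$, and $e^{-\phi(M)}$ is $1/e^{\phi}$ applied to $M$. It is presupposed that $\phi$ is defined at the matrices where it is evaluated, i.e. that $e^{\phi}$ does not vanish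 at the eigenvalues of $-\lambda^nQ$, $n\in\mathbb{N}$. *)

theory Defs
  imports "HOL-Complex_Analysis.Complex_Analysis" "HOL-Probability.Probability"
begin

section \<open>Matrices\<close>

text \<open>
  The index set \<open>{1,...,m}\<close> is a finite type \<open>'m\<close>. On the type \<open>'a^'m^'m\<close> the overloaded
  \<open>*\<close>, \<open>^\<close> and \<open>1\<close> are componentwise, so powers are taken with respect to \<open>**\<close>.
\<close>

primrec mat_pow :: "'a::semiring_1^'s^'s \<Rightarrow> nat \<Rightarrow> 'a^'s^'s" where
  "mat_pow A 0 = mat 1"
| "mat_pow A (Suc n) = A ** mat_pow A n"

definition mat_exp :: "real^'s^'s \<Rightarrow> real^'s^'s" where
  "mat_exp A = (\<Sum>n. (1 / fact n) *\<^sub>R mat_pow A n)"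

definition cmat :: "real^'s^'s \<Rightarrow> complex^'s^'s" where
  "cmat A = map_matrix complex_of_real A"

definition cvec :: "real^'s \<Rightarrow> complex^'s" where
  "cvec v = (\<chi> i. complex_of_real (v $ i))"

definition Sp :: "complex^'s^'s \<Rightarrow> complex set" where
  "Sp A = {z. \<exists>v. v \<noteq> 0 \<and> A *v v = z *s v}"

text \<open>
  Holomorphic functional calculus: \<open>f(A)\<close> is the Cauchy integral
  \<open>1/(2 \<pi> \<i>) \<integral> f(z) (z I - A)\<^sup>-\<^sup>1 dz\<close> (entrywise) over a contour surrounding the spectrum of \<open>A\<close>
  inside a domain on which \<open>f\<close> is holomorphic. The contour consists of one small positively
  oriented circle around every eigenvalue; \<^const>\<open>residue\<close> is by definition
  \<open>1/(2 \<pi> \<i>)\<close> times the integral over all sufficiently small such circles.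
\<close>

definition fun_calc :: "(complex \<Rightarrow> complex) \<Rightarrow> complex^'s^'s \<Rightarrow> complex^'s^'s" where
  "fun_calc f A = (\<chi> i j. \<Sum>\<mu>\<in>Sp A. residue (\<lambda>z. f z * matrix_inv (mat z - A) $ i $ j) \<mu>)"

section \<open>Markov chains and phasetype times\<close>

definition is_generator :: "real^'s^'s \<Rightarrow> bool" where
  "is_generator A \<longleftrightarrow> (\<forall>i j. i \<noteq> j \<longrightarrow> 0 \<le> A $ i $ j) \<and> (\<forall>i. (\<Sum>j\<in>UNIV. A $ i $ j) = 0)"

definition markov_chain ::
  "'w measure \<Rightarrow> (real \<Rightarrow> 'w \<Rightarrow> 's::finite) \<Rightarrow> real^'s^'s \<Rightarrow> ('s \<Rightarrow> real) \<Rightarrow> bool" where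
  "markov_chain M K A \<mu> \<longleftrightarrow>
     is_generator A \<and>
     (\<forall>t\<ge>0. K t \<in> measurable M (count_space UNIV)) \<and>
     (\<forall>w\<in>space M. \<forall>t\<ge>0. \<forall>\<^sub>F s in at_right t. K s w = K t w) \<and>
     (\<forall>n t s. t 0 = 0 \<and> (\<forall>k<n. t k \<le> t (Suc k)) \<longrightarrow>
        measure M {w\<in>space M. \<forall>k\<le>n. K (t k) w = s k} =
        \<mu> (s 0) * (\<Prod>k<n. mat_exp ((t (Suc k) - t k) *\<^sub>R A) $ s k $ s (Suc k)))"

text \<open>
  A state \<open>i\<close> is transient if the chain started in \<open>i\<close> almost surely visits \<open>i\<close> only in a bounded set
  of times. The law of a right-continuous chain is determined by its generator and initial state,
  and the path space \<open>real \<Rightarrow> 's\<close> carries a realization of it, so the existential quantifier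
  over realizations on that space is no restriction.
\<close>

definition transient_state :: "real^'s^'s \<Rightarrow> 's::finite \<Rightarrow> bool" where
  "transient_state A i \<longleftrightarrow>
     (\<exists>(N :: (real \<Rightarrow> 's) measure) K. prob_space N \<and>
        markov_chain N K A (\<lambda>j. if j = i then 1 else 0) \<and>
        (AE w in N. bounded {t. 0 \<le> t \<and> K t w = i}))"

text \<open>In \<open>'m option\<close> the value \<^const>\<open>None\<close> is the absorbing state \<open>\<Delta>\<close>.\<close>

definition exit_rates :: "real^'m^'m \<Rightarrow> real^'m" where
  "exit_rates Q = - (Q *v (\<chi> i. 1))"

definition gen_hat :: "real^'m^'m \<Rightarrow> real^('m option)^('m::finite option)" where
  "gen_hat Q = (\<chi> i j. case i of None \<Rightarrow> 0
     | Some k \<Rightarrow> (case j of None \<Rightarrow> exit_rates Q $ k | Some l \<Rightarrow> Q $ k $ l))"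

definition init_hat :: "real^'m \<Rightarrow> 'm option \<Rightarrow> real" where
  "init_hat \<alpha> j = (case j of None \<Rightarrow> 0 | Some i \<Rightarrow> \<alpha> $ i)"

text \<open>
  Under transience the chain is absorbed almost surely; on the null event where it is not, the
  infimum is infinite and the real value is set to \<open>0\<close>.
\<close>

definition absorption_time :: "(real \<Rightarrow> 'w \<Rightarrow> 'm option) \<Rightarrow> 'w \<Rightarrow> real" where
  "absorption_time K w =
     (if \<exists>t\<ge>0. K t w = None then Inf {t. 0 \<le> t \<and> K t w = None} else 0)"

definition chain_events :: "'w measure \<Rightarrow> (real \<Rightarrow> 'w \<Rightarrow> 's) \<Rightarrow> 'w set set" where
  "chain_events M K =
     sets (vimage_algebra (space M) (\<lambda>w. \<lambda>t\<in>{0..}. K t w) (PiM {0..} (\<lambda>_. count_space UNIV)))"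

definition rv_events :: "'w measure \<Rightarrow> ('w \<Rightarrow> real) \<Rightarrow> 'w set set" where
  "rv_events M Z = sets (vimage_algebra (space M) Z borel)"

section \<open>The autoregressive process and its embedding\<close>

text \<open>
  The innovations are \<open>Z n = S n - T n\<close> for \<open>n \<ge> 1\<close>, where \<open>S n\<close> is the absorption time of the chain
  \<open>J n\<close>; the values of \<open>J\<close> and \<open>T\<close> at index \<open>0\<close> are not used. The
  autoregression coefficient is called \<open>l\<close>. Being a function of the starting value
  \<open>x\<close>, the process is defined for all \<open>x\<close> on the same probability space.
\<close>

primrec ar_process ::
  "real \<Rightarrow> (nat \<Rightarrow> real \<Rightarrow> 'w \<Rightarrow> 'm option) \<Rightarrow> (nat \<Rightarrow> 'w \<Rightarrow> real) \<Rightarrow> real \<Rightarrow> nat \<Rightarrow> 'w \<Rightarrow> real" where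
  "ar_process l J T x 0 w = x"
| "ar_process l J T x (Suc n) w =
     l * ar_process l J T x n w + (absorption_time (J (Suc n)) w - T (Suc n) w)"

definition partial_time :: "(nat \<Rightarrow> real \<Rightarrow> 'w \<Rightarrow> 'm option) \<Rightarrow> nat \<Rightarrow> 'w \<Rightarrow> real" where
  "partial_time J n w = (\<Sum>k=1..n. absorption_time (J k) w)"

definition step_index :: "(nat \<Rightarrow> real \<Rightarrow> 'w \<Rightarrow> 'm option) \<Rightarrow> real \<Rightarrow> 'w \<Rightarrow> nat" where
  "step_index J t w = Max {n. partial_time J n w \<le> t}"

definition embedded_phase ::
  "(nat \<Rightarrow> real \<Rightarrow> 'w \<Rightarrow> 'm option) \<Rightarrow> real \<Rightarrow> 'w \<Rightarrow> 'm option" where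
  "embedded_phase J t w =
     (let n = step_index J t w in J (Suc n) (t - partial_time J n w) w)"

definition embedded_level ::
  "real \<Rightarrow> (nat \<Rightarrow> real \<Rightarrow> 'w \<Rightarrow> 'm option) \<Rightarrow> (nat \<Rightarrow> 'w \<Rightarrow> real) \<Rightarrow> real \<Rightarrow> real \<Rightarrow> 'w \<Rightarrow> real" where
  "embedded_level l J T x t w =
     (let n = step_index J t w
      in l * ar_process l J T x n w - T (Suc n) w + t - partial_time J n w)"

definition phase_event ::
  "real \<Rightarrow> (nat \<Rightarrow> real \<Rightarrow> 'w \<Rightarrow> 'm option) \<Rightarrow> (nat \<Rightarrow> 'w \<Rightarrow> real) \<Rightarrow> real \<Rightarrow> real \<Rightarrow> 'm \<Rightarrow> 'w set" where
  "phase_event l J T b x i =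
     {w. (\<exists>t\<ge>0. embedded_level l J T x t w \<ge> b) \<and>
         embedded_phase J (Inf {t. 0 \<le> t \<and> embedded_level l J T x t w \<ge> b}) w = Some i}"

definition Phi ::
  "'w measure \<Rightarrow> real \<Rightarrow> (nat \<Rightarrow> real \<Rightarrow> 'w \<Rightarrow> 'm option) \<Rightarrow> (nat \<Rightarrow> 'w \<Rightarrow> real) \<Rightarrow>
     real \<Rightarrow> real \<Rightarrow> 'm \<Rightarrow> real \<Rightarrow> real" where
  "Phi M l J T \<rho> b i x =
     (\<integral>w. (if (\<exists>k. ar_process l J T x k w \<ge> b) \<and> w \<in> phase_event l J T b x i
           then \<rho> ^ (LEAST k. ar_process l J T x k w \<ge> b) else 0) \<partial>M)"

section \<open>Transforms\<close>

text \<open>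
  \<open>ph_transform Q a\<close> is the rational extension of the transform of the phasetype distribution with
  initial vector \<open>a\<close>: it is \<open>exp \<psi>\<^sub>1\<close> for \<open>a = \<alpha>\<close> and \<open>exp \<psi>\<^sup>i\<close> for \<open>a = axis i 1\<close>.
  Likewise \<open>exp_psi2\<close> and \<open>exp_phi\<close> are \<open>exp \<psi>\<^sub>2\<close> and \<open>exp \<phi>\<close>; the logarithms themselves never occur.
\<close>

definition ph_transform :: "real^'m^'m \<Rightarrow> real^'m \<Rightarrow> complex \<Rightarrow> complex" where
  "ph_transform Q a u =
     scalar_product (cvec a v* matrix_inv (mat (- u) - cmat Q)) (cvec (exit_rates Q))"

definition exp_psi2 :: "'w measure \<Rightarrow> (nat \<Rightarrow> 'w \<Rightarrow> real) \<Rightarrow> complex \<Rightarrow> complex" where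
  "exp_psi2 M T u = (\<integral>w. exp (- u * complex_of_real (T 1 w)) \<partial>M)"

definition exp_phi ::
  "'w measure \<Rightarrow> real \<Rightarrow> real^'m^'m \<Rightarrow> real^'m \<Rightarrow> (nat \<Rightarrow> 'w \<Rightarrow> real) \<Rightarrow> complex \<Rightarrow> complex" where
  "exp_phi M l Q \<alpha> T u =
     prodinf (\<lambda>k. ph_transform Q \<alpha> (of_real (l ^ k) * u) * exp_psi2 M T (of_real (l ^ k) * u))"

section \<open>The functions \<open>h\<^sub>\<delta>\<close> and \<open>\<eta>\<^sub>\<delta>\<^sub>,\<^sub>i\<close>\<close>

text \<open>
  An exponential of a sum of functions of one matrix \<open>A\<close> is the corresponding product of scalar
  functions applied to \<open>A\<close>; for instance \<open>exp (- x \<lambda>\<^sup>n Q - \<phi>(- \<lambda>\<^sup>n Q))\<close> is the function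
  \<open>u \<mapsto> exp (x u) / exp (\<phi> u)\<close> applied to \<open>A = - \<lambda>\<^sup>n Q\<close>, and \<open>exp ((\<delta> I + Q) b + \<psi>\<^sub>2(- Q))\<close> is
  \<open>u \<mapsto> exp ((\<delta> - u) b) exp (\<psi>\<^sub>2 u)\<close> applied to \<open>A = - Q\<close>.
\<close>

definition h_term ::
  "'w measure \<Rightarrow> real \<Rightarrow> real^'m^'m \<Rightarrow> real^'m \<Rightarrow> (nat \<Rightarrow> 'w \<Rightarrow> real) \<Rightarrow> real \<Rightarrow> real \<Rightarrow> nat
     \<Rightarrow> complex^'m^'m" where
  "h_term M l Q \<alpha> T \<rho> x n =
     \<rho> ^ (n - 1) *\<^sub>R
       fun_calc (\<lambda>u. exp (of_real x * u) / exp_phi M l Q \<alpha> T u) (- (l ^ n *\<^sub>R cmat Q))"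

definition alpha_delta ::
  "'w measure \<Rightarrow> real^'m^'m \<Rightarrow> real^'m \<Rightarrow> (nat \<Rightarrow> 'w \<Rightarrow> real) \<Rightarrow> real \<Rightarrow> real \<Rightarrow> complex
     \<Rightarrow> complex^'m" where
  "alpha_delta M Q \<alpha> T \<rho> b \<delta> =
     \<rho> *\<^sub>R (cvec \<alpha> v* matrix_inv (mat (- \<delta>) - cmat Q)
            v* fun_calc (\<lambda>u. exp ((\<delta> - u) * of_real b) * exp_psi2 M T u) (- cmat Q))"

definition h_fun ::
  "'w measure \<Rightarrow> real \<Rightarrow> real^'m^'m \<Rightarrow> real^'m \<Rightarrow> (nat \<Rightarrow> 'w \<Rightarrow> real) \<Rightarrow> real \<Rightarrow> real \<Rightarrow> complex
     \<Rightarrow> real \<Rightarrow> complex" where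
  "h_fun M l Q \<alpha> T \<rho> b \<delta> x =
     (if x \<ge> b then exp (\<delta> * of_real x) else 0) +
     scalar_product
       (alpha_delta M Q \<alpha> T \<rho> b \<delta>
          v* fun_calc (exp_phi M l Q \<alpha> T) (- (l *\<^sub>R cmat Q))
          v* (\<Sum>n. h_term M l Q \<alpha> T \<rho> x (Suc n)))
       (cvec (exit_rates Q))"

definition eta_term ::
  "'w measure \<Rightarrow> real \<Rightarrow> real^'m^'m \<Rightarrow> real^'m \<Rightarrow> (nat \<Rightarrow> 'w \<Rightarrow> real) \<Rightarrow> real \<Rightarrow> real \<Rightarrow> 'm \<Rightarrow> nat
     \<Rightarrow> complex^'m^'m" where
  "eta_term M l Q \<alpha> T \<rho> b i n =
     \<rho> ^ n *\<^sub>R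
       fun_calc (\<lambda>u. exp (of_real b * u) / exp_phi M l Q \<alpha> T u * ph_transform Q (axis i 1) u)
         (- (l ^ n *\<^sub>R cmat Q))"

definition eta ::
  "'w measure \<Rightarrow> real \<Rightarrow> real^'m^'m \<Rightarrow> real^'m \<Rightarrow> (nat \<Rightarrow> 'w \<Rightarrow> real) \<Rightarrow> real \<Rightarrow> real \<Rightarrow> complex
     \<Rightarrow> 'm \<Rightarrow> complex" where
  "eta M l Q \<alpha> T \<rho> b \<delta> i =
     exp (\<delta> * of_real b) *
     scalar_product
       ((axis i 1 +
           cvec \<alpha> v* fun_calc (\<lambda>u. exp (- of_real b * u) * exp_psi2 M T u *
                                 exp_phi M l Q \<alpha> T (of_real l * u)) (- cmat Q)
             v* (\<Sum>n. eta_term M l Q \<alpha> T \<rho> b i (Suc n)))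
          v* matrix_inv (mat (- \<delta>) - cmat Q))
       (cvec (exit_rates Q))"

end

theory Submission
  imports Defs "HOL-Computational_Algebra.Fundamental_Theorem_Algebra"
begin

text \<open>
  Write \<open>A = - Q\<close>; by transience its eigenvalues have positive real part. A step from \<open>y < b\<close> leads to
  \<open>X = l y + S - T\<close>. During the step the level rises with slope one from \<open>l y - T\<close>, so if it reaches \<open>b\<close>,
  this happens after the time \<open>c = b - l y + T\<close>, in phase \<open>i\<close> with probability \<open>(\<alpha> exp (Q c))\<^sub>i\<close>, and the
  rest of \<open>S\<close> is again phasetype, started in \<open>i\<close>. Let \<open>r\<^sub>i y\<close> be the probability that the step crosses
  \<open>b\<close> in phase \<open>i\<close>. Then, with \<open>e\<^sup>\<psi> = e\<^sup>\<psi>\<^sup>1 e\<^sup>\<psi>\<^sup>2\<close> and the transforms \<open>g\<^sub>i\<close> of the phasetype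
  distributions,
  
    \<open>exp (u l y) e\<^sup>\<psi>(u) = E [exp (u X); X < b] + exp (u b) (\<Sum>i. r\<^sub>i y g\<^sub>i(u))\<close>.
  
  For small \<open>Re u\<close> this is the decomposition of \<open>E (exp (u X))\<close>. It stays true for every \<open>u\<close> with
  \<open>Re u > 0\<close> outside the spectrum of \<open>A\<close>, where \<open>E (exp (u X))\<close> may be infinite: the truncated
  expectation always exists and an exponential times a phasetype density has an explicit primitive
  (\<open>truncated_transform\<close>, \<open>one_step_transform\<close>). Evaluating at large exponents is the point of the proof,
  because the identity is used near \<open>u = l\<^sup>n \<mu>\<close> with \<open>\<mu>\<close> in the spectrum of \<open>A\<close>.
  
  More precisely, put \<open>L = exp (- b A) e\<^sup>\<psi>\<^sup>2(A)\<close> and let \<open>W\<^sub>n(y)\<close> be the row vector that arises from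
  \<open>\<alpha> L\<close> by applying the function \<open>u \<mapsto> exp (l\<^sup>n\<^sup>+\<^sup>1 y u) (\<Prod>k=1..n. e\<^sup>\<psi>(l\<^sup>k u))\<close> of \<open>A\<close>. Then
  \<open>W\<^sub>0(y) = E (\<alpha> exp (Q c)) = r(y)\<close> (\<open>W_base\<close>), and multiplying the one-step identity at \<open>l\<^sup>n\<^sup>+\<^sup>1 u\<close> by the
  product and passing to functions of \<open>A\<close> gives
  
    \<open>W\<^sub>n\<^sub>+\<^sub>1(y) = E [W\<^sub>n(X); X < b] + (\<Sum>i. r\<^sub>i y D\<^sub>n\<^sub>,\<^sub>i)\<close>
  
  with row vectors \<open>D\<^sub>n\<^sub>,\<^sub>i\<close> that do not depend on \<open>y\<close> (\<open>W_step\<close>). Iterating along the process killed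
  above \<open>b\<close> expresses \<open>W\<^sub>n(x)\<close> through the probabilities that the first passage happens in step \<open>k\<close>
  and phase \<open>i\<close>. These are the coefficients of \<open>\<Phi>\<^sub>i(x)\<close> as a power series in \<open>\<rho>\<close> (\<open>Phi_sums\<close>), and
  summation with the weights \<open>\<rho>\<^sup>n\<^sup>+\<^sup>1\<close> yields the row identity
  
    \<open>\<rho> (\<Sum>n. \<rho>\<^sup>n W\<^sub>n(x)) = (\<Sum>i. \<Phi>\<^sub>i(x) (e\<^sub>i + (\<Sum>n. \<rho>\<^sup>n\<^sup>+\<^sup>1 D\<^sub>n\<^sub>,\<^sub>i)))\<close>   (\<open>discounted_identity\<close>, \<open>row_identity\<close>).
  
  Since \<open>(\<Prod>k=1..n. e\<^sup>\<psi>(l\<^sup>k u)) = exp (\<phi>(l u) - \<phi>(l\<^sup>n\<^sup>+\<^sup>1 u))\<close>, the two sums over \<open>n\<close> are the series in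
  \<open>h\<^sub>\<delta>\<close> and in \<open>\<eta>\<^sub>\<delta>\<^sub>,\<^sub>i\<close> (\<open>h_term_eq\<close>, \<open>eta_term_eq\<close>). The parameter \<open>\<delta>\<close> enters only through
  \<open>exp (\<delta> b) (- \<delta> I - Q)\<^sup>-\<^sup>1 q\<close>, applied from the right to both sides; the resolvent commutes with the
  other functions of \<open>A\<close> (\<open>expansion_identity\<close>).
  
  The analysis behind this concerns the points \<open>l\<^sup>k u\<close>, \<open>k \<ge> 1\<close>, for \<open>u\<close> near the spectrum of \<open>A\<close>. By the
  spectral hypothesis they keep away from the poles of the transforms, and the logarithmic moment makes
  \<open>\<Sum>k. \<bar>e\<^sup>\<psi>(l\<^sup>k u) - 1\<bar>\<close> converge uniformly (\<open>admissible_exists\<close>).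
\<close>

unbundle no fps_syntax

section \<open>The resolvent of a complex matrix\<close>

lemma mat_mult_vec: "(mat c :: 'a::comm_semiring_1^'n^'n) *v v = c *s v"
  by (simp add: vec_eq_iff mat_def matrix_vector_mult_def if_distrib[where f="\<lambda>x. x * _"] cong: if_cong)

lemma matrix_inv_mult:
  fixes A :: "'a::field^'n^'n"
  assumes "invertible A"
  shows "A ** matrix_inv A = mat 1" "matrix_inv A ** A = mat 1"
proof -
  have "\<exists>A'. A ** A' = mat 1 \<and> A' ** A = mat 1"
    using assms by (simp add: invertible_def)
  then have "A ** matrix_inv A = mat 1 \<and> matrix_inv A ** A = mat 1"
    unfolding matrix_inv_def by (rule someI_ex)
  then show "A ** matrix_inv A = mat 1" "matrix_inv A ** A = mat 1" by auto
qed

lemma matrix_inv_eqI: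
  fixes A :: "'a::field^'n^'n"
  assumes "A ** B = mat 1"
  shows "matrix_inv A = B"
proof -
  have "invertible A" using assms invertible_right_inverse by blast
  then have "matrix_inv A = matrix_inv A ** (A ** B)"
    using assms by simp
  also have "\<dots> = B"
    using matrix_inv_mult(2)[OF \<open>invertible A\<close>] by (simp add: matrix_mul_assoc)
  finally show ?thesis .
qed

lemma Sp_iff: "z \<in> Sp A \<longleftrightarrow> \<not> invertible (mat z - A)" for A :: "complex^'s^'s"
proof -
  have "invertible (mat z - A) \<longleftrightarrow> (\<forall>v. (mat z - A) *v v = 0 \<longrightarrow> v = 0)"
    by (simp add: invertible_left_inverse matrix_left_invertible_ker)
  then show ?thesis
    by (auto simp: Sp_def matrix_vector_mult_diff_rdistrib mat_mult_vec)
qed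

lemma finite_type_maximum:
  fixes f :: "'s::finite \<Rightarrow> real"
  obtains i where "\<And>j. f j \<le> f i"
proof -
  have "Max (range f) \<in> range f" by (intro Max_in) auto
  then obtain i where "Max (range f) = f i" by (elim rangeE)
  then have "f j \<le> f i" for j using Max_ge[of "range f" "f j"] by simp
  then show ?thesis using that by blast
qed

lemma Sp_bounded:
  fixes A :: "complex^'s^'s"
  assumes "z \<in> Sp A"
  shows "cmod z \<le> (\<Sum>i\<in>UNIV. \<Sum>j\<in>UNIV. cmod (A $ i $ j))"
proof -
  obtain v where v: "v \<noteq> 0" "A *v v = z *s v"
    using assms by (auto simp: Sp_def)
  obtain i where i: "\<And>j. cmod (v $ j) \<le> cmod (v $ i)"
    using finite_type_maximum[of "\<lambda>j. cmod (v $ j)"] by blast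
  from v(1) have "cmod (v $ i) > 0"
  proof -
    obtain k where "v $ k \<noteq> 0" using v(1) by (auto simp: vec_eq_iff)
    then have "0 < cmod (v $ k)" by simp
    then show ?thesis using i[of k] by (rule less_le_trans)
  qed
  have "cmod z * cmod (v $ i) = cmod ((A *v v) $ i)"
    by (simp add: v(2) norm_mult)
  also have "\<dots> \<le> (\<Sum>j\<in>UNIV. cmod (A $ i $ j) * cmod (v $ j))"
    unfolding matrix_vector_mult_def by (simp add: sum_norm_le norm_mult)
  also have "\<dots> \<le> (\<Sum>j\<in>UNIV. cmod (A $ i $ j)) * cmod (v $ i)"
    unfolding sum_distrib_right by (intro sum_mono mult_left_mono i) auto
  finally have "cmod z \<le> (\<Sum>j\<in>UNIV. cmod (A $ i $ j))"
    using \<open>cmod (v $ i) > 0\<close> by simp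
  also have "\<dots> \<le> (\<Sum>i\<in>UNIV. \<Sum>j\<in>UNIV. cmod (A $ i $ j))"
    by (intro member_le_sum) (auto intro: sum_nonneg)
  finally show ?thesis .
qed

lemma poly_det:
  fixes P :: "complex poly^'s^'s"
  shows "poly (det P) z = det (\<chi> i j. poly (P $ i $ j) z)"
  by (simp add: det_def poly_sum poly_prod)

text \<open>
  Cramer's rule: the common denominator of the entries of the resolvent is the characteristic polynomial.
\<close>

lemma resolvent_rational:
  fixes A :: "complex^'s^'s"
  obtains p r where "p \<noteq> 0" "\<And>z. z \<in> Sp A \<longleftrightarrow> poly p z = 0"
    "\<And>z i j. z \<notin> Sp A \<Longrightarrow> matrix_inv (mat z - A) $ i $ j = poly (r i j) z / poly p z"
proof -
  define P :: "complex poly^'s^'s"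
    where "P = (\<chi> i j. if i = j then [:- A $ i $ j, 1:] else [:- A $ i $ j:])"
  define r where "r k l = det (\<chi> i j. if j = k then (if i = l then 1 else 0) else P $ i $ j)" for k l
  have P: "(\<chi> i j. poly (P $ i $ j) z) = mat z - A" for z
    by (simp add: vec_eq_iff P_def mat_def)
  have p: "poly (det P) z = det (mat z - A)" for z
    by (simp add: poly_det P)
  have Sp: "z \<in> Sp A \<longleftrightarrow> poly (det P) z = 0" for z
    by (simp add: p Sp_iff invertible_det_nz)
  have "det P \<noteq> 0"
  proof
    assume "det P = 0"
    then have "z \<in> Sp A" for z by (simp add: Sp)
    from Sp_bounded[OF this, of "of_real (1 + (\<Sum>i\<in>UNIV. \<Sum>j\<in>UNIV. cmod (A $ i $ j)))"]
    have "\<bar>1 + (\<Sum>i\<in>UNIV. \<Sum>j\<in>UNIV. cmod (A $ i $ j))\<bar> \<le> (\<Sum>i\<in>UNIV. \<Sum>j\<in>UNIV. cmod (A $ i $ j))"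
      by (simp only: norm_of_real)
    then show False by linarith
  qed
  moreover have "matrix_inv (mat z - A) $ k $ l = poly (r k l) z / poly (det P) z"
    if "z \<notin> Sp A" for z k l
  proof -
    let ?B = "mat z - A"
    have "invertible ?B" using that by (simp add: Sp_iff)
    have "?B *v (matrix_inv ?B *v axis l 1) = axis l 1"
      by (simp add: matrix_vector_mul_assoc matrix_inv_mult[OF \<open>invertible ?B\<close>])
    then have "matrix_inv ?B *v axis l 1 =
        (\<chi> k. det (\<chi> i j. if j = k then axis l 1 $ i else ?B $ i $ j) / det ?B)"
      using \<open>invertible ?B\<close> by (subst (asm) cramer) (auto simp: invertible_det_nz)
    then have "(matrix_inv ?B *v axis l 1) $ k =
        det (\<chi> i j. if j = k then axis l 1 $ i else ?B $ i $ j) / det ?B"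
      by simp
    moreover have "(matrix_inv ?B *v axis l 1) $ k = matrix_inv ?B $ k $ l"
      by (simp add: matrix_vector_mult_def axis_def if_distrib[where f="\<lambda>x. _ * x"] cong: if_cong)
    moreover have "(\<chi> i j. poly ((\<chi> i j. if j = k then (if i = l then 1 else 0) else P $ i $ j) $ i $ j) z)
       = (\<chi> i j. if j = k then axis l 1 $ i else ?B $ i $ j)"
      unfolding P[symmetric] by (simp add: vec_eq_iff axis_def)
    ultimately show ?thesis
      by (simp add: r_def poly_det p[unfolded poly_det])
  qed
  ultimately show ?thesis using that Sp by blast
qed

lemma finite_Sp: "finite (Sp A)" for A :: "complex^'s^'s"
proof -
  obtain p r where "p \<noteq> 0" "\<And>z. z \<in> Sp A \<longleftrightarrow> poly p z = 0"
    "\<And>z i j. z \<notin> Sp A \<Longrightarrow> matrix_inv (mat z - A) $ i $ j = poly (r i j) z / poly p z"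
    by (rule resolvent_rational[of A]) blast
  then have "Sp A = {z. poly p z = 0}" by blast
  then show ?thesis using poly_roots_finite[OF \<open>p \<noteq> 0\<close>] by simp
qed

lemma resolvent_holomorphic: "(\<lambda>z. matrix_inv (mat z - A) $ i $ j) holomorphic_on (- Sp A)"
  for A :: "complex^'s^'s"
proof -
  obtain p r where pr: "p \<noteq> 0" "\<And>z. z \<in> Sp A \<longleftrightarrow> poly p z = 0"
    "\<And>z i j. z \<notin> Sp A \<Longrightarrow> matrix_inv (mat z - A) $ i $ j = poly (r i j) z / poly p z"
    by (rule resolvent_rational[of A]) blast
  have "(\<lambda>z. poly (r i j) z / poly p z) holomorphic_on (- Sp A)"
    using pr(2) by (intro holomorphic_intros) auto
  then show ?thesis
    by (rule holomorphic_transform) (use pr(3) in auto)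
qed

lemma resolvent_mult:
  fixes A :: "complex^'s^'s"
  assumes "z \<notin> Sp A"
  shows "z * matrix_inv (mat z - A) $ i $ j =
    (if i = j then 1 else 0) + (\<Sum>k\<in>UNIV. A $ i $ k * matrix_inv (mat z - A) $ k $ j)"
proof -
  let ?R = "matrix_inv (mat z - A)"
  have "(mat z - A) ** ?R = mat 1"
    using assms by (intro matrix_inv_mult) (simp add: Sp_iff)
  then have "((mat z - A) ** ?R) $ i $ j = (if i = j then 1 else 0)"
    by (simp add: mat_def)
  moreover have "((mat z - A) ** ?R) $ i $ j = z * ?R $ i $ j - (\<Sum>k\<in>UNIV. A $ i $ k * ?R $ k $ j)"
    by (simp add: matrix_matrix_mult_def mat_def left_diff_distrib sum_subtractf
        if_distrib[where f="\<lambda>x. x * _"] cong: if_cong)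
  ultimately show ?thesis by (simp add: algebra_simps)
qed

section \<open>The holomorphic functional calculus\<close>

lemma isolating_ball:
  fixes A :: "complex^'s^'s"
  assumes "f analytic_on Sp A" "\<mu> \<in> Sp A"
  obtains r where "r > 0" "f holomorphic_on ball \<mu> r" "ball \<mu> r - {\<mu>} \<subseteq> - Sp A"
proof -
  have "f analytic_on {\<mu>}" using assms analytic_on_subset by blast
  then obtain r1 where r1: "r1 > 0" "f holomorphic_on ball \<mu> r1"
    by (auto simp: analytic_on_def)
  obtain r2 where r2: "r2 > 0" "\<forall>y\<in>Sp A. y \<noteq> \<mu> \<longrightarrow> r2 \<le> dist \<mu> y"
    using finite_set_avoid[OF finite_Sp] by blast
  show ?thesis
  proof
    show "min r1 r2 > 0" using r1 r2 by simp
    show "f holomorphic_on ball \<mu> (min r1 r2)"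
      using r1(2) by (rule holomorphic_on_subset) auto
    show "ball \<mu> (min r1 r2) - {\<mu>} \<subseteq> - Sp A" using r2(2) by force
  qed
qed

lemma residue_lincomb:
  assumes "finite S" "open U" "z \<in> U" "\<And>k. k \<in> S \<Longrightarrow> f k holomorphic_on U - {z}"
  shows "residue (\<lambda>w. \<Sum>k\<in>S. c k * f k w) z = (\<Sum>k\<in>S. c k * residue (f k) z)"
  using assms(1,4)
proof (induction S)
  case empty
  then show ?case by (simp add: residue_const)
next
  case (insert k S)
  have "residue (\<lambda>w. c k * f k w + (\<Sum>k\<in>S. c k * f k w)) z =
      residue (\<lambda>w. c k * f k w) z + residue (\<lambda>w. \<Sum>k\<in>S. c k * f k w) z"
    using insert.prems assms by (intro residue_add[of U]) (auto intro!: holomorphic_intros)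
  also have "residue (\<lambda>w. c k * f k w) z = c k * residue (f k) z"
    using insert.prems assms by (intro residue_lmul[of U]) auto
  finally show ?case using insert by simp
qed

lemma fun_calc_cong:
  fixes A :: "complex^'s^'s"
  assumes "\<And>\<mu>. \<mu> \<in> Sp A \<Longrightarrow> eventually (\<lambda>z. f z = g z) (nhds \<mu>)"
  shows "fun_calc f A = fun_calc g A"
  unfolding fun_calc_def
proof (intro arg_cong[where f=vec_lambda] ext sum.cong refl residue_cong)
  fix i j \<mu> assume "\<mu> \<in> Sp A"
  have "eventually (\<lambda>z. f z = g z) (at \<mu>)"
    using assms[OF \<open>\<mu> \<in> Sp A\<close>] by (auto simp: eventually_at_filter elim: eventually_mono)
  then show "\<forall>\<^sub>F z in at \<mu>. f z * matrix_inv (mat z - A) $ i $ j = g z * matrix_inv (mat z - A) $ i $ j"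
    by (auto elim: eventually_mono)
qed

lemma fun_calc_add:
  fixes A :: "complex^'s^'s"
  assumes "f analytic_on Sp A" "g analytic_on Sp A"
  shows "fun_calc (\<lambda>z. f z + g z) A = fun_calc f A + fun_calc g A"
proof -
  have "residue (\<lambda>z. (f z + g z) * matrix_inv (mat z - A) $ i $ j) \<mu> =
      residue (\<lambda>z. f z * matrix_inv (mat z - A) $ i $ j) \<mu> + residue (\<lambda>z. g z * matrix_inv (mat z - A) $ i $ j) \<mu>"
    if \<mu>: "\<mu> \<in> Sp A" for i j \<mu>
  proof -
    obtain r1 where r1: "r1 > 0" "f holomorphic_on ball \<mu> r1" "ball \<mu> r1 - {\<mu>} \<subseteq> - Sp A"
      using isolating_ball[OF assms(1) \<mu>] .
    obtain r2 where r2: "r2 > 0" "g holomorphic_on ball \<mu> r2" "ball \<mu> r2 - {\<mu>} \<subseteq> - Sp A"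
      using isolating_ball[OF assms(2) \<mu>] .
    have sub: "ball \<mu> (min r1 r2) - {\<mu>} \<subseteq> - Sp A" "ball \<mu> (min r1 r2) - {\<mu>} \<subseteq> ball \<mu> r1"
      "ball \<mu> (min r1 r2) - {\<mu>} \<subseteq> ball \<mu> r2"
      using r1 by auto
    note h = holomorphic_on_subset[OF resolvent_holomorphic sub(1)]
      holomorphic_on_subset[OF r1(2) sub(2)] holomorphic_on_subset[OF r2(2) sub(3)]
    show ?thesis
      unfolding distrib_right using r1 r2 h
      by (intro residue_add[of "ball \<mu> (min r1 r2)"] holomorphic_intros) auto
  qed
  then show ?thesis
    by (simp add: fun_calc_def vec_eq_iff sum.distrib)
qed

text \<open>
  Since \<open>z (z - A)\<^sup>-\<^sup>1 = 1 + A (z - A)\<^sup>-\<^sup>1\<close> and the first summand has no pole, multiplying the scalar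
  function by its argument multiplies the matrix by \<open>A\<close>.
\<close>

lemma fun_calc_times_id:
  fixes A :: "complex^'s^'s"
  assumes "f analytic_on Sp A"
  shows "fun_calc (\<lambda>z. z * f z) A = A ** fun_calc f A"
proof -
  have "residue (\<lambda>z. (z * f z) * matrix_inv (mat z - A) $ i $ j) \<mu> =
      (\<Sum>k\<in>UNIV. A $ i $ k * residue (\<lambda>z. f z * matrix_inv (mat z - A) $ k $ j) \<mu>)"
    if \<mu>: "\<mu> \<in> Sp A" for i j \<mu>
  proof -
    obtain r where r: "r > 0" "f holomorphic_on ball \<mu> r" "ball \<mu> r - {\<mu>} \<subseteq> - Sp A"
      using isolating_ball[OF assms(1) \<mu>] .
    note h = holomorphic_on_subset[OF resolvent_holomorphic r(3)]
      holomorphic_on_subset[OF r(2), of "ball \<mu> r - {\<mu>}"]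
    have "residue (\<lambda>z. (z * f z) * matrix_inv (mat z - A) $ i $ j) \<mu> =
       residue (\<lambda>z. (if i = j then 1 else 0) * f z +
          (\<Sum>k\<in>UNIV. A $ i $ k * (f z * matrix_inv (mat z - A) $ k $ j))) \<mu>"
    proof (rule residue_cong[OF _ refl])
      have "\<forall>\<^sub>F z in at \<mu>. z \<in> ball \<mu> r - {\<mu>}"
        using r(1) by (intro eventually_at_in_open) auto
      then show "\<forall>\<^sub>F z in at \<mu>. (z * f z) * matrix_inv (mat z - A) $ i $ j =
        (if i = j then 1 else 0) * f z +
          (\<Sum>k\<in>UNIV. A $ i $ k * (f z * matrix_inv (mat z - A) $ k $ j))"
      proof eventually_elim
        case (elim z)
        then have "z \<notin> Sp A" using r(3) by auto
        have "(z * f z) * matrix_inv (mat z - A) $ i $ j = f z * (z * matrix_inv (mat z - A) $ i $ j)"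
          by simp
        then show ?case
          unfolding resolvent_mult[OF \<open>z \<notin> Sp A\<close>]
          by (simp add: distrib_left sum_distrib_left mult.left_commute)
      qed
    qed
    also have "\<dots> = residue (\<lambda>z. (if i = j then 1 else 0) * f z) \<mu> +
       residue (\<lambda>z. \<Sum>k\<in>UNIV. A $ i $ k * (f z * matrix_inv (mat z - A) $ k $ j)) \<mu>"
      using r h by (intro residue_add[of "ball \<mu> r"] holomorphic_intros) auto
    also have "residue (\<lambda>z. (if i = j then 1 else 0) * f z) \<mu> = 0"
      using r by (intro residue_holo[of "ball \<mu> r"] holomorphic_intros) auto
    also have "residue (\<lambda>z. \<Sum>k\<in>UNIV. A $ i $ k * (f z * matrix_inv (mat z - A) $ k $ j)) \<mu> =
       (\<Sum>k\<in>UNIV. A $ i $ k * residue (\<lambda>z. f z * matrix_inv (mat z - A) $ k $ j) \<mu>)"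
      using r h by (intro residue_lincomb[of _ "ball \<mu> r"] holomorphic_intros) auto
    finally show ?thesis by simp
  qed
  then show ?thesis
    by (simp add: fun_calc_def vec_eq_iff matrix_matrix_mult_def sum_distrib_left sum.swap[of _ "Sp A"])
qed

lemma fun_calc_const_mult:
  fixes A :: "complex^'s^'s"
  assumes "f analytic_on Sp A"
  shows "fun_calc (\<lambda>z. c * f z) A = mat c ** fun_calc f A"
proof -
  have "residue (\<lambda>z. (c * f z) * matrix_inv (mat z - A) $ i $ j) \<mu> =
      c * residue (\<lambda>z. f z * matrix_inv (mat z - A) $ i $ j) \<mu>"
    if \<mu>: "\<mu> \<in> Sp A" for i j \<mu>
  proof -
    obtain r where r: "r > 0" "f holomorphic_on ball \<mu> r" "ball \<mu> r - {\<mu>} \<subseteq> - Sp A"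
      using isolating_ball[OF assms(1) \<mu>] .
    note h = holomorphic_on_subset[OF resolvent_holomorphic r(3)]
      holomorphic_on_subset[OF r(2), of "ball \<mu> r - {\<mu>}"]
    show ?thesis
      unfolding mult.assoc using r h by (intro residue_lmul[of "ball \<mu> r"] holomorphic_intros) auto
  qed
  then have "fun_calc (\<lambda>z. c * f z) A $ i $ j = c * fun_calc f A $ i $ j" for i j
    by (simp add: fun_calc_def sum_distrib_left)
  moreover have "(mat c ** B) $ i $ j = c * B $ i $ j" for B :: "complex^'s^'s" and i j
    by (simp add: matrix_matrix_mult_def mat_def if_distrib[where f="\<lambda>x. x * _"] cong: if_cong)
  ultimately show ?thesis by (simp add: vec_eq_iff)
qed

text \<open>
  The sum of the residues of the resolvent is an integral over a large circle, on which
  \<open>(z - A)\<^sup>-\<^sup>1 = z\<^sup>-\<^sup>1 + O(\<bar>z\<bar>\<^sup>-\<^sup>2)\<close>.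
\<close>

lemma fun_calc_one: "fun_calc (\<lambda>_. 1) A = mat 1" for A :: "complex^'s^'s"
proof -
  \<comment> \<open>\<open>a\<close> bounds the row sums of \<open>A\<close> and, strictly, its spectrum\<close>
  define a where "a = (\<Sum>i\<in>UNIV. \<Sum>j\<in>UNIV. cmod (A $ i $ j)) + 1"
  have "a > 0" unfolding a_def by (smt (verit) sum_nonneg norm_ge_zero)
  have row: "(\<Sum>k\<in>UNIV. cmod (A $ i $ k)) \<le> a" for i
  proof -
    have "(\<Sum>j\<in>UNIV. cmod (A $ i $ j)) \<le> (\<Sum>i\<in>UNIV. \<Sum>j\<in>UNIV. cmod (A $ i $ j))"
      by (intro member_le_sum) (auto intro: sum_nonneg)
    then show ?thesis by (simp add: a_def)
  qed
  have notSp: "z \<notin> Sp A" if "cmod z \<ge> a" for z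
    using Sp_bounded[of z A] that by (auto simp: a_def)
  have bound: "cmod (matrix_inv (mat z - A) $ i $ j) \<le> 2 / cmod z" if z: "cmod z \<ge> 2 * a" for z i j
  proof -
    let ?R = "matrix_inv (mat z - A)"
    obtain k where k: "\<And>i. cmod (?R $ i $ j) \<le> cmod (?R $ k $ j)"
      using finite_type_maximum[of "\<lambda>k. cmod (?R $ k $ j)"] by blast
    have "z \<notin> Sp A" using notSp z \<open>a > 0\<close> by simp
    have "cmod z * cmod (?R $ k $ j) = cmod (z * ?R $ k $ j)" by (simp add: norm_mult)
    also have "\<dots> \<le> 1 + (\<Sum>l\<in>UNIV. cmod (A $ k $ l) * cmod (?R $ l $ j))"
      unfolding resolvent_mult[OF \<open>z \<notin> Sp A\<close>]
      by (intro norm_triangle_le add_mono sum_norm_le) (auto simp: norm_mult)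
    also have "(\<Sum>l\<in>UNIV. cmod (A $ k $ l) * cmod (?R $ l $ j)) \<le> (\<Sum>l\<in>UNIV. cmod (A $ k $ l)) * cmod (?R $ k $ j)"
      unfolding sum_distrib_right by (intro sum_mono mult_left_mono k) auto
    also have "\<dots> \<le> cmod z / 2 * cmod (?R $ k $ j)"
      using z by (intro mult_right_mono order_trans[OF row]) auto
    finally have "cmod z / 2 * cmod (?R $ k $ j) \<le> 1" by simp
    then have "cmod (?R $ k $ j) \<le> 2 / cmod z"
    proof -
      have "cmod z > 0" using z \<open>a > 0\<close> by linarith
      then show ?thesis using \<open>cmod z / 2 * cmod (?R $ k $ j) \<le> 1\<close>
        by (simp add: pos_le_divide_eq mult.commute)
    qed
    then show ?thesis using k[of i] by simp
  qed
  have "fun_calc (\<lambda>_. 1) A $ i $ j = mat 1 $ i $ j" for i j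
  proof -
    let ?R = "\<lambda>z. matrix_inv (mat z - A) $ i $ j"
    let ?d = "if i = j then 1 else 0 :: complex"
    let ?c = "(\<Sum>\<mu>\<in>Sp A. residue ?R \<mu>)"
    have est: "cmod (?c - ?d) * r \<le> 2 * a" if r: "r \<ge> 2 * a" for r
    proof -
      have "r > 0" using r \<open>a > 0\<close> by simp
      have nSp: "z \<notin> Sp A" if "cmod z = r" for z using notSp that r \<open>a > 0\<close> by simp
      have path: "path_image (circlepath 0 r) \<subseteq> - Sp A"
        using nSp \<open>r > 0\<close> by auto
      have "contour_integral (circlepath 0 r) ?R =
         2 * pi * \<i> * (\<Sum>p\<in>Sp A. winding_number (circlepath 0 r) p * residue ?R p)"
        using path resolvent_holomorphic[of A i j] finite_Sp
        by (intro Residue_theorem[of UNIV]) (auto simp: Compl_eq_Diff_UNIV)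
      also have "(\<Sum>p\<in>Sp A. winding_number (circlepath 0 r) p * residue ?R p) = ?c"
      proof (intro sum.cong refl)
        fix p assume "p \<in> Sp A"
        then have "cmod p < r" using notSp[of p] r \<open>a > 0\<close> by force
        then show "winding_number (circlepath 0 r) p * residue ?R p = residue ?R p"
          by (simp add: winding_number_circlepath)
      qed
      finally have I: "contour_integral (circlepath 0 r) ?R = 2 * pi * \<i> * ?c" .
      have "(?R has_contour_integral (2 * pi * \<i> * ?c)) (circlepath 0 r)"
        unfolding I[symmetric]
        by (intro has_contour_integral_integral contour_integrable_continuous_circlepath
            continuous_on_subset[OF holomorphic_on_imp_continuous_on[OF resolvent_holomorphic] path])
      moreover have "((\<lambda>z. ?d / (z - 0)) has_contour_integral (2 * pi * \<i> * ?d)) (circlepath 0 r)"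
        using \<open>r > 0\<close> Cauchy_integral_circlepath[of 0 r "\<lambda>_. ?d" 0] by simp
      ultimately have "((\<lambda>z. ?R z - ?d / (z - 0)) has_contour_integral
          (2 * pi * \<i> * ?c - 2 * pi * \<i> * ?d)) (circlepath 0 r)"
        by (rule has_contour_integral_diff)
      then have "norm (2 * pi * \<i> * ?c - 2 * pi * \<i> * ?d) \<le> (2 * a / r^2) * (2 * pi * r)"
      proof (rule has_contour_integral_bound_circlepath)
        fix z :: complex assume z: "cmod (z - 0) = r"
        then have "z \<noteq> 0" "cmod z = r" "z \<notin> Sp A" using \<open>r > 0\<close> nSp by auto
        have "z * (?R z - ?d / (z - 0)) = (\<Sum>k\<in>UNIV. A $ i $ k * matrix_inv (mat z - A) $ k $ j)"
          using resolvent_mult[OF \<open>z \<notin> Sp A\<close>, of i j] \<open>z \<noteq> 0\<close> by (auto simp: algebra_simps)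
        then have "r * cmod (?R z - ?d / (z - 0)) = cmod (\<Sum>k\<in>UNIV. A $ i $ k * matrix_inv (mat z - A) $ k $ j)"
          by (metis norm_mult \<open>cmod z = r\<close>)
        also have "\<dots> \<le> (\<Sum>k\<in>UNIV. cmod (A $ i $ k) * (2 / r))"
        proof (rule sum_norm_le)
          fix k
          show "cmod (A $ i $ k * matrix_inv (mat z - A) $ k $ j) \<le> cmod (A $ i $ k) * (2 / r)"
            unfolding norm_mult using bound[of z k j] r \<open>cmod z = r\<close> by (intro mult_left_mono) auto
        qed
        also have "\<dots> \<le> a * (2 / r)"
          unfolding sum_distrib_right[symmetric] using \<open>r > 0\<close> by (intro mult_right_mono row) auto
        finally show "cmod (?R z - ?d / (z - 0)) \<le> 2 * a / r^2"
          using \<open>r > 0\<close> by (simp add: field_simps power2_eq_square)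
      qed (use \<open>r > 0\<close> \<open>a > 0\<close> in auto)
      also have "(2 * a / r^2) * (2 * pi * r) = 2 * pi * (2 * a / r)"
        using \<open>r > 0\<close> by (simp add: field_simps power2_eq_square)
      also have "2 * pi * \<i> * ?c - 2 * pi * \<i> * ?d = 2 * pi * \<i> * (?c - ?d)"
        by (simp add: algebra_simps)
      finally have le: "norm (2 * pi * \<i> * (?c - ?d)) \<le> 2 * pi * (2 * a / r)" .
      define D where "D = ?c - ?d"
      have "2 * pi * cmod D \<le> 2 * pi * (2 * a / r)"
        using le unfolding D_def[symmetric] by (simp add: norm_mult)
      then have "cmod (?c - ?d) \<le> 2 * a / r"
        unfolding D_def[symmetric] by (simp del: times_divide_eq_right)
      then show ?thesis using \<open>r > 0\<close> by (simp add: field_simps)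
    qed
    have "?c = ?d"
    proof (rule ccontr)
      assume "?c \<noteq> ?d"
      then have pos: "cmod (?c - ?d) > 0" by simp
      define r where "r = max (2 * a) (2 * a / cmod (?c - ?d) + 1)"
      have "cmod (?c - ?d) * r \<ge> cmod (?c - ?d) * (2 * a / cmod (?c - ?d) + 1)"
        by (intro mult_left_mono) (auto simp: r_def)
      also have "cmod (?c - ?d) * (2 * a / cmod (?c - ?d) + 1) = 2 * a + cmod (?c - ?d)"
        using pos by (simp only: distrib_left) simp
      finally show False using est[of r] pos by (auto simp: r_def)
    qed
    then show ?thesis by (simp add: fun_calc_def mat_def)
  qed
  then show ?thesis by (simp add: vec_eq_iff)
qed

text \<open>
  Newton interpolation with repeated nodes: splitting off one node \<open>x\<close> at a time replaces the
  remainder \<open>h\<close> by \<open>h x\<close> plus \<open>z - x\<close> times the difference quotient of \<open>h\<close>, which is holomorphic again.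
\<close>

lemma newton_interpolation:
  assumes "open U" "f holomorphic_on U" "set xs \<subseteq> U"
  obtains p h where "h holomorphic_on U" "\<And>z. z \<in> U \<Longrightarrow> f z = poly p z + (\<Prod>x\<leftarrow>xs. z - x) * h z"
proof -
  have "\<exists>p h. h holomorphic_on U \<and> (\<forall>z\<in>U. f z = poly p z + (\<Prod>x\<leftarrow>xs. z - x) * h z)"
    using assms(3)
  proof (induction xs)
    case Nil
    have "f holomorphic_on U \<and> (\<forall>z\<in>U. f z = poly 0 z + (\<Prod>x\<leftarrow>[]. z - x) * f z)"
      using assms(2) by simp
    then show ?case by blast
  next
    case (Cons a xs)
    then obtain p h where h: "h holomorphic_on U"
      "\<And>z. z \<in> U \<Longrightarrow> f z = poly p z + (\<Prod>x\<leftarrow>xs. z - x) * h z" by auto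
    define g where "g z = (if z = a then deriv h a else (h z - h a) / (z - a))" for z
    have "a \<in> interior U" using Cons.prems assms(1) by (simp add: interior_open)
    have "g holomorphic_on U"
      unfolding g_def by (rule pole_lemma[OF h(1) \<open>a \<in> interior U\<close>])
    moreover have "f z = poly (p + smult (h a) (\<Prod>x\<leftarrow>xs. [:-x, 1:])) z + (\<Prod>x\<leftarrow>a # xs. z - x) * g z"
      if "z \<in> U" for z
    proof -
      have "h z = h a + (z - a) * g z" by (simp add: g_def)
      moreover have "poly (\<Prod>x\<leftarrow>xs. [:-x, 1:]) z = (\<Prod>x\<leftarrow>xs. z - x)"
        by (induction xs) (auto simp: algebra_simps)
      moreover have "(\<Prod>x\<leftarrow>a # xs. z - x) = (z - a) * (\<Prod>x\<leftarrow>xs. z - x)" by simp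
      ultimately have *: "f z = poly p z + (\<Prod>x\<leftarrow>xs. z - x) * (h a + (z - a) * g z)"
        "poly (\<Prod>x\<leftarrow>xs. [:-x, 1:]) z = (\<Prod>x\<leftarrow>xs. z - x)"
        "(\<Prod>x\<leftarrow>a # xs. z - x) = (z - a) * (\<Prod>x\<leftarrow>xs. z - x)"
        using h(2)[OF that] by auto
      show ?thesis
        unfolding *(1,3) poly_add poly_smult *(2) by (simp add: algebra_simps)
    qed
    ultimately show ?case by blast
  qed
  then show ?thesis using that by blast
qed

text \<open>
  The denominator of the resolvent as a product of linear factors, in the form in which it is the remainder
  term of Newton interpolation at the eigenvalues.
\<close>

lemma resolvent_denominator:
  fixes A :: "complex^'s^'s"
  obtains xs g where "set xs \<subseteq> Sp A" "\<And>i j. g i j holomorphic_on UNIV"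
    "\<And>z i j. z \<notin> Sp A \<Longrightarrow> (\<Prod>x\<leftarrow>xs. z - x) * matrix_inv (mat z - A) $ i $ j = g i j z"
proof -
  obtain p r where pr: "p \<noteq> 0" "\<And>z. z \<in> Sp A \<longleftrightarrow> poly p z = 0"
    "\<And>z i j. z \<notin> Sp A \<Longrightarrow> matrix_inv (mat z - A) $ i $ j = poly (r i j) z / poly p z"
    by (rule resolvent_rational[of A]) blast
  obtain xs where xs: "mset xs = proots p" using ex_mset by blast
  have p: "poly p z = lead_coeff p * (\<Prod>x\<leftarrow>xs. z - x)" for z
  proof -
    have "poly (\<Prod>x\<leftarrow>xs. [:-x, 1:]) z = (\<Prod>x\<leftarrow>xs. z - x)"
      by (induction xs) (auto simp: algebra_simps)
    moreover have "p = smult (lead_coeff p) (\<Prod>x\<leftarrow>xs. [:-x, 1:])"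
      using complex_poly_decompose_multiset[of p]
      by (simp flip: xs mset_map add: prod_mset_prod_list)
    ultimately show ?thesis by (metis poly_smult)
  qed
  show ?thesis
  proof
    show "set xs \<subseteq> Sp A"
      unfolding pr(2) subset_iff p by (auto simp: prod_list_zero_iff)
    show "(\<lambda>z. poly (r i j) z / lead_coeff p) holomorphic_on UNIV" for i j
      using pr(1) by (intro holomorphic_intros) auto
    show "(\<Prod>x\<leftarrow>xs. z - x) * matrix_inv (mat z - A) $ i $ j = poly (r i j) z / lead_coeff p"
      if "z \<notin> Sp A" for z i j
      using that pr(1) pr(2)[of z] unfolding pr(3)[OF that] p by auto
  qed
qed

lemma Sp_scale:
  fixes A :: "complex^'s^'s"
  assumes "c \<noteq> 0"
  shows "z \<in> Sp (c *\<^sub>R A) \<longleftrightarrow> z / of_real c \<in> Sp A"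
proof -
  have "(c *\<^sub>R A *v v = z *s v) \<longleftrightarrow> (A *v v = (z / of_real c) *s v)" for v
  proof -
    have "c *\<^sub>R A *v v = of_real c *s (A *v v)"
      by (simp add: vec_eq_iff matrix_vector_mult_def sum_distrib_left scaleR_conv_of_real[where 'a=complex] mult.assoc)
    then show ?thesis using assms by (auto simp: vec_eq_iff field_simps)
  qed
  then show ?thesis by (simp add: Sp_def)
qed

lemma resolvent_scale:
  fixes A :: "complex^'s^'s"
  assumes "c \<noteq> 0" "z \<notin> Sp (c *\<^sub>R A)"
  shows "matrix_inv (mat z - c *\<^sub>R A) $ i $ j = matrix_inv (mat (z / of_real c) - A) $ i $ j / of_real c"
proof -
  let ?B = "mat (z / of_real c) - A"
  have "invertible ?B" using assms Sp_scale[of c z A] by (simp add: Sp_iff)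
  have *: "mat z - c *\<^sub>R A = c *\<^sub>R ?B"
    using assms(1) by (simp add: vec_eq_iff mat_def scaleR_conv_of_real[where 'a=complex] field_simps)
  have "(c *\<^sub>R ?B) ** ((1 / c) *\<^sub>R matrix_inv ?B) = ?B ** matrix_inv ?B"
    using assms(1) by (simp add: vec_eq_iff matrix_matrix_mult_def scaleR_conv_of_real[where 'a=complex])
  then have "matrix_inv (c *\<^sub>R ?B) = (1 / c) *\<^sub>R matrix_inv ?B"
    by (intro matrix_inv_eqI) (simp add: matrix_inv_mult[OF \<open>invertible ?B\<close>])
  then show ?thesis unfolding * by (simp add: scaleR_conv_of_real[where 'a=complex])
qed

text \<open>
  A factor \<open>w\<close> that clears the denominator of the resolvent leaves no residue.
\<close>

lemma fun_calc_zero: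
  fixes A :: "complex^'s^'s"
  assumes "\<And>i j. g i j holomorphic_on UNIV"
    and "\<And>z i j. z \<notin> Sp A \<Longrightarrow> w z * matrix_inv (mat z - A) $ i $ j = g i j z"
    and "h analytic_on Sp A"
  shows "fun_calc (\<lambda>z. w z * h z) A = 0"
proof -
  have "residue (\<lambda>z. w z * h z * matrix_inv (mat z - A) $ i $ j) \<mu> = 0" if \<mu>: "\<mu> \<in> Sp A" for \<mu> i j
  proof -
    obtain r where r: "r > 0" "h holomorphic_on ball \<mu> r" "ball \<mu> r - {\<mu>} \<subseteq> - Sp A"
      using isolating_ball[OF assms(3) \<mu>] .
    have "residue (\<lambda>z. w z * h z * matrix_inv (mat z - A) $ i $ j) \<mu> = residue (\<lambda>z. g i j z * h z) \<mu>"
    proof (rule residue_cong[OF _ refl])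
      have "\<forall>\<^sub>F z in at \<mu>. z \<in> ball \<mu> r - {\<mu>}"
        using r(1) by (intro eventually_at_in_open) auto
      then show "\<forall>\<^sub>F z in at \<mu>. w z * h z * matrix_inv (mat z - A) $ i $ j = g i j z * h z"
      proof eventually_elim
        case (elim z)
        then show ?case using r(3) assms(2)[of z i j] by (auto simp: mult_ac)
      qed
    qed
    also have "\<dots> = 0"
      using r(1,2) assms(1)[of i j]
      by (intro residue_holo[of "ball \<mu> r"] holomorphic_intros) (auto elim: holomorphic_on_subset)
    finally show ?thesis .
  qed
  then show ?thesis by (simp add: fun_calc_def vec_eq_iff)
qed

lemma scaleR_mult_mat_inverse: "(c *\<^sub>R A) ** mat (1 / of_real c) = A"
  if "c \<noteq> 0" for A :: "complex^'s^'s"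
  using that by (simp add: vec_eq_iff matrix_matrix_mult_def mat_def scaleR_conv_of_real[where 'a=complex]
        if_distrib[where f="\<lambda>x. _ * x"] cong: if_cong)

lemma matrix_add_rdistrib: "(A + B) ** C = A ** C + B ** C"
  for A B :: "'a::comm_semiring_1^'n^'m"
  by (simp add: vec_eq_iff matrix_matrix_mult_def distrib_right sum.distrib)

text \<open>
  The matrix \<open>B\<close> depends neither on \<open>c\<close> nor on \<open>g\<close>. With \<open>c = 1\<close> this gives multiplicativity of the
  functional calculus; comparing \<open>c = 1\<close> with general \<open>c\<close> gives its behaviour under dilations.
\<close>

lemma fun_calc_poly_scaled:
  fixes A :: "complex^'s^'s"
  shows "\<exists>B. \<forall>c g. c \<noteq> 0 \<longrightarrow> g analytic_on Sp (c *\<^sub>R A) \<longrightarrow>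
    fun_calc (\<lambda>z. poly p (z / of_real c) * g z) (c *\<^sub>R A) = B ** fun_calc g (c *\<^sub>R A)"
proof (induction p)
  case 0
  have "fun_calc (\<lambda>z. 0) B = 0" for B :: "complex^'s^'s"
    by (simp add: fun_calc_def vec_eq_iff residue_const)
  then show ?case by (intro exI[of _ 0]) (simp add: matrix_matrix_mult_def vec_eq_iff)
next
  case (pCons a p)
  then obtain B where B: "\<And>c g. c \<noteq> 0 \<Longrightarrow> g analytic_on Sp (c *\<^sub>R A) \<Longrightarrow>
    fun_calc (\<lambda>z. poly p (z / of_real c) * g z) (c *\<^sub>R A) = B ** fun_calc g (c *\<^sub>R A)" by blast
  have "fun_calc (\<lambda>z. poly (pCons a p) (z / of_real c) * g z) (c *\<^sub>R A) = (mat a + A ** B) ** fun_calc g (c *\<^sub>R A)"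
    if c: "c \<noteq> 0" and g: "g analytic_on Sp (c *\<^sub>R A)" for c g
  proof -
    let ?q = "\<lambda>z. poly p (z / of_real c) * g z"
    have q: "?q analytic_on Sp (c *\<^sub>R A)"
    proof -
      have "(\<lambda>z. poly p (z / of_real c)) holomorphic_on UNIV" using c by (intro holomorphic_intros) auto
      then have "(\<lambda>z. poly p (z / of_real c)) analytic_on Sp (c *\<^sub>R A)"
        by (metis analytic_on_open open_UNIV analytic_on_subset subset_UNIV)
      then show ?thesis using g by (intro analytic_intros)
    qed
    have "fun_calc (\<lambda>z. poly (pCons a p) (z / of_real c) * g z) (c *\<^sub>R A) =
        fun_calc (\<lambda>z. a * g z + z * ((1 / of_real c) * ?q z)) (c *\<^sub>R A)"
      by (simp add: distrib_right mult.assoc)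
    also have "\<dots> = fun_calc (\<lambda>z. a * g z) (c *\<^sub>R A) + fun_calc (\<lambda>z. z * ((1 / of_real c) * ?q z)) (c *\<^sub>R A)"
      by (intro fun_calc_add analytic_on_mult analytic_on_const analytic_on_ident q g)
    also have "fun_calc (\<lambda>z. z * ((1 / of_real c) * ?q z)) (c *\<^sub>R A) = (c *\<^sub>R A) ** (mat (1 / of_real c) ** fun_calc ?q (c *\<^sub>R A))"
      by (subst fun_calc_times_id) (intro analytic_on_mult analytic_on_const q, simp only: fun_calc_const_mult[OF q])
    also have "fun_calc (\<lambda>z. a * g z) (c *\<^sub>R A) = mat a ** fun_calc g (c *\<^sub>R A)"
      by (rule fun_calc_const_mult[OF g])
    finally show ?thesis
      by (simp add: B[OF c g] scaleR_mult_mat_inverse[OF c] matrix_mul_assoc matrix_add_rdistrib)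
  qed
  then show ?case by blast
qed

text \<open>
  Interpolating \<open>f\<close> at the eigenvalues with the multiplicities of the denominator of the resolvent
  changes \<open>f\<close> only by a function that the functional calculus annihilates. Up to a dilation of the
  matrix, \<open>f\<close> can therefore be replaced by a polynomial.
\<close>

lemma fun_calc_scaled_mult:
  fixes A :: "complex^'s^'s"
  assumes "f analytic_on Sp A"
  shows "\<exists>B. \<forall>c g. c \<noteq> 0 \<longrightarrow> g analytic_on Sp (c *\<^sub>R A) \<longrightarrow>
    fun_calc (\<lambda>z. f (z / of_real c) * g z) (c *\<^sub>R A) = B ** fun_calc g (c *\<^sub>R A)"
proof -
  obtain U where U: "open U" "Sp A \<subseteq> U" "f holomorphic_on U"
    using assms unfolding analytic_on_holomorphic by blast
  obtain xs G where xs: "set xs \<subseteq> Sp A" "\<And>i j. G i j holomorphic_on UNIV"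
    "\<And>z i j. z \<notin> Sp A \<Longrightarrow> (\<Prod>x\<leftarrow>xs. z - x) * matrix_inv (mat z - A) $ i $ j = G i j z"
    by (rule resolvent_denominator[of A]) blast
  obtain h p where ph: "h holomorphic_on U" "\<And>z. z \<in> U \<Longrightarrow> f z = poly p z + (\<Prod>x\<leftarrow>xs. z - x) * h z"
    by (rule newton_interpolation[OF U(1,3) order_trans[OF xs(1) U(2)]]) blast
  obtain B where B: "\<And>c g. c \<noteq> 0 \<Longrightarrow> g analytic_on Sp (c *\<^sub>R A) \<Longrightarrow>
    fun_calc (\<lambda>z. poly p (z / of_real c) * g z) (c *\<^sub>R A) = B ** fun_calc g (c *\<^sub>R A)"
    using fun_calc_poly_scaled[of A p] by blast
  have "fun_calc (\<lambda>z. f (z / of_real c) * g z) (c *\<^sub>R A) = B ** fun_calc g (c *\<^sub>R A)"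
    if c: "c \<noteq> 0" and g: "g analytic_on Sp (c *\<^sub>R A)" for c g
  proof -
    let ?w = "\<lambda>z. (\<Prod>x\<leftarrow>xs. z / of_real c - x)"
    have lin: "(\<lambda>z. z / of_real c) analytic_on S" for S
      using c by (intro analytic_intros) auto
    have img: "(\<lambda>z. z / of_real c) ` Sp (c *\<^sub>R A) \<subseteq> Sp A"
      using Sp_scale[OF c] by auto
    have h: "(\<lambda>z. h (z / of_real c)) analytic_on Sp (c *\<^sub>R A)"
    proof -
      have "h analytic_on U" using ph(1) U(1) by (simp add: analytic_on_open)
      then have "h \<circ> (\<lambda>z. z / of_real c) analytic_on Sp (c *\<^sub>R A)"
        using img U(2) by (intro analytic_on_compose_gen[OF lin, of h U]) auto
      then show ?thesis by (simp add: o_def)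
    qed
    have p: "(\<lambda>z. poly p (z / of_real c)) analytic_on Sp (c *\<^sub>R A)"
    proof -
      have "(\<lambda>z. poly p (z / of_real c)) holomorphic_on UNIV" using c by (intro holomorphic_intros) auto
      then show ?thesis by (metis analytic_on_open open_UNIV analytic_on_subset subset_UNIV)
    qed
    have w: "?w analytic_on S" for S
    proof (induction xs)
      case (Cons x xs)
      then show ?case using c by (auto intro!: analytic_intros)
    qed auto
    have "fun_calc (\<lambda>z. f (z / of_real c) * g z) (c *\<^sub>R A) =
        fun_calc (\<lambda>z. poly p (z / of_real c) * g z + ?w z * (h (z / of_real c) * g z)) (c *\<^sub>R A)"
    proof (rule fun_calc_cong)
      fix \<mu> assume "\<mu> \<in> Sp (c *\<^sub>R A)"
      then have "\<mu> / of_real c \<in> U" using img U(2) by blast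
      moreover have "((\<lambda>z. z / of_real c) \<longlongrightarrow> \<mu> / of_real c) (nhds \<mu>)"
        using c by (intro tendsto_intros filterlim_ident) auto
      ultimately have "\<forall>\<^sub>F z in nhds \<mu>. z / of_real c \<in> U"
        using U(1) topological_tendstoD by blast
      then show "\<forall>\<^sub>F z in nhds \<mu>. f (z / of_real c) * g z =
          poly p (z / of_real c) * g z + ?w z * (h (z / of_real c) * g z)"
        by eventually_elim (simp add: ph(2) algebra_simps)
    qed
    also have "\<dots> = fun_calc (\<lambda>z. poly p (z / of_real c) * g z) (c *\<^sub>R A) +
        fun_calc (\<lambda>z. ?w z * (h (z / of_real c) * g z)) (c *\<^sub>R A)"
      using p h g w by (intro fun_calc_add analytic_intros)
    also have "fun_calc (\<lambda>z. ?w z * (h (z / of_real c) * g z)) (c *\<^sub>R A) = 0"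
    proof (rule fun_calc_zero)
      show "(\<lambda>z. G i j (z / of_real c) / of_real c) holomorphic_on UNIV" for i j
      proof -
        have "G i j \<circ> (\<lambda>z. z / of_real c) holomorphic_on UNIV"
          using c by (intro holomorphic_on_compose_gen[OF _ xs(2)] holomorphic_intros) auto
        then show ?thesis using c by (auto simp: o_def intro!: holomorphic_intros)
      qed
      show "?w z * matrix_inv (mat z - c *\<^sub>R A) $ i $ j = G i j (z / of_real c) / of_real c"
        if "z \<notin> Sp (c *\<^sub>R A)" for z i j
        unfolding resolvent_scale[OF c that]
        using xs(3)[of "z / of_real c" i j] that Sp_scale[OF c, of z A] by simp
      show "(\<lambda>z. h (z / of_real c) * g z) analytic_on Sp (c *\<^sub>R A)"
        using h g by (intro analytic_intros)
    qed
    finally show ?thesis using B[OF c g] by simp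
  qed
  then show ?thesis by blast
qed

lemma fun_calc_mult:
  fixes A :: "complex^'s^'s"
  assumes "f analytic_on Sp A" "g analytic_on Sp A"
  shows "fun_calc (\<lambda>z. f z * g z) A = fun_calc f A ** fun_calc g A"
proof -
  obtain B where B: "\<And>c g. c \<noteq> 0 \<Longrightarrow> g analytic_on Sp (c *\<^sub>R A) \<Longrightarrow>
    fun_calc (\<lambda>z. f (z / of_real c) * g z) (c *\<^sub>R A) = B ** fun_calc g (c *\<^sub>R A)"
    using fun_calc_scaled_mult[OF assms(1)] by blast
  have *: "fun_calc (\<lambda>z. f z * g z) A = B ** fun_calc g A" if "g analytic_on Sp A" for g
    using B[of 1 g] that by simp
  from *[of "\<lambda>_. 1"] have "fun_calc f A = B" by (simp add: fun_calc_one)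
  then show ?thesis using *[OF assms(2)] by simp
qed

lemma fun_calc_commute:
  fixes A :: "complex^'s^'s"
  assumes "f analytic_on Sp A" "g analytic_on Sp A"
  shows "fun_calc f A ** fun_calc g A = fun_calc g A ** fun_calc f A"
  using fun_calc_mult[OF assms] fun_calc_mult[OF assms(2,1)] by (simp add: mult.commute)

lemma fun_calc_scale:
  fixes A :: "complex^'s^'s"
  assumes "c \<noteq> 0" "(\<lambda>z. f (of_real c * z)) analytic_on Sp A"
  shows "fun_calc f (c *\<^sub>R A) = fun_calc (\<lambda>z. f (of_real c * z)) A"
proof -
  obtain B where B: "\<And>d g. d \<noteq> 0 \<Longrightarrow> g analytic_on Sp (d *\<^sub>R A) \<Longrightarrow>
    fun_calc (\<lambda>z. f (of_real c * (z / of_real d)) * g z) (d *\<^sub>R A) = B ** fun_calc g (d *\<^sub>R A)"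
    using fun_calc_scaled_mult[OF assms(2)] by blast
  have "fun_calc f (c *\<^sub>R A) = B" using B[of c "\<lambda>_. 1"] assms(1) by (simp add: fun_calc_one)
  moreover have "fun_calc (\<lambda>z. f (of_real c * z)) A = B" using B[of 1 "\<lambda>_. 1"] by (simp add: fun_calc_one)
  ultimately show ?thesis by simp
qed

lemma fun_calc_resolvent:
  fixes A :: "complex^'s^'s"
  assumes "\<delta> \<notin> Sp A"
  shows "matrix_inv (A - mat \<delta>) = fun_calc (\<lambda>z. 1 / (z - \<delta>)) A"
    and "(\<lambda>z. 1 / (z - \<delta>)) analytic_on Sp A"
proof -
  show an: "(\<lambda>z. 1 / (z - \<delta>)) analytic_on Sp A"
    using assms by (intro analytic_intros) auto
  have id: "fun_calc (\<lambda>z. z - \<delta>) A = A - mat \<delta>"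
  proof -
    have "fun_calc (\<lambda>z. z * 1 + (- \<delta>) * 1) A = fun_calc (\<lambda>z. z * 1) A + fun_calc (\<lambda>z. (- \<delta>) * 1) A"
      by (intro fun_calc_add analytic_intros)
    also have "\<dots> = A - mat \<delta>"
      by (subst fun_calc_times_id, simp, subst fun_calc_const_mult, simp, unfold fun_calc_one matrix_mul_rid)
        (simp add: vec_eq_iff mat_def)
    finally show ?thesis by simp
  qed
  have "(A - mat \<delta>) ** fun_calc (\<lambda>z. 1 / (z - \<delta>)) A = fun_calc (\<lambda>z. (z - \<delta>) * (1 / (z - \<delta>))) A"
    unfolding id[symmetric] by (rule fun_calc_mult[symmetric]) (intro analytic_intros an)+
  also have "\<dots> = fun_calc (\<lambda>z. 1) A"
  proof (rule fun_calc_cong)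
    fix \<mu> assume "\<mu> \<in> Sp A"
    then have "\<forall>\<^sub>F z in nhds \<mu>. z \<in> - {\<delta>}" using assms by (intro eventually_nhds_in_open) auto
    then show "\<forall>\<^sub>F z in nhds \<mu>. (z - \<delta>) * (1 / (z - \<delta>)) = 1"
      by eventually_elim auto
  qed
  finally show "matrix_inv (A - mat \<delta>) = fun_calc (\<lambda>z. 1 / (z - \<delta>)) A"
    by (intro matrix_inv_eqI) (simp add: fun_calc_one)
qed

text \<open>
  The functional calculus only sees finitely many derivatives of the function at the eigenvalues.
  This form makes estimates and interchanges with expectations pointwise statements about
  derivatives.
\<close>

lemma fun_calc_derivatives:
  fixes A :: "complex^'s^'s"
  obtains K :: nat and N where "\<And>f i j. f analytic_on Sp A \<Longrightarrow>
    fun_calc f A $ i $ j = (\<Sum>\<mu>\<in>Sp A. \<Sum>k<K. (deriv ^^ k) f \<mu> * N \<mu> k i j)"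
proof -
  obtain p r where pr: "p \<noteq> 0" "\<And>z. z \<in> Sp A \<longleftrightarrow> poly p z = 0"
    "\<And>z i j. z \<notin> Sp A \<Longrightarrow> matrix_inv (mat z - A) $ i $ j = poly (r i j) z / poly p z"
    by (rule resolvent_rational[of A]) blast
  define q where "q \<mu> = p div [:-\<mu>, 1:] ^ order \<mu> p" for \<mu>
  have pq: "p = [:-\<mu>, 1:] ^ order \<mu> p * q \<mu>" for \<mu>
    unfolding q_def using order_1[of \<mu> p] by simp
  have q0: "poly (q \<mu>) \<mu> \<noteq> 0" for \<mu>
  proof
    assume "poly (q \<mu>) \<mu> = 0"
    then have "[:-\<mu>, 1:] dvd q \<mu>" by (simp add: poly_eq_0_iff_dvd)
    then have "[:-\<mu>, 1:] ^ order \<mu> p * [:-\<mu>, 1:] dvd [:-\<mu>, 1:] ^ order \<mu> p * q \<mu>"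
      by (intro mult_dvd_mono dvd_refl)
    then have "[:-\<mu>, 1:] ^ Suc (order \<mu> p) dvd p"
      unfolding power_Suc2 by (simp only: pq[of \<mu>, symmetric])
    then show False using order_2[OF pr(1)] by blast
  qed
  define g where "g \<mu> i j z = poly (r i j) z / poly (q \<mu>) z" for \<mu> i j z
  define N where "N \<mu> k i j = (if k < order \<mu> p then
      of_nat ((order \<mu> p - 1) choose k) * (deriv ^^ (order \<mu> p - 1 - k)) (g \<mu> i j) \<mu> / fact (order \<mu> p - 1) else 0)"
    for \<mu> k i j
  have "residue (\<lambda>z. f z * matrix_inv (mat z - A) $ i $ j) \<mu> = (\<Sum>k<Suc (degree p). (deriv ^^ k) f \<mu> * N \<mu> k i j)"
    if f: "f analytic_on Sp A" and \<mu>: "\<mu> \<in> Sp A" for f i j \<mu>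
  proof -
    obtain d where d: "d > 0" "f holomorphic_on ball \<mu> d" "ball \<mu> d - {\<mu>} \<subseteq> - Sp A"
      using isolating_ball[OF f \<mu>] .
    let ?n = "order \<mu> p"
    have n: "?n > 0" using \<mu> pr(1,2) by (simp add: order_root)
    have pz: "poly p z = (z - \<mu>) ^ ?n * poly (q \<mu>) z" for z
      by (subst pq[of \<mu>]) (simp add: poly_power)
    have qne: "poly (q \<mu>) z \<noteq> 0" if "z \<in> ball \<mu> d" for z
    proof (cases "z = \<mu>")
      case False
      then have "z \<notin> Sp A" using that d(3) by auto
      then show ?thesis using pr(2)[of z] pz[of z] by auto
    qed (simp add: q0)
    have g: "g \<mu> i j holomorphic_on ball \<mu> d"
      unfolding g_def using qne by (intro holomorphic_intros) auto
    have "residue (\<lambda>z. f z * matrix_inv (mat z - A) $ i $ j) \<mu> =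
        residue (\<lambda>z. (f z * g \<mu> i j z) / (z - \<mu>) ^ Suc (?n - 1)) \<mu>"
    proof (rule residue_cong[OF _ refl])
      have "\<forall>\<^sub>F z in at \<mu>. z \<in> ball \<mu> d - {\<mu>}"
        using d(1) by (intro eventually_at_in_open) auto
      then show "\<forall>\<^sub>F z in at \<mu>. f z * matrix_inv (mat z - A) $ i $ j =
          (f z * g \<mu> i j z) / (z - \<mu>) ^ Suc (?n - 1)"
      proof eventually_elim
        case (elim z)
        then have "z \<notin> Sp A" using d(3) by auto
        show ?case
          using n unfolding pr(3)[OF \<open>z \<notin> Sp A\<close>] pz g_def by (simp add: mult.commute)
      qed
    qed
    also have "\<dots> = (deriv ^^ (?n - 1)) (\<lambda>z. f z * g \<mu> i j z) \<mu> / fact (?n - 1)"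
      using d g by (intro residue_holomorphic_over_power[of "ball \<mu> d"] holomorphic_intros) auto
    also have "(deriv ^^ (?n - 1)) (\<lambda>z. f z * g \<mu> i j z) \<mu> =
        (\<Sum>k = 0..?n - 1. of_nat ((?n - 1) choose k) * (deriv ^^ k) f \<mu> * (deriv ^^ (?n - 1 - k)) (g \<mu> i j) \<mu>)"
      using d g by (intro higher_deriv_mult[of _ "ball \<mu> d"]) auto
    also have "\<dots> / fact (?n - 1) = (\<Sum>k = 0..?n - 1. (deriv ^^ k) f \<mu> * N \<mu> k i j)"
      unfolding sum_divide_distrib using n by (intro sum.cong) (auto simp: N_def)
    also have "\<dots> = (\<Sum>k<Suc (degree p). (deriv ^^ k) f \<mu> * N \<mu> k i j)"
      using order_degree[OF pr(1), of \<mu>] n by (intro sum.mono_neutral_left) (auto simp: N_def)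
    finally show ?thesis .
  qed
  then show ?thesis by (intro that[of N "Suc (degree p)"]) (simp add: fun_calc_def)
qed

text \<open>
  Cauchy's inequalities for the finitely many derivatives that enter.
\<close>

lemma fun_calc_bounded:
  fixes A :: "complex^'s^'s"
  assumes "r > 0"
  shows "\<exists>C\<ge>0. \<forall>f B i j. f holomorphic_on (\<Union>\<mu>\<in>Sp A. ball \<mu> r) \<longrightarrow>
    (\<forall>z\<in>(\<Union>\<mu>\<in>Sp A. ball \<mu> r). cmod (f z) \<le> B) \<longrightarrow> cmod (fun_calc f A $ i $ j) \<le> C * B"
proof -
  obtain K N where N: "\<And>f i j. f analytic_on Sp A \<Longrightarrow>
    fun_calc f A $ i $ j = (\<Sum>\<mu>\<in>Sp A. \<Sum>k<K. (deriv ^^ k) f \<mu> * N \<mu> k i j)"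
    by (rule fun_calc_derivatives[of A]) blast
  define c where "c i j = (\<Sum>\<mu>\<in>Sp A. \<Sum>k<K. fact k / (r / 2) ^ k * cmod (N \<mu> k i j))" for i j
  have c0: "c i j \<ge> 0" for i j
    unfolding c_def using assms by (intro sum_nonneg mult_nonneg_nonneg divide_nonneg_pos) auto
  show ?thesis
  proof (intro exI[of _ "\<Sum>i\<in>UNIV. \<Sum>j\<in>UNIV. c i j"] conjI allI impI)
    show "(\<Sum>i\<in>UNIV. \<Sum>j\<in>UNIV. c i j) \<ge> 0" by (intro sum_nonneg c0)
    fix f B i j
    assume f: "f holomorphic_on (\<Union>\<mu>\<in>Sp A. ball \<mu> r)"
      and B': "\<forall>z\<in>(\<Union>\<mu>\<in>Sp A. ball \<mu> r). cmod (f z) \<le> B"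
    have B: "\<And>z. z \<in> (\<Union>\<mu>\<in>Sp A. ball \<mu> r) \<Longrightarrow> cmod (f z) \<le> B"
      using B' by blast
    have "f analytic_on (\<Union>\<mu>\<in>Sp A. ball \<mu> r)" using f by (subst analytic_on_open) auto
    then have "f analytic_on Sp A" by (rule analytic_on_subset) (use assms in auto)
    have d: "cmod ((deriv ^^ k) f \<mu>) \<le> fact k * B / (r / 2) ^ k" if "\<mu> \<in> Sp A" for k \<mu>
    proof (rule Cauchy_inequality)
      have sub: "cball \<mu> (r / 2) \<subseteq> (\<Union>\<mu>\<in>Sp A. ball \<mu> r)" using that assms by force
      show "f holomorphic_on ball \<mu> (r / 2)"
        using f by (rule holomorphic_on_subset) (use sub ball_subset_cball in blast)
      show "continuous_on (cball \<mu> (r / 2)) f"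
        using holomorphic_on_imp_continuous_on[OF f] sub continuous_on_subset by blast
      show "cmod (f x) \<le> B" if "cmod (\<mu> - x) = r / 2" for x
        using sub that by (intro B) (auto simp: dist_norm subset_iff)
    qed (use assms in auto)
    have "Sp A \<noteq> {} \<Longrightarrow> B \<ge> 0"
      using B norm_ge_zero assms by (metis UN_I centre_in_ball ex_in_conv order_trans)
    then have B0: "c i j * B \<le> (\<Sum>i\<in>UNIV. \<Sum>j\<in>UNIV. c i j) * B"
    proof (cases "Sp A = {}")
      case False
      have "c i j \<le> (\<Sum>j\<in>UNIV. c i j)" by (intro member_le_sum c0) auto
      also have "\<dots> \<le> (\<Sum>i\<in>UNIV. \<Sum>j\<in>UNIV. c i j)" by (intro member_le_sum sum_nonneg c0) auto
      finally show ?thesis using False \<open>Sp A \<noteq> {} \<Longrightarrow> B \<ge> 0\<close> by (intro mult_right_mono) auto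
    qed (simp add: c_def)
    have "cmod (fun_calc f A $ i $ j) \<le> (\<Sum>\<mu>\<in>Sp A. \<Sum>k<K. cmod ((deriv ^^ k) f \<mu>) * cmod (N \<mu> k i j))"
      unfolding N[OF \<open>f analytic_on Sp A\<close>] by (intro order_trans[OF norm_sum] sum_mono) (auto simp: norm_mult)
    also have "\<dots> \<le> (\<Sum>\<mu>\<in>Sp A. \<Sum>k<K. fact k * B / (r / 2) ^ k * cmod (N \<mu> k i j))"
      by (intro sum_mono mult_right_mono d) auto
    also have "\<dots> = c i j * B"
      unfolding c_def sum_distrib_right by (intro sum.cong) (auto simp: field_simps)
    finally show "cmod (fun_calc f A $ i $ j) \<le> (\<Sum>i\<in>UNIV. \<Sum>j\<in>UNIV. c i j) * B" using B0 by simp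
  qed
qed

section \<open>Matrix exponentials\<close>

lemma mat_pow_bounded:
  fixes A :: "real^'s^'s"
  defines "a \<equiv> \<Sum>i\<in>UNIV. \<Sum>j\<in>UNIV. \<bar>A $ i $ j\<bar>"
  shows "\<bar>mat_pow A n $ i $ j\<bar> \<le> a ^ n"
proof (induction n arbitrary: i)
  case 0
  then show ?case by (simp add: mat_def)
next
  case (Suc n)
  have "a \<ge> 0" unfolding a_def by (intro sum_nonneg) auto
  have "\<bar>mat_pow A (Suc n) $ i $ j\<bar> \<le> (\<Sum>k\<in>UNIV. \<bar>A $ i $ k\<bar> * a ^ n)"
    unfolding mat_pow.simps matrix_matrix_mult_def vec_lambda_beta
    by (rule order_trans[OF sum_abs], intro sum_mono) (simp add: abs_mult mult_left_mono Suc)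
  also have "\<dots> = (\<Sum>k\<in>UNIV. \<bar>A $ i $ k\<bar>) * a ^ n" by (simp add: sum_distrib_right)
  also have "\<dots> \<le> a * a ^ n"
    unfolding a_def using \<open>a \<ge> 0\<close>[unfolded a_def] by (intro mult_right_mono member_le_sum sum_nonneg) auto
  finally show ?case by simp
qed

lemma mat_pow_scaleR: "mat_pow (c *\<^sub>R A) n = c ^ n *\<^sub>R mat_pow A n" for A :: "real^'s^'s"
  by (induction n) (simp_all add: vec_eq_iff matrix_matrix_mult_def sum_distrib_left mult_ac)

lemma mat_exp_summable:
  fixes A :: "real^'s^'s"
  shows "summable (\<lambda>n. mat_pow A n $ i $ j / fact n * t ^ n)"
proof (rule summable_comparison_test')
  define a where "a = (\<Sum>i\<in>UNIV. \<Sum>j\<in>UNIV. \<bar>A $ i $ j\<bar>)"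
  show "summable (\<lambda>n. (a * \<bar>t\<bar>) ^ n / fact n)"
    using summable_exp[of "a * \<bar>t\<bar>"] by (simp add: field_simps)
  show "norm (mat_pow A n $ i $ j / fact n * t ^ n) \<le> (a * \<bar>t\<bar>) ^ n / fact n" if "n \<ge> 0" for n
    using mat_pow_bounded[of A n i j, folded a_def]
    by (simp add: abs_mult power_abs power_mult_distrib mult_right_mono divide_right_mono)
qed

lemma mat_exp_sums:
  fixes A :: "real^'s^'s"
  shows "(\<lambda>n. mat_pow A n $ i $ j / fact n * t ^ n) sums (mat_exp (t *\<^sub>R A) $ i $ j)"
proof -
  have "(\<lambda>n. \<Sum>k<n. (1 / fact k) *\<^sub>R mat_pow (t *\<^sub>R A) k) \<longlonglongrightarrow>
     (\<chi> i j. \<Sum>k. mat_pow A k $ i $ j / fact k * t ^ k)"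
    unfolding tendsto_componentwise_iff[where 'b="real^'s"] 
  proof (intro vec_tendstoI)
    fix i j
    have "(\<lambda>n. \<Sum>k<n. mat_pow A k $ i $ j / fact k * t ^ k) \<longlonglongrightarrow> (\<Sum>k. mat_pow A k $ i $ j / fact k * t ^ k)"
      using mat_exp_summable[of A i j t] by (simp add: summable_LIMSEQ)
    then show "(\<lambda>n. (\<Sum>k<n. (1 / fact k) *\<^sub>R mat_pow (t *\<^sub>R A) k) $ i $ j) \<longlonglongrightarrow>
      (\<chi> i j. \<Sum>k. mat_pow A k $ i $ j / fact k * t ^ k) $ i $ j"
      by (simp add: mat_pow_scaleR mult_ac)
  qed
  then have "(\<lambda>k. (1 / fact k) *\<^sub>R mat_pow (t *\<^sub>R A) k) sums (\<chi> i j. \<Sum>k. mat_pow A k $ i $ j / fact k * t ^ k)"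
    by (simp add: sums_def)
  then have "mat_exp (t *\<^sub>R A) = (\<chi> i j. \<Sum>k. mat_pow A k $ i $ j / fact k * t ^ k)"
    unfolding mat_exp_def by (rule sums_unique[symmetric])
  then show ?thesis using mat_exp_summable[of A i j t] by (simp add: summable_sums)
qed

lemma mat_exp_has_derivative:
  fixes A :: "real^'s^'s"
  shows "((\<lambda>t. mat_exp (t *\<^sub>R A) $ i $ j) has_real_derivative
    (\<Sum>k\<in>UNIV. mat_exp (t *\<^sub>R A) $ i $ k * A $ k $ j)) (at t)"
proof -
  have comm: "mat_pow A n ** A = A ** mat_pow A n" for n
    by (induction n) (simp_all add: matrix_mul_assoc[symmetric])
  let ?c = "\<lambda>n. mat_pow A n $ i $ j / fact n"
  have eq: "(\<lambda>t. mat_exp (t *\<^sub>R A) $ i $ j) = (\<lambda>t. \<Sum>n. ?c n * t ^ n)"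
    using mat_exp_sums[of A i j] by (auto simp: sums_iff)
  have "((\<lambda>t. \<Sum>n. ?c n * t ^ n) has_real_derivative (\<Sum>n. diffs ?c n * t ^ n)) (at t)"
    by (intro termdiffs_strong_converges_everywhere mat_exp_summable)
  moreover have "(\<lambda>n. diffs ?c n * t ^ n) sums (\<Sum>k\<in>UNIV. mat_exp (t *\<^sub>R A) $ i $ k * A $ k $ j)"
  proof -
    have "(\<lambda>n. \<Sum>k\<in>UNIV. (mat_pow A n $ i $ k / fact n * t ^ n) * A $ k $ j) sums
      (\<Sum>k\<in>UNIV. mat_exp (t *\<^sub>R A) $ i $ k * A $ k $ j)"
      by (intro sums_sum sums_mult2 mat_exp_sums)
    moreover have "(\<Sum>k\<in>UNIV. (mat_pow A n $ i $ k / fact n * t ^ n) * A $ k $ j) = diffs ?c n * t ^ n" for n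
    proof -
      have "(\<Sum>k\<in>UNIV. (mat_pow A n $ i $ k / fact n * t ^ n) * A $ k $ j) =
        (mat_pow A n ** A) $ i $ j / fact n * t ^ n"
        by (simp add: matrix_matrix_mult_def sum_distrib_right sum_divide_distrib sum_distrib_left mult_ac)
      also have "\<dots> = mat_pow A (Suc n) $ i $ j / fact n * t ^ n" by (simp add: comm)
      also have "\<dots> = diffs ?c n * t ^ n" by (simp add: diffs_def del: mat_pow.simps)
      finally show ?thesis .
    qed
    ultimately show ?thesis by simp
  qed
  ultimately show ?thesis unfolding eq by (simp add: sums_iff)
qed

text \<open>
  The Taylor polynomials of the exponential converge uniformly near the spectrum, and on polynomials the
  functional calculus agrees with matrix powers.
\<close>

lemma fun_calc_exp:
  fixes Q :: "real^'s^'s"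
  shows "fun_calc (\<lambda>u. exp (- of_real t * u)) (- cmat Q) = cmat (mat_exp (t *\<^sub>R Q))"
proof -
  let ?A = "- cmat Q"
  define f where "f n u = (\<Sum>k<n. (- of_real t * u) ^ k / fact k)" for n and u :: complex
  have pow: "fun_calc (\<lambda>u. u ^ k) ?A $ i $ j = of_real ((- 1) ^ k * mat_pow Q k $ i $ j)" for k i j
  proof -
    have "fun_calc (\<lambda>u. u ^ k) ?A = cmat ((- 1) ^ k *\<^sub>R mat_pow Q k)"
    proof (induction k)
      case 0
      show ?case by (simp add: fun_calc_one cmat_def vec_eq_iff mat_def)
    next
      case (Suc k)
      have "fun_calc (\<lambda>u. u * u ^ k) ?A = ?A ** fun_calc (\<lambda>u. u ^ k) ?A"
        by (intro fun_calc_times_id analytic_intros)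
      then show ?case
        unfolding Suc by (simp add: cmat_def vec_eq_iff matrix_matrix_mult_def sum_distrib_left sum_negf mult_ac)
    qed
    then show ?thesis by (simp add: cmat_def)
  qed
  have f_an: "f n analytic_on S" for n S
    unfolding f_def by (intro analytic_intros) auto
  have fn: "fun_calc (f n) ?A $ i $ j = of_real (\<Sum>k<n. mat_pow Q k $ i $ j / fact k * t ^ k)" for n i j
  proof (induction n)
    case 0
    then show ?case by (simp add: f_def fun_calc_def residue_const)
  next
    case (Suc n)
    have "f (Suc n) = (\<lambda>u. f n u + ((- of_real t) ^ n / fact n) * u ^ n)"
      unfolding f_def by (simp add: fun_eq_iff) (metis mult_minus_left power_mult_distrib)
    then have "fun_calc (f (Suc n)) ?A = fun_calc (f n) ?A + mat ((- of_real t) ^ n / fact n) ** fun_calc (\<lambda>u. u ^ n) ?A"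
      by (simp only:) (subst fun_calc_add, rule f_an, intro analytic_intros,
          subst fun_calc_const_mult, intro analytic_intros, rule refl)
    then have "fun_calc (f (Suc n)) ?A $ i $ j = fun_calc (f n) ?A $ i $ j +
       ((- of_real t) ^ n / fact n) * fun_calc (\<lambda>u. u ^ n) ?A $ i $ j"
      by (simp add: matrix_matrix_mult_def mat_def if_distrib[where f="\<lambda>x. x * _"] cong: if_cong)
    also have "((- of_real t) ^ n / fact n) * fun_calc (\<lambda>u. u ^ n) ?A $ i $ j =
        of_real (mat_pow Q n $ i $ j / fact n * t ^ n)"
    proof -
      have "(- t) ^ n * (- 1) ^ n = t ^ n" by (simp flip: power_mult_distrib)
      then have "complex_of_real (t ^ n) = (- of_real t) ^ n * (- 1) ^ n"
        by (metis of_real_minus of_real_mult of_real_power of_real_1)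
      then show ?thesis unfolding pow of_real_mult of_real_divide of_real_fact by simp
    qed
    finally show ?case by (simp add: Suc)
  qed
  obtain C where C: "\<forall>f B i j. f holomorphic_on (\<Union>\<mu>\<in>Sp ?A. ball \<mu> 1) \<longrightarrow>
    (\<forall>z\<in>(\<Union>\<mu>\<in>Sp ?A. ball \<mu> 1). cmod (f z) \<le> B) \<longrightarrow> cmod (fun_calc f ?A $ i $ j) \<le> C * B"
    using fun_calc_bounded[of 1 ?A, OF zero_less_one] by (elim exE conjE)
  \<comment> \<open>all arguments of the exponential that occur lie in the disc of radius \<open>R\<close>\<close>
  define R where "R = \<bar>t\<bar> * ((\<Sum>i\<in>UNIV. \<Sum>j\<in>UNIV. cmod (?A $ i $ j)) + 1)"
  have R: "cmod (- of_real t * z) \<le> R" if "z \<in> (\<Union>\<mu>\<in>Sp ?A. ball \<mu> 1)" for z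
  proof -
    obtain \<mu> where \<mu>: "\<mu> \<in> Sp ?A" "cmod (\<mu> - z) < 1" using \<open>z \<in> _\<close> by (auto simp: dist_norm)
    have "cmod z \<le> cmod \<mu> + cmod (\<mu> - z)" by (metis norm_triangle_sub norm_minus_commute)
    also have "\<dots> \<le> (\<Sum>i\<in>UNIV. \<Sum>j\<in>UNIV. cmod (?A $ i $ j)) + 1" using Sp_bounded[OF \<mu>(1)] \<mu>(2) by simp
    finally show ?thesis by (simp add: R_def norm_mult mult_left_mono)
  qed
  \<comment> \<open>the remainder of the exponential series at \<open>R\<close> dominates the remainders on the whole disc\<close>
  define \<epsilon> where "\<epsilon> n = exp R - (\<Sum>k<n. R ^ k / fact k)" for n
  have sR: "summable (\<lambda>k. R ^ k / fact k)" using summable_exp[of R] by (simp add: field_simps)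
  have eR: "exp R = (\<Sum>k. R ^ k / fact k)" by (simp add: exp_def divide_inverse mult.commute)
  have "\<epsilon> \<longlonglongrightarrow> exp R - exp R"
    unfolding \<epsilon>_def using summable_LIMSEQ[OF sR] by (intro tendsto_diff tendsto_const) (simp add: eR)
  then have \<epsilon>: "\<epsilon> \<longlonglongrightarrow> 0" by simp
  have exp_tail: "cmod (exp w - (\<Sum>k<n. w ^ k / fact k)) \<le> \<epsilon> n" if w: "cmod w \<le> R" for w n
  proof -
    have sw: "summable (\<lambda>k. w ^ k / fact k)" using summable_exp[of w] by (simp add: field_simps)
    have "exp w - (\<Sum>k<n. w ^ k / fact k) = (\<Sum>k. w ^ (k + n) / fact (k + n))"
      using suminf_minus_initial_segment[OF sw, of n] by (simp add: exp_def scaleR_conv_of_real field_simps)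
    also have "cmod \<dots> \<le> (\<Sum>k. R ^ (k + n) / fact (k + n))"
    proof (rule norm_suminf_le)
      show "summable (\<lambda>k. R ^ (k + n) / fact (k + n))"
        using summable_ignore_initial_segment[OF sR] .
      show "cmod (w ^ (k + n) / fact (k + n)) \<le> R ^ (k + n) / fact (k + n)" for k
        using w by (simp add: norm_divide norm_power divide_right_mono power_mono)
    qed
    also have "\<dots> = \<epsilon> n" using suminf_minus_initial_segment[OF sR, of n] by (simp add: \<epsilon>_def eR)
    finally show ?thesis .
  qed
  have "fun_calc (\<lambda>u. exp (- of_real t * u)) ?A $ i $ j = cmat (mat_exp (t *\<^sub>R Q)) $ i $ j" for i j
  proof -
    have "(\<lambda>n. fun_calc (f n) ?A $ i $ j - fun_calc (\<lambda>u. exp (- of_real t * u)) ?A $ i $ j) \<longlonglongrightarrow> 0"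
    proof (rule Lim_null_comparison)
      show "(\<lambda>n. C * \<epsilon> n) \<longlonglongrightarrow> 0" using tendsto_mult_left[OF \<epsilon>, of C] by simp
      have "cmod (fun_calc (f n) ?A $ i $ j - fun_calc (\<lambda>u. exp (- of_real t * u)) ?A $ i $ j) \<le> C * \<epsilon> n" for n
      proof -
        have "fun_calc (\<lambda>u. f n u + (- 1) * exp (- of_real t * u)) ?A =
           fun_calc (f n) ?A + mat (- 1) ** fun_calc (\<lambda>u. exp (- of_real t * u)) ?A"
          by (subst fun_calc_add, rule f_an, intro analytic_intros, subst fun_calc_const_mult, intro analytic_intros, rule refl)
        then have "fun_calc (\<lambda>u. f n u + (- 1) * exp (- of_real t * u)) ?A $ i $ j =
           fun_calc (f n) ?A $ i $ j - fun_calc (\<lambda>u. exp (- of_real t * u)) ?A $ i $ j"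
          by (simp add: matrix_matrix_mult_def mat_def if_distrib[where f="\<lambda>x. x * _"] cong: if_cong)
        moreover have "cmod (fun_calc (\<lambda>u. f n u + (- 1) * exp (- of_real t * u)) ?A $ i $ j) \<le> C * \<epsilon> n"
        proof (rule C[rule_format])
          show "(\<lambda>u. f n u + (- 1) * exp (- of_real t * u)) holomorphic_on (\<Union>\<mu>\<in>Sp ?A. ball \<mu> 1)"
            unfolding f_def by (intro holomorphic_intros) auto
          fix z assume z: "z \<in> (\<Union>\<mu>\<in>Sp ?A. ball \<mu> 1)"
          show "cmod (f n z + (- 1) * exp (- of_real t * z)) \<le> \<epsilon> n"
            using exp_tail[OF R[OF z], of n] by (simp add: f_def norm_minus_commute)
        qed
        ultimately show ?thesis by simp
      qed
      then show "\<forall>\<^sub>F n in sequentially. norm (fun_calc (f n) ?A $ i $ j - fun_calc (\<lambda>u. exp (- of_real t * u)) ?A $ i $ j) \<le> C * \<epsilon> n"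
        by simp
    qed
    then have "(\<lambda>n. fun_calc (f n) ?A $ i $ j) \<longlonglongrightarrow> fun_calc (\<lambda>u. exp (- of_real t * u)) ?A $ i $ j"
      by (simp add: LIM_zero_iff)
    moreover have "(\<lambda>n. fun_calc (f n) ?A $ i $ j) \<longlonglongrightarrow> of_real (mat_exp (t *\<^sub>R Q) $ i $ j)"
      unfolding fn using mat_exp_sums[of Q i j t] by (intro tendsto_of_real) (simp add: sums_def)
    ultimately show ?thesis by (simp add: LIMSEQ_unique cmat_def)
  qed
  then show ?thesis by (simp add: vec_eq_iff)
qed

section \<open>Exponential moments as functions of the exponent\<close>

lemma power_exp_bounded:
  fixes \<sigma> b :: real
  assumes "\<sigma> > 0"
  obtains C where "C \<ge> 0" "\<And>y. y \<le> b \<Longrightarrow> \<bar>y\<bar> ^ k * exp (\<sigma> * y) \<le> C"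
proof
  define m where "m = max b 0"
  let ?C = "m ^ k * exp (\<sigma> * m) + fact k / \<sigma> ^ k"
  have m: "m \<ge> 0" "b \<le> m" by (auto simp: m_def)
  then show "?C \<ge> 0" using assms by (intro add_nonneg_nonneg mult_nonneg_nonneg divide_nonneg_pos) auto
  show "\<bar>y\<bar> ^ k * exp (\<sigma> * y) \<le> ?C" if "y \<le> b" for y
  proof (cases "y \<ge> 0")
    case True
    then have "\<bar>y\<bar> ^ k * exp (\<sigma> * y) \<le> m ^ k * exp (\<sigma> * m)"
      using that m assms by (intro mult_mono power_mono) auto
    moreover have "fact k / \<sigma> ^ k \<ge> (0::real)" using assms by simp
    ultimately show ?thesis by linarith
  next
    case False
    let ?x = "\<sigma> * \<bar>y\<bar>"
    have "summable (\<lambda>n. ?x ^ n / fact n)" using summable_exp[of ?x] by (simp add: field_simps)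
    then have "(\<Sum>n\<in>{k}. ?x ^ n / fact n) \<le> (\<Sum>n. ?x ^ n / fact n)"
      using assms by (intro sum_le_suminf) auto
    then have "?x ^ k / fact k \<le> exp ?x" by (simp add: exp_def divide_inverse mult.commute)
    then have "\<bar>y\<bar> ^ k \<le> fact k / \<sigma> ^ k * exp ?x"
      using assms by (simp add: power_mult_distrib field_simps)
    then have "\<bar>y\<bar> ^ k * exp (\<sigma> * y) \<le> fact k / \<sigma> ^ k * exp ?x * exp (\<sigma> * y)"
      by (intro mult_right_mono) auto
    also have "exp ?x * exp (\<sigma> * y) = 1" using False by (simp flip: exp_add)
    then have "fact k / \<sigma> ^ k * exp ?x * exp (\<sigma> * y) = fact k / \<sigma> ^ k" by (simp only: mult.assoc mult_1_right)
    finally show ?thesis using m by (simp add: add_increasing)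
  qed
qed

definition exp_moment :: "'w measure \<Rightarrow> 'w set \<Rightarrow> ('w \<Rightarrow> real) \<Rightarrow> nat \<Rightarrow> complex \<Rightarrow> complex" where
  "exp_moment N D Y k u = (\<integral>w. indicator D w *\<^sub>R (of_real (Y w) ^ k * exp (u * of_real (Y w))) \<partial>N)"

context prob_space
begin

lemma exp_moment_integrable:
  assumes Y: "Y \<in> borel_measurable M" and D: "D \<in> sets M" and b: "AE w in M. w \<in> D \<longrightarrow> Y w \<le> b"
    and u: "Re u > 0"
  shows "integrable M (\<lambda>w. indicator D w *\<^sub>R (complex_of_real (Y w) ^ k * exp (u * of_real (Y w))))"
proof -
  obtain C where C: "C \<ge> 0" "\<And>y. y \<le> b \<Longrightarrow> \<bar>y\<bar> ^ k * exp (Re u * y) \<le> C"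
    using power_exp_bounded[OF u, of b k] by blast
  show ?thesis
  proof (rule integrable_const_bound[of _ C])
    show "AE w in M. norm (indicator D w *\<^sub>R (complex_of_real (Y w) ^ k * exp (u * of_real (Y w)))) \<le> C"
      using b
    proof eventually_elim
      case (elim w)
      then show ?case using C(1) C(2)[of "Y w"]
        by (auto simp: norm_mult norm_power indicator_def)
    qed
  qed (use Y D in measurable)
qed

text \<open>
  Differentiation under the expectation is allowed because \<open>Y\<close> is bounded above on \<open>D\<close> and the exponent has
  positive real part: for negative values of \<open>Y\<close> the exponential is a damping factor that controls every
  power, also after a shift of the exponent by less than half of its real part.
\<close>

lemma exp_moment_deriv:
  assumes Y: "Y \<in> borel_measurable M" and D: "D \<in> sets M" and b: "AE w in M. w \<in> D \<longrightarrow> Y w \<le> b"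
    and u: "Re u > 0"
  shows "(exp_moment M D Y k has_field_derivative exp_moment M D Y (Suc k) u) (at u)"
proof -
  define \<sigma> where "\<sigma> = Re u"
  have "\<sigma> > 0" "\<sigma> / 2 > 0" using u by (auto simp: \<sigma>_def)
  obtain C where C: "C \<ge> 0" "\<And>y. y \<le> b \<Longrightarrow> \<bar>y\<bar> ^ (k + 2) * exp (\<sigma> / 2 * y) \<le> C"
    using power_exp_bounded[OF \<open>\<sigma> / 2 > 0\<close>, of b "k + 2"] by blast
  define C' where "C' = exp (\<sigma> * max b 0) * C"
  have C': "C' \<ge> 0" using C(1) by (simp add: C'_def)
  let ?f = "\<lambda>k u w. indicator D w *\<^sub>R (complex_of_real (Y w) ^ k * exp (u * of_real (Y w)))"
  have pt: "cmod (of_real y ^ k * exp ((u + h) * of_real y) - of_real y ^ k * exp (u * of_real y)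
       - h * (of_real y ^ Suc k * exp (u * of_real y))) \<le> (cmod h)\<^sup>2 * C'"
    if "y \<le> b" "cmod h \<le> \<sigma> / 2" for y h
  proof -
    let ?z = "h * of_real y"
    have "cmod (exp ?z - (\<Sum>k\<le>1. ?z ^ k / fact k)) \<le> exp \<bar>Re ?z\<bar> * cmod ?z ^ Suc 1 / fact 1"
      by (rule Taylor_exp)
    then have "cmod (exp ?z - 1 - ?z) \<le> exp \<bar>Re ?z\<bar> * (cmod ?z)\<^sup>2"
      by (simp add: power2_eq_square diff_diff_eq)
    also have "\<dots> \<le> exp (cmod h * \<bar>y\<bar>) * (cmod ?z)\<^sup>2"
    proof -
      have "\<bar>Re ?z\<bar> \<le> cmod ?z" by (rule abs_Re_le_cmod)
      then show ?thesis by (intro mult_right_mono) (auto simp: norm_mult)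
    qed
    also have "(cmod ?z)\<^sup>2 = (cmod h)\<^sup>2 * \<bar>y\<bar>\<^sup>2" by (simp add: norm_mult power_mult_distrib)
    finally have t: "cmod (exp ?z - 1 - ?z) \<le> exp (cmod h * \<bar>y\<bar>) * ((cmod h)\<^sup>2 * \<bar>y\<bar>\<^sup>2)" .
    have "of_real y ^ k * exp ((u + h) * of_real y) - of_real y ^ k * exp (u * of_real y)
       - h * (of_real y ^ Suc k * exp (u * of_real y)) = of_real y ^ k * exp (u * of_real y) * (exp ?z - 1 - ?z)"
      by (simp add: distrib_right exp_add algebra_simps)
    also have "cmod \<dots> = \<bar>y\<bar> ^ k * exp (\<sigma> * y) * cmod (exp ?z - 1 - ?z)"
      by (simp add: norm_mult norm_power \<sigma>_def)
    also have "\<dots> \<le> \<bar>y\<bar> ^ k * exp (\<sigma> * y) * (exp (cmod h * \<bar>y\<bar>) * ((cmod h)\<^sup>2 * \<bar>y\<bar>\<^sup>2))"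
      by (intro mult_left_mono t) auto
    also have "\<dots> = (cmod h)\<^sup>2 * (\<bar>y\<bar> ^ (k + 2) * exp (\<sigma> * y + cmod h * \<bar>y\<bar>))"
      by (simp add: exp_add power_add power2_eq_square mult_ac)
    also have "\<dots> \<le> (cmod h)\<^sup>2 * (\<bar>y\<bar> ^ (k + 2) * exp (\<sigma> * max b 0 + \<sigma> / 2 * y))"
    proof -
      have "cmod h * \<bar>y\<bar> \<le> \<sigma> / 2 * \<bar>y\<bar>" using that by (intro mult_right_mono) auto
      moreover have "\<sigma> / 2 * \<bar>y\<bar> + \<sigma> / 2 * y \<le> \<sigma> * max b 0"
      proof (cases "y \<ge> 0")
        case True
        then have "\<sigma> / 2 * \<bar>y\<bar> + \<sigma> / 2 * y = \<sigma> * y" by simp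
        also have "\<dots> \<le> \<sigma> * max b 0" using that \<open>\<sigma> > 0\<close> by (intro mult_left_mono) auto
        finally show ?thesis .
      qed (use \<open>\<sigma> > 0\<close> in auto)
      ultimately have "\<sigma> * y + cmod h * \<bar>y\<bar> \<le> \<sigma> * max b 0 + \<sigma> / 2 * y" by (simp add: field_simps)
      then show ?thesis by (intro mult_left_mono) auto
    qed
    also have "\<dots> = (cmod h)\<^sup>2 * (exp (\<sigma> * max b 0) * (\<bar>y\<bar> ^ (k + 2) * exp (\<sigma> / 2 * y)))"
      by (simp add: exp_add mult_ac)
    also have "\<dots> \<le> (cmod h)\<^sup>2 * C'"
      unfolding C'_def by (intro mult_left_mono C that) auto
    finally show ?thesis .
  qed
  have est: "cmod ((exp_moment M D Y k (u + h) - exp_moment M D Y k u) / h - exp_moment M D Y (Suc k) u) \<le> cmod h * C'"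
    if h: "h \<noteq> 0" "cmod h < \<sigma> / 2" for h
  proof -
    have "Re (u + h) > 0" using h abs_Re_le_cmod[of h] \<open>\<sigma> > 0\<close> by (simp add: \<sigma>_def)
    note int = exp_moment_integrable[OF Y D b]
    have eq: "exp_moment M D Y k (u + h) - exp_moment M D Y k u - h * exp_moment M D Y (Suc k) u =
        (\<integral>w. ?f k (u + h) w - ?f k u w - h * ?f (Suc k) u w \<partial>M)"
      unfolding exp_moment_def
      using int[OF \<open>Re (u + h) > 0\<close>, of k] int[OF u, of k] int[OF u, of "Suc k"]
      by (simp only: Bochner_Integration.integral_diff Bochner_Integration.integrable_diff
          integrable_mult_right integral_mult_right_zero)
    have "cmod (exp_moment M D Y k (u + h) - exp_moment M D Y k u - h * exp_moment M D Y (Suc k) u) \<le>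
        (\<integral>w. cmod (?f k (u + h) w - ?f k u w - h * ?f (Suc k) u w) \<partial>M)"
      unfolding eq by (rule integral_norm_bound)
    moreover have "(\<integral>w. cmod (?f k (u + h) w - ?f k u w - h * ?f (Suc k) u w) \<partial>M) \<le> (\<integral>w. (cmod h)\<^sup>2 * C' \<partial>M)"
    proof (rule integral_mono_AE)
      show "integrable M (\<lambda>w. cmod (?f k (u + h) w - ?f k u w - h * ?f (Suc k) u w))"
        using int[OF \<open>Re (u + h) > 0\<close>, of k] int[OF u, of k] int[OF u, of "Suc k"]
        by (intro integrable_norm Bochner_Integration.integrable_diff integrable_mult_right)
      show "AE w in M. cmod (?f k (u + h) w - ?f k u w - h * ?f (Suc k) u w) \<le> (cmod h)\<^sup>2 * C'"
        using b
      proof eventually_elim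
        case (elim w)
        then show ?case
          using pt[of "Y w" h] h C' by (cases "w \<in> D") (auto simp: indicator_def)
      qed
    qed simp
    moreover have "(\<integral>w. (cmod h)\<^sup>2 * C' \<partial>M) = (cmod h)\<^sup>2 * C'" by (simp add: prob_space)
    ultimately have "cmod (exp_moment M D Y k (u + h) - exp_moment M D Y k u - h * exp_moment M D Y (Suc k) u) \<le> (cmod h)\<^sup>2 * C'" by linarith
    moreover have "(exp_moment M D Y k (u + h) - exp_moment M D Y k u) / h - exp_moment M D Y (Suc k) u =
       (exp_moment M D Y k (u + h) - exp_moment M D Y k u - h * exp_moment M D Y (Suc k) u) / h"
      using h(1) by (simp add: field_simps)
    ultimately show ?thesis
      using h(1) by (simp add: norm_divide divide_le_eq power2_eq_square mult_ac)
  qed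
  have "((\<lambda>h. (exp_moment M D Y k (u + h) - exp_moment M D Y k u) / h - exp_moment M D Y (Suc k) u) \<longlongrightarrow> 0) (at 0)"
  proof (rule Lim_null_comparison)
    show "((\<lambda>h. cmod h * C') \<longlongrightarrow> 0) (at 0)" by (auto intro!: tendsto_eq_intros)
    have "\<forall>\<^sub>F h in at 0. h \<in> ball 0 (\<sigma> / 2) - {0 :: complex}"
      using \<open>\<sigma> > 0\<close> by (intro eventually_at_in_open) auto
    then show "\<forall>\<^sub>F h in at 0. norm ((exp_moment M D Y k (u + h) - exp_moment M D Y k u) / h - exp_moment M D Y (Suc k) u) \<le> cmod h * C'"
      by eventually_elim (use est in auto)
  qed
  then show ?thesis
    unfolding DERIV_def by (simp add: LIM_zero_iff)
qed

lemma exp_moment_holomorphic: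
  assumes Y: "Y \<in> borel_measurable M" and D: "D \<in> sets M" and b: "AE w in M. w \<in> D \<longrightarrow> Y w \<le> b"
  shows "exp_moment M D Y 0 holomorphic_on {u. Re u > 0}"
  unfolding holomorphic_on_open[OF open_halfspace_Re_gt]
  using exp_moment_deriv[OF Y D b] by blast

lemma exp_moment_higher_deriv:
  assumes Y: "Y \<in> borel_measurable M" and D: "D \<in> sets M" and b: "AE w in M. w \<in> D \<longrightarrow> Y w \<le> b"
    and "Re u > 0"
  shows "(deriv ^^ k) (exp_moment M D Y 0) u = exp_moment M D Y k u"
  using \<open>Re u > 0\<close>
proof (induction k arbitrary: u)
  case (Suc k)
  have "\<forall>\<^sub>F v in nhds u. v \<in> {u. Re u > 0}"
    using Suc.prems by (intro eventually_nhds_in_open open_halfspace_Re_gt) auto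
  then have "deriv ((deriv ^^ k) (exp_moment M D Y 0)) u = deriv (exp_moment M D Y k) u"
    by (intro deriv_cong_ev refl) (auto elim!: eventually_mono simp: Suc.IH)
  also have "\<dots> = exp_moment M D Y (Suc k) u"
    by (intro DERIV_imp_deriv exp_moment_deriv[OF Y D b] Suc.prems)
  finally show ?case by simp
qed simp

lemma higher_deriv_exp_mult: "(deriv ^^ k) (\<lambda>u. exp (u * c)) u = c ^ k * exp (u * c)" for c u :: complex
proof (induction k arbitrary: u)
  case (Suc k)
  then have "(deriv ^^ k) (\<lambda>u. exp (u * c)) = (\<lambda>u. c ^ k * exp (u * c))" by (simp add: fun_eq_iff)
  moreover have "deriv (\<lambda>u. c ^ k * exp (u * c)) u = c ^ Suc k * exp (u * c)"
    by (rule DERIV_imp_deriv) (auto intro!: derivative_eq_intros)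
  ultimately show ?case by simp
qed simp

text \<open>
  Expectation and functional calculus commute: the functional calculus is a finite combination of
  derivatives, and each of these may be taken under the expectation.
\<close>

lemma fun_calc_exp_moment:
  fixes A :: "complex^'s^'s"
  assumes Y: "Y \<in> borel_measurable M" and D: "D \<in> sets M" and b: "AE w in M. w \<in> D \<longrightarrow> Y w \<le> b"
    and A: "\<And>\<mu>. \<mu> \<in> Sp A \<Longrightarrow> Re \<mu> > 0"
  shows "integrable M (\<lambda>w. indicator D w *\<^sub>R fun_calc (\<lambda>u. exp (u * of_real (Y w))) A $ i $ j)"
    and "fun_calc (exp_moment M D Y 0) A $ i $ j =
      (\<integral>w. indicator D w *\<^sub>R fun_calc (\<lambda>u. exp (u * of_real (Y w))) A $ i $ j \<partial>M)"
proof -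
  obtain K N where N: "\<And>f i j. f analytic_on Sp A \<Longrightarrow>
    fun_calc f A $ i $ j = (\<Sum>\<mu>\<in>Sp A. \<Sum>k<K. (deriv ^^ k) f \<mu> * N \<mu> k i j)"
    by (rule fun_calc_derivatives[of A]) blast
  have "exp_moment M D Y 0 analytic_on {u. Re u > 0}"
    using exp_moment_holomorphic[OF Y D b] by (subst analytic_on_open) (auto simp: open_halfspace_Re_gt)
  then have an: "exp_moment M D Y 0 analytic_on Sp A" by (rule analytic_on_subset) (use A in auto)
  have e: "fun_calc (\<lambda>u. exp (u * of_real y)) A $ i $ j =
      (\<Sum>\<mu>\<in>Sp A. \<Sum>k<K. (of_real y ^ k * exp (\<mu> * of_real y)) * N \<mu> k i j)" for y
  proof -
    have "(\<lambda>u. exp (u * of_real y)) analytic_on Sp A"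
      by (intro analytic_intros)
    then show ?thesis by (simp add: N higher_deriv_exp_mult)
  qed
  have ew: "indicator D w *\<^sub>R fun_calc (\<lambda>u. exp (u * of_real (Y w))) A $ i $ j =
     (\<Sum>\<mu>\<in>Sp A. \<Sum>k<K. (indicator D w *\<^sub>R (of_real (Y w) ^ k * exp (\<mu> * of_real (Y w)))) * N \<mu> k i j)" for w
    unfolding e by (simp add: scaleR_sum_right)
  show "integrable M (\<lambda>w. indicator D w *\<^sub>R fun_calc (\<lambda>u. exp (u * of_real (Y w))) A $ i $ j)"
    unfolding ew
    by (intro Bochner_Integration.integrable_sum integrable_mult_left exp_moment_integrable[OF Y D b] A)
  have "fun_calc (exp_moment M D Y 0) A $ i $ j = (\<Sum>\<mu>\<in>Sp A. \<Sum>k<K. exp_moment M D Y k \<mu> * N \<mu> k i j)"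
    unfolding N[OF an] by (intro sum.cong refl) (simp add: exp_moment_higher_deriv[OF Y D b A])
  also have "\<dots> = (\<Sum>\<mu>\<in>Sp A. \<Sum>k<K. \<integral>w. (indicator D w *\<^sub>R (of_real (Y w) ^ k * exp (\<mu> * of_real (Y w)))) * N \<mu> k i j \<partial>M)"
    unfolding exp_moment_def by (intro sum.cong refl integral_mult_left_zero[symmetric])
  also have "\<dots> = (\<Sum>\<mu>\<in>Sp A. \<integral>w. (\<Sum>k<K. (indicator D w *\<^sub>R (of_real (Y w) ^ k * exp (\<mu> * of_real (Y w)))) * N \<mu> k i j) \<partial>M)"
    by (intro sum.cong refl Bochner_Integration.integral_sum[symmetric] integrable_mult_left exp_moment_integrable[OF Y D b] A)
  also have "\<dots> = (\<integral>w. indicator D w *\<^sub>R fun_calc (\<lambda>u. exp (u * of_real (Y w))) A $ i $ j \<partial>M)"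
    unfolding ew
    by (intro Bochner_Integration.integral_sum[symmetric] Bochner_Integration.integrable_sum integrable_mult_left
        exp_moment_integrable[OF Y D b] A)
  finally show "fun_calc (exp_moment M D Y 0) A $ i $ j =
      (\<integral>w. indicator D w *\<^sub>R fun_calc (\<lambda>u. exp (u * of_real (Y w))) A $ i $ j \<partial>M)" .
qed

end

section \<open>Transience and the semigroup of the phases\<close>

lemma sum_option: "(\<Sum>j\<in>(UNIV :: 'a::finite option set). f j) = f None + (\<Sum>j\<in>UNIV. f (Some j))"
  by (simp add: UNIV_option_conv sum.reindex o_def)

lemma gen_hat_entries [simp]:
  "gen_hat Q $ None $ j = 0" "gen_hat Q $ Some i $ Some k = Q $ i $ k"
  "gen_hat Q $ Some i $ None = exit_rates Q $ i"
  by (simp_all add: gen_hat_def)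

lemma mat_pow_gen_hat: "mat_pow (gen_hat Q) n $ Some i $ Some j = mat_pow Q n $ i $ j"
  "mat_pow (gen_hat Q) n $ None $ Some j = 0"
  by (induction n arbitrary: i) (simp_all add: mat_def matrix_matrix_mult_def sum_option)

lemma mat_exp_gen_hat:
  "mat_exp (t *\<^sub>R gen_hat Q) $ Some i $ Some j = mat_exp (t *\<^sub>R Q) $ i $ j"
  "mat_exp (t *\<^sub>R gen_hat Q) $ None $ Some j = 0"
proof -
  show "mat_exp (t *\<^sub>R gen_hat Q) $ Some i $ Some j = mat_exp (t *\<^sub>R Q) $ i $ j"
    using mat_exp_sums[of "gen_hat Q" "Some i" "Some j" t] mat_exp_sums[of Q i j t]
    unfolding mat_pow_gen_hat by (rule sums_unique2)
  show "mat_exp (t *\<^sub>R gen_hat Q) $ None $ Some j = 0"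
    using mat_exp_sums[of "gen_hat Q" None "Some j" t] unfolding mat_pow_gen_hat by (simp add: sums_iff)
qed

lemma mat_exp_zero: "mat_exp (0 *\<^sub>R A) = mat 1" for A :: "real^'s^'s"
proof -
  have "mat_exp (0 *\<^sub>R A) $ i $ j = mat 1 $ i $ j" for i j
    using mat_exp_sums[of A i j 0] sums_finite[of "{0}" "\<lambda>n. mat_pow A n $ i $ j / fact n * 0 ^ n"]
    by (auto intro: sums_unique2)
  then show ?thesis by (simp add: vec_eq_iff)
qed

lemma mat_exp_eigenvector:
  fixes Q :: "real^'s^'s"
  assumes "cmat Q *v v = z *s v"
  shows "(\<Sum>j\<in>UNIV. of_real (mat_exp (t *\<^sub>R Q) $ i $ j) * v $ j) = exp (of_real t * z) * v $ i"
proof -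
  have pow: "(\<Sum>j\<in>UNIV. of_real (mat_pow Q n $ i $ j) * v $ j) = z ^ n * v $ i" for n i
  proof (induction n arbitrary: i)
    case 0
    show ?case by (simp add: mat_def if_distrib[where f="\<lambda>x. of_real x * _"] cong: if_cong)
  next
    case (Suc n)
    have "(\<Sum>j\<in>UNIV. of_real (mat_pow Q (Suc n) $ i $ j) * v $ j) =
        (\<Sum>k\<in>UNIV. of_real (Q $ i $ k) * (\<Sum>j\<in>UNIV. of_real (mat_pow Q n $ k $ j) * v $ j))"
      by (simp add: matrix_matrix_mult_def sum_distrib_right sum_distrib_left mult.assoc) (rule sum.swap)
    also have "\<dots> = z ^ n * (cmat Q *v v) $ i"
      unfolding Suc by (simp add: matrix_vector_mult_def cmat_def sum_distrib_left mult_ac)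
    finally show ?case unfolding assms by simp
  qed
  have "(\<lambda>n. \<Sum>j\<in>UNIV. of_real (mat_pow Q n $ i $ j / fact n * t ^ n) * v $ j) sums
      (\<Sum>j\<in>UNIV. of_real (mat_exp (t *\<^sub>R Q) $ i $ j) * v $ j)"
    by (intro sums_sum sums_mult2 sums_of_real mat_exp_sums)
  moreover have "(\<Sum>j\<in>UNIV. of_real (mat_pow Q n $ i $ j / fact n * t ^ n) * v $ j) =
     (of_real t * z) ^ n /\<^sub>R fact n * v $ i" for n
  proof -
    have "(\<Sum>j\<in>UNIV. of_real (mat_pow Q n $ i $ j / fact n * t ^ n) * v $ j) =
       of_real (t ^ n / fact n) * (\<Sum>j\<in>UNIV. of_real (mat_pow Q n $ i $ j) * v $ j)"
      by (simp add: sum_distrib_left sum_divide_distrib mult_ac)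
    then show ?thesis unfolding pow by (simp add: scaleR_conv_of_real power_mult_distrib divide_inverse mult_ac)
  qed
  ultimately have "(\<lambda>n. (of_real t * z) ^ n /\<^sub>R fact n * v $ i) sums
      (\<Sum>j\<in>UNIV. of_real (mat_exp (t *\<^sub>R Q) $ i $ j) * v $ j)" by simp
  moreover have "(\<lambda>n. (of_real t * z) ^ n /\<^sub>R fact n * v $ i) sums (exp (of_real t * z) * v $ i)"
    by (intro sums_mult2 exp_converges)
  ultimately show ?thesis by (rule sums_unique2)
qed

context prob_space
begin

lemma markov_chain_measurable:
  assumes "markov_chain M K A \<mu>" "t \<ge> 0"
  shows "{w\<in>space M. K t w = j} \<in> sets M"
proof -
  have "K t \<in> measurable M (count_space UNIV)" using assms by (simp add: markov_chain_def)
  then have "K t -` {j} \<inter> space M \<in> sets M" by (rule measurable_sets) simp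
  then show ?thesis by (simp add: vimage_def Int_def conj_commute)
qed

lemma prob_split:
  fixes Z :: "'a \<Rightarrow> 's::finite"
  assumes "\<And>i. {w\<in>space M. Z w = i} \<in> sets M" "{w\<in>space M. P w} \<in> sets M"
  shows "prob {w\<in>space M. P w} = (\<Sum>i\<in>UNIV. prob {w\<in>space M. Z w = i \<and> P w})"
proof -
  have "{w\<in>space M. P w} = (\<Union>i\<in>UNIV. {w\<in>space M. Z w = i \<and> P w})" by auto
  moreover have "{w\<in>space M. Z w = i \<and> P w} \<in> sets M" for i
    using sets.Int[OF assms(1)[of i] assms(2)] by (simp add: Int_def conj_ac)
  then have "prob (\<Union>i\<in>UNIV. {w\<in>space M. Z w = i \<and> P w}) = (\<Sum>i\<in>UNIV. prob {w\<in>space M. Z w = i \<and> P w})"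
    by (intro finite_measure_finite_Union) (auto simp: disjoint_family_on_def)
  ultimately show ?thesis by simp
qed

lemma markov_chain_marginal:
  assumes mc: "markov_chain M K A \<mu>" and t: "0 \<le> t"
  shows "prob {w\<in>space M. K t w = j} = (\<Sum>i\<in>UNIV. \<mu> i * mat_exp (t *\<^sub>R A) $ i $ j)"
proof -
  have "prob {w\<in>space M. K 0 w = i \<and> K t w = j} = \<mu> i * mat_exp (t *\<^sub>R A) $ i $ j" for i
  proof -
    let ?t = "\<lambda>k::nat. if k = 0 then 0 else t" and ?s = "\<lambda>k::nat. if k = 0 then i else j"
    have "prob {w\<in>space M. \<forall>k\<le>1. K (?t k) w = ?s k} =
        \<mu> (?s 0) * (\<Prod>k<1. mat_exp ((?t (Suc k) - ?t k) *\<^sub>R A) $ ?s k $ ?s (Suc k))"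
      using mc t unfolding markov_chain_def by (elim conjE allE[of _ 1] allE[of _ ?t] allE[of _ ?s]) auto
    moreover have "(\<forall>k\<le>1. K (?t k) w = ?s k) \<longleftrightarrow> K 0 w = i \<and> K t w = j" for w
      by (auto simp: le_Suc_eq)
    ultimately show ?thesis by simp
  qed
  then show ?thesis
    using markov_chain_measurable[OF mc] t by (subst prob_split[of "K 0"]) auto
qed

lemma markov_chain_two_times:
  assumes mc: "markov_chain M K A \<mu>" and t: "0 \<le> s" "0 \<le> t"
  shows "prob {w\<in>space M. K s w = j \<and> K (s + t) w = k} = prob {w\<in>space M. K s w = j} * mat_exp (t *\<^sub>R A) $ j $ k"
proof -
  have "prob {w\<in>space M. K 0 w = i \<and> K s w = j \<and> K (s + t) w = k} =
      \<mu> i * mat_exp (s *\<^sub>R A) $ i $ j * mat_exp (t *\<^sub>R A) $ j $ k" for i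
  proof -
    let ?t = "\<lambda>n::nat. if n = 0 then 0 else if n = 1 then s else s + t"
      and ?s = "\<lambda>n::nat. if n = 0 then i else if n = 1 then j else k"
    have "prob {w\<in>space M. \<forall>n\<le>2. K (?t n) w = ?s n} =
        \<mu> (?s 0) * (\<Prod>k<2. mat_exp ((?t (Suc k) - ?t k) *\<^sub>R A) $ ?s k $ ?s (Suc k))"
      using mc t unfolding markov_chain_def by (elim conjE allE[of _ 2] allE[of _ ?t] allE[of _ ?s]) auto
    moreover have "(\<forall>n\<le>2. K (?t n) w = ?s n) \<longleftrightarrow> K 0 w = i \<and> K s w = j \<and> K (s + t) w = k" for w
      by (auto simp: le_Suc_eq numeral_2_eq_2)
    ultimately show ?thesis by (simp add: numeral_2_eq_2)
  qed
  moreover have "{w\<in>space M. K s w = j \<and> K (s + t) w = k} \<in> sets M"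
    using sets.Int[OF markov_chain_measurable[OF mc, of s j] markov_chain_measurable[OF mc, of "s + t" k]] t
    by (simp add: Int_def conj_ac)
  ultimately show ?thesis
    using markov_chain_measurable[OF mc] t
    by (subst prob_split[of "K 0"]) (auto simp: markov_chain_marginal[OF mc t(1)] sum_distrib_right)
qed

end

text \<open>
  Only the diagonal entries are known to vanish. Let \<open>m n\<close> be the largest entry of column \<open>j\<close> of the
  \<open>n\<close>-th power, a decreasing sequence. If its limit \<open>L\<close> were positive, some row \<open>i\<close> would attain the
  maximum infinitely often and would have a positive entry \<open>p\<close> in column \<open>j\<close>. Splitting off the passage to
  \<open>j\<close> bounds a later maximum by \<open>p\<close> times a vanishing diagonal entry plus \<open>1 - p\<close> times an earlier
  maximum, which ends below \<open>L\<close>.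
\<close>

lemma nonneg_substochastic_powers_vanish:
  fixes P :: "nat \<Rightarrow> 's::finite \<Rightarrow> 's \<Rightarrow> real"
  assumes nonneg: "\<And>n i j. P n i j \<ge> 0" and sub: "\<And>n i. (\<Sum>j\<in>UNIV. P n i j) \<le> 1"
    and CK: "\<And>m n i j. P (m + n) i j = (\<Sum>k\<in>UNIV. P m i k * P n k j)"
    and diag: "(\<lambda>n. P n j j) \<longlonglongrightarrow> 0"
  shows "(\<lambda>n. P n i j) \<longlonglongrightarrow> 0"
proof -
  define m where "m n = Max (range (\<lambda>i. P n i j))" for n
  have m: "P n i j \<le> m n" for n i unfolding m_def by (intro Max_ge) auto
  have m_in: "\<exists>i. m n = P n i j" for n
  proof -
    have "m n \<in> range (\<lambda>i. P n i j)" unfolding m_def by (intro Max_in) auto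
    then show ?thesis by (simp add: image_iff)
  qed
  have m0: "m n \<ge> 0" for n using m nonneg order_trans by blast
  have step: "P (k + n) i j \<le> P k i j * P n j j + (1 - P k i j) * m n" for k n i
  proof -
    have "P (k + n) i j = P k i j * P n j j + (\<Sum>l\<in>UNIV - {j}. P k i l * P n l j)"
      unfolding CK by (simp add: sum.remove[of _ j])
    also have "(\<Sum>l\<in>UNIV - {j}. P k i l * P n l j) \<le> (\<Sum>l\<in>UNIV - {j}. P k i l) * m n"
      unfolding sum_distrib_right by (intro sum_mono mult_left_mono m nonneg)
    also have "\<dots> \<le> (1 - P k i j) * m n"
      using sub[of k i] m0 by (intro mult_right_mono) (simp_all add: sum.remove[of _ j])
    finally show ?thesis by simp
  qed
  have dec: "m (k + n) \<le> m n" for k n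
  proof -
    obtain i where "m (k + n) = P (k + n) i j" using m_in by blast
    also have "\<dots> = (\<Sum>l\<in>UNIV. P k i l * P n l j)" by (rule CK)
    also have "\<dots> \<le> (\<Sum>l\<in>UNIV. P k i l) * m n"
      unfolding sum_distrib_right by (intro sum_mono mult_left_mono m nonneg)
    also have "\<dots> \<le> 1 * m n" by (intro mult_right_mono sub m0)
    finally show ?thesis by simp
  qed
  have "decseq m" unfolding decseq_Suc_iff using dec[of 1] by simp
  then obtain L where L: "m \<longlonglongrightarrow> L" "\<And>n. L \<le> m n"
    using decseq_convergent[of m 0] m0 by blast
  have "L \<ge> 0" using L(1) m0 by (simp add: LIMSEQ_le_const)
  have "L = 0"
  proof (rule ccontr)
    assume "L \<noteq> 0"
    then have "L > 0" using \<open>L \<ge> 0\<close> by simp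
    define c where "c n = (SOME i. m n = P n i j)" for n
    have c: "m n = P n (c n) j" for n unfolding c_def using m_in by (rule someI_ex)
    obtain i where i: "infinite {n. c n = i}"
      using pigeonhole_infinite[of "UNIV :: nat set" c] by auto
    then obtain n0 where n0: "c n0 = i" by (metis (mono_tags) Collect_empty_eq finite.emptyI)
    define p where "p = P n0 i j"
    have "p > 0" using c[of n0] L(2)[of n0] \<open>L > 0\<close> by (simp add: p_def n0)
    have "(\<lambda>n. p * P n j j + (1 - p) * m n) \<longlonglongrightarrow> p * 0 + (1 - p) * L"
      by (intro tendsto_intros diag L)
    then have "\<forall>\<^sub>F n in sequentially. p * P n j j + (1 - p) * m n < L"
      by (rule order_tendstoD(2)) (use \<open>p > 0\<close> \<open>L > 0\<close> in \<open>simp add: algebra_simps\<close>)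
    then obtain N where N: "\<And>n. n \<ge> N \<Longrightarrow> p * P n j j + (1 - p) * m n < L"
      by (auto simp: eventually_sequentially)
    obtain n where n: "n \<ge> N + n0" "c n = i"
      using i unfolding infinite_nat_iff_unbounded_le by blast
    have "L \<le> m n" by (rule L)
    also have "\<dots> = P (n0 + (n - n0)) i j" using c[of n] n by simp
    also have "\<dots> \<le> p * P (n - n0) j j + (1 - p) * m (n - n0)" unfolding p_def by (rule step)
    also have "\<dots> < L" using n by (intro N) simp
    finally show False by simp
  qed
  show ?thesis
  proof (rule tendsto_sandwich)
    show "(\<lambda>n. 0) \<longlonglongrightarrow> (0::real)" by simp
    show "m \<longlonglongrightarrow> 0" using L(1) \<open>L = 0\<close> by simp
  qed (auto simp: nonneg m)
qed

locale transient_phases =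
  fixes Q :: "real^'m^'m"
  assumes transient: "\<And>i. transient_state (gen_hat Q) (Some i)"
begin

abbreviation p :: "real \<Rightarrow> 'm \<Rightarrow> 'm \<Rightarrow> real" where
  "p t i j \<equiv> mat_exp (t *\<^sub>R Q) $ i $ j"

lemma p_chain:
  fixes i :: 'm
  obtains N :: "(real \<Rightarrow> 'm option) measure" and K where "prob_space N"
    "markov_chain N K (gen_hat Q) (\<lambda>j. if j = Some i then 1 else 0)"
    "AE w in N. bounded {t. 0 \<le> t \<and> K t w = Some i}"
    "\<And>t j. 0 \<le> t \<Longrightarrow> p t i j = measure N {w\<in>space N. K t w = Some j}"
proof -
  obtain N :: "(real \<Rightarrow> 'm option) measure" and K where N: "prob_space N"
    "markov_chain N K (gen_hat Q) (\<lambda>j. if j = Some i then 1 else 0)"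
    "AE w in N. bounded {t. 0 \<le> t \<and> K t w = Some i}"
    using transient[of i] unfolding transient_state_def by auto
  interpret prob_space N by fact
  have "p t i j = measure N {w\<in>space N. K t w = Some j}" if "0 \<le> t" for t j
    unfolding markov_chain_marginal[OF N(2) that]
    by (simp add: if_distrib[where f="\<lambda>x. x * _"] mat_exp_gen_hat cong: if_cong)
  then show ?thesis using N that by blast
qed

lemma p_nonneg: "0 \<le> t \<Longrightarrow> 0 \<le> p t i j"
  by (rule p_chain[of i]) simp

lemma p_sum_le_1: "0 \<le> t \<Longrightarrow> (\<Sum>j\<in>UNIV. p t i j) \<le> 1"
proof -
  assume t: "0 \<le> t"
  obtain N :: "(real \<Rightarrow> 'm option) measure" and K where N: "prob_space N"
    "markov_chain N K (gen_hat Q) (\<lambda>j. if j = Some i then 1 else 0)"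
    "\<And>t j. 0 \<le> t \<Longrightarrow> p t i j = measure N {w\<in>space N. K t w = Some j}"
    by (rule p_chain[of i]) blast
  interpret prob_space N by fact
  have "prob {w\<in>space N. True} = (\<Sum>j\<in>UNIV. prob {w\<in>space N. K t w = j \<and> True})"
    using markov_chain_measurable[OF N(2) t] by (intro prob_split) auto
  then have "1 = prob {w\<in>space N. K t w = None} + (\<Sum>j\<in>UNIV. p t i j)"
    unfolding sum_option using N(3)[OF t] by (simp add: prob_space)
  then show ?thesis using measure_nonneg[of N "{w\<in>space N. K t w = None}"] by linarith
qed

lemma p_le_1: "0 \<le> t \<Longrightarrow> p t i j \<le> 1"
  by (rule p_chain[of i]) (simp add: prob_space.prob_le_1)

lemma p_add:
  assumes "0 \<le> s" "0 \<le> t"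
  shows "p (s + t) i k = (\<Sum>j\<in>UNIV. p s i j * p t j k)"
proof -
  obtain N :: "(real \<Rightarrow> 'm option) measure" and K where N: "prob_space N"
    "markov_chain N K (gen_hat Q) (\<lambda>j. if j = Some i then 1 else 0)"
    "\<And>t j. 0 \<le> t \<Longrightarrow> p t i j = measure N {w\<in>space N. K t w = Some j}"
    by (rule p_chain[of i]) blast
  interpret prob_space N by fact
  have "p (s + t) i k = prob {w\<in>space N. K (s + t) w = Some k}"
    using assms by (intro N) simp
  also have "\<dots> = (\<Sum>j\<in>UNIV. prob {w\<in>space N. K s w = j \<and> K (s + t) w = Some k})"
    using markov_chain_measurable[OF N(2)] assms by (intro prob_split) auto
  also have "\<dots> = (\<Sum>j\<in>UNIV. p s i j * p t j k)"
    unfolding markov_chain_two_times[OF N(2) assms] sum_option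
    by (simp add: mat_exp_gen_hat N(3)[OF assms(1)])
  finally show ?thesis .
qed

text \<open>
  A transient state is almost surely left for ever, so the probability of being there tends to zero by
  dominated convergence.
\<close>

lemma p_diag_vanishes: "(\<lambda>n. p (real n) i i) \<longlonglongrightarrow> 0"
proof -
  obtain N :: "(real \<Rightarrow> 'm option) measure" and K where N: "prob_space N"
    "markov_chain N K (gen_hat Q) (\<lambda>j. if j = Some i then 1 else 0)"
    "AE w in N. bounded {t. 0 \<le> t \<and> K t w = Some i}"
    "\<And>t j. 0 \<le> t \<Longrightarrow> p t i j = measure N {w\<in>space N. K t w = Some j}"
    by (rule p_chain[of i]) blast
  interpret prob_space N by fact
  let ?A = "\<lambda>n::nat. {w\<in>space N. K (real n) w = Some i}"
  have meas: "?A n \<in> sets N" for n using markov_chain_measurable[OF N(2)] by simp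
  have "(\<lambda>n. \<integral>w. indicator (?A n) w \<partial>N) \<longlonglongrightarrow> (\<integral>w. (0::real) \<partial>N)"
  proof (rule integral_dominated_convergence[where w="\<lambda>_. 1"])
    show "AE w in N. (\<lambda>n. indicator (?A n) w :: real) \<longlonglongrightarrow> 0"
      using N(3)
    proof eventually_elim
      case (elim w)
      then obtain B where B: "\<And>t. 0 \<le> t \<Longrightarrow> K t w = Some i \<Longrightarrow> \<bar>t\<bar> \<le> B"
        unfolding bounded_iff by auto
      have "\<forall>\<^sub>F n in sequentially. real n > B" by real_asymp
      then have "\<forall>\<^sub>F n in sequentially. (indicator (?A n) w :: real) = 0"
      proof eventually_elim
        case (elim n)
        then have "K (real n) w \<noteq> Some i" using B[of "real n"] by auto
        then show ?case by simp
      qed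
      then show ?case by (rule tendsto_eventually)
    qed
  qed (use meas in auto)
  then show ?thesis using N(4) meas by simp
qed

lemma p_vanishes: "(\<lambda>n. p (real n) i j) \<longlonglongrightarrow> 0"
proof (rule nonneg_substochastic_powers_vanish[of "\<lambda>n. p (real n)"])
  show "p (real (m + n)) i j = (\<Sum>k\<in>UNIV. p (real m) i k * p (real n) k j)" for m n i j
    using p_add[of "real m" "real n"] by simp
qed (auto simp: p_nonneg p_sum_le_1 p_diag_vanishes)

text \<open>
  On an eigenvector the semigroup acts as \<open>exp (t z)\<close>, and the semigroup tends to zero.
\<close>

lemma Sp_neg_Re:
  assumes "z \<in> Sp (cmat Q)"
  shows "Re z < 0"
proof -
  obtain v where v: "v \<noteq> 0" "cmat Q *v v = z *s v" using assms by (auto simp: Sp_def)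
  then obtain i where i: "v $ i \<noteq> 0" by (auto simp: vec_eq_iff)
  have "(\<lambda>n. \<Sum>j\<in>UNIV. of_real (p (real n) i j) * v $ j) \<longlonglongrightarrow> (\<Sum>j\<in>UNIV. of_real 0 * v $ j)"
    by (intro tendsto_intros p_vanishes)
  then have "(\<lambda>n. exp (of_real (real n) * z) * v $ i) \<longlonglongrightarrow> 0"
    unfolding mat_exp_eigenvector[OF v(2)] by simp
  then have "(\<lambda>n. cmod (exp (of_real (real n) * z) * v $ i)) \<longlonglongrightarrow> 0"
    by (rule tendsto_norm_zero)
  then have "\<forall>\<^sub>F n in sequentially. cmod (exp (of_real (real n) * z) * v $ i) < cmod (v $ i)"
    using i by (intro order_tendstoD) auto
  then obtain n where "cmod (exp (of_real (real n) * z) * v $ i) < cmod (v $ i)"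
    unfolding eventually_sequentially by blast
  then have "exp (real n * Re z) < 1" using i by (simp add: norm_mult)
  then have "real n * Re z < 0" by simp
  then show ?thesis by (simp add: mult_less_0_iff)
qed

lemma Sp_pos_Re: "Re z > 0" if "z \<in> Sp (- cmat Q)"
proof -
  have "- z \<in> Sp (cmat Q)"
    using that Sp_scale[of "-1" "- z" "- cmat Q"] by simp
  from Sp_neg_Re[OF this] show ?thesis by simp
qed

definition surv :: "real \<Rightarrow> 'm \<Rightarrow> real" where "surv t i = (\<Sum>j\<in>UNIV. p t i j)"

lemma surv_antimono: "0 \<le> s \<Longrightarrow> s \<le> t \<Longrightarrow> surv t i \<le> surv s i"
proof -
  assume st: "0 \<le> s" "s \<le> t"
  have "surv t i = (\<Sum>k\<in>UNIV. \<Sum>j\<in>UNIV. p s i j * p (t - s) j k)"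
    unfolding surv_def using p_add[of s "t - s" i] st by simp
  also have "\<dots> = (\<Sum>j\<in>UNIV. p s i j * surv (t - s) j)"
    unfolding surv_def sum_distrib_left by (rule sum.swap)
  also have "\<dots> \<le> (\<Sum>j\<in>UNIV. p s i j * 1)"
    unfolding surv_def using st by (intro sum_mono mult_left_mono p_sum_le_1 p_nonneg) auto
  finally show ?thesis by (simp add: surv_def)
qed

lemma surv_vanishes: "((\<lambda>t. surv t i) \<longlongrightarrow> 0) at_top"
proof (rule order_tendstoI)
  fix a :: real assume "a > 0"
  have "(\<lambda>n. surv (real n) i) \<longlonglongrightarrow> (\<Sum>j\<in>(UNIV::'m set). 0)"
    unfolding surv_def by (intro tendsto_sum p_vanishes)
  then have "\<forall>\<^sub>F n in sequentially. surv (real n) i < a" using \<open>a > 0\<close> by (intro order_tendstoD) auto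
  then obtain n where "surv (real n) i < a" unfolding eventually_sequentially by blast
  have "\<forall>\<^sub>F t in at_top. t \<ge> real n" by (rule eventually_ge_at_top)
  then show "\<forall>\<^sub>F t in at_top. surv t i < a"
  proof eventually_elim
    case (elim t)
    then show ?case using surv_antimono[of "real n" t i] \<open>surv (real n) i < a\<close> by simp
  qed
next
  fix a :: real assume "a < 0"
  have "\<forall>\<^sub>F t in at_top. t \<ge> (0::real)" by (rule eventually_ge_at_top)
  then show "\<forall>\<^sub>F t in at_top. a < surv t i"
  proof eventually_elim
    case (elim t)
    then have "0 \<le> surv t i" unfolding surv_def by (intro sum_nonneg p_nonneg)
    then show ?case using \<open>a < 0\<close> by simp
  qed
qed

lemma surv_0: "surv 0 i = 1"
  using mat_exp_zero[of Q] by (simp add: surv_def mat_def)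

lemma exit_rates_nonneg: "exit_rates Q $ i \<ge> 0"
proof -
  obtain N :: "(real \<Rightarrow> 'm option) measure" and K where
    "markov_chain N K (gen_hat Q) (\<lambda>j. if j = Some i then 1 else 0)"
    by (rule p_chain[of i]) blast
  then have "is_generator (gen_hat Q)" by (simp add: markov_chain_def)
  then have "0 \<le> gen_hat Q $ Some i $ None" unfolding is_generator_def by blast
  then show ?thesis by simp
qed

lemma p_deriv: "((\<lambda>t. p t i j) has_real_derivative (\<Sum>k\<in>UNIV. p t i k * Q $ k $ j)) (at t)"
  by (rule mat_exp_has_derivative)

lemma p_continuous: "isCont (\<lambda>t. p t i j) t"
  using p_deriv by (rule DERIV_isCont)

lemma surv_deriv: "((\<lambda>t. surv t i) has_real_derivative - (\<Sum>k\<in>UNIV. p t i k * exit_rates Q $ k)) (at t)"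
proof -
  have "((\<lambda>t. surv t i) has_real_derivative (\<Sum>j\<in>UNIV. \<Sum>k\<in>UNIV. p t i k * Q $ k $ j)) (at t)"
    unfolding surv_def by (intro DERIV_sum p_deriv)
  also have "(\<Sum>j\<in>UNIV. \<Sum>k\<in>UNIV. p t i k * Q $ k $ j) = - (\<Sum>k\<in>UNIV. p t i k * exit_rates Q $ k)"
    by (subst sum.swap) (simp add: exit_rates_def matrix_vector_mult_def sum_distrib_left sum_negf)
  finally show ?thesis .
qed

end

section \<open>Right-continuous jump paths\<close>

definition right_constant :: "(real \<Rightarrow> 'a) \<Rightarrow> bool" where
  "right_constant f \<longleftrightarrow> (\<forall>t\<ge>0. \<forall>\<^sub>F s in at_right t. f s = f t)"

lemma right_constantD:
  assumes "right_constant f" "0 \<le> t"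
  shows "\<exists>e>0. \<forall>s. t \<le> s \<longrightarrow> s < t + e \<longrightarrow> f s = f t"
proof -
  obtain b where b: "b > t" "\<And>s. s > t \<Longrightarrow> s < b \<Longrightarrow> f s = f t"
    using assms unfolding right_constant_def eventually_at_right_field by blast
  have "\<forall>s. t \<le> s \<longrightarrow> s < t + (b - t) \<longrightarrow> f s = f t"
  proof (intro allI impI)
    fix s assume "t \<le> s" "s < t + (b - t)"
    then have "s = t \<or> (t < s \<and> s < b)" by auto
    then show "f s = f t" using b(2) by blast
  qed
  moreover have "b - t > 0" using b(1) by simp
  ultimately show ?thesis by blast
qed

lemma right_constant_rational:
  assumes "right_constant f" "0 \<le> t" "t < a"
  obtains r :: rat where "t < of_rat r" "of_rat r < a" "f (of_rat r) = f t"
proof -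
  obtain e where e: "e > 0" "\<And>s. t \<le> s \<Longrightarrow> s < t + e \<Longrightarrow> f s = f t"
    using right_constantD[OF assms(1,2)] by blast
  obtain r where "t < of_rat r" "of_rat r < min a (t + e)"
    using of_rat_dense[of t "min a (t + e)"] e(1) assms(3) by auto
  then show ?thesis using that[of r] e(2)[of "of_rat r"] by simp
qed

text \<open>
  The points lie strictly to the right of \<open>x\<close>, so that a right-continuous path with discrete values takes
  its value at \<open>x\<close> there from some \<open>n\<close> on.
\<close>

definition dyadic_above :: "nat \<Rightarrow> real \<Rightarrow> real" where
  "dyadic_above n x = (real (nat \<lfloor>2 ^ n * x\<rfloor>) + 1) / 2 ^ n"

lemma dyadic_above:
  assumes "0 \<le> x"
  shows "x < dyadic_above n x" "dyadic_above n x \<le> x + 1 / 2 ^ n"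
proof -
  have *: "real (nat \<lfloor>2 ^ n * x\<rfloor>) = of_int \<lfloor>2 ^ n * x\<rfloor>" using assms by simp
  show "x < dyadic_above n x" "dyadic_above n x \<le> x + 1 / 2 ^ n"
    unfolding dyadic_above_def * by (simp_all add: field_simps) linarith+
qed

lemma dyadic_above_tendsto:
  assumes "0 \<le> x"
  shows "(\<lambda>n. dyadic_above n x) \<longlonglongrightarrow> x"
proof (rule tendsto_sandwich)
  show "\<forall>\<^sub>F n in sequentially. x \<le> dyadic_above n x" "\<forall>\<^sub>F n in sequentially. dyadic_above n x \<le> x + 1 / 2 ^ n"
    using dyadic_above[OF assms] by (auto intro!: always_eventually less_imp_le)
  show "(\<lambda>n. x + 1 / 2 ^ n) \<longlonglongrightarrow> x" by real_asymp
qed simp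

lemma right_constant_dyadic:
  assumes "right_constant f" "0 \<le> x"
  shows "\<forall>\<^sub>F n in sequentially. f (dyadic_above n x) = f x"
proof -
  obtain e where e: "e > 0" "\<And>s. x \<le> s \<Longrightarrow> s < x + e \<Longrightarrow> f s = f x"
    using right_constantD[OF assms] by blast
  have "\<forall>\<^sub>F n in sequentially. dyadic_above n x < x + e"
    by (rule order_tendstoD(2)[OF dyadic_above_tendsto[OF assms(2)]]) (use e(1) in simp)
  then show ?thesis
  proof eventually_elim
    case (elim n)
    then show ?case using dyadic_above(1)[OF assms(2), of n] by (intro e(2)) simp_all
  qed
qed

lemma measurable_dyadic_index: "(\<lambda>x::real. nat \<lfloor>2 ^ n * x\<rfloor>) \<in> measurable borel (count_space UNIV)"
  by measurable

lemma measurable_right_constant_at: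
  fixes K :: "real \<Rightarrow> 'w \<Rightarrow> 's::countable"
  assumes K: "\<And>t. 0 \<le> t \<Longrightarrow> K t \<in> measurable N (count_space UNIV)"
    and rc: "\<And>w. w \<in> space N \<Longrightarrow> right_constant (\<lambda>t. K t w)"
    and Z: "Z \<in> borel_measurable N"
    and pos: "\<And>w. w \<in> space N \<Longrightarrow> 0 \<le> Z w"
  shows "(\<lambda>w. K (Z w) w) \<in> measurable N (count_space UNIV)"
proof -
  have Kn: "(\<lambda>w. K (dyadic_above n (Z w)) w) \<in> measurable N (count_space UNIV)" for n
  proof -
    have "(\<lambda>w. nat \<lfloor>2 ^ n * Z w\<rfloor>) \<in> measurable N (count_space UNIV)"
      using measurable_compose[OF Z measurable_dyadic_index[of n]] .
    moreover have "(\<lambda>w. K ((real k + 1) / 2 ^ n) w) \<in> measurable N (count_space UNIV)" for k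
      by (rule K) simp
    ultimately show ?thesis
      unfolding dyadic_above_def
      by (rule measurable_compose_countable[where f="\<lambda>k w. K ((real k + 1) / 2 ^ n) w"
            and g="\<lambda>w. nat \<lfloor>2 ^ n * Z w\<rfloor>", rotated])
  qed
  show ?thesis
    unfolding measurable_count_space_eq2_countable
  proof safe
    fix j :: 's
    have "(\<lambda>w. K (Z w) w) -` {j} \<inter> space N =
       {w\<in>space N. \<exists>m. \<forall>n\<ge>m. K (dyadic_above n (Z w)) w = j}"
    proof -
      have "K (Z w) w = j \<longleftrightarrow> (\<exists>m. \<forall>n\<ge>m. K (dyadic_above n (Z w)) w = j)" if w: "w \<in> space N" for w
      proof -
        have "\<forall>\<^sub>F n in sequentially. K (dyadic_above n (Z w)) w = K (Z w) w"
          using right_constant_dyadic[OF rc[OF w] pos[OF w]] .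
        then obtain m where m: "\<And>n. n \<ge> m \<Longrightarrow> K (dyadic_above n (Z w)) w = K (Z w) w"
          by (auto simp: eventually_sequentially)
        then show ?thesis by (metis le_cases)
      qed
      then show ?thesis by auto
    qed
    moreover have "{w\<in>space N. \<exists>m. \<forall>n\<ge>m. K (dyadic_above n (Z w)) w = j} =
        (\<Union>m. \<Inter>n\<in>{m..}. (\<lambda>w. K (dyadic_above n (Z w)) w) -` {j} \<inter> space N)" by auto
    moreover have "\<dots> \<in> sets N"
    proof -
      have "(\<lambda>w. K (dyadic_above n (Z w)) w) -` {j} \<inter> space N \<in> sets N" for n
        by (rule measurable_sets[OF Kn]) simp
      then have "(\<Inter>n\<in>{m..}. (\<lambda>w. K (dyadic_above n (Z w)) w) -` {j} \<inter> space N) \<in> sets N" for m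
        by (intro sets.countable_INT') (simp_all only: image_subset_iff, auto)
      then show ?thesis by (rule sets.countable_UN'[rotated 1, OF image_subsetI]) simp
    qed
    ultimately show "(\<lambda>w. K (Z w) w) -` {j} \<inter> space N \<in> sets N" by simp
  qed auto
qed

lemma Collect_if_Ex:
  "{w\<in>X. if \<exists>r. A r w \<and> B r w then \<exists>r. A r w \<and> C r \<and> B r w else d} =
   (\<Union>r\<in>{r. C r}. {w\<in>X. A r w \<and> B r w}) \<union> (if d then X - (\<Union>r. {w\<in>X. A r w \<and> B r w}) else {})"
  by auto

text \<open>
  By right-continuity a path is absorbed before \<open>a\<close> if and only if it is absorbed at a rational time before
  \<open>a\<close>. Paths that are never absorbed have absorption time \<open>0\<close> and account for the second case.
\<close>

lemma measurable_absorption_time: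
  fixes K :: "real \<Rightarrow> 'w \<Rightarrow> 'm::countable option"
  assumes K: "\<And>t. 0 \<le> t \<Longrightarrow> K t \<in> measurable N (count_space UNIV)"
    and rc: "\<And>w. w \<in> space N \<Longrightarrow> right_constant (\<lambda>t. K t w)"
  shows "absorption_time K \<in> borel_measurable N"
proof -
  have rat: "(\<exists>t\<ge>0. t < a \<and> K t w = None) \<longleftrightarrow> (\<exists>r::rat. 0 \<le> r \<and> of_rat r < a \<and> K (of_rat r) w = None)"
    if w: "w \<in> space N" for w and a :: real
  proof
    assume "\<exists>t\<ge>0. t < a \<and> K t w = None"
    then obtain t where t: "0 \<le> t" "t < a" "K t w = None" by auto
    obtain r :: rat where "t < of_rat r" "of_rat r < a" "K (of_rat r) w = K t w"
      using right_constant_rational[OF rc[OF w] t(1,2)] .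
    moreover from this(1) t(1) have "0 \<le> r" by (metis less_eq_real_def less_trans zero_le_of_rat_iff)
    ultimately show "\<exists>r::rat. 0 \<le> r \<and> of_rat r < a \<and> K (of_rat r) w = None" using t(3) by auto
  next
    assume "\<exists>r::rat. 0 \<le> r \<and> of_rat r < a \<and> K (of_rat r) w = None"
    then obtain r :: rat where "0 \<le> r" "of_rat r < a" "K (of_rat r) w = None" by auto
    then show "\<exists>t\<ge>0. t < a \<and> K t w = None" by (intro exI[of _ "of_rat r"]) auto
  qed
  have rat': "(\<exists>t\<ge>0. K t w = None) \<longleftrightarrow> (\<exists>r::rat. 0 \<le> r \<and> K (of_rat r) w = None)" if w: "w \<in> space N" for w
  proof
    assume "\<exists>t\<ge>0. K t w = None"
    then obtain t where "0 \<le> t" "K t w = None" by auto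
    then have "\<exists>t'\<ge>0. t' < t + 1 \<and> K t' w = None" by (intro exI[of _ t]) auto
    then show "\<exists>r::rat. 0 \<le> r \<and> K (of_rat r) w = None" using rat[OF w, of "t + 1"] by auto
  next
    assume "\<exists>r::rat. 0 \<le> r \<and> K (of_rat r) w = None"
    then obtain r :: rat where "0 \<le> r" "K (of_rat r) w = None" by auto
    then show "\<exists>t\<ge>0. K t w = None" by (intro exI[of _ "of_rat r"]) auto
  qed
  have less: "absorption_time K w < a \<longleftrightarrow>
      (if \<exists>r::rat. 0 \<le> r \<and> K (of_rat r) w = None then \<exists>r::rat. 0 \<le> r \<and> of_rat r < a \<and> K (of_rat r) w = None else 0 < a)"
    if w: "w \<in> space N" for w a
  proof (cases "\<exists>t\<ge>0. K t w = None")
    case True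
    then have "absorption_time K w = Inf {t. 0 \<le> t \<and> K t w = None}" by (simp add: absorption_time_def)
    then have "absorption_time K w < a \<longleftrightarrow> (\<exists>t\<in>{t. 0 \<le> t \<and> K t w = None}. t < a)"
      using True by (simp only:) (intro cInf_less_iff, auto intro: bdd_belowI[of _ 0])
    also have "\<dots> \<longleftrightarrow> (\<exists>t\<ge>0. t < a \<and> K t w = None)" by auto
    finally show ?thesis using True rat[OF w] rat'[OF w] by simp
  next
    case False
    then have "absorption_time K w = 0" by (auto simp: absorption_time_def)
    moreover have "\<not> (\<exists>r::rat. 0 \<le> r \<and> K (of_rat r) w = None)"
      using False unfolding rat'[OF w] .
    ultimately show ?thesis by (simp only: if_False)
  qed
  show ?thesis
    unfolding borel_measurable_iff_less
  proof safe
    fix a :: real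
    have K_None: "{w\<in>space N. 0 \<le> r \<and> K (of_rat r) w = None} \<in> sets N" for r :: rat
    proof (cases "0 \<le> r")
      case True
      then have "K (of_rat r) -` {None} \<inter> space N \<in> sets N"
        by (intro measurable_sets[OF K]) auto
      then show ?thesis using True by (simp add: vimage_def Int_def conj_commute)
    qed simp
    have "{w\<in>space N. absorption_time K w < a} = {w\<in>space N.
      (if \<exists>r::rat. 0 \<le> r \<and> K (of_rat r) w = None then \<exists>r::rat. 0 \<le> r \<and> of_rat r < a \<and> K (of_rat r) w = None else 0 < a)}"
      by (rule Collect_cong, rule conj_cong[OF refl less])
    also have "\<dots> = (\<Union>r\<in>{r::rat. of_rat r < a}. {w\<in>space N. 0 \<le> r \<and> K (of_rat r) w = None}) \<union>
        (if 0 < a then space N - (\<Union>r. {w\<in>space N. 0 \<le> r \<and> K (of_rat r) w = None}) else {})"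
      by (rule Collect_if_Ex)
    also have "\<dots> \<in> sets N"
    proof -
      have "(\<Union>r\<in>R. {w\<in>space N. 0 \<le> r \<and> K (of_rat r) w = None}) \<in> sets N" for R :: "rat set"
        by (rule sets.countable_UN') (simp_all only: image_subset_iff K_None countableI_type, simp)
      from this[of "{r. of_rat r < a}"] this[of UNIV] show ?thesis
        by (cases "0 < a") (simp_all only: if_True if_False sets.Un sets.Diff sets.top sets.empty_sets)
    qed
    finally show "{w\<in>space N. absorption_time K w < a} \<in> sets N" .
  qed
qed

lemma absorption_time_nonneg: "0 \<le> absorption_time K w"
  unfolding absorption_time_def by (auto intro!: cInf_greatest)

text \<open>
  On such a path \<open>None\<close> is absorbing and reached, though not at time \<open>0\<close>. A chain that is given through its
  finite-dimensional distributions has these properties only almost surely.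
\<close>

definition absorbed_path :: "(real \<Rightarrow> 'm option) \<Rightarrow> bool" where
  "absorbed_path f \<longleftrightarrow> f 0 \<noteq> None \<and> (\<exists>t\<ge>0. f t = None) \<and> (\<forall>s t. 0 \<le> s \<longrightarrow> s \<le> t \<longrightarrow> f s = None \<longrightarrow> f t = None)"

lemma absorbed_path_iff:
  assumes "absorbed_path (\<lambda>t. K t w)" "right_constant (\<lambda>t. K t w)"
  shows "absorption_time K w > 0" "0 \<le> t \<Longrightarrow> K t w = None \<longleftrightarrow> absorption_time K w \<le> t"
proof -
  let ?A = "{t. 0 \<le> t \<and> K t w = None}" and ?S = "absorption_time K w"
  have ne: "?A \<noteq> {}" and bdd: "bdd_below ?A"
    using assms(1) by (auto simp: absorbed_path_def intro: bdd_belowI[of _ 0])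
  have S: "?S = Inf ?A" using ne by (auto simp: absorption_time_def)
  have S0: "?S \<ge> 0" by (rule absorption_time_nonneg)
  have None_S: "K ?S w = None"
  proof -
    obtain e where e: "e > 0" "\<And>s. ?S \<le> s \<Longrightarrow> s < ?S + e \<Longrightarrow> K s w = K ?S w"
      using right_constantD[OF assms(2) S0] by blast
    obtain s where "s \<in> ?A" "s < ?S + e"
      using cInf_less_iff[OF ne bdd, of "?S + e"] e(1) S by auto
    moreover have "?S \<le> s" unfolding S using \<open>s \<in> ?A\<close> bdd by (intro cInf_lower)
    ultimately show ?thesis using e(2)[of s] by simp
  qed
  have "K 0 w \<noteq> None" using assms(1) unfolding absorbed_path_def by blast
  then have "?S \<noteq> 0" using None_S by metis
  then show "?S > 0" using S0 by simp
  show "K t w = None \<longleftrightarrow> ?S \<le> t" if "0 \<le> t"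
  proof
    assume "K t w = None"
    then show "?S \<le> t" unfolding S using that bdd by (intro cInf_lower) auto
  next
    assume "?S \<le> t"
    then show "K t w = None" using None_S S0 assms(1) unfolding absorbed_path_def by blast
  qed
qed

section \<open>The innovations\<close>

lemma measurable_finer:
  assumes "f \<in> measurable N1 L" "space N1 = space N2" "sets N1 \<subseteq> sets N2"
  shows "f \<in> measurable N2 L"
proof (rule measurableI)
  show "f x \<in> space L" if "x \<in> space N2" for x
    using measurable_space[OF assms(1)] that assms(2) by simp
  show "f -` A \<inter> space N2 \<in> sets N2" if "A \<in> sets L" for A
    using measurable_sets[OF assms(1) that] assms(2,3) by auto
qed

locale ar_process_setup = prob_space M + transient_phases Q
  for M :: "'w measure" and Q :: "real^'m::finite^'m" +
  fixes J :: "nat \<Rightarrow> real \<Rightarrow> 'w \<Rightarrow> 'm option"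
    and T :: "nat \<Rightarrow> 'w \<Rightarrow> real"
    and \<alpha> :: "real^'m"
  assumes \<alpha>_nonneg: "\<And>i. 0 \<le> \<alpha> $ i" and \<alpha>_sum: "(\<Sum>i\<in>UNIV. \<alpha> $ i) = 1"
    and chains: "\<And>n. n \<ge> 1 \<Longrightarrow> markov_chain M (J n) (gen_hat Q) (init_hat \<alpha>)"
    and T_measurable: "\<And>n. n \<ge> 1 \<Longrightarrow> T n \<in> borel_measurable M"
    and T_nonneg: "\<And>n. n \<ge> 1 \<Longrightarrow> AE w in M. 0 \<le> T n w"
    and T_identical: "\<And>n. n \<ge> 1 \<Longrightarrow> distr M borel (T n) = distr M borel (T 1)"
    and independent: "indep_sets
          (case_sum (\<lambda>n. chain_events M (J n)) (\<lambda>n. rv_events M (T n)))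
          (Inl ` {1..} \<union> Inr ` {1..})"
begin

abbreviation S :: "nat \<Rightarrow> 'w \<Rightarrow> real" where "S n \<equiv> absorption_time (J n)"

definition source :: "nat + nat \<Rightarrow> 'w set set" where
  "source = case_sum (\<lambda>n. chain_events M (J n)) (\<lambda>n. rv_events M (T n))"

text \<open>
  The information contained in the chains \<open>J\<close> and the variables \<open>T\<close> with index in \<open>I\<close>; disjoint index sets give
  independent \<sigma>-algebras.
\<close>

definition info :: "(nat + nat) set \<Rightarrow> 'w measure" where
  "info I = sigma (space M) (\<Union>k\<in>I. source k)"

lemma source_sets: "\<exists>N. space N = space M \<and> source k = sets N"
  by (cases k) (auto simp: source_def chain_events_def rv_events_def intro: exI[of _ "vimage_algebra _ _ _"])

lemma source_Pow: "(\<Union>k\<in>I. source k) \<subseteq> Pow (space M)"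
proof -
  have "source k \<subseteq> Pow (space M)" for k
    using source_sets[of k] sets.space_closed by metis
  then show ?thesis by blast
qed

lemma space_info [simp]: "space (info I) = space M"
  by (simp add: info_def space_measure_of_conv)

lemma sets_info: "sets (info I) = sigma_sets (space M) (\<Union>k\<in>I. source k)"
  unfolding info_def by (rule sets_measure_of[OF source_Pow])

lemma info_mono: "I \<subseteq> I' \<Longrightarrow> sets (info I) \<subseteq> sets (info I')"
  unfolding sets_info by (intro sigma_sets_mono') auto

lemma source_events: "k \<in> Inl ` {1..} \<union> Inr ` {1..} \<Longrightarrow> source k \<subseteq> events"
  using independent unfolding source_def indep_sets_def by blast

lemma info_events: "I \<subseteq> Inl ` {1..} \<union> Inr ` {1..} \<Longrightarrow> sets (info I) \<subseteq> events"
  unfolding sets_info using source_events by (intro sets.sigma_sets_subset) blast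

lemma measurable_info_mono: "f \<in> measurable (info I) N \<Longrightarrow> I \<subseteq> I' \<Longrightarrow> f \<in> measurable (info I') N"
  by (rule measurable_finer[OF _ _ info_mono]) simp_all

lemma measurable_info: "f \<in> measurable (info I) N \<Longrightarrow> I \<subseteq> Inl ` {1..} \<union> Inr ` {1..} \<Longrightarrow> f \<in> measurable M N"
  by (rule measurable_finer[OF _ _ info_events]) simp_all

lemma info_indep:
  assumes "I1 \<subseteq> Inl ` {1..} \<union> Inr ` {1..}" "I2 \<subseteq> Inl ` {1..} \<union> Inr ` {1..}" "I1 \<inter> I2 = {}"
    and "A \<in> sets (info I1)" "B \<in> sets (info I2)"
  shows "prob (A \<inter> B) = prob A * prob B"
proof -
  have "indep_sets (\<lambda>j. sigma_sets (space M) (\<Union>k\<in>case_bool I1 I2 j. source k)) UNIV"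
  proof (rule indep_sets_collect_sigma)
    show "indep_sets source (\<Union>j\<in>UNIV. case_bool I1 I2 j)"
      using assms(1,2) by (intro indep_sets_mono_index[OF _ independent[folded source_def]]) (auto simp: UNIV_bool)
    show "Int_stable (source k)" for k
      using source_sets[of k] by (auto simp: Int_stable_def)
    show "disjoint_family_on (case_bool I1 I2) UNIV"
      using assms(3) by (auto simp: disjoint_family_on_def split: bool.split)
  qed
  moreover have "(\<lambda>j. sigma_sets (space M) (\<Union>k\<in>case_bool I1 I2 j. source k)) = case_bool (sets (info I1)) (sets (info I2))"
    by (auto simp: fun_eq_iff sets_info split: bool.split)
  ultimately have "indep_set (sets (info I1)) (sets (info I2))"
    unfolding indep_set_def by simp
  then show ?thesis using assms(4,5) by (rule indep_setD)
qed

lemma info_indep_var: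
  assumes "I1 \<subseteq> Inl ` {1..} \<union> Inr ` {1..}" "I2 \<subseteq> Inl ` {1..} \<union> Inr ` {1..}" "I1 \<inter> I2 = {}"
    and X: "X \<in> measurable (info I1) N1" and Y: "Y \<in> measurable (info I2) N2"
  shows "indep_var N1 X N2 Y"
proof -
  have sub: "sigma_sets (space M) {X -` A \<inter> space M | A. A \<in> sets N} \<subseteq> sets (info I)"
    if "X \<in> measurable (info I) N" for X :: "'w \<Rightarrow> 'c" and N and I
    using sets.sigma_sets_subset[of "{X -` A \<inter> space M | A. A \<in> sets N}" "info I"]
      measurable_sets[OF that] by (auto simp: subset_iff)
  show ?thesis
    unfolding indep_var_eq
  proof (intro conjI indep_setI)
    show "random_variable N1 X" "random_variable N2 Y"
      using measurable_info[OF X assms(1)] measurable_info[OF Y assms(2)] .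
    show "sigma_sets (space M) {X -` A \<inter> space M | A. A \<in> sets N1} \<subseteq> events"
      "sigma_sets (space M) {Y -` A \<inter> space M | A. A \<in> sets N2} \<subseteq> events"
      using sub[OF X] sub[OF Y] info_events[OF assms(1)] info_events[OF assms(2)] by auto
    show "prob (A \<inter> B) = prob A * prob B"
      if "A \<in> sigma_sets (space M) {X -` A \<inter> space M | A. A \<in> sets N1}"
        "B \<in> sigma_sets (space M) {Y -` A \<inter> space M | A. A \<in> sets N2}" for A B
      using info_indep[OF assms(1-3)] sub[OF X] sub[OF Y] that by blast
  qed
qed

lemma J_measurable_info: "0 \<le> t \<Longrightarrow> J n t \<in> measurable (info {Inl n}) (count_space UNIV)"
proof -
  assume t: "0 \<le> t"
  let ?P = "PiM {0..} (\<lambda>_. count_space UNIV) :: (real \<Rightarrow> 'm option) measure"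
  let ?V = "vimage_algebra (space M) (\<lambda>w. \<lambda>t\<in>{0..}. J n t w) ?P"
  have "(\<lambda>w. \<lambda>t\<in>{0..}. J n t w) \<in> measurable ?V ?P"
    by (intro measurable_vimage_algebra1) (auto simp: space_PiM)
  from measurable_compose[OF this measurable_component_singleton[of t]] t
  have "(\<lambda>w. (\<lambda>t\<in>{0..}. J n t w) t) \<in> measurable ?V (count_space UNIV)" by simp
  then have m: "J n t \<in> measurable ?V (count_space UNIV)" using t by simp
  have "sets ?V \<subseteq> sets (info {Inl n})"
    by (auto simp: sets_info source_def chain_events_def)
  from measurable_finer[OF m _ this] show ?thesis by simp
qed

lemma T_measurable_info: "T n \<in> measurable (info {Inr n}) borel"
proof -
  have m: "T n \<in> measurable (vimage_algebra (space M) (T n) borel) borel"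
    by (intro measurable_vimage_algebra1) auto
  have "sets (vimage_algebra (space M) (T n) borel) \<subseteq> sets (info {Inr n})"
    by (auto simp: sets_info source_def rv_events_def)
  from measurable_finer[OF m _ this] show ?thesis by simp
qed

lemma J_right_constant: "1 \<le> n \<Longrightarrow> w \<in> space M \<Longrightarrow> right_constant (\<lambda>t. J n t w)"
  using chains[of n] unfolding markov_chain_def right_constant_def by blast

lemma J_measurable: "1 \<le> n \<Longrightarrow> 0 \<le> t \<Longrightarrow> J n t \<in> measurable M (count_space UNIV)"
  using chains[of n] by (simp add: markov_chain_def)

lemma S_measurable_info: "1 \<le> n \<Longrightarrow> S n \<in> borel_measurable (info {Inl n})"
  by (rule measurable_absorption_time) (auto simp: J_measurable_info J_right_constant)

lemma S_measurable: "1 \<le> n \<Longrightarrow> S n \<in> borel_measurable M"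
  by (rule measurable_absorption_time) (auto simp: J_measurable J_right_constant)

definition phase_prob :: "real \<Rightarrow> 'm \<Rightarrow> real" where
  "phase_prob t i = (\<Sum>k\<in>UNIV. \<alpha> $ k * p t k i)"

lemma prob_J: "1 \<le> n \<Longrightarrow> 0 \<le> t \<Longrightarrow> prob {w\<in>space M. J n t w = Some i} = phase_prob t i"
  using markov_chain_marginal[OF chains, of n t "Some i"]
  by (simp add: sum_option init_hat_def mat_exp_gen_hat phase_prob_def)

lemma phase_prob_bounds: "0 \<le> t \<Longrightarrow> 0 \<le> phase_prob t i" "0 \<le> t \<Longrightarrow> phase_prob t i \<le> 1"
  using prob_J[of 1 t i] measure_nonneg[of M "{w\<in>space M. J 1 t w = Some i}"]
    prob_le_1[of "{w\<in>space M. J 1 t w = Some i}"] by auto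

lemma phase_prob_continuous: "isCont (\<lambda>t. phase_prob t i) t"
  unfolding phase_prob_def by (intro continuous_intros p_continuous)

lemma prob_J_absorbed: "1 \<le> n \<Longrightarrow> 0 \<le> t \<Longrightarrow> prob {w\<in>space M. J n t w \<noteq> None} = (\<Sum>i\<in>UNIV. \<alpha> $ i * surv t i)"
proof -
  assume n: "1 \<le> n" and t: "0 \<le> t"
  note meas = markov_chain_measurable[OF chains[OF n] t]
  have "{w\<in>space M. J n t w \<noteq> None} = space M - {w\<in>space M. J n t w = None}" by auto
  then have m: "{w\<in>space M. J n t w \<noteq> None} \<in> events" using meas[of None] by auto
  have "prob {w\<in>space M. J n t w \<noteq> None} = (\<Sum>j\<in>UNIV. prob {w\<in>space M. J n t w = j \<and> J n t w \<noteq> None})"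
    using meas m by (intro prob_split)
  also have "\<dots> = (\<Sum>i\<in>UNIV. prob {w\<in>space M. J n t w = Some i})"
  proof -
    have "{w\<in>space M. J n t w = Some i \<and> J n t w \<noteq> None} = {w\<in>space M. J n t w = Some i}" for i by auto
    moreover have "{w\<in>space M. J n t w = None \<and> J n t w \<noteq> None} = {}" by auto
    ultimately show ?thesis by (simp only: sum_option) simp
  qed
  also have "\<dots> = (\<Sum>i\<in>UNIV. \<alpha> $ i * surv t i)"
    unfolding prob_J[OF n t] phase_prob_def surv_def sum_distrib_left by (rule sum.swap)
  finally show ?thesis .
qed

text \<open>
  That \<open>None\<close> is never left holds almost surely for each pair of rational times, hence for all of them at
  once, and extends to all times by right-continuity.
\<close>

lemma AE_absorbed_path:
  assumes n: "1 \<le> n"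
  shows "AE w in M. absorbed_path (\<lambda>t. J n t w)"
proof -
  note meas = markov_chain_measurable[OF chains[OF n]]
  have start: "AE w in M. J n 0 w \<noteq> None"
  proof (rule AE_I')
    have "prob {w\<in>space M. J n 0 w = None} = 0"
      using markov_chain_marginal[OF chains[OF n], of 0 None] mat_exp_zero[of "gen_hat Q"]
      by (simp add: sum_option init_hat_def mat_def)
    then show "{w\<in>space M. J n 0 w = None} \<in> null_sets M" using meas[of 0 None]
      by (simp add: null_sets_def emeasure_eq_measure)
  qed auto
  have absorb: "AE w in M. \<exists>k::nat. J n (real k) w = None"
  proof -
    let ?B = "{w\<in>space M. \<forall>k::nat. J n (real k) w \<noteq> None}"
    have B: "?B \<in> events"
    proof -
      have "Measurable.pred M (\<lambda>w. J n (real k) w = None)" for k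
        using J_measurable[OF n, of "real k"] by simp
      then show ?thesis by measurable
    qed
    have "prob ?B \<le> (\<Sum>i\<in>UNIV. \<alpha> $ i * surv (real k) i)" for k
      unfolding prob_J_absorbed[OF n, of "real k", simplified, symmetric]
    proof (rule finite_measure_mono)
      have "{w\<in>space M. J n (real k) w \<noteq> None} = space M - {w\<in>space M. J n (real k) w = None}" by auto
      then show "{w\<in>space M. \<exists>y. J n (real k) w = Some y} \<in> events"
        using meas[of "real k" None] by (auto simp: not_None_eq)
    qed auto
    moreover have "(\<lambda>k. \<Sum>i\<in>UNIV. \<alpha> $ i * surv (real k) i) \<longlonglongrightarrow> (\<Sum>i\<in>UNIV. \<alpha> $ i * 0)"
      by (intro tendsto_intros filterlim_compose[OF surv_vanishes] filterlim_real_sequentially)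
    ultimately have "prob ?B \<le> 0"
      by (intro LIMSEQ_le_const) (auto intro!: exI[of _ 0])
    then have "?B \<in> null_sets M" using B
      by (simp add: null_sets_def emeasure_eq_measure measure_le_0_iff)
    then show ?thesis by (rule AE_I') auto
  qed
  have stay: "AE w in M. \<forall>r\<in>{r::rat. 0 \<le> r}. \<forall>r'\<in>{r'. 0 \<le> r'}. J n (of_rat r) w = None \<longrightarrow> J n (of_rat r + of_rat r') w = None"
  proof (intro AE_ball_countable[THEN iffD2] ballI)
    fix r r' :: rat assume r: "r \<in> {r. 0 \<le> r}" "r' \<in> {r'. 0 \<le> r'}"
    let ?r = "of_rat r :: real" and ?r' = "of_rat r' :: real"
    have r0: "0 \<le> ?r" "0 \<le> ?r'" using r by auto
    have "AE w in M. \<forall>j. \<not> (J n ?r w = None \<and> J n (?r + ?r') w = Some j)"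
    proof (rule AE_all_countable[THEN iffD2], rule allI)
      fix j
      have "prob {w\<in>space M. J n ?r w = None \<and> J n (?r + ?r') w = Some j} = 0"
        unfolding markov_chain_two_times[OF chains[OF n] r0] mat_exp_gen_hat by simp
      moreover have "{w\<in>space M. J n ?r w = None \<and> J n (?r + ?r') w = Some j} \<in> events"
        using sets.Int[OF meas[OF r0(1), of None] meas[of "?r + ?r'" "Some j"]] r0
        by (simp add: Int_def conj_ac)
      ultimately have "{w\<in>space M. J n ?r w = None \<and> J n (?r + ?r') w = Some j} \<in> null_sets M"
        by (simp add: null_sets_def emeasure_eq_measure)
      then show "AE w in M. \<not> (J n ?r w = None \<and> J n (?r + ?r') w = Some j)"
        by (rule AE_I') auto
    qed
    then show "AE w in M. J n ?r w = None \<longrightarrow> J n (?r + ?r') w = None"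
      by eventually_elim (metis not_None_eq)
  qed auto
  show ?thesis
    using start absorb stay AE_space
  proof eventually_elim
    case (elim w)
    note rc = J_right_constant[OF n \<open>w \<in> space M\<close>]
    have "J n t w = None" if st: "0 \<le> s" "s \<le> t" "J n s w = None" for s t
    proof (cases "s = t")
      case False
      then have "s < t" using st by simp
      obtain r1 :: rat where r1: "s < of_rat r1" "of_rat r1 < t" "J n (of_rat r1) w = J n s w"
        using right_constant_rational[OF rc st(1) \<open>s < t\<close>] .
      have "0 \<le> t" using st by simp
      then obtain r2 :: rat where r2: "t < of_rat r2" "J n (of_rat r2) w = J n t w"
        using right_constant_rational[OF rc \<open>0 \<le> t\<close>, of "t + 1"] by auto
      have "0 \<le> r1" using r1(1) st(1) by (metis less_eq_real_def less_trans zero_le_of_rat_iff)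
      moreover have "0 \<le> r2 - r1"
        using r1(2) r2(1) by (metis diff_ge_0_iff_ge less_eq_real_def less_trans of_rat_less_eq)
      ultimately have "J n (of_rat r1 + of_rat (r2 - r1)) w = None"
        using elim(3) r1(3) st(3) by simp
      then have "J n (of_rat r2) w = None" by (simp add: of_rat_diff)
      then show ?thesis using r2(2) by simp
    qed (use st in simp)
    moreover have "\<exists>t\<ge>0. J n t w = None" using elim(2) by (metis of_nat_0_le_iff)
    ultimately show ?case using elim(1) unfolding absorbed_path_def by blast
  qed
qed

lemma AE_S:
  assumes n: "1 \<le> n"
  shows "AE w in M. 0 < S n w \<and> (\<forall>t\<ge>0. J n t w = None \<longleftrightarrow> S n w \<le> t)"
  using AE_absorbed_path[OF n] AE_space
proof eventually_elim
  case (elim w)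
  then show ?case using absorbed_path_iff[of "J n" w] J_right_constant[OF n] by auto
qed

definition S_density :: "real \<Rightarrow> real" where
  "S_density s = (\<Sum>i\<in>UNIV. phase_prob s i * exit_rates Q $ i)"

lemma S_density_nonneg: "0 \<le> s \<Longrightarrow> 0 \<le> S_density s"
  unfolding S_density_def by (intro sum_nonneg mult_nonneg_nonneg phase_prob_bounds exit_rates_nonneg)

lemma S_density_continuous: "isCont S_density t"
  unfolding S_density_def by (intro continuous_intros phase_prob_continuous)

lemma S_density_measurable [measurable]: "S_density \<in> borel_measurable borel"
  using S_density_continuous by (intro borel_measurable_continuous_onI) (simp add: continuous_at_imp_continuous_on)

lemma prob_S_greater: "1 \<le> n \<Longrightarrow> 0 \<le> t \<Longrightarrow> prob {w\<in>space M. t < S n w} = (\<Sum>i\<in>UNIV. \<alpha> $ i * surv t i)"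
proof -
  assume n: "1 \<le> n" and t: "0 \<le> t"
  have "{w\<in>space M. J n t w \<noteq> None} = space M - {w\<in>space M. J n t w = None}" by auto
  then have "{w\<in>space M. J n t w \<noteq> None} \<in> events"
    using markov_chain_measurable[OF chains[OF n] t, of None] by auto
  moreover have "{w\<in>space M. t < S n w} \<in> events" using S_measurable[OF n] by measurable
  moreover have "AE w in M. w \<in> {w\<in>space M. t < S n w} \<longleftrightarrow> w \<in> {w\<in>space M. J n t w \<noteq> None}"
    using AE_S[OF n] by eventually_elim (use t in \<open>auto simp: not_le\<close>)
  ultimately show ?thesis
    unfolding prob_J_absorbed[OF n t, symmetric] by (intro measure_eq_AE)
qed

text \<open>
  The survival function \<open>\<Sum>i. \<alpha>\<^sub>i surv t i\<close> has derivative \<open>- S_density\<close> and vanishes at infinity.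
\<close>

lemma S_distr:
  assumes n: "1 \<le> n"
  shows "distr M borel (S n) = density lborel (\<lambda>s. ennreal (S_density s) * indicator {0..} s)"
proof (rule measure_eqI_lessThan)
  let ?D = "density lborel (\<lambda>s. ennreal (S_density s) * indicator {0..} s)"
  let ?F = "\<lambda>t. - (\<Sum>i\<in>UNIV. \<alpha> $ i * surv t i)"
  have lim: "(?F \<longlongrightarrow> - (\<Sum>i\<in>UNIV. \<alpha> $ i * 0)) at_top"
    by (intro tendsto_intros surv_vanishes)
  have der: "(?F has_real_derivative S_density t) (at t)" for t
  proof -
    have "(?F has_real_derivative - (\<Sum>i\<in>UNIV. \<alpha> $ i * (- (\<Sum>k\<in>UNIV. p t i k * exit_rates Q $ k)))) (at t)"
      by (intro DERIV_minus DERIV_sum DERIV_cmult surv_deriv)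
    also have "- (\<Sum>i\<in>UNIV. \<alpha> $ i * (- (\<Sum>k\<in>UNIV. p t i k * exit_rates Q $ k))) = S_density t"
      unfolding S_density_def phase_prob_def sum_distrib_right sum_distrib_left
      by (simp add: sum_negf sum_distrib_left mult.assoc) (rule sum.swap)
    finally show ?thesis .
  qed
  have tail: "(\<integral>\<^sup>+s. ennreal (S_density s) * indicator {a..} s \<partial>lborel) = ennreal (\<Sum>i\<in>UNIV. \<alpha> $ i * surv a i)"
    if "0 \<le> a" for a
    using nn_integral_FTC_atLeast[of S_density a ?F, OF _ der _ lim] S_density_nonneg that by simp
  interpret D: prob_space "distr M borel (S n)" using S_measurable[OF n] by (rule prob_space_distr)
  show "emeasure (distr M borel (S n)) {x<..} < \<infinity>" for x by (simp add: D.emeasure_eq_measure)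
  show "emeasure (distr M borel (S n)) {x<..} = emeasure ?D {x<..}" for x
  proof -
    have vi: "S n -` {x<..} \<inter> space M = {w\<in>space M. x < S n w}" by auto
    have l: "emeasure (distr M borel (S n)) {x<..} = ennreal (prob {w\<in>space M. x < S n w})"
      using S_measurable[OF n] by (simp add: emeasure_distr vi emeasure_eq_measure)
    have r: "emeasure ?D {x<..} = (\<integral>\<^sup>+s. ennreal (S_density s) * indicator {0..} s * indicator {x<..} s \<partial>lborel)"
      by (simp add: emeasure_density)
    show ?thesis
    proof (cases "0 \<le> x")
      case True
      have "(\<integral>\<^sup>+s. ennreal (S_density s) * indicator {0..} s * indicator {x<..} s \<partial>lborel) =
         (\<integral>\<^sup>+s. ennreal (S_density s) * indicator {x..} s \<partial>lborel)"
        using AE_lborel_singleton[of x] True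
        by (intro nn_integral_cong_AE) (auto simp: indicator_def)
      then show ?thesis unfolding l r using tail[OF True] prob_S_greater[OF n True] by simp
    next
      case False
      have "(\<integral>\<^sup>+s. ennreal (S_density s) * indicator {0..} s * indicator {x<..} s \<partial>lborel) =
         (\<integral>\<^sup>+s. ennreal (S_density s) * indicator {0..} s \<partial>lborel)"
        using False by (intro nn_integral_cong) (auto simp: indicator_def)
      also have "\<dots> = 1" using tail[of 0] \<alpha>_sum by (simp add: surv_0)
      moreover have "{w\<in>space M. x < S n w} = space M"
        using absorption_time_nonneg[of "J n"] False by (auto intro: less_le_trans simp: not_le)
      ultimately show ?thesis unfolding l r by (simp add: prob_space)
    qed
  qed
qed auto

end

context prob_space
begin

text \<open>
  Fubini's theorem, with both integrals taken over the underlying probability space.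
\<close>

lemma indep_var_expectation:
  fixes g :: "real \<times> real \<Rightarrow> 'b::{banach,second_countable_topology}"
  assumes ind: "indep_var borel U borel V"
    and g: "g \<in> borel_measurable (borel \<Otimes>\<^sub>M borel)" and bound: "\<And>p. norm (g p) \<le> B"
  shows "(\<integral>w. g (U w, V w) \<partial>M) = (\<integral>w. (\<integral>w'. g (U w, V w') \<partial>M) \<partial>M)"
    and "(\<lambda>u. \<integral>w'. g (u, V w') \<partial>M) \<in> borel_measurable borel"
proof -
  have U: "U \<in> borel_measurable M" and V: "V \<in> borel_measurable M"
    using indep_var_rv1[OF ind] indep_var_rv2[OF ind] by auto
  interpret D1: prob_space "distr M borel U" using U by (rule prob_space_distr)
  interpret D2: prob_space "distr M borel V" using V by (rule prob_space_distr)
  interpret P: pair_prob_space "distr M borel U" "distr M borel V" ..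
  have gP: "g \<in> borel_measurable (distr M borel U \<Otimes>\<^sub>M distr M borel V)"
    using g by (simp cong: measurable_cong_sets)
  have gu: "(\<lambda>v. g (u, v)) \<in> borel_measurable borel" for u
    using measurable_compose[OF measurable_Pair1' g, of u] by simp
  have inner: "(\<integral>v. g (u, v) \<partial>distr M borel V) = (\<integral>w'. g (u, V w') \<partial>M)" for u
    using V gu by (rule integral_distr)
  have "(\<lambda>u. \<integral>v. g (u, v) \<partial>distr M borel V) \<in> borel_measurable borel"
    using g by (intro D2.borel_measurable_lebesgue_integral) (simp add: case_prod_unfold cong: measurable_cong_sets)
  then show m: "(\<lambda>u. \<integral>w'. g (u, V w') \<partial>M) \<in> borel_measurable borel"
    unfolding inner .
  have int: "integrable (distr M borel U \<Otimes>\<^sub>M distr M borel V) g"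
    by (rule P.integrable_const_bound[of _ B]) (use gP bound in auto)
  have "(\<integral>w. g (U w, V w) \<partial>M) = (\<integral>p. g p \<partial>distr M (borel \<Otimes>\<^sub>M borel) (\<lambda>w. (U w, V w)))"
    using U V g by (subst integral_distr) auto
  also have "distr M (borel \<Otimes>\<^sub>M borel) (\<lambda>w. (U w, V w)) = distr M borel U \<Otimes>\<^sub>M distr M borel V"
    using ind indep_var_distribution_eq[of borel U borel V] by simp
  also have "(\<integral>p. g p \<partial>(distr M borel U \<Otimes>\<^sub>M distr M borel V)) = (\<integral>u. (\<integral>v. g (u, v) \<partial>distr M borel V) \<partial>distr M borel U)"
    using P.integral_fst'[OF int] by simp
  also have "\<dots> = (\<integral>u. (\<integral>w'. g (u, V w') \<partial>M) \<partial>distr M borel U)" unfolding inner ..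
  also have "\<dots> = (\<integral>w. (\<integral>w'. g (U w, V w') \<partial>M) \<partial>M)"
    using U m by (rule integral_distr)
  finally show "(\<integral>w. g (U w, V w) \<partial>M) = (\<integral>w. (\<integral>w'. g (U w, V w') \<partial>M) \<partial>M)" .
qed

end

context ar_process_setup
begin

abbreviation sources :: "(nat + nat) set" where "sources \<equiv> Inl ` {1..} \<union> Inr ` {1..}"

lemma phase_prob_measurable [measurable]: "(\<lambda>t. phase_prob t i) \<in> borel_measurable borel"
  using phase_prob_continuous by (intro borel_measurable_continuous_onI) (simp add: continuous_at_imp_continuous_on)

text \<open>
  The phase process may be evaluated at an independent random time as if that time were constant:
  for times with values in a lattice this is the definition of independence, and right-continuity
  of the paths and continuity of the phase probabilities give the general case.
\<close>

lemma phase_at_lattice_time: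
  assumes n: "1 \<le> n" and I: "I \<subseteq> sources" "Inl n \<notin> I"
    and A: "A \<in> sets (info I)" and Y: "Y \<in> borel_measurable (info I)"
  shows "prob {w\<in>space M. w \<in> A \<and> J n (dyadic_above N (Y w)) w = Some i} =
    (\<integral>w. indicator A w * phase_prob (dyadic_above N (Y w)) i \<partial>M)"
    and "{w\<in>space M. w \<in> A \<and> J n (dyadic_above N (Y w)) w = Some i} \<in> events"
proof -
  let ?t = "\<lambda>k::nat. (real k + 1) / 2 ^ N"
  define R where "R k = A \<inter> ((\<lambda>w. nat \<lfloor>2 ^ N * Y w\<rfloor>) -` {k} \<inter> space M)" for k :: nat
  have Rinfo: "R k \<in> sets (info I)" for k
    unfolding R_def using measurable_sets[OF measurable_compose[OF Y measurable_dyadic_index[of N]], of "{k}"]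
    by (intro sets.Int[OF A]) simp
  have Rev: "R k \<in> events" for k using Rinfo info_events[OF I(1)] by blast
  have Aev: "A \<in> events" using A info_events[OF I(1)] by blast
  have Asub: "A \<subseteq> space M" using Aev by (rule sets.sets_into_space)
  have disj: "disjoint_family R" by (auto simp: disjoint_family_on_def R_def)
  have RU: "(\<Union>k. R k) = A" using Asub by (auto simp: R_def)
  have dy: "dyadic_above N (Y w) = ?t k" if "w \<in> R k" for w k
    using that by (auto simp: R_def dyadic_above_def)
  define B where "B k = J n (?t k) -` {Some i} \<inter> space M" for k
  have Binfo: "B k \<in> sets (info {Inl n})" for k
    unfolding B_def using measurable_sets[OF J_measurable_info[of "?t k" n], of "{Some i}"] by simp
  have Bev: "B k \<in> events" for k
    using Binfo[of k] info_events[of "{Inl n}"] n by blast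
  have pB: "prob (B k) = phase_prob (?t k) i" for k
    using prob_J[OF n, of "?t k" i] by (simp add: B_def vimage_def Int_def conj_commute)
  have eq: "{w\<in>space M. w \<in> A \<and> J n (dyadic_above N (Y w)) w = Some i} = (\<Union>k. R k \<inter> B k)"
    using dy RU unfolding B_def by auto
  show "{w\<in>space M. w \<in> A \<and> J n (dyadic_above N (Y w)) w = Some i} \<in> events"
    unfolding eq using Rev Bev by auto
  have "emeasure M (\<Union>k. R k \<inter> B k) = (\<Sum>k. emeasure M (R k \<inter> B k))"
    using Rev Bev by (intro suminf_emeasure[symmetric] disjoint_family_subset[OF disj]) auto
  also have "\<dots> = (\<Sum>k. ennreal (phase_prob (?t k) i) * emeasure M (R k))"
  proof (intro suminf_cong)
    fix k
    have "prob (B k \<inter> R k) = prob (B k) * prob (R k)"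
      using info_indep[of "{Inl n}" I "B k" "R k"] n I Binfo Rinfo by blast
    then show "emeasure M (R k \<inter> B k) = ennreal (phase_prob (?t k) i) * emeasure M (R k)"
      by (simp add: emeasure_eq_measure pB Int_commute ennreal_mult phase_prob_bounds)
  qed
  also have "\<dots> = (\<Sum>k. \<integral>\<^sup>+w. ennreal (phase_prob (?t k) i) * indicator (R k) w \<partial>M)"
    using Rev by (simp add: nn_integral_cmult_indicator)
  also have "\<dots> = (\<integral>\<^sup>+w. (\<Sum>k. ennreal (phase_prob (?t k) i) * indicator (R k) w) \<partial>M)"
    using Rev by (intro nn_integral_suminf[symmetric]) auto
  also have "\<dots> = (\<integral>\<^sup>+w. ennreal (indicator A w * phase_prob (dyadic_above N (Y w)) i) \<partial>M)"
  proof (intro nn_integral_cong)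
    fix w
    show "(\<Sum>k. ennreal (phase_prob (?t k) i) * indicator (R k) w) = ennreal (indicator A w * phase_prob (dyadic_above N (Y w)) i)"
    proof (cases "w \<in> A")
      case True
      then obtain k where k: "w \<in> R k" using RU by blast
      show ?thesis using suminf_cmult_indicator[OF disj k, of "\<lambda>k. ennreal (phase_prob (?t k) i)"] dy[OF k] True by simp
    next
      case False
      then have "w \<notin> R k" for k using RU by blast
      then show ?thesis using False by simp
    qed
  qed
  also have "\<dots> = ennreal (\<integral>w. indicator A w * phase_prob (dyadic_above N (Y w)) i \<partial>M)"
  proof (rule nn_integral_eq_integral)
    have YM: "Y \<in> borel_measurable M" using measurable_info[OF Y I(1)] .
    have "(\<lambda>x. dyadic_above N x) \<in> borel_measurable borel" unfolding dyadic_above_def by measurable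
    from measurable_compose[OF measurable_compose[OF YM this] phase_prob_measurable[of i]]
    have "(\<lambda>w. phase_prob (dyadic_above N (Y w)) i) \<in> borel_measurable M" .
    moreover have "0 \<le> dyadic_above N y" for y by (simp add: dyadic_above_def)
    ultimately show "integrable M (\<lambda>w. indicator A w * phase_prob (dyadic_above N (Y w)) i)"
      using phase_prob_bounds Aev
      by (intro integrable_const_bound[of _ 1] AE_I2) (auto simp: indicator_def)
    show "AE w in M. 0 \<le> indicator A w * phase_prob (dyadic_above N (Y w)) i"
      using phase_prob_bounds(1) by (simp add: dyadic_above_def)
  qed
  finally have "ennreal (prob (\<Union>k. R k \<inter> B k)) = ennreal (\<integral>w. indicator A w * phase_prob (dyadic_above N (Y w)) i \<partial>M)"
    by (simp add: emeasure_eq_measure)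
  moreover have "0 \<le> (\<integral>w. indicator A w * phase_prob (dyadic_above N (Y w)) i \<partial>M)"
    using phase_prob_bounds(1) by (intro integral_nonneg_AE AE_I2) (simp add: dyadic_above_def)
  ultimately show "prob {w\<in>space M. w \<in> A \<and> J n (dyadic_above N (Y w)) w = Some i} =
    (\<integral>w. indicator A w * phase_prob (dyadic_above N (Y w)) i \<partial>M)"
    unfolding eq by simp
qed

lemma phase_at_independent_time:
  assumes n: "1 \<le> n" and I: "I \<subseteq> sources" "Inl n \<notin> I"
    and A: "A \<in> sets (info I)" and Y: "Y \<in> borel_measurable (info I)"
    and pos: "\<And>w. w \<in> space M \<Longrightarrow> 0 \<le> Y w"
  shows "prob {w\<in>space M. w \<in> A \<and> J n (Y w) w = Some i} = (\<integral>w. indicator A w * phase_prob (Y w) i \<partial>M)"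
    and "{w\<in>space M. w \<in> A \<and> J n (Y w) w = Some i} \<in> events"
proof -
  let ?B = "\<lambda>N. {w\<in>space M. w \<in> A \<and> J n (dyadic_above N (Y w)) w = Some i}"
  let ?C = "{w\<in>space M. w \<in> A \<and> J n (Y w) w = Some i}"
  have YM: "Y \<in> borel_measurable M" using measurable_info[OF Y I(1)] .
  have Aev: "A \<in> events" using A info_events[OF I(1)] by blast
  have JY: "(\<lambda>w. J n (Y w) w) \<in> measurable M (count_space UNIV)"
    by (rule measurable_right_constant_at[OF J_measurable[OF n] J_right_constant[OF n] YM pos])
  have C: "?C \<in> events"
  proof -
    have "A \<inter> ((\<lambda>w. J n (Y w) w) -` {Some i} \<inter> space M) \<in> events"
      using measurable_sets[OF JY, of "{Some i}"] by (intro sets.Int[OF Aev]) simp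
    also have "A \<inter> ((\<lambda>w. J n (Y w) w) -` {Some i} \<inter> space M) = ?C" by auto
    finally show ?thesis .
  qed
  then show "?C \<in> events" .
  have dm: "(\<lambda>w. phase_prob (dyadic_above N (Y w)) i) \<in> borel_measurable M" for N
  proof -
    have "(\<lambda>x. dyadic_above N x) \<in> borel_measurable borel" unfolding dyadic_above_def by measurable
    from measurable_compose[OF measurable_compose[OF YM this] phase_prob_measurable[of i]] show ?thesis .
  qed
  have "(\<lambda>N. \<integral>w. indicator A w * phase_prob (dyadic_above N (Y w)) i \<partial>M) \<longlonglongrightarrow> (\<integral>w. indicator A w * phase_prob (Y w) i \<partial>M)"
  proof (rule integral_dominated_convergence[where w="\<lambda>_. 1"])
    show "(\<lambda>w. indicator A w * phase_prob (Y w) i) \<in> borel_measurable M"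
      using measurable_compose[OF YM phase_prob_measurable[of i]] Aev by simp
    show "(\<lambda>w. indicator A w * phase_prob (dyadic_above N (Y w)) i) \<in> borel_measurable M" for N
      using dm[of N] Aev by simp
    show "AE w in M. (\<lambda>N. indicator A w * phase_prob (dyadic_above N (Y w)) i) \<longlonglongrightarrow> indicator A w * phase_prob (Y w) i"
    proof (rule AE_I2)
      fix w assume "w \<in> space M"
      then show "(\<lambda>N. indicator A w * phase_prob (dyadic_above N (Y w)) i) \<longlonglongrightarrow> indicator A w * phase_prob (Y w) i"
        by (intro tendsto_mult tendsto_const isCont_tendsto_compose[OF phase_prob_continuous] dyadic_above_tendsto pos)
    qed
    show "AE w in M. norm (indicator A w * phase_prob (dyadic_above N (Y w)) i) \<le> 1" for N
    proof (rule AE_I2)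
      fix w
      have "0 \<le> dyadic_above N (Y w)" by (simp add: dyadic_above_def)
      then show "norm (indicator A w * phase_prob (dyadic_above N (Y w)) i) \<le> 1"
        using phase_prob_bounds by (auto simp: indicator_def)
    qed
  qed simp
  moreover have "(\<lambda>N. \<integral>w. indicator (?B N) w \<partial>M) \<longlonglongrightarrow> (\<integral>w. indicator ?C w \<partial>M :: real)"
  proof (rule integral_dominated_convergence[where w="\<lambda>_. 1"])
    show "indicator ?C \<in> borel_measurable M" using C by simp
    show "indicator (?B N) \<in> borel_measurable M" for N
      using phase_at_lattice_time(2)[OF n I A Y, of N i] by simp
    show "AE w in M. (\<lambda>N. indicator (?B N) w :: real) \<longlonglongrightarrow> indicator ?C w"
    proof (rule AE_I2)
      fix w assume w: "w \<in> space M"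
      have "\<forall>\<^sub>F N in sequentially. J n (dyadic_above N (Y w)) w = J n (Y w) w"
        using right_constant_dyadic[OF J_right_constant[OF n w] pos[OF w]] .
      then have "\<forall>\<^sub>F N in sequentially. (indicator (?B N) w :: real) = indicator ?C w"
        by (rule eventually_mono) (simp add: indicator_def)
      then show "(\<lambda>N. indicator (?B N) w :: real) \<longlonglongrightarrow> indicator ?C w" by (rule tendsto_eventually)
    qed
  qed (auto simp: indicator_def)
  then have "(\<lambda>N. prob (?B N)) \<longlonglongrightarrow> prob ?C"
    using C phase_at_lattice_time(2)[OF n I A Y, of _ i] by simp
  then have "(\<lambda>N. \<integral>w. indicator A w * phase_prob (dyadic_above N (Y w)) i \<partial>M) \<longlonglongrightarrow> prob ?C"
    unfolding phase_at_lattice_time(1)[OF n I A Y, of _ i] .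
  ultimately show "prob ?C = (\<integral>w. indicator A w * phase_prob (Y w) i \<partial>M)"
    by (rule LIMSEQ_unique[symmetric])
qed

lemma S_no_atom: "1 \<le> n \<Longrightarrow> prob {w\<in>space M. S n w = s} = 0"
proof -
  assume n: "1 \<le> n"
  have "emeasure (distr M borel (S n)) {s} = emeasure M {w\<in>space M. S n w = s}"
    using S_measurable[OF n] by (subst emeasure_distr) (auto intro!: arg_cong[where f="emeasure M"])
  moreover have "emeasure (distr M borel (S n)) {s} = 0"
    unfolding S_distr[OF n]
    using AE_lborel_singleton[of s] by (subst emeasure_density) (auto intro!: nn_integral_0_iff_AE[THEN iffD2] simp: indicator_def)
  ultimately show ?thesis by (simp add: emeasure_eq_measure)
qed

end

section \<open>The embedded process\<close>

lemma Max_atMost_nat: "Max {m::nat. m \<le> n} = n"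
  by (rule Max_eqI) auto

lemma eventually_at_right_near: "0 < d \<Longrightarrow> \<forall>\<^sub>F s in at_right t. t < s \<and> s < t + d" for t d :: real
  unfolding eventually_at_right_field by (rule exI[of _ "t + d"]) simp

locale ar_crossing = ar_process_setup M Q J T \<alpha>
  for M :: "'w measure" and Q :: "real^'m::finite^'m"
    and J :: "nat \<Rightarrow> real \<Rightarrow> 'w \<Rightarrow> 'm option" and T :: "nat \<Rightarrow> 'w \<Rightarrow> real" and \<alpha> :: "real^'m" +
  fixes l b x \<rho> :: real
  assumes l: "0 < l" "l < 1" and b: "0 \<le> b" and x: "x < b" and \<rho>: "0 < \<rho>" "\<rho> < 1"
begin

abbreviation X :: "nat \<Rightarrow> 'w \<Rightarrow> real" where "X \<equiv> ar_process l J T x"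
abbreviation arrival :: "nat \<Rightarrow> 'w \<Rightarrow> real" where "arrival \<equiv> partial_time J"
abbreviation level :: "real \<Rightarrow> 'w \<Rightarrow> real" where "level \<equiv> embedded_level l J T x"
abbreviation phase :: "real \<Rightarrow> 'w \<Rightarrow> 'm option" where "phase \<equiv> embedded_phase J"

lemma scale_below: "y < b \<Longrightarrow> l * y < b"
proof (cases "0 \<le> y")
  case True
  assume "y < b"
  have "l * y \<le> 1 * y" using True l by (intro mult_right_mono) auto
  then show "l * y < b" using \<open>y < b\<close> by simp
next
  case False
  then have "l * y < 0" using l by (simp add: mult_less_0_iff)
  then show "l * y < b" using b by simp
qed

lemma arrival_simps: "arrival 0 w = 0" "arrival (Suc n) w = arrival n w + S (Suc n) w"
  by (simp_all add: partial_time_def)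

lemma arrival_mono: "m \<le> n \<Longrightarrow> arrival m w \<le> arrival n w"
  unfolding partial_time_def by (intro sum_mono2) (auto simp: absorption_time_nonneg)

lemma step_index_eq:
  assumes "arrival n w \<le> t" "t < arrival (Suc n) w"
  shows "step_index J t w = n"
proof -
  have "arrival m w \<le> t \<longleftrightarrow> m \<le> n" for m
    using assms arrival_mono[of m n w] arrival_mono[of "Suc n" m w] by (meson not_less_eq_eq order_trans not_le)
  then show ?thesis by (simp add: step_index_def Max_atMost_nat)
qed

lemma step_index_cases:
  assumes "0 \<le> t"
  shows "arrival (step_index J t w) w \<le> t \<and>
    (\<exists>e>0. \<forall>s. t \<le> s \<longrightarrow> s < t + e \<longrightarrow> step_index J s w = step_index J t w)"
proof (cases "finite {n. arrival n w \<le> t}")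
  case True
  have "0 \<in> {n. arrival n w \<le> t}" using assms by (simp add: arrival_simps)
  then have "step_index J t w \<in> {n. arrival n w \<le> t}"
    unfolding step_index_def using True by (intro Max_in) auto
  moreover have "Suc (step_index J t w) \<notin> {n. arrival n w \<le> t}"
    unfolding step_index_def using Max_ge[OF True] by (metis Suc_n_not_le_n)
  ultimately have n: "arrival (step_index J t w) w \<le> t" "t < arrival (Suc (step_index J t w)) w" by auto
  have "step_index J s w = step_index J t w"
    if "t \<le> s" "s < t + (arrival (Suc (step_index J t w)) w - t)" for s
    using n that by (intro step_index_eq) auto
  moreover have "0 < arrival (Suc (step_index J t w)) w - t" using n by simp
  ultimately show ?thesis using n(1) by blast
next
  case False
  have all: "arrival n w \<le> t" for n
  proof -
    obtain m where "n \<le> m" "arrival m w \<le> t" using False unfolding infinite_nat_iff_unbounded_le by blast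
    then show ?thesis using arrival_mono[of n m w] by simp
  qed
  have "step_index J s w = step_index J t w" if "t \<le> s" for s
  proof -
    have "arrival n w \<le> s" for n using all[of n] that by simp
    then have "{n. arrival n w \<le> s} = {n. arrival n w \<le> t}" using all by auto
    then show ?thesis by (simp add: step_index_def)
  qed
  then have "\<forall>s. t \<le> s \<longrightarrow> s < t + 1 \<longrightarrow> step_index J s w = step_index J t w" by blast
  then show ?thesis using all zero_less_one by blast
qed

lemma X_measurable_info: "X n \<in> borel_measurable (info (Inl ` {1..n} \<union> Inr ` {1..n}))"
proof (induction n)
  case (Suc n)
  let ?I = "Inl ` {1..Suc n} \<union> Inr ` {1..Suc n}"
  have Xm: "X n \<in> borel_measurable (info ?I)" by (rule measurable_info_mono[OF Suc]) auto
  have Sm: "S (Suc n) \<in> borel_measurable (info ?I)" by (rule measurable_info_mono[OF S_measurable_info]) auto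
  have Tm: "T (Suc n) \<in> borel_measurable (info ?I)" by (rule measurable_info_mono[OF T_measurable_info]) auto
  have "(\<lambda>w. l * X n w + (S (Suc n) w - T (Suc n) w)) \<in> borel_measurable (info ?I)"
    by (rule borel_measurable_add[OF borel_measurable_times[OF borel_measurable_const Xm] borel_measurable_diff[OF Sm Tm]])
  then show ?case by simp
qed simp

lemma hist_sources: "Inl ` {1..n} \<union> Inr ` {1..n} \<subseteq> sources" by auto

lemma X_measurable [measurable]: "X n \<in> borel_measurable M"
  using measurable_info[OF X_measurable_info hist_sources] .

lemma arrival_measurable [measurable]: "arrival n \<in> borel_measurable M"
  unfolding partial_time_def by (intro borel_measurable_sum S_measurable) auto

lemma step_index_measurable: "step_index J t \<in> measurable M (count_space UNIV)"
  unfolding step_index_def by (rule measurable_Max_nat) measurable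

text \<open>
  The first passage above \<open>b\<close> is written as the absorption time of a process with two values, which
  makes the measurability results for right-continuous paths available for it.
\<close>

definition below :: "real \<Rightarrow> 'w \<Rightarrow> unit option" where
  "below t w = (if b \<le> level t w then None else Some ())"

lemma below_None: "below t w = None \<longleftrightarrow> b \<le> level t w"
  by (simp add: below_def)

lemma below_measurable: "below t \<in> measurable M (count_space UNIV)"
proof -
  have n: "(\<lambda>w. if b \<le> l * X n w - T (Suc n) w + t - arrival n w then None else Some ()) \<in> measurable M (count_space UNIV)" for n
    using T_measurable[of "Suc n"] by measurable
  have "below t = (\<lambda>w. (\<lambda>n w. if b \<le> l * X n w - T (Suc n) w + t - arrival n w then None else Some ()) (step_index J t w) w)"
    by (simp add: below_def embedded_level_def Let_def fun_eq_iff)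
  also have "\<dots> \<in> measurable M (count_space UNIV)"
    using n step_index_measurable by (rule measurable_compose_countable)
  finally show ?thesis .
qed

lemma below_right_constant: "right_constant (\<lambda>t. below t w)"
  unfolding right_constant_def
proof (intro allI impI)
  fix t :: real assume t: "0 \<le> t"
  obtain e where e: "e > 0" "\<And>s. t \<le> s \<Longrightarrow> s < t + e \<Longrightarrow> step_index J s w = step_index J t w"
    using step_index_cases[OF t, of w] by blast
  have lev: "level s w = level t w + (s - t)" if "t \<le> s" "s < t + e" for s
    using e(2)[OF that] by (simp add: embedded_level_def Let_def)
  have "\<forall>\<^sub>F s in at_right t. t < s \<and> s < t + (if b \<le> level t w then e else min e (b - level t w))"
    using e(1) by (intro eventually_at_right_near) simp
  then show "\<forall>\<^sub>F s in at_right t. below s w = below t w"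
  proof eventually_elim
    case (elim s)
    then have "level s w = level t w + (s - t)" by (intro lev) (auto split: if_splits)
    then show ?case using elim by (auto simp: below_def split: if_splits)
  qed
qed

lemma phase_measurable:
  assumes t: "0 \<le> t"
  shows "phase t \<in> measurable M (count_space UNIV)"
proof -
  have n: "(\<lambda>w. J (Suc n) (max 0 (t - arrival n w)) w) \<in> measurable M (count_space UNIV)" for n
    by (rule measurable_right_constant_at[OF J_measurable J_right_constant]) auto
  have "phase t = (\<lambda>w. (\<lambda>n w. J (Suc n) (max 0 (t - arrival n w)) w) (step_index J t w) w)"
    using step_index_cases[OF t] by (simp add: embedded_phase_def Let_def fun_eq_iff max_def)
  also have "\<dots> \<in> measurable M (count_space UNIV)"
    using n step_index_measurable by (rule measurable_compose_countable)
  finally show ?thesis .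
qed

lemma phase_right_constant: "w \<in> space M \<Longrightarrow> right_constant (\<lambda>t. phase t w)"
  unfolding right_constant_def
proof (intro allI impI)
  fix t :: real assume w: "w \<in> space M" and t: "0 \<le> t"
  obtain e where e: "e > 0" "\<And>s. t \<le> s \<Longrightarrow> s < t + e \<Longrightarrow> step_index J s w = step_index J t w"
    using step_index_cases[OF t, of w] by blast
  define n where "n = step_index J t w"
  have n: "arrival n w \<le> t" using step_index_cases[OF t, of w] by (simp add: n_def)
  then have "0 \<le> t - arrival n w" by simp
  then obtain d where d: "d > 0" "\<And>s. t - arrival n w \<le> s \<Longrightarrow> s < t - arrival n w + d \<Longrightarrow>
      J (Suc n) s w = J (Suc n) (t - arrival n w) w"
    using right_constantD[OF J_right_constant[OF _ w, of "Suc n"]] by (metis le_add1 plus_1_eq_Suc)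
  have "\<forall>\<^sub>F s in at_right t. t < s \<and> s < t + min e d"
    using e(1) d(1) by (intro eventually_at_right_near) simp
  then show "\<forall>\<^sub>F s in at_right t. phase s w = phase t w"
  proof eventually_elim
    case (elim s)
    then have "step_index J s w = n" unfolding n_def by (intro e(2)) auto
    moreover have "J (Suc n) (s - arrival n w) w = J (Suc n) (t - arrival n w) w"
      using elim by (intro d(2)) auto
    ultimately show ?case by (simp add: embedded_phase_def Let_def n_def)
  qed
qed

definition crossing :: "'w \<Rightarrow> real" where "crossing = absorption_time below"

lemma crossing_nonneg: "0 \<le> crossing w"
  by (simp add: crossing_def absorption_time_nonneg)

lemma crossing_measurable: "crossing \<in> borel_measurable M"
  unfolding crossing_def
  by (rule measurable_absorption_time) (rule below_measurable, rule below_right_constant)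

lemma crossing_eq: "\<exists>t\<ge>0. b \<le> level t w \<Longrightarrow> crossing w = Inf {t. 0 \<le> t \<and> b \<le> level t w}"
  by (auto simp: crossing_def absorption_time_def below_None)

lemma below_crossing: "below (crossing w) w = None \<longleftrightarrow> (\<exists>t\<ge>0. b \<le> level t w)"
proof
  assume "below (crossing w) w = None"
  then show "\<exists>t\<ge>0. b \<le> level t w" using crossing_nonneg below_None by blast
next
  assume ex: "\<exists>t\<ge>0. b \<le> level t w"
  let ?A = "{t. 0 \<le> t \<and> b \<le> level t w}"
  have ne: "?A \<noteq> {}" and bdd: "bdd_below ?A" using ex by (auto intro: bdd_belowI[of _ 0])
  obtain e where e: "e > 0" "\<forall>s. crossing w \<le> s \<longrightarrow> s < crossing w + e \<longrightarrow> below s w = below (crossing w) w"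
    using right_constantD[OF below_right_constant crossing_nonneg] by blast
  obtain s where s: "s \<in> ?A" "s < crossing w + e"
    using cInf_less_iff[OF ne bdd, of "crossing w + e"] e(1) crossing_eq[OF ex] by auto
  moreover have "crossing w \<le> s" unfolding crossing_eq[OF ex] using s(1) bdd by (intro cInf_lower)
  ultimately have "below s w = below (crossing w) w" using e(2) by blast
  moreover have "below s w = None" using s(1) by (simp add: below_None)
  ultimately show "below (crossing w) w = None" by simp
qed

lemma phase_event_eq:
  "w \<in> phase_event l J T b x i \<longleftrightarrow> below (crossing w) w = None \<and> phase (crossing w) w = Some i"
proof (cases "\<exists>t\<ge>0. b \<le> level t w")
  case True
  show ?thesis
    unfolding phase_event_def below_crossing mem_Collect_eq crossing_eq[OF True, symmetric] by (rule refl)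
next
  case False
  then show ?thesis
    unfolding phase_event_def below_crossing mem_Collect_eq by blast
qed

lemma phase_event_measurable: "{w\<in>space M. w \<in> phase_event l J T b x i} \<in> events"
proof -
  have B: "(\<lambda>w. below (crossing w) w) \<in> measurable M (count_space UNIV)"
    by (rule measurable_right_constant_at) (rule below_measurable below_right_constant crossing_measurable crossing_nonneg)+
  have P: "(\<lambda>w. phase (crossing w) w) \<in> measurable M (count_space UNIV)"
    by (rule measurable_right_constant_at[OF phase_measurable phase_right_constant crossing_measurable crossing_nonneg])
  have "((\<lambda>w. below (crossing w) w) -` {None} \<inter> space M) \<inter> ((\<lambda>w. phase (crossing w) w) -` {Some i} \<inter> space M) \<in> events"
    by (rule sets.Int[OF measurable_sets[OF B] measurable_sets[OF P]]) simp_all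
  also have "((\<lambda>w. below (crossing w) w) -` {None} \<inter> space M) \<inter> ((\<lambda>w. phase (crossing w) w) -` {Some i} \<inter> space M)
      = {w\<in>space M. w \<in> phase_event l J T b x i}"
    unfolding phase_event_eq by auto
  finally show ?thesis .
qed

text \<open>
  The time from the start of the \<open>k\<close>-th step to the passage of the level through \<open>b\<close>, if the step takes
  that long. On \<open>alive (k - 1)\<close> it is positive for \<open>T k \<ge> 0\<close>; elsewhere truncation at \<open>0\<close> keeps it a valid time.
\<close>

definition gap :: "nat \<Rightarrow> 'w \<Rightarrow> real" where
  "gap k w = max 0 (b - l * X (k - 1) w + T k w)"

definition alive :: "nat \<Rightarrow> 'w set" where
  "alive k = {w\<in>space M. \<forall>j\<le>k. X j w < b}"

definition hit :: "nat \<Rightarrow> 'm \<Rightarrow> 'w set" where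
  "hit k i = {w\<in>space M. w \<in> alive (k - 1) \<and> J k (gap k w) w = Some i}"

text \<open>
  The exclusion of \<open>X n = b\<close> is needed at the end of a step: there the level approaches \<open>X n\<close> without
  attaining it, so for \<open>X n = b\<close> the passage would not happen in that step.
\<close>

definition regular :: "'w \<Rightarrow> bool" where
  "regular w \<longleftrightarrow> (\<forall>n\<ge>1. 0 \<le> T n w \<and> 0 < S n w \<and> (\<forall>t\<ge>0. J n t w = None \<longleftrightarrow> S n w \<le> t) \<and> X n w \<noteq> b)"

lemma gap_eq:
  assumes "regular w" "w \<in> alive (k - 1)" "1 \<le> k"
  shows "gap k w = b - l * X (k - 1) w + T k w" "0 < gap k w" "X k w = b + (S k w - gap k w)"
proof -
  have "X (k - 1) w < b" using assms(2) by (simp add: alive_def)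
  then have "l * X (k - 1) w < b" by (rule scale_below)
  moreover have "0 \<le> T k w" using assms(1,3) by (simp add: regular_def)
  ultimately show g: "gap k w = b - l * X (k - 1) w + T k w" and "0 < gap k w" by (auto simp: gap_def)
  obtain m where "k = Suc m" using assms(3) by (cases k) auto
  then show "X k w = b + (S k w - gap k w)" using g by simp
qed

text \<open>
  Pathwise, the first passage of the embedded process happens during the step that leads to the first
  \<open>X k\<close> above \<open>b\<close>: in a step the level rises with slope one and approaches the value of \<open>X\<close> at its end.
\<close>

lemma phase_event_at_crossing:
  assumes reg: "regular w" and al: "w \<in> alive (k - 1)" and k: "1 \<le> k" and up: "b < X k w"
  shows "w \<in> phase_event l J T b x i \<longleftrightarrow> J k (gap k w) w = Some i"
proof -
  note g = gap_eq[OF reg al k]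
  obtain m where m: "k = Suc m" using k by (cases k) auto
  let ?t = "arrival m w + gap k w"
  have arr_m: "0 \<le> arrival m w" using arrival_mono[of 0 m w] by (simp add: arrival_simps)
  have gS: "gap k w < S k w" using g(3) up by simp
  have lev_t: "level s w = b + (s - ?t)" if "arrival m w \<le> s" "s < arrival k w" for s
  proof -
    have "step_index J s w = m" using that m by (intro step_index_eq) auto
    then show ?thesis using g(1) m by (simp add: embedded_level_def Let_def)
  qed
  have t_in: "arrival m w \<le> ?t" "?t < arrival k w" using g(2) gS m by (auto simp: arrival_simps)
  have low: "level s w < b" if s: "0 \<le> s" "s < ?t" for s
  proof (cases "arrival m w \<le> s")
    case True
    then show ?thesis using lev_t[of s] s t_in by auto
  next
    case False
    define n where "n = step_index J s w"
    have n: "arrival n w \<le> s" using step_index_cases[OF s(1), of w] by (simp add: n_def)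
    have fin: "finite {n. arrival n w \<le> s}"
    proof (rule finite_subset)
      show "{n. arrival n w \<le> s} \<subseteq> {..m}"
      proof safe
        fix n assume "arrival n w \<le> s"
        then have "\<not> m \<le> n" using False arrival_mono[of m n w] by linarith
        then show "n \<le> m" by simp
      qed
    qed simp
    have n1: "s < arrival (Suc n) w"
    proof (rule ccontr)
      assume "\<not> s < arrival (Suc n) w"
      then have "Suc n \<le> Max {n. arrival n w \<le> s}" using fin by (intro Max_ge) auto
      then show False by (simp add: n_def step_index_def)
    qed
    have "n < m" using n False arrival_mono[of m n w] by (cases "n < m") auto
    then have "X (Suc n) w < b" using al m by (auto simp: alive_def simp del: ar_process.simps)
    moreover have "level s w = l * X n w - T (Suc n) w + s - arrival n w"
      by (simp add: embedded_level_def Let_def n_def)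
    ultimately show ?thesis using n1 by (simp add: arrival_simps)
  qed
  have "Inf {t. 0 \<le> t \<and> b \<le> level t w} = ?t"
  proof (rule cInf_eq_minimum)
    show "?t \<in> {t. 0 \<le> t \<and> b \<le> level t w}" using lev_t[OF t_in] arr_m g(2) by auto
    show "?t \<le> s" if "s \<in> {t. 0 \<le> t \<and> b \<le> level t w}" for s
      using low[of s] that by (auto simp: not_less[symmetric])
  qed
  moreover have "step_index J ?t w = m" using t_in m by (intro step_index_eq) auto
  then have "phase ?t w = J k (gap k w) w" using m by (simp add: embedded_phase_def Let_def)
  moreover have "\<exists>t\<ge>0. b \<le> level t w"
    using lev_t[OF t_in] arr_m g(2) by (intro exI[of _ ?t]) auto
  ultimately show ?thesis by (simp add: phase_event_def)
qed

text \<open>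
  The phase at time \<open>gap k\<close> of the \<open>k\<close>-th step is a transient one exactly if the step lasts beyond that time,
  that is, if it ends above \<open>b\<close>.
\<close>

lemma hit_iff:
  assumes reg: "regular w" and w: "w \<in> space M" and k: "1 \<le> k"
  shows "w \<in> hit k i \<longleftrightarrow>
    (\<exists>k. b \<le> X k w) \<and> w \<in> phase_event l J T b x i \<and> (LEAST k. b \<le> X k w) = k"
proof
  assume h: "w \<in> hit k i"
  then have al: "w \<in> alive (k - 1)" and Jk: "J k (gap k w) w = Some i" by (auto simp: hit_def)
  note g = gap_eq[OF reg al k]
  have "\<not> S k w \<le> gap k w" using Jk reg k g(2) unfolding regular_def by (metis less_imp_le option.distinct(1))
  then have up: "b < X k w" using g(3) by simp
  moreover have "(LEAST k. b \<le> X k w) = k"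
  proof (rule Least_equality)
    show "b \<le> X k w" using up by simp
    show "k \<le> j" if "b \<le> X j w" for j
    proof (rule ccontr)
      assume "\<not> k \<le> j"
      then have "X j w < b" using al k by (simp add: alive_def)
      then show False using that by simp
    qed
  qed
  ultimately show "(\<exists>k. b \<le> X k w) \<and> w \<in> phase_event l J T b x i \<and> (LEAST k. b \<le> X k w) = k"
    using phase_event_at_crossing[OF reg al k up, of i] Jk less_imp_le by blast
next
  assume *: "(\<exists>k. b \<le> X k w) \<and> w \<in> phase_event l J T b x i \<and> (LEAST k. b \<le> X k w) = k"
  then have "b \<le> X k w" by (metis (mono_tags, lifting) LeastI_ex)
  then have up: "b < X k w" using reg k unfolding regular_def by (metis order_le_less)
  have al: "w \<in> alive (k - 1)"
  proof -
    have "X j w < b" if "j \<le> k - 1" for j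
    proof (rule ccontr)
      assume "\<not> X j w < b"
      then have "(LEAST k. b \<le> X k w) \<le> j" by (intro Least_le) simp
      then show False using * that k by simp
    qed
    then show ?thesis using w by (simp add: alive_def)
  qed
  show "w \<in> hit k i"
    using phase_event_at_crossing[OF reg al k up, of i] * al w by (simp add: hit_def)
qed

lemma alive_info: "alive n \<in> sets (info (Inl ` {1..n} \<union> Inr ` {1..n}))"
proof -
  let ?H = "info (Inl ` {1..n} \<union> Inr ` {1..n})"
  have "alive n = space M - (\<Union>j\<in>{..n}. space M - (X j -` {..<b} \<inter> space M))"
    by (auto simp: alive_def)
  moreover have "X j -` {..<b} \<inter> space M \<in> sets ?H" if "j \<le> n" for j
  proof -
    have "X j \<in> borel_measurable ?H" by (rule measurable_info_mono[OF X_measurable_info]) (use that in auto)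
    from measurable_sets[OF this, of "{..<b}"] show ?thesis by simp
  qed
  moreover have "space M \<in> sets ?H" using sets.top[of ?H] by simp
  ultimately show ?thesis by (simp only:) (intro sets.Diff sets.finite_UN, auto)
qed

lemma room_measurable_info:
  "(\<lambda>w. b - l * X m w + T k w) \<in> borel_measurable (info (insert (Inr k) (Inl ` {1..m} \<union> Inr ` {1..m})))"
proof -
  let ?I = "insert (Inr k) (Inl ` {1..m} \<union> Inr ` {1..m})"
  have Xm: "X m \<in> borel_measurable (info ?I)" by (rule measurable_info_mono[OF X_measurable_info]) auto
  have Tm: "T k \<in> borel_measurable (info ?I)" by (rule measurable_info_mono[OF T_measurable_info]) auto
  show ?thesis
    by (rule borel_measurable_add[OF borel_measurable_diff[OF borel_measurable_const
            borel_measurable_times[OF borel_measurable_const Xm]] Tm])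
qed

lemma gap_measurable_info: "gap k \<in> borel_measurable (info (insert (Inr k) (Inl ` {1..k - 1} \<union> Inr ` {1..k - 1})))"
  unfolding gap_def by (rule borel_measurable_max[OF room_measurable_info borel_measurable_const])

text \<open>
  Any value outside the half-line below \<open>b\<close> serves as cemetery; with \<open>b\<close> the event of being alive can be
  read off from \<open>killed k\<close>.
\<close>

definition killed :: "nat \<Rightarrow> 'w \<Rightarrow> real" where
  "killed k w = (if w \<in> alive k then X k w else b)"

lemma killed_measurable_info: "killed n \<in> borel_measurable (info (Inl ` {1..n} \<union> Inr ` {1..n}))"
proof -
  have "alive n \<inter> space (info (Inl ` {1..n} \<union> Inr ` {1..n})) \<in> sets (info (Inl ` {1..n} \<union> Inr ` {1..n}))"
    using alive_info by (rule sets.Int[OF _ sets.top])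
  then show ?thesis
    unfolding killed_def by (rule measurable_If_set[OF X_measurable_info borel_measurable_const])
qed

lemma killed_less: "killed k w < b \<longleftrightarrow> w \<in> alive k"
  by (auto simp: killed_def alive_def)

text \<open>
  Absorption times have a density, so that \<open>X n = l X (n - 1) + S n - T n\<close> hits \<open>b\<close> with probability zero.
\<close>

lemma AE_regular: "AE w in M. regular w"
proof -
  have "AE w in M. X n w \<noteq> b" if n: "1 \<le> n" for n
  proof -
    obtain m where m: "n = Suc m" using n by (cases n) auto
    let ?I = "insert (Inr n) (Inl ` {1..m} \<union> Inr ` {1..m})"
    let ?U = "\<lambda>w. b - l * X m w + T n w"
    have U: "?U \<in> borel_measurable (info ?I)" by (rule room_measurable_info)
    have ind: "indep_var borel ?U borel (S n)"
      by (rule info_indep_var[OF _ _ _ U S_measurable_info[OF n]]) (use n m in auto)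
    have D: "(\<lambda>p. indicator {p :: real \<times> real. fst p = snd p} p :: real) \<in> borel_measurable (borel \<Otimes>\<^sub>M borel)"
      by measurable
    have iterated: "(\<integral>w. (indicator {p. fst p = snd p} (?U w, S n w) :: real) \<partial>M) =
        (\<integral>w. (\<integral>w'. indicator {p. fst p = snd p} (?U w, S n w') \<partial>M) \<partial>M)"
      by (rule indep_var_expectation(1)[OF ind D, of 1]) (simp add: indicator_def)
    have inner: "(\<integral>w'. indicator {p. fst p = snd p} (u, S n w') \<partial>M) = (0::real)" for u
    proof -
      have "(\<integral>w'. indicator {p. fst p = snd p} (u, S n w') \<partial>M) = (\<integral>w'. indicator {w\<in>space M. S n w = u} w' \<partial>M :: real)"
        by (rule Bochner_Integration.integral_cong) (auto simp: indicator_def)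
      also have "\<dots> = prob {w\<in>space M. S n w = u}" using S_measurable[OF n] by simp
      finally show ?thesis using S_no_atom[OF n] by simp
    qed
    have "(\<integral>w. (indicator {p. fst p = snd p} (?U w, S n w) :: real) \<partial>M) = 0"
      unfolding iterated inner by simp
    moreover have "(\<lambda>w. (indicator {p. fst p = snd p} (?U w, S n w) :: real)) = (\<lambda>w. indicator {w. X n w = b} w)"
      using m by (auto simp: fun_eq_iff indicator_def)
    ultimately have "(\<integral>w. (indicator {w. X n w = b} w :: real) \<partial>M) = 0" by simp
    moreover have "(\<integral>w. (indicator {w. X n w = b} w :: real) \<partial>M) = (\<integral>w. (indicator {w\<in>space M. X n w = b} w) \<partial>M)"
      by (rule Bochner_Integration.integral_cong) (auto simp: indicator_def)
    moreover have ev: "{w\<in>space M. X n w = b} \<in> events" by measurable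
    ultimately have "{w\<in>space M. X n w = b} \<in> null_sets M"
      by (simp add: null_sets_def emeasure_eq_measure)
    then show ?thesis by (rule AE_I') auto
  qed
  then have each: "AE w in M. 0 \<le> T n w \<and> (0 < S n w \<and> (\<forall>t\<ge>0. J n t w = None \<longleftrightarrow> S n w \<le> t)) \<and> X n w \<noteq> b" if "1 \<le> n" for n
    using T_nonneg[OF that] AE_S[OF that] that by (intro AE_conjI) auto
  have "AE w in M. \<forall>n. 1 \<le> n \<longrightarrow> 0 \<le> T n w \<and> (0 < S n w \<and> (\<forall>t\<ge>0. J n t w = None \<longleftrightarrow> S n w \<le> t)) \<and> X n w \<noteq> b"
  proof (rule AE_all_countable[THEN iffD2], rule allI)
    fix n
    show "AE w in M. 1 \<le> n \<longrightarrow> 0 \<le> T n w \<and> (0 < S n w \<and> (\<forall>t\<ge>0. J n t w = None \<longleftrightarrow> S n w \<le> t)) \<and> X n w \<noteq> b"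
    proof (cases "1 \<le> n")
      case True
      from each[OF this] show ?thesis by (rule eventually_mono) blast
    qed simp
  qed
  then show ?thesis unfolding regular_def by (rule eventually_mono) blast
qed

definition hit_prob :: "nat \<Rightarrow> 'm \<Rightarrow> real" where "hit_prob k i = prob (hit k i)"

text \<open>
  The gap of step \<open>k\<close> depends on the past and on \<open>T k\<close> only, hence is independent of the chain of step \<open>k\<close>.
\<close>

lemma hit_events: "1 \<le> k \<Longrightarrow> hit k i \<in> events"
  and hit_prob_eq: "1 \<le> k \<Longrightarrow> hit_prob k i = (\<integral>w. indicator (alive (k - 1)) w * phase_prob (gap k w) i \<partial>M)"
proof -
  assume k: "1 \<le> k"
  let ?I = "insert (Inr k) (Inl ` {1..k - 1} \<union> Inr ` {1..k - 1})"
  have I: "?I \<subseteq> sources" "Inl k \<notin> ?I" using k by auto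
  have A: "alive (k - 1) \<in> sets (info ?I)"
    by (rule subsetD[OF info_mono alive_info]) auto
  note * = phase_at_independent_time[OF k I A gap_measurable_info, of i]
  show "hit k i \<in> events" unfolding hit_def by (rule *(2)) (simp add: gap_def)
  show "hit_prob k i = (\<integral>w. indicator (alive (k - 1)) w * phase_prob (gap k w) i \<partial>M)"
    unfolding hit_prob_def hit_def by (rule *(1)) (simp add: gap_def)
qed

text \<open>
  Decomposition according to the step in which the first passage happens; \<open>x < b\<close> excludes passage at time \<open>0\<close>.
\<close>

lemma Phi_sums: "(\<lambda>n. \<rho> ^ Suc n * hit_prob (Suc n) i) sums Phi M l J T \<rho> b i x"
proof -
  let ?f = "\<lambda>w. if (\<exists>k. b \<le> X k w) \<and> w \<in> phase_event l J T b x i then \<rho> ^ (LEAST k. b \<le> X k w) else 0"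
  let ?g = "\<lambda>n w. \<rho> ^ Suc n * indicator (hit (Suc n) i) w"
  have gint: "integrable M (?g n)" for n
    using hit_events[of "Suc n" i] by (intro integrable_mult_right integrable_real_indicator) (auto simp: emeasure_eq_measure)
  have normg: "norm (?g n w) \<le> \<rho> ^ Suc n" for n w
    using \<rho> by (simp add: indicator_def)
  have geo: "summable (\<lambda>n. \<rho> ^ Suc n)" using \<rho> by (simp add: summable_geometric summable_mult)
  have AEsum: "AE w in M. summable (\<lambda>n. norm (?g n w))"
    by (rule AE_I2, rule summable_comparison_test'[OF geo, of 0]) (use normg in simp)
  have Isum: "summable (\<lambda>n. \<integral>w. norm (?g n w) \<partial>M)"
  proof (rule summable_comparison_test'[OF geo, of 0])
    fix n
    have "(\<integral>w. norm (?g n w) \<partial>M) \<le> (\<integral>w. \<rho> ^ Suc n \<partial>M)"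
      using gint by (intro integral_mono integrable_norm normg) auto
    then show "norm (\<integral>w. norm (?g n w) \<partial>M) \<le> \<rho> ^ Suc n" by (simp add: prob_space)
  qed
  have sums: "(\<lambda>n. \<integral>w. ?g n w \<partial>M) sums (\<integral>w. (\<Sum>n. ?g n w) \<partial>M)"
    by (rule sums_integral[OF gint AEsum Isum])
  have "(\<integral>w. ?f w \<partial>M) = (\<integral>w. (\<Sum>n. ?g n w) \<partial>M)"
  proof (rule integral_cong_AE)
    show "(\<lambda>w. \<Sum>n. ?g n w) \<in> borel_measurable M"
      by (rule borel_measurable_suminf[OF borel_measurable_integrable[OF gint]])
    have [measurable]: "Measurable.pred M (\<lambda>w. w \<in> phase_event l J T b x i)"
      using phase_event_measurable by (simp add: pred_def)
    show "?f \<in> borel_measurable M" by measurable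
    show "AE w in M. ?f w = (\<Sum>n. ?g n w)"
      using AE_regular AE_space
    proof eventually_elim
      case (elim w)
      show ?case
      proof (cases "(\<exists>k. b \<le> X k w) \<and> w \<in> phase_event l J T b x i")
        case True
        define k where "k = (LEAST k. b \<le> X k w)"
        have "b \<le> X k w" unfolding k_def using True by (metis (mono_tags, lifting) LeastI_ex)
        then have "k \<noteq> 0" using x by (cases k) auto
        then obtain m where m: "k = Suc m" by (cases k) auto
        have h: "w \<in> hit (Suc n) i \<longleftrightarrow> n = m" for n
          using hit_iff[OF elim, of "Suc n" i] True m unfolding k_def by auto
        have "(\<Sum>n. ?g n w) = (\<Sum>n\<in>{m}. ?g n w)"
          by (rule suminf_finite) (auto simp: h)
        then show ?thesis using True h m unfolding k_def[symmetric] by simp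
      next
        case False
        then have "w \<notin> hit (Suc n) i" for n using hit_iff[OF elim, of "Suc n" i] by auto
        then show ?thesis unfolding if_not_P[OF False] by simp
      qed
    qed
  qed
  then have "Phi M l J T \<rho> b i x = (\<integral>w. (\<Sum>n. ?g n w) \<partial>M)" by (simp add: Phi_def)
  then show ?thesis using sums hit_events[of "Suc _" i] by (simp add: hit_prob_def)
qed

end

section \<open>The transforms of one innovation\<close>

lemma sum_axis:
  fixes f :: "'n::finite \<Rightarrow> 'a::comm_semiring_1"
  shows "(\<Sum>i\<in>UNIV. axis k 1 $ i * f i) = f k"
  by (simp add: axis_def if_distrib[where f="\<lambda>x. x * _"] cong: if_cong)

context transient_phases
begin

definition A :: "complex^'m^'m" where "A = - cmat Q"

lemma Sp_A_Re: "\<mu> \<in> Sp A \<Longrightarrow> 0 < Re \<mu>"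
  using Sp_pos_Re by (simp add: A_def)

lemma shifted: "mat (- u) - cmat Q = A - mat u"
  by (simp add: A_def vec_eq_iff mat_def)

lemma invertible_shifted: "u \<notin> Sp A \<Longrightarrow> invertible (A - mat u)"
proof -
  assume "u \<notin> Sp A"
  then have "invertible (mat u - A)" by (simp add: Sp_iff)
  then have "(A - mat u) ** (- matrix_inv (mat u - A)) = mat 1"
    using matrix_inv_mult(1)[of "mat u - A"]
    by (simp add: vec_eq_iff matrix_matrix_mult_def sum_negf[symmetric] algebra_simps)
  then show ?thesis using invertible_right_inverse by blast
qed

text \<open>The transform of the absorption time of the chain started in phase \<open>i\<close>, extended to a rational function.\<close>

definition g :: "'m \<Rightarrow> complex \<Rightarrow> complex" where
  "g i u = ph_transform Q (axis i 1) u"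

lemma g_eq: "g i u = (matrix_inv (A - mat u) *v cvec (exit_rates Q)) $ i"
proof -
  have "(cvec (axis i 1) v* B) $ j = B $ i $ j" for B :: "complex^'m^'m" and j
  proof -
    have "cvec (axis i 1) = (axis i 1 :: complex^'m)" by (simp add: cvec_def vec_eq_iff axis_def)
    then show ?thesis using sum_axis[of i "\<lambda>k. B $ k $ j"] by (simp add: vector_matrix_mult_def mult.commute)
  qed
  then show ?thesis
    unfolding g_def ph_transform_def shifted
    by (simp add: scalar_product_def matrix_vector_mult_def)
qed

lemma ph_transform_eq: "ph_transform Q a u = (\<Sum>i\<in>UNIV. of_real (a $ i) * g i u)"
  unfolding g_eq ph_transform_def shifted
  by (simp add: scalar_product_def matrix_vector_mult_def vector_matrix_mult_def cvec_def
      sum_distrib_left sum_distrib_right mult_ac) (rule sum.swap)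

text \<open>
  The equation \<open>(Q + u) g = - q\<close> for the vector of the transforms, which drives the integration of
  truncated moments.
\<close>

lemma g_equation:
  assumes "u \<notin> Sp A"
  shows "(\<Sum>i\<in>UNIV. of_real (Q $ k $ i) * g i u) + u * g k u = - of_real (exit_rates Q $ k)"
proof -
  let ?q = "cvec (exit_rates Q)"
  have "(A - mat u) *v (matrix_inv (A - mat u) *v ?q) = ?q"
    by (simp add: matrix_vector_mul_assoc matrix_inv_mult[OF invertible_shifted[OF assms]])
  then have "((A - mat u) *v (matrix_inv (A - mat u) *v ?q)) $ k = ?q $ k" by simp
  moreover have "((A - mat u) *v v) $ k = - (\<Sum>i\<in>UNIV. of_real (Q $ k $ i) * v $ i) - u * v $ k" for v
    unfolding matrix_vector_mult_diff_rdistrib mat_mult_vec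
    by (simp add: A_def matrix_vector_mult_def cmat_def sum_negf)
  moreover have "?q $ k = of_real (exit_rates Q $ k)" by (simp add: cvec_def)
  ultimately have "- (\<Sum>i\<in>UNIV. of_real (Q $ k $ i) * g i u) - u * g k u = of_real (exit_rates Q $ k)"
    unfolding g_eq by simp
  from arg_cong[OF this, of uminus] show ?thesis by (simp add: add.commute)
qed

lemma g_holomorphic: "g i holomorphic_on (- Sp A)"
proof -
  have "(\<lambda>u. \<Sum>j\<in>UNIV. - matrix_inv (mat u - A) $ i $ j * of_real (exit_rates Q $ j)) holomorphic_on (- Sp A)"
    by (intro holomorphic_intros resolvent_holomorphic)
  moreover have "(\<Sum>j\<in>UNIV. - matrix_inv (mat u - A) $ i $ j * of_real (exit_rates Q $ j)) = g i u" if "u \<in> - Sp A" for u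
  proof -
    have "invertible (mat u - A)" using that by (simp add: Sp_iff)
    then have "(A - mat u) ** (- matrix_inv (mat u - A)) = mat 1"
      using matrix_inv_mult(1)[of "mat u - A"]
      by (simp add: vec_eq_iff matrix_matrix_mult_def sum_negf[symmetric] algebra_simps)
    then have "matrix_inv (A - mat u) = - matrix_inv (mat u - A)" by (rule matrix_inv_eqI)
    then show ?thesis by (simp add: g_eq matrix_vector_mult_def cvec_def)
  qed
  ultimately show ?thesis by (rule holomorphic_transform) 
qed

end

context ar_process_setup
begin

definition ph :: "complex \<Rightarrow> complex" where "ph u = ph_transform Q \<alpha> u"
definition psi2 :: "complex \<Rightarrow> complex" where "psi2 u = exp_psi2 M T u"

lemma ph_eq: "ph u = (\<Sum>i\<in>UNIV. of_real (\<alpha> $ i) * g i u)"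
  by (simp add: ph_def ph_transform_eq)

lemma ph_holomorphic: "ph holomorphic_on (- Sp A)"
  unfolding ph_eq[abs_def] by (intro holomorphic_intros g_holomorphic)

lemma phase_prob_deriv:
  "((\<lambda>t. phase_prob t i) has_real_derivative (\<Sum>k\<in>UNIV. phase_prob t k * Q $ k $ i)) (at t)"
proof -
  have "((\<lambda>t. phase_prob t i) has_real_derivative (\<Sum>k\<in>UNIV. \<alpha> $ k * (\<Sum>j\<in>UNIV. p t k j * Q $ j $ i))) (at t)"
    unfolding phase_prob_def by (intro DERIV_sum DERIV_cmult p_deriv)
  also have "(\<Sum>k\<in>UNIV. \<alpha> $ k * (\<Sum>j\<in>UNIV. p t k j * Q $ j $ i)) = (\<Sum>k\<in>UNIV. phase_prob t k * Q $ k $ i)"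
    unfolding phase_prob_def sum_distrib_left sum_distrib_right by (subst sum.swap) (simp add: mult.assoc)
  finally show ?thesis .
qed

lemma phase_prob_0: "phase_prob 0 i = \<alpha> $ i"
  unfolding phase_prob_def mat_exp_zero by (simp add: mat_def if_distrib[where f="\<lambda>x. _ * x"] cong: if_cong)

text \<open>
  Truncated exponential moments of an absorption time exist for every exponent. Integrating
  \<open>exp (u s) \<alpha> exp (Q s) q\<close> up to \<open>c\<close> produces the rational transform minus the value that the chain
  would still collect after \<open>c\<close>, whatever the exponent.
\<close>

lemma truncated_transform:
  assumes n: "1 \<le> n" and u: "u \<notin> Sp A" and c: "0 \<le> c"
  shows "(\<integral>w. indicator {..<c} (S n w) *\<^sub>R exp (u * of_real (S n w)) \<partial>M) =
    ph u - exp (u * of_real c) * (\<Sum>i\<in>UNIV. of_real (phase_prob c i) * g i u)"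
proof -
  let ?F = "\<lambda>s. - (exp (u * of_real s) * (\<Sum>i\<in>UNIV. of_real (phase_prob s i) * g i u))"
  let ?f = "\<lambda>s. S_density s *\<^sub>R exp (u * of_real s)"
  \<comment> \<open>by \<open>g_equation\<close>, \<open>?F\<close> is a primitive of \<open>exp (u s)\<close> times the density, whatever the sign of \<open>Re u\<close>\<close>
  have der: "(?F has_vector_derivative ?f s) (at s within X)" for s X
  proof -
    have 1: "((\<lambda>s. of_real (phase_prob s i) :: complex) has_vector_derivative
        of_real (\<Sum>k\<in>UNIV. phase_prob s k * Q $ k $ i)) (at s within X)" for i
      by (rule has_vector_derivative_of_real)
        (use phase_prob_deriv[of i s] in \<open>auto intro: has_field_derivative_at_within\<close>)
    have 2: "((\<lambda>s. exp (u * of_real s)) has_vector_derivative (u * exp (u * of_real s))) (at s within X)"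
      by (auto intro!: derivative_eq_intros has_vector_derivative_real_field)
    have "(?F has_vector_derivative - (exp (u * of_real s) * (\<Sum>i\<in>UNIV. of_real (\<Sum>k\<in>UNIV. phase_prob s k * Q $ k $ i) * g i u) +
        u * exp (u * of_real s) * (\<Sum>i\<in>UNIV. of_real (phase_prob s i) * g i u))) (at s within X)"
      by (intro has_vector_derivative_minus has_vector_derivative_mult 2 has_vector_derivative_sum
          has_vector_derivative_mult_left 1)
    moreover have "- (exp (u * of_real s) * (\<Sum>i\<in>UNIV. of_real (\<Sum>k\<in>UNIV. phase_prob s k * Q $ k $ i) * g i u) +
        u * exp (u * of_real s) * (\<Sum>i\<in>UNIV. of_real (phase_prob s i) * g i u)) = ?f s"
    proof -
      have "(\<Sum>i\<in>UNIV. of_real (\<Sum>k\<in>UNIV. phase_prob s k * Q $ k $ i) * g i u) =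
          (\<Sum>k\<in>UNIV. of_real (phase_prob s k) * (\<Sum>i\<in>UNIV. of_real (Q $ k $ i) * g i u))"
        by (simp add: sum_distrib_left sum_distrib_right mult.assoc) (rule sum.swap)
      also have "\<dots> = (\<Sum>k\<in>UNIV. of_real (phase_prob s k) * (- of_real (exit_rates Q $ k) - u * g k u))"
        using g_equation[OF u] by (intro sum.cong refl arg_cong[where f="\<lambda>z. _ * z"]) (metis add_diff_cancel_right')
      also have "\<dots> = - of_real (S_density s) - u * (\<Sum>i\<in>UNIV. of_real (phase_prob s i) * g i u)"
        by (simp add: S_density_def right_diff_distrib sum_subtractf sum_negf sum_distrib_left mult_ac)
      finally have W: "(\<Sum>i\<in>UNIV. of_real (\<Sum>k\<in>UNIV. phase_prob s k * Q $ k $ i) * g i u) =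
          - of_real (S_density s) - u * (\<Sum>i\<in>UNIV. of_real (phase_prob s i) * g i u)" .
      show ?thesis unfolding W by (simp add: algebra_simps scaleR_conv_of_real)
    qed
    ultimately show ?thesis by simp
  qed
  have cont: "continuous_on {0..c} ?f"
    by (intro continuous_intros continuous_at_imp_continuous_on ballI S_density_continuous)
  have FTC: "(\<integral>s. indicator {0..c} s *\<^sub>R ?f s \<partial>lborel) = ?F c - ?F 0"
    using c cont by (intro integral_FTC_Icc der) auto
  let ?h = "\<lambda>s. indicator {..<c} s *\<^sub>R exp (u * of_real s) :: complex"
  have hm: "?h \<in> borel_measurable borel" by measurable
  have "(\<integral>w. ?h (S n w) \<partial>M) = (\<integral>s. ?h s \<partial>distr M borel (S n))"
    by (rule integral_distr[symmetric, OF S_measurable[OF n] hm])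
  also have "distr M borel (S n) = density lborel (\<lambda>s. ennreal (S_density s * indicator {0..} s))"
    unfolding S_distr[OF n] by (rule density_cong) (auto simp: indicator_def)
  also have "(\<integral>s. ?h s \<partial>density lborel (\<lambda>s. ennreal (S_density s * indicator {0..} s))) =
      (\<integral>s. (S_density s * indicator {0..} s) *\<^sub>R ?h s \<partial>lborel)"
    using hm S_density_nonneg by (intro integral_density AE_I2) (auto simp: indicator_def)
  also have "\<dots> = (\<integral>s. indicator {0..c} s *\<^sub>R ?f s \<partial>lborel)"
  proof (rule integral_cong_AE)
    show "AE s in lborel. (S_density s * indicator {0..} s) *\<^sub>R ?h s = indicator {0..c} s *\<^sub>R ?f s"
      using AE_lborel_singleton[of c] by eventually_elim (auto simp: indicator_def)
  qed (use hm in measurable)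
  also have "\<dots> = ?F c - ?F 0" by (rule FTC)
  also have "\<dots> = ph u - exp (u * of_real c) * (\<Sum>i\<in>UNIV. of_real (phase_prob c i) * g i u)"
    by (simp add: phase_prob_0 ph_eq)
  finally show ?thesis .
qed

lemma psi2_eq: "psi2 u = exp_moment M (space M) (\<lambda>w. - T 1 w) 0 u"
  unfolding psi2_def exp_psi2_def exp_moment_def
  by (rule Bochner_Integration.integral_cong) auto

lemma T_nonpos: "AE w in M. w \<in> space M \<longrightarrow> - T 1 w \<le> 0"
  using T_nonneg[of 1] by auto

lemma psi2_holomorphic: "psi2 holomorphic_on {u. 0 < Re u}"
  unfolding psi2_eq[abs_def] by (rule exp_moment_holomorphic[OF _ _ T_nonpos]) (use T_measurable[of 1] in auto)

lemma psi2_integrable: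
  assumes "0 \<le> Re u"
  shows "integrable M (\<lambda>w. exp (- u * complex_of_real (T 1 w)))"
proof (rule integrable_const_bound[of _ 1])
  show "AE w in M. norm (exp (- u * complex_of_real (T 1 w))) \<le> 1"
    using T_nonneg[of 1, OF order_refl] by eventually_elim (use assms in \<open>simp\<close>)
qed (use T_measurable[of 1] in measurable)

lemma psi2_bounded:
  assumes "0 \<le> Re u"
  shows "cmod (psi2 u) \<le> 1"
proof -
  have "cmod (psi2 u) \<le> (\<integral>w. norm (exp (- u * complex_of_real (T 1 w))) \<partial>M)"
    unfolding psi2_def exp_psi2_def by (rule integral_norm_bound)
  also have "\<dots> \<le> (\<integral>w. 1 \<partial>M)"
  proof (rule integral_mono_AE)
    show "AE w in M. norm (exp (- u * complex_of_real (T 1 w))) \<le> 1"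
      using T_nonneg[of 1, OF order_refl] by eventually_elim (use assms in \<open>simp\<close>)
    show "integrable M (\<lambda>w. norm (exp (- u * complex_of_real (T 1 w))))"
      by (rule integrable_norm[OF psi2_integrable[OF assms]])
  qed simp
  finally show ?thesis by (simp add: prob_space)
qed

end

context ar_crossing
begin

text \<open>\<open>cross y i\<close> is the probability that one step from \<open>y < b\<close> leads above \<open>b\<close>, crossing in phase \<open>i\<close>.\<close>

definition cross :: "real \<Rightarrow> 'm \<Rightarrow> real" where
  "cross y i = (\<integral>w. phase_prob (max 0 (b - l * y + T 1 w)) i \<partial>M)"

lemma expectation_T:
  fixes f :: "real \<Rightarrow> 'c::{banach,second_countable_topology}"
  assumes "1 \<le> k" "f \<in> borel_measurable borel"
  shows "(\<integral>w. f (T k w) \<partial>M) = (\<integral>w. f (T 1 w) \<partial>M)"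
proof -
  have "(\<integral>w. f (T k w) \<partial>M) = (\<integral>t. f t \<partial>distr M borel (T k))"
    using assms T_measurable by (intro integral_distr[symmetric]) auto
  also have "\<dots> = (\<integral>w. f (T 1 w) \<partial>M)"
    unfolding T_identical[OF assms(1)] using assms T_measurable by (intro integral_distr) auto
  finally show ?thesis .
qed

lemma cross_integrand_measurable:
  "(\<lambda>p. indicator {..<b} (fst p) * phase_prob (max 0 (b - l * fst p + snd p)) i) \<in> borel_measurable (borel \<Otimes>\<^sub>M borel)"
proof -
  have "(\<lambda>p :: real \<times> real. max 0 (b - l * fst p + snd p)) \<in> borel_measurable (borel \<Otimes>\<^sub>M borel)" by measurable
  from measurable_compose[OF this phase_prob_measurable[of i]] show ?thesis
    by (intro borel_measurable_times borel_measurable_indicator') auto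
qed

lemma indicator_killed: "(indicator {..<b} (killed k w) :: real) = indicator (alive k) w"
  using killed_less[of k w] by (simp add: indicator_def)

lemma killed_alive: "w \<in> alive k \<Longrightarrow> killed k w = X k w"
  by (simp add: killed_def)

lemma cross_measurable: "(\<lambda>y. indicator {..<b} y * cross y i) \<in> borel_measurable borel"
  and hit_prob_cross: "1 \<le> k \<Longrightarrow> hit_prob k i = (\<integral>w. indicator (alive (k - 1)) w * cross (X (k - 1) w) i \<partial>M)"
proof -
  have bnd: "norm (indicator {..<b} (fst p) * phase_prob (max 0 (b - l * fst p + snd p)) i) \<le> 1" for p
    using phase_prob_bounds by (simp add: indicator_def)
  have main: "(\<integral>w. indicator {..<b} (killed (k - 1) w) * phase_prob (max 0 (b - l * killed (k - 1) w + T k w)) i \<partial>M) =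
      (\<integral>w. (\<integral>w'. indicator {..<b} (killed (k - 1) w) * phase_prob (max 0 (b - l * killed (k - 1) w + T k w')) i \<partial>M) \<partial>M)"
    "(\<lambda>y. \<integral>w'. indicator {..<b} y * phase_prob (max 0 (b - l * y + T k w')) i \<partial>M) \<in> borel_measurable borel"
    if k: "1 \<le> k" for k
  proof -
    have "indep_var borel (killed (k - 1)) borel (T k)"
      by (rule info_indep_var[OF _ _ _ killed_measurable_info T_measurable_info]) (use k in auto)
    note * = indep_var_expectation[OF this cross_integrand_measurable bnd, unfolded fst_conv snd_conv]
    show "(\<integral>w. indicator {..<b} (killed (k - 1) w) * phase_prob (max 0 (b - l * killed (k - 1) w + T k w)) i \<partial>M) =
      (\<integral>w. (\<integral>w'. indicator {..<b} (killed (k - 1) w) * phase_prob (max 0 (b - l * killed (k - 1) w + T k w')) i \<partial>M) \<partial>M)"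
      "(\<lambda>y. \<integral>w'. indicator {..<b} y * phase_prob (max 0 (b - l * y + T k w')) i \<partial>M) \<in> borel_measurable borel"
      by (rule *)+
  qed
  show "(\<lambda>y. indicator {..<b} y * cross y i) \<in> borel_measurable borel"
    using main(2)[of 1] by (simp add: cross_def)
  assume k: "1 \<le> k"
  have "hit_prob k i = (\<integral>w. indicator {..<b} (killed (k - 1) w) * phase_prob (max 0 (b - l * killed (k - 1) w + T k w)) i \<partial>M)"
    unfolding hit_prob_eq[OF k] indicator_killed
    by (rule Bochner_Integration.integral_cong) (auto simp: indicator_def killed_alive gap_def)
  also have "\<dots> = (\<integral>w. indicator (alive (k - 1)) w * cross (X (k - 1) w) i \<partial>M)"
    unfolding main(1)[OF k]
  proof (rule Bochner_Integration.integral_cong[OF refl])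
    fix w
    have "(\<lambda>t. phase_prob (max 0 (b - l * y + t)) i) \<in> borel_measurable borel" for y
      by (rule measurable_compose[OF _ phase_prob_measurable[of i]]) measurable
    from expectation_T[OF k this]
    show "(\<integral>w'. indicator {..<b} (killed (k - 1) w) * phase_prob (max 0 (b - l * killed (k - 1) w + T k w')) i \<partial>M) =
       indicator (alive (k - 1)) w * cross (X (k - 1) w) i"
      unfolding indicator_killed cross_def by (cases "w \<in> alive (k - 1)") (simp_all add: killed_alive)
  qed
  finally show "hit_prob k i = (\<integral>w. indicator (alive (k - 1)) w * cross (X (k - 1) w) i \<partial>M)" .
qed

text \<open>
  A step is modelled by the first innovation; all innovations have the same law.
\<close>

definition step :: "real \<Rightarrow> 'w \<Rightarrow> real" where "step y w = l * y + (S 1 w - T 1 w)"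
definition stay :: "real \<Rightarrow> 'w set" where "stay y = {w\<in>space M. step y w < b}"

lemma step_measurable: "step y \<in> borel_measurable M"
  unfolding step_def using S_measurable[of 1] T_measurable[of 1] by measurable

lemma stay_events: "stay y \<in> events"
proof -
  have "step y -` {..<b} \<inter> space M \<in> events" using measurable_sets[OF step_measurable] by simp
  also have "step y -` {..<b} \<inter> space M = stay y" by (auto simp: stay_def)
  finally show ?thesis .
qed

lemma stay_bound: "AE w in M. w \<in> stay y \<longrightarrow> step y w \<le> b"
  by (rule AE_I2) (simp add: stay_def)

text \<open>
  Given \<open>T\<close>, the step stays below \<open>b\<close> exactly if \<open>S < c\<close> with \<open>c = b - l y + T\<close>; the truncated transform at
  \<open>c\<close> splits off the crossing part, in which the factor \<open>exp (u (l y - T)) exp (u c)\<close> is \<open>exp (u b)\<close>.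
\<close>

lemma one_step_transform:
  assumes y: "y < b" and u: "0 < Re u" "u \<notin> Sp A"
  shows "exp_moment M (stay y) (step y) 0 u =
    exp (u * of_real (l * y)) * (ph u * psi2 u) - exp (u * of_real b) * (\<Sum>i\<in>UNIV. of_real (cross y i) * g i u)"
proof -
  let ?h = "\<lambda>p. indicator {p. l * y + (snd p - fst p) < b} p *\<^sub>R exp (u * of_real (l * y + (snd p - fst p))) :: complex"
  have hm: "?h \<in> borel_measurable (borel \<Otimes>\<^sub>M borel)" by measurable
  have hb: "norm (?h p) \<le> exp (Re u * b)" for p
    using u(1) by (auto simp: indicator_def intro!: mult_left_mono)
  have ind: "indep_var borel (T 1) borel (S 1)"
    by (rule info_indep_var[OF _ _ _ T_measurable_info S_measurable_info]) auto
  note * = indep_var_expectation(1)[OF ind hm hb, unfolded fst_conv snd_conv]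
  have "exp_moment M (stay y) (step y) 0 u = (\<integral>w. ?h (T 1 w, S 1 w) \<partial>M)"
    unfolding exp_moment_def by (rule Bochner_Integration.integral_cong) (auto simp: stay_def step_def indicator_def)
  also have "\<dots> = (\<integral>w. (\<integral>w'. ?h (T 1 w, S 1 w') \<partial>M) \<partial>M)" using * by simp
  also have "\<dots> = (\<integral>w. exp (u * of_real (l * y)) * ph u * exp (- u * of_real (T 1 w)) -
      exp (u * of_real b) * (\<Sum>i\<in>UNIV. of_real (phase_prob (max 0 (b - l * y + T 1 w)) i) * g i u) \<partial>M)" (is "_ = (\<integral>w. ?r w \<partial>M)")
  proof (rule integral_cong_AE)
    show "(\<lambda>w. \<integral>w'. ?h (T 1 w, S 1 w') \<partial>M) \<in> borel_measurable M"
      using measurable_compose[OF T_measurable[of 1, OF order_refl] indep_var_expectation(2)[OF ind hm hb]] by simp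
    have "(\<lambda>w. phase_prob (max 0 (b - l * y + T 1 w)) i) \<in> borel_measurable M" for i
      by (rule measurable_compose[OF _ phase_prob_measurable[of i]]) (use T_measurable[of 1] in measurable)
    moreover have "(\<lambda>w. exp (- u * complex_of_real (T 1 w))) \<in> borel_measurable M"
      using psi2_integrable[of u] u(1) by (intro borel_measurable_integrable) simp
    ultimately show "?r \<in> borel_measurable M"
      by (intro borel_measurable_diff borel_measurable_times borel_measurable_const borel_measurable_sum
          measurable_compose[OF _ borel_measurable_of_real])
    show "AE w in M. (\<integral>w'. ?h (T 1 w, S 1 w') \<partial>M) = ?r w"
      using T_nonneg[of 1, OF order_refl]
    proof eventually_elim
      case (elim w)
      let ?c = "b - l * y + T 1 w"
      have c: "0 \<le> ?c" using scale_below[OF y] elim by simp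
      have "(\<integral>w'. ?h (T 1 w, S 1 w') \<partial>M) =
          (\<integral>w'. exp (u * of_real (l * y - T 1 w)) * (indicator {..<?c} (S 1 w') *\<^sub>R exp (u * of_real (S 1 w'))) \<partial>M)"
      proof (rule Bochner_Integration.integral_cong[OF refl])
        fix w'
        have "exp (u * complex_of_real (l * y + (S 1 w' - T 1 w))) =
            exp (u * of_real (l * y - T 1 w)) * exp (u * of_real (S 1 w'))"
          unfolding exp_add[symmetric] distrib_left[symmetric] of_real_add[symmetric]
          by (rule arg_cong[where f="\<lambda>r. exp (u * of_real r)"]) simp
        moreover have "l * y + (S 1 w' - T 1 w) < b \<longleftrightarrow> S 1 w' < ?c" by linarith
        ultimately show "?h (T 1 w, S 1 w') =
            exp (u * of_real (l * y - T 1 w)) * (indicator {..<?c} (S 1 w') *\<^sub>R exp (u * of_real (S 1 w')))"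
          unfolding indicator_def fst_conv snd_conv mem_Collect_eq lessThan_iff by simp
      qed
      also have "\<dots> = exp (u * of_real (l * y - T 1 w)) *
          (ph u - exp (u * of_real ?c) * (\<Sum>i\<in>UNIV. of_real (phase_prob ?c i) * g i u))"
        by (simp only: integral_mult_right_zero truncated_transform[OF order_refl u(2) c])
      also have "\<dots> = exp (u * of_real (l * y - T 1 w)) * ph u -
          (exp (u * of_real (l * y - T 1 w)) * exp (u * of_real ?c)) * (\<Sum>i\<in>UNIV. of_real (phase_prob ?c i) * g i u)"
        by (simp add: right_diff_distrib mult.assoc)
      also have "exp (u * of_real (l * y - T 1 w)) * exp (u * of_real ?c) = exp (u * of_real b)"
        unfolding exp_add[symmetric] distrib_left[symmetric] of_real_add[symmetric] by simp
      also have "exp (u * of_real (l * y - T 1 w)) = exp (u * of_real (l * y)) * exp (- u * of_real (T 1 w))"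
        unfolding exp_add[symmetric] by (simp add: algebra_simps)
      finally show ?case using c by (simp add: mult_ac max_def)
    qed
  qed
  also have "\<dots> = exp (u * of_real (l * y)) * ph u * psi2 u -
      exp (u * of_real b) * (\<Sum>i\<in>UNIV. of_real (cross y i) * g i u)"
  proof -
    have pm: "(\<lambda>w. phase_prob (max 0 (b - l * y + T 1 w)) i) \<in> borel_measurable M" for i
      by (rule measurable_compose[OF _ phase_prob_measurable[of i]]) (use T_measurable[of 1] in measurable)
    have pi: "integrable M (\<lambda>w. phase_prob (max 0 (b - l * y + T 1 w)) i)" for i
      by (rule integrable_const_bound[of _ 1]) (use phase_prob_bounds pm in auto)
    have pc: "integrable M (\<lambda>w. complex_of_real (phase_prob (max 0 (b - l * y + T 1 w)) i) * g i u)" for i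
      by (intro integrable_mult_left integrable_of_real pi)
    have "(\<integral>w. complex_of_real (phase_prob (max 0 (b - l * y + T 1 w)) i) * g i u \<partial>M) = of_real (cross y i) * g i u" for i
      by (simp add: cross_def)
    then have I2: "(\<integral>w. exp (u * of_real b) * (\<Sum>i\<in>UNIV. of_real (phase_prob (max 0 (b - l * y + T 1 w)) i) * g i u) \<partial>M) =
        exp (u * of_real b) * (\<Sum>i\<in>UNIV. of_real (cross y i) * g i u)"
      by (simp only: integral_mult_right_zero Bochner_Integration.integral_sum[OF pc])
    have "0 \<le> Re u" using u by simp
    have I1: "(\<integral>w. exp (u * of_real (l * y)) * ph u * exp (- u * of_real (T 1 w)) \<partial>M) = exp (u * of_real (l * y)) * ph u * psi2 u"
      by (simp only: integral_mult_right_zero psi2_def exp_psi2_def)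
    show ?thesis
      by (subst Bochner_Integration.integral_diff)
        (simp_all only: I1 I2 integrable_mult_right[OF psi2_integrable[OF \<open>0 \<le> Re u\<close>]]
          integrable_mult_right[OF Bochner_Integration.integrable_sum[OF pc]])
  qed
  finally show ?thesis by (simp add: mult.assoc)
qed

end

section \<open>The infinite product\<close>

text \<open>
  The terms \<open>min 1 (l\<^sup>k s)\<close> are dominated by increments of \<open>ln (1 + l\<^sup>k s)\<close> in \<open>k\<close>, so that their sum
  telescopes. This is where a logarithmic moment is exactly what convergence of the product asks for.
\<close>

lemma sum_min_le_ln:
  fixes l s :: real
  assumes l: "0 < l" "l < 1" and s: "0 \<le> s"
  shows "(\<Sum>k<n. min 1 (l ^ k * s)) \<le> 2 / (1 - l) * ln (1 + s)"
proof -
  have step: "min 1 x \<le> 2 / (1 - l) * (ln (1 + x) - ln (1 + l * x))" if x: "0 \<le> x" for x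
  proof -
    have pos: "0 < 1 + x" "0 < 1 + l * x" using x l by (auto intro: add_pos_nonneg)
    have "ln ((1 + l * x) / (1 + x)) \<le> (1 + l * x) / (1 + x) - 1"
      using pos by (intro ln_le_minus_one) simp
    then have "1 - (1 + l * x) / (1 + x) \<le> ln (1 + x) - ln (1 + l * x)"
      using pos by (simp add: ln_div)
    moreover have "1 - (1 + l * x) / (1 + x) = (1 - l) * (x / (1 + x))"
      using pos by (simp add: field_simps)
    ultimately have *: "(1 - l) * (x / (1 + x)) \<le> ln (1 + x) - ln (1 + l * x)" by simp
    have "min 1 x \<le> 2 * (x / (1 + x))"
    proof (cases "x \<le> 1")
      case True
      then have "x * (1 + x) \<le> x * 2" using x by (intro mult_left_mono) auto
      then show ?thesis using True pos by (simp add: field_simps)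
    next
      case False
      then show ?thesis using pos by (simp add: field_simps)
    qed
    also have "\<dots> = 2 / (1 - l) * ((1 - l) * (x / (1 + x)))" using l by simp
    also have "\<dots> \<le> 2 / (1 - l) * (ln (1 + x) - ln (1 + l * x))"
      using l by (intro mult_left_mono *) auto
    finally show ?thesis .
  qed
  have "(\<Sum>k<n. min 1 (l ^ k * s)) \<le> (\<Sum>k<n. 2 / (1 - l) * (ln (1 + l ^ k * s) - ln (1 + l ^ Suc k * s)))"
    using step[of "l ^ _ * s"] l s by (intro sum_mono) (simp add: mult.assoc)
  also have "\<dots> = 2 / (1 - l) * (ln (1 + s) - ln (1 + l ^ n * s))"
    unfolding sum_distrib_left[symmetric] by (subst sum_lessThan_telescope') simp
  also have "\<dots> \<le> 2 / (1 - l) * ln (1 + s)"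
    using l s by (intro mult_left_mono) auto
  finally show ?thesis .
qed

text \<open>
  Linear for small arguments and bounded for large ones, to fit \<open>sum_min_le_ln\<close>.
\<close>

lemma norm_exp_minus_one_le:
  fixes z :: complex
  assumes "0 \<le> Re z"
  shows "cmod (exp (- z) - 1) \<le> 3 * min 1 (cmod z)"
proof (cases "cmod z \<le> 1")
  case True
  have "cmod (exp (- z) - (\<Sum>k\<le>0. (- z) ^ k / fact k)) \<le> exp \<bar>Re (- z)\<bar> * cmod (- z) ^ Suc 0 / fact 0"
    by (rule Taylor_exp)
  then have "cmod (exp (- z) - 1) \<le> exp \<bar>Re z\<bar> * cmod z" by simp
  also have "\<dots> \<le> 3 * cmod z"
  proof (intro mult_right_mono)
    have "exp \<bar>Re z\<bar> \<le> exp 1" using True abs_Re_le_cmod[of z] by simp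
    then show "exp \<bar>Re z\<bar> \<le> 3" using exp_le by (rule order_trans)
  qed simp
  finally show ?thesis using True by (simp add: min_def)
next
  case False
  have "cmod (exp (- z) - 1) \<le> cmod (exp (- z)) + 1" by (metis norm_one norm_triangle_ineq4)
  also have "\<dots> \<le> 2" using assms by simp
  finally show ?thesis using False by (simp add: min_def)
qed

lemma sequence_lower_bound:
  fixes f :: "nat \<Rightarrow> real"
  assumes "f \<longlonglongrightarrow> L" "0 < L" "\<And>k. 1 \<le> k \<Longrightarrow> 0 < f k"
  shows "\<exists>e>0. \<forall>k\<ge>1. e \<le> f k"
proof -
  have "\<forall>\<^sub>F k in sequentially. L / 2 < f k" using assms(1,2) by (intro order_tendstoD) auto
  then obtain N where N: "\<And>k. k \<ge> N \<Longrightarrow> L / 2 < f k" by (auto simp: eventually_sequentially)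
  define e where "e = Min (insert (L / 2) (f ` {1..N}))"
  have "0 < e" unfolding e_def using assms by (subst Min_gr_iff) auto
  moreover have "e \<le> f k" if "1 \<le> k" for k
  proof (cases "k \<le> N")
    case True
    then show ?thesis unfolding e_def using that by (intro Min_le) auto
  next
    case False
    have "e \<le> L / 2" unfolding e_def by (intro Min_le) auto
    then show ?thesis using N[of k] False by simp
  qed
  ultimately show ?thesis by blast
qed

lemma finite_uniform_lower_bound:
  fixes f :: "'x \<Rightarrow> 'y \<Rightarrow> real"
  assumes "finite X" "\<And>x. x \<in> X \<Longrightarrow> \<exists>e>0. \<forall>y\<in>Y. e \<le> f x y"
  shows "\<exists>e>0. \<forall>x\<in>X. \<forall>y\<in>Y. e \<le> f x y"
  using assms
proof (induction X)
  case empty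
  then show ?case by (intro exI[of _ 1]) simp
next
  case (insert a X)
  then obtain e1 e2 where e: "e1 > 0" "\<forall>y\<in>Y. e1 \<le> f a y" "e2 > 0" "\<forall>x\<in>X. \<forall>y\<in>Y. e2 \<le> f x y"
    by (metis insertI1 insertI2)
  then show ?case by (intro exI[of _ "min e1 e2"]) (auto simp: min_le_iff_disj)
qed

lemma prod_limit_lessThan:
  fixes f :: "nat \<Rightarrow> complex"
  assumes "summable (\<lambda>k. cmod (f k - 1))"
  shows "(\<lambda>n. \<Prod>k<n. f k) \<longlonglongrightarrow> prodinf f"
proof -
  have "convergent_prod f"
    using assms by (intro abs_convergent_prod_imp_convergent_prod summable_imp_abs_convergent_prod)
  then have "(\<lambda>n. \<Prod>k\<le>n. f k) \<longlonglongrightarrow> prodinf f" by (rule convergent_prod_LIMSEQ)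
  then show ?thesis by (simp only: LIMSEQ_lessThan_iff_atMost)
qed

lemma prod_bounded:
  fixes f :: "nat \<Rightarrow> complex"
  assumes "\<And>k. cmod (f k - 1) \<le> M k" "summable M"
  shows "cmod (\<Prod>k<n. f k) \<le> exp (suminf M)"
proof -
  have M0: "0 \<le> M k" for k using assms(1)[of k] norm_ge_zero order_trans by blast
  have "cmod (\<Prod>k<n. f k) = (\<Prod>k<n. cmod (f k))" by (simp add: prod_norm)
  also have "\<dots> \<le> (\<Prod>k<n. 1 + M k)"
  proof (intro prod_mono conjI norm_ge_zero)
    fix k
    have "cmod (f k) \<le> 1 + cmod (f k - 1)" by (metis norm_one norm_triangle_sub add.commute)
    then show "cmod (f k) \<le> 1 + M k" using assms(1)[of k] by simp
  qed
  also have "\<dots> \<le> exp (\<Sum>k<n. M k)" using M0 by (intro prod_le_exp_sum) auto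
  also have "\<dots> \<le> exp (suminf M)" using M0 assms(2) by (simp add: sum_le_suminf)
  finally show ?thesis .
qed

text \<open>
  The Weierstrass test for the telescoping series of the differences of consecutive partial products.
\<close>

lemma uniform_limit_prod_lessThan:
  fixes f :: "nat \<Rightarrow> complex \<Rightarrow> complex"
  assumes bound: "\<And>k u. u \<in> D \<Longrightarrow> cmod (f k u - 1) \<le> M k" and M: "summable M"
  shows "uniform_limit D (\<lambda>n u. \<Prod>k<n. f k u) (\<lambda>u. prodinf (\<lambda>k. f k u)) sequentially"
proof -
  let ?P = "\<lambda>n u. \<Prod>k<n. f k u"
  have P: "cmod (?P n u) \<le> exp (suminf M)" if "u \<in> D" for n u
    using prod_bounded[of "\<lambda>k. f k u", OF bound[OF that] M] .
  have "uniform_limit D (\<lambda>n u. \<Sum>k<n. ?P (Suc k) u - ?P k u) (\<lambda>u. \<Sum>k. ?P (Suc k) u - ?P k u) sequentially"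
  proof (rule Weierstrass_m_test)
    show "cmod (?P (Suc k) u - ?P k u) \<le> exp (suminf M) * M k" if "u \<in> D" for k u
    proof -
      have "?P (Suc k) u - ?P k u = ?P k u * (f k u - 1)" by (simp add: algebra_simps)
      then show ?thesis using P[OF that] bound[OF that] by (simp add: norm_mult mult_mono)
    qed
    show "summable (\<lambda>k. exp (suminf M) * M k)" using M by (rule summable_mult)
  qed
  then have ul: "uniform_limit D (\<lambda>n u. 1 + (\<Sum>k<n. ?P (Suc k) u - ?P k u)) (\<lambda>u. 1 + (\<Sum>k. ?P (Suc k) u - ?P k u)) sequentially"
    by (intro uniform_limit_add uniform_limit_const)
  have tel: "1 + (\<Sum>k<n. ?P (Suc k) u - ?P k u) = ?P n u" for n u
    by (subst sum_lessThan_telescope) simp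
  have lim: "1 + (\<Sum>k. ?P (Suc k) u - ?P k u) = prodinf (\<lambda>k. f k u)" if "u \<in> D" for u
  proof (rule LIMSEQ_unique)
    show "(\<lambda>n. ?P n u) \<longlonglongrightarrow> 1 + (\<Sum>k. ?P (Suc k) u - ?P k u)"
      using tendsto_uniform_limitI[OF ul that] unfolding tel .
    have "summable (\<lambda>k. cmod (f k u - 1))"
      using bound[OF that] by (intro summable_comparison_test'[OF M, of 0]) auto
    then show "(\<lambda>n. ?P n u) \<longlonglongrightarrow> prodinf (\<lambda>k. f k u)" by (rule prod_limit_lessThan)
  qed
  show ?thesis
    using ul by (rule uniform_limit_cong'[THEN iffD1, rotated -1]) (simp_all only: tel lim)
qed

locale ar_spectral = ar_crossing M Q J T \<alpha> l b x \<rho>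
  for M :: "'w measure" and Q :: "real^'m::finite^'m"
    and J :: "nat \<Rightarrow> real \<Rightarrow> 'w \<Rightarrow> 'm option" and T :: "nat \<Rightarrow> 'w \<Rightarrow> real" and \<alpha> :: "real^'m"
    and l b x \<rho> :: real +
  assumes log_moment: "integrable M (\<lambda>w. ln (1 + \<bar>absorption_time (J 1) w - T 1 w\<bar>))"
    and spectra: "\<And>n. n \<ge> 1 \<Longrightarrow> Sp (l ^ n *\<^sub>R cmat Q) \<inter> Sp (cmat Q) = {}"
    and exp_phi_nonzero: "\<And>n u. n \<ge> 1 \<Longrightarrow> u \<in> Sp (- (l ^ n *\<^sub>R cmat Q)) \<Longrightarrow> exp_phi M l Q \<alpha> T u \<noteq> 0"
begin

definition \<phi> :: "complex \<Rightarrow> complex" where "\<phi> u = exp_phi M l Q \<alpha> T u"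
definition fac :: "nat \<Rightarrow> complex \<Rightarrow> complex" where
  "fac k u = ph (of_real (l ^ k) * u) * psi2 (of_real (l ^ k) * u)"

lemma \<phi>_eq: "\<phi> u = prodinf (\<lambda>k. fac k u)"
  by (simp add: \<phi>_def exp_phi_def fac_def ph_def psi2_def)

lemma fac_shift: "fac k (of_real (l ^ n) * u) = fac (k + n) u"
  by (simp add: fac_def power_add mult.assoc)

lemma Sp_A_iff: "z \<in> Sp A \<longleftrightarrow> - z \<in> Sp (cmat Q)"
  using Sp_scale[of "-1" z "cmat Q"] by (simp add: A_def)

lemma scaled_eigenvalues_differ:
  assumes "1 \<le> k" "\<mu> \<in> Sp A" "\<nu> \<in> Sp A"
  shows "of_real (l ^ k) * \<mu> \<noteq> \<nu>"
proof
  assume eq: "of_real (l ^ k) * \<mu> = \<nu>"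
  have lk: "l ^ k \<noteq> 0" using l by simp
  have "- \<nu> / of_real (l ^ k) = - \<mu>" using eq lk by auto
  then have "- \<nu> \<in> Sp (l ^ k *\<^sub>R cmat Q)"
    using assms(2) Sp_A_iff Sp_scale[OF lk, of "- \<nu>" "cmat Q"] by simp
  moreover have "- \<nu> \<in> Sp (cmat Q)" using assms(3) Sp_A_iff by simp
  ultimately show False using spectra[OF assms(1)] by blast
qed

text \<open>
  For each pair of eigenvalues the distances are positive by the spectral hypothesis and tend to \<open>\<bar>\<nu>\<bar> > 0\<close>.
\<close>

lemma eigenvalue_separation:
  obtains e where "0 < e" "\<And>\<mu> \<nu> k. \<mu> \<in> Sp A \<Longrightarrow> \<nu> \<in> Sp A \<Longrightarrow> 1 \<le> k \<Longrightarrow> e \<le> cmod (of_real (l ^ k) * \<mu> - \<nu>)"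
proof -
  have "\<exists>e>0. \<forall>p\<in>Sp A \<times> Sp A. \<forall>k\<in>{1..}. e \<le> cmod (of_real (l ^ k) * fst p - snd p)"
  proof (rule finite_uniform_lower_bound)
    show "finite (Sp A \<times> Sp A)" by (simp add: finite_Sp)
    fix p assume p: "p \<in> Sp A \<times> Sp A"
    have "(\<lambda>k. l ^ k) \<longlonglongrightarrow> 0" by (rule LIMSEQ_power_zero) (use l in simp)
    then have "(\<lambda>k. cmod (of_real (l ^ k) * fst p - snd p)) \<longlonglongrightarrow> cmod (of_real 0 * fst p - snd p)"
      by (intro tendsto_norm tendsto_diff tendsto_mult tendsto_of_real tendsto_const)
    moreover have "0 < cmod (of_real 0 * fst p - snd p)"
      using p Sp_A_Re[of "snd p"] by auto
    ultimately have "\<exists>e>0. \<forall>k\<ge>1. e \<le> cmod (of_real (l ^ k) * fst p - snd p)"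
      using p scaled_eigenvalues_differ by (intro sequence_lower_bound) auto
    then show "\<exists>e>0. \<forall>k\<in>{1..}. e \<le> cmod (of_real (l ^ k) * fst p - snd p)" by auto
  qed
  then show ?thesis using that by force
qed

lemma g_0: "g i 0 = 1"
proof -
  have "0 \<notin> Sp A" using Sp_A_Re by force
  then have inv: "invertible (A - mat 0)" by (rule invertible_shifted)
  have "(A - mat 0) *v (\<chi> i. 1) = cvec (exit_rates Q)"
    by (simp add: vec_eq_iff A_def cmat_def cvec_def exit_rates_def matrix_vector_mult_def mat_def sum_negf)
  then have "matrix_inv (A - mat 0) *v cvec (exit_rates Q) = (\<chi> i. 1)"
    by (metis matrix_inv_mult(2)[OF inv] matrix_vector_mul_assoc matrix_vector_mul_lid)
  then show ?thesis unfolding g_eq by simp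
qed

lemma ph_0: "ph 0 = 1"
proof -
  have "ph 0 = of_real (\<Sum>i\<in>UNIV. \<alpha> $ i)" by (simp add: ph_eq g_0)
  then show ?thesis by (simp add: \<alpha>_sum)
qed

text \<open>
  The logarithmic moment is assumed for \<open>S - T\<close>, but it is needed for \<open>T\<close>. On the event \<open>S \<le> c\<close>, which has
  positive probability \<open>p0\<close> for large \<open>c\<close> and is independent of \<open>T\<close>, the two differ by a bounded amount.
\<close>

lemma truncated_T_summable:
  assumes R: "0 \<le> R"
  shows "summable (\<lambda>k. \<integral>w. min 1 (l ^ k * (R * \<bar>T 1 w\<bar>)) \<partial>M)"
proof -
  let ?m = "\<lambda>k t. min 1 (l ^ k * (R * \<bar>t\<bar>))"
  have m: "0 \<le> ?m k t" "?m k t \<le> 1" for k t using R l by auto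
  have T1: "T 1 \<in> borel_measurable M" and S1: "S 1 \<in> borel_measurable M"
    using T_measurable[of 1] S_measurable[of 1] by auto
  have mint: "integrable M (\<lambda>w. ?m k (T 1 w))" for k
    by (rule integrable_const_bound[of _ 1]) (use m T1 in auto)
  have "((\<lambda>t. \<Sum>i\<in>UNIV. \<alpha> $ i * surv t i) \<longlongrightarrow> (\<Sum>i\<in>UNIV. \<alpha> $ i * 0)) at_top"
    by (intro tendsto_intros surv_vanishes)
  then have "\<forall>\<^sub>F t in at_top. (\<Sum>i\<in>UNIV. \<alpha> $ i * surv t i) < 1"
    by (intro order_tendstoD) auto
  then have "\<forall>\<^sub>F t in at_top. 0 \<le> t \<and> (\<Sum>i\<in>UNIV. \<alpha> $ i * surv t i) < 1"
    using eventually_ge_at_top[of 0] by eventually_elim simp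
  then obtain c where c: "0 \<le> c" "(\<Sum>i\<in>UNIV. \<alpha> $ i * surv c i) < 1"
    by (metis (no_types, lifting) eventually_happens' trivial_limit_at_top_linorder)
  define p0 where "p0 = (\<integral>w. indicator {..c} (S 1 w) \<partial>M :: real)"
  have "p0 = prob {w\<in>space M. S 1 w \<le> c}"
  proof -
    have "p0 = (\<integral>w. indicator {w\<in>space M. S 1 w \<le> c} w \<partial>M)"
      unfolding p0_def by (rule Bochner_Integration.integral_cong) (auto simp: indicator_def)
    also have "\<dots> = prob {w\<in>space M. S 1 w \<le> c}" using S1 by simp
    finally show ?thesis .
  qed
  also have "{w\<in>space M. S 1 w \<le> c} = space M - {w\<in>space M. c < S 1 w}" by auto
  also have "prob (space M - {w\<in>space M. c < S 1 w}) = 1 - (\<Sum>i\<in>UNIV. \<alpha> $ i * surv c i)"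
    using S1 prob_S_greater[OF order_refl c(1)] by (subst prob_compl) auto
  finally have p0: "0 < p0" using c(2) by simp
  let ?B = "\<lambda>w. 2 / (1 - l) * (ln (1 + R) + ln (1 + c) + ln (1 + \<bar>S 1 w - T 1 w\<bar>))"
  have Bint: "integrable M ?B" using log_moment by auto
  have "(\<Sum>k<n. \<integral>w. ?m k (T 1 w) \<partial>M) \<le> (\<integral>w. ?B w \<partial>M) / p0" for n
  proof -
    let ?G = "\<lambda>t. \<Sum>k<n. ?m k t"
    have G: "0 \<le> ?G t" "?G t \<le> real n" for t
      using m sum_bounded_above[of "{..<n}" "\<lambda>k. ?m k t" 1] by (auto intro!: sum_nonneg)
    have ind: "indep_var borel (T 1) borel (S 1)"
      by (rule info_indep_var[OF _ _ _ T_measurable_info S_measurable_info]) auto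
    have hm: "(\<lambda>p. ?G (fst p) * indicator {..c} (snd p)) \<in> borel_measurable (borel \<Otimes>\<^sub>M borel)" by measurable
    have hb: "norm (?G (fst p) * indicator {..c} (snd p)) \<le> real n" for p :: "real \<times> real"
      using G by (auto simp: indicator_def)
    have "(\<integral>w. ?G (T 1 w) \<partial>M) * p0 = (\<integral>w. (\<integral>w'. ?G (T 1 w) * indicator {..c} (S 1 w') \<partial>M) \<partial>M)"
      unfolding p0_def by simp
    also have "\<dots> = (\<integral>w. ?G (T 1 w) * indicator {..c} (S 1 w) \<partial>M)"
      using indep_var_expectation(1)[OF ind hm hb] by simp
    also have "\<dots> \<le> (\<integral>w. ?B w \<partial>M)"
    proof (rule integral_mono[OF _ Bint])
      show "integrable M (\<lambda>w. ?G (T 1 w) * indicator {..c} (S 1 w))"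
        by (rule integrable_const_bound[of _ "real n"]) (use hb[of "(T 1 _, S 1 _)"] T1 S1 in auto)
      fix w
      have B0: "0 \<le> ?B w" using l R c(1) by (intro mult_nonneg_nonneg add_nonneg_nonneg) auto
      show "?G (T 1 w) * indicator {..c} (S 1 w) \<le> ?B w"
      proof (cases "S 1 w \<le> c")
        case True
        have S0: "0 \<le> S 1 w" by (rule absorption_time_nonneg)
        have "1 + \<bar>T 1 w\<bar> \<le> (1 + c) + 1 * \<bar>S 1 w - T 1 w\<bar>" using True S0 by simp
        also have "\<dots> \<le> (1 + c) + (1 + c) * \<bar>S 1 w - T 1 w\<bar>"
          using c(1) by (intro add_left_mono mult_right_mono) auto
        also have "\<dots> = (1 + c) * (1 + \<bar>S 1 w - T 1 w\<bar>)" by (simp add: algebra_simps)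
        finally have T': "1 + \<bar>T 1 w\<bar> \<le> (1 + c) * (1 + \<bar>S 1 w - T 1 w\<bar>)" .
        have "1 + R * \<bar>T 1 w\<bar> \<le> (1 + R) * (1 + \<bar>T 1 w\<bar>)" using R by (simp add: algebra_simps)
        also have "\<dots> \<le> (1 + R) * ((1 + c) * (1 + \<bar>S 1 w - T 1 w\<bar>))"
          using R by (intro mult_left_mono T') auto
        finally have le: "1 + R * \<bar>T 1 w\<bar> \<le> (1 + R) * ((1 + c) * (1 + \<bar>S 1 w - T 1 w\<bar>))" .
        have p: "0 < 1 + R * \<bar>T 1 w\<bar>" "0 < 1 + R" "0 < 1 + c" "0 < 1 + \<bar>S 1 w - T 1 w\<bar>"
          using R c(1) by (auto intro: add_pos_nonneg)
        have "ln (1 + R * \<bar>T 1 w\<bar>) \<le> ln ((1 + R) * ((1 + c) * (1 + \<bar>S 1 w - T 1 w\<bar>)))"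
          using le p by (intro ln_mono) auto
        also have "\<dots> = ln (1 + R) + ln (1 + c) + ln (1 + \<bar>S 1 w - T 1 w\<bar>)"
          using p by (simp add: ln_mult)
        finally have "2 / (1 - l) * ln (1 + R * \<bar>T 1 w\<bar>) \<le> ?B w"
          using l by (intro mult_left_mono) auto
        moreover have "?G (T 1 w) \<le> 2 / (1 - l) * ln (1 + R * \<bar>T 1 w\<bar>)"
          using R by (intro sum_min_le_ln l) simp
        ultimately show ?thesis using True by simp
      qed (use B0 in simp)
    qed
    finally have "(\<integral>w. ?G (T 1 w) \<partial>M) \<le> (\<integral>w. ?B w \<partial>M) / p0" using p0 by (simp only: pos_le_divide_eq)
    then show ?thesis by (simp only: Bochner_Integration.integral_sum[OF mint])
  qed
  then show ?thesis
    by (intro summableI_nonneg_bounded[where x="(\<integral>w. ?B w \<partial>M) / p0"] integral_nonneg_AE AE_I2 m(1))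
qed

lemma psi2_minus_one:
  assumes "0 \<le> Re u" "cmod u \<le> R"
  shows "cmod (psi2 (of_real (l ^ k) * u) - 1) \<le> 3 * (\<integral>w. min 1 (l ^ k * (R * \<bar>T 1 w\<bar>)) \<partial>M)"
proof -
  let ?v = "of_real (l ^ k) * u"
  have R: "0 \<le> R" using assms(2) norm_ge_zero order_trans by blast
  have T1: "T 1 \<in> borel_measurable M" using T_measurable[of 1] by auto
  have nv: "cmod ?v = l ^ k * cmod u" using l by (simp add: norm_mult norm_power)
  have v: "0 \<le> Re ?v" "cmod ?v \<le> l ^ k * R"
    unfolding nv using assms l by (auto simp flip: of_real_power intro!: mult_left_mono)
  have mint: "integrable M (\<lambda>w. min 1 (l ^ k * (R * \<bar>T 1 w\<bar>)))"
    by (rule integrable_const_bound[of _ 1]) (use R l T1 in auto)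
  have eint: "integrable M (\<lambda>w. exp (- ?v * complex_of_real (T 1 w)) - 1)"
    by (intro Bochner_Integration.integrable_diff psi2_integrable v) simp
  have "psi2 ?v - 1 = (\<integral>w. exp (- ?v * complex_of_real (T 1 w)) - 1 \<partial>M)"
    unfolding psi2_def exp_psi2_def
    by (subst Bochner_Integration.integral_diff[OF psi2_integrable[OF v(1)]]) (simp_all add: prob_space)
  then have "cmod (psi2 ?v - 1) \<le> (\<integral>w. cmod (exp (- ?v * complex_of_real (T 1 w)) - 1) \<partial>M)"
    by (simp only: integral_norm_bound)
  also have "\<dots> \<le> (\<integral>w. 3 * min 1 (l ^ k * (R * \<bar>T 1 w\<bar>)) \<partial>M)"
  proof (rule integral_mono_AE[OF integrable_norm[OF eint] integrable_mult_right[OF mint]])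
    show "AE w in M. cmod (exp (- ?v * complex_of_real (T 1 w)) - 1) \<le> 3 * min 1 (l ^ k * (R * \<bar>T 1 w\<bar>))"
      using T_nonneg[of 1, OF order_refl]
    proof eventually_elim
      case (elim w)
      let ?z = "?v * complex_of_real (T 1 w)"
      have "cmod (exp (- ?z) - 1) \<le> 3 * min 1 (cmod ?z)"
        by (rule norm_exp_minus_one_le) (use v(1) elim in simp)
      moreover have "cmod ?z \<le> l ^ k * (R * \<bar>T 1 w\<bar>)"
        unfolding norm_mult[of ?v] norm_of_real mult.assoc[symmetric] by (intro mult_right_mono v) simp
      ultimately show ?case by (simp only: mult_minus_left)
    qed
  qed
  finally show ?thesis by simp
qed

definition nbhd :: "real \<Rightarrow> complex set" where "nbhd r = (\<Union>\<mu>\<in>Sp A. ball \<mu> r)"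

lemma nbhd_open: "open (nbhd r)" by (auto simp: nbhd_def)

lemma Sp_nbhd: "0 < r \<Longrightarrow> Sp A \<subseteq> nbhd r" by (auto simp: nbhd_def)

lemma nbhd_mono: "r \<le> r' \<Longrightarrow> nbhd r \<subseteq> nbhd r'" by (force simp: nbhd_def)

text \<open>
  On \<open>nbhd r\<close> the scaled points \<open>l\<^sup>k u\<close>, \<open>k \<ge> 1\<close>, avoid the poles of the transforms, and the factors of
  the product and the transforms are controlled uniformly by \<open>B\<close> and \<open>C\<close>.
\<close>

definition admissible :: "real \<Rightarrow> (nat \<Rightarrow> real) \<Rightarrow> real \<Rightarrow> bool" where
  "admissible r B C \<longleftrightarrow> 0 < r \<and> summable B \<and> (\<forall>u\<in>nbhd r. 0 < Re u \<and> cmod u \<le> C \<and>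
     (\<forall>k\<ge>1. of_real (l ^ k) * u \<notin> Sp A \<and> cmod (fac k u - 1) \<le> B k \<and> (\<forall>i. cmod (g i (of_real (l ^ k) * u)) \<le> C)))"

text \<open>
  For small \<open>r\<close> the scaled points stay in a compact set \<open>V\<close> that does not meet the spectrum of \<open>A\<close>. There the
  rational transforms are bounded, and \<open>ph\<close> differs from its value \<open>1\<close> at the origin by at most a multiple of
  \<open>l\<^sup>k\<close>; the factors coming from \<open>T\<close> are treated by \<open>psi2_minus_one\<close>.
\<close>

lemma admissible_exists: "\<exists>r B C. admissible r B C"
proof -
  obtain e where e: "0 < e" "\<And>\<mu> \<nu> k. \<mu> \<in> Sp A \<Longrightarrow> \<nu> \<in> Sp A \<Longrightarrow> 1 \<le> k \<Longrightarrow> e \<le> cmod (of_real (l ^ k) * \<mu> - \<nu>)"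
    by (rule eigenvalue_separation) blast
  obtain d where d: "0 < d" "\<And>\<mu>. \<mu> \<in> Sp A \<Longrightarrow> d \<le> Re \<mu>"
    using finite_uniform_lower_bound[OF finite_Sp[of A], of "{()}" "\<lambda>\<mu> _. Re \<mu>"] Sp_A_Re by auto
  define r where "r = min (e / 2) (d / 2)"
  have r: "0 < r" using e d by (simp add: r_def)
  define R where "R = (\<Sum>i\<in>UNIV. \<Sum>j\<in>UNIV. cmod (A $ i $ j)) + r"
  have R0: "0 \<le> R" using r unfolding R_def by (intro add_nonneg_nonneg sum_nonneg) auto
  define V where "V = {v. cmod v \<le> R \<and> (\<forall>\<nu>\<in>Sp A. e / 2 \<le> cmod (v - \<nu>))}"
  have V_Sp: "V \<subseteq> - Sp A" using e(1) by (auto simp: V_def)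
  have "compact V"
  proof -
    have "V = cball 0 R \<inter> (\<Inter>\<nu>\<in>Sp A. - ball \<nu> (e / 2))"
      by (auto simp: V_def dist_norm norm_minus_commute not_less)
    moreover have "closed (\<Inter>\<nu>\<in>Sp A. - ball \<nu> (e / 2))" by (intro closed_INT) auto
    ultimately show ?thesis by (metis compact_Int_closed compact_cball)
  qed
  have bdd: "\<exists>c\<ge>0. \<forall>v\<in>V. cmod (f v) \<le> c" if "f holomorphic_on (- Sp A)" for f
  proof -
    have "continuous_on V f" using that V_Sp holomorphic_on_imp_continuous_on continuous_on_subset by blast
    then have "bounded (f ` V)" using \<open>compact V\<close> compact_continuous_image compact_imp_bounded by blast
    then obtain c where "\<forall>v\<in>V. cmod (f v) \<le> c" by (auto simp: bounded_iff)
    then have "\<forall>v\<in>V. cmod (f v) \<le> max 0 c" by force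
    then show ?thesis by (intro exI[of _ "max 0 c"]) simp
  qed
  have "\<exists>c\<ge>0. \<forall>i. \<forall>v\<in>V. cmod (g i v) \<le> c"
  proof -
    have "\<forall>i. \<exists>c\<ge>0. \<forall>v\<in>V. cmod (g i v) \<le> c" using bdd g_holomorphic by blast
    then obtain c where c: "\<And>i. 0 \<le> c i" "\<And>i v. v \<in> V \<Longrightarrow> cmod (g i v) \<le> c i" by metis
    have "c i \<le> (\<Sum>i\<in>UNIV. c i)" for i by (intro member_le_sum c) auto
    then show ?thesis using c by (intro exI[of _ "\<Sum>i\<in>UNIV. c i"]) (meson order_trans sum_nonneg)
  qed
  then obtain Cg where Cg: "0 \<le> Cg" "\<And>i v. v \<in> V \<Longrightarrow> cmod (g i v) \<le> Cg" by blast
  \<comment> \<open>the difference quotient of \<open>ph\<close> at \<open>0\<close>, continued holomorphically\<close>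
  define h where "h v = (if v = 0 then deriv ph 0 else (ph v - ph 0) / (v - 0))" for v
  have "open (- Sp A)" by (intro open_Compl finite_imp_closed finite_Sp)
  moreover have "0 \<notin> Sp A" using Sp_A_Re by force
  ultimately have "h holomorphic_on (- Sp A)"
    unfolding h_def by (intro pole_lemma ph_holomorphic) (simp add: interior_open)
  then obtain Ch where Ch: "0 \<le> Ch" "\<And>v. v \<in> V \<Longrightarrow> cmod (h v) \<le> Ch" using bdd by blast
  have ph1: "cmod (ph v - 1) \<le> cmod v * Ch" if "v \<in> V" for v
  proof -
    have "ph v - 1 = v * h v" by (simp add: h_def ph_0)
    then show ?thesis using Ch(2)[OF that] by (simp add: norm_mult mult_left_mono)
  qed
  define B where "B k = l ^ k * (R * Ch) + 3 * (\<integral>w. min 1 (l ^ k * (R * \<bar>T 1 w\<bar>)) \<partial>M)" for k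
  have "summable B"
    unfolding B_def using l by (intro summable_add summable_mult summable_mult2 summable_geometric truncated_T_summable R0) auto
  moreover have "0 < Re u \<and> cmod u \<le> max R Cg \<and> (\<forall>k\<ge>1. of_real (l ^ k) * u \<notin> Sp A \<and> cmod (fac k u - 1) \<le> B k \<and>
      (\<forall>i. cmod (g i (of_real (l ^ k) * u)) \<le> max R Cg))" if "u \<in> nbhd r" for u
  proof -
    obtain \<mu> where "\<mu> \<in> Sp A" "u \<in> ball \<mu> r" using \<open>u \<in> nbhd r\<close> unfolding nbhd_def by blast
    then have \<mu>: "\<mu> \<in> Sp A" "cmod (u - \<mu>) < r" by (auto simp: dist_norm norm_minus_commute)
    have "Re \<mu> - Re u \<le> cmod (u - \<mu>)" using abs_Re_le_cmod[of "u - \<mu>"] by simp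
    moreover have "r \<le> d / 2" by (simp add: r_def)
    ultimately have Re_u: "0 < Re u" using d(2)[OF \<mu>(1)] \<mu>(2) d(1) by linarith
    have "cmod u \<le> cmod \<mu> + cmod (u - \<mu>)" by (rule norm_triangle_sub)
    then have u_R: "cmod u \<le> R" using Sp_bounded[OF \<mu>(1)] \<mu>(2) by (simp add: R_def)
    have lV: "of_real (l ^ k) * u \<in> V" if k: "1 \<le> k" for k
    proof -
      have lk: "0 \<le> l ^ k" "l ^ k \<le> 1" using l by (auto simp: power_le_one)
      have nl: "cmod (complex_of_real (l ^ k)) = l ^ k" using lk by (simp only: norm_of_real abs_of_nonneg)
      have "cmod (of_real (l ^ k) * u) \<le> 1 * R"
        unfolding norm_mult nl using lk u_R by (intro mult_mono) auto
      moreover have "e / 2 \<le> cmod (of_real (l ^ k) * u - \<nu>)" if \<nu>: "\<nu> \<in> Sp A" for \<nu>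
      proof -
        have "of_real (l ^ k) * \<mu> - \<nu> = (of_real (l ^ k) * u - \<nu>) - of_real (l ^ k) * (u - \<mu>)"
          by (simp add: algebra_simps)
        then have "cmod (of_real (l ^ k) * \<mu> - \<nu>) \<le> cmod (of_real (l ^ k) * u - \<nu>) + cmod (of_real (l ^ k) * (u - \<mu>))"
          by (metis norm_triangle_ineq4)
        moreover have "cmod (of_real (l ^ k) * (u - \<mu>)) \<le> 1 * r"
          unfolding norm_mult nl using lk \<mu>(2) by (intro mult_mono) auto
        moreover have "r \<le> e / 2" by (simp add: r_def)
        ultimately show ?thesis using e(2)[OF \<mu>(1) \<nu> k] by linarith
      qed
      ultimately show ?thesis by (simp add: V_def)
    qed
    have "cmod (fac k u - 1) \<le> B k" if k: "1 \<le> k" for k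
    proof -
      let ?v = "of_real (l ^ k) * u"
      have "cmod ?v \<le> l ^ k * R" using l u_R by (simp add: norm_mult norm_power mult_left_mono)
      then have p: "cmod (ph ?v - 1) \<le> l ^ k * R * Ch"
        using ph1[OF lV[OF k]] Ch(1) by (meson mult_right_mono order_trans)
      have Rv: "0 \<le> Re ?v" using l Re_u by simp
      have "fac k u - 1 = (ph ?v - 1) * psi2 ?v + (psi2 ?v - 1)" by (simp add: fac_def algebra_simps)
      then have "cmod (fac k u - 1) \<le> cmod (ph ?v - 1) * cmod (psi2 ?v) + cmod (psi2 ?v - 1)"
        by (metis norm_mult norm_triangle_ineq)
      also have "\<dots> \<le> l ^ k * R * Ch * 1 + 3 * (\<integral>w. min 1 (l ^ k * (R * \<bar>T 1 w\<bar>)) \<partial>M)"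
        using p psi2_bounded[OF Rv] psi2_minus_one[OF less_imp_le[OF Re_u] u_R] l R0 Ch(1)
        by (intro add_mono mult_mono) auto
      finally show ?thesis by (simp add: B_def mult.assoc)
    qed
    then show ?thesis using Re_u u_R lV V_Sp Cg(2)[OF lV] by (auto simp: le_max_iff_disj)
  qed
  ultimately show ?thesis using r unfolding admissible_def by blast
qed

end

context ar_crossing
begin

lemma expectation_S:
  fixes f :: "real \<Rightarrow> 'c::{banach,second_countable_topology}"
  assumes "1 \<le> k" "f \<in> borel_measurable borel"
  shows "(\<integral>w. f (S k w) \<partial>M) = (\<integral>w. f (S 1 w) \<partial>M)"
proof -
  have "(\<integral>w. f (S k w) \<partial>M) = (\<integral>t. f t \<partial>distr M borel (S k))"
    using assms S_measurable by (intro integral_distr[symmetric]) auto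
  also have "\<dots> = (\<integral>t. f t \<partial>distr M borel (S 1))"
    unfolding S_distr[OF assms(1)] S_distr[OF order_refl] ..
  also have "\<dots> = (\<integral>w. f (S 1 w) \<partial>M)"
    using assms S_measurable by (intro integral_distr) auto
  finally show ?thesis .
qed

lemma expectation_innovation:
  fixes f :: "real \<Rightarrow> 'c::{banach,second_countable_topology}"
  assumes k: "1 \<le> k" and f: "f \<in> borel_measurable borel" and bnd: "\<And>z. norm (f z) \<le> K"
  shows "(\<integral>w. f (S k w - T k w) \<partial>M) = (\<integral>w. f (S 1 w - T 1 w) \<partial>M)"
proof -
  let ?h = "\<lambda>p. f (snd p - fst p)"
  have hm: "?h \<in> borel_measurable (borel \<Otimes>\<^sub>M borel)"
    by (rule measurable_compose[OF _ f]) measurable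
  have main: "(\<integral>w. f (S j w - T j w) \<partial>M) = (\<integral>w. (\<integral>w'. f (S 1 w' - T 1 w) \<partial>M) \<partial>M)" if j: "1 \<le> j" for j
  proof -
    have ind: "indep_var borel (T j) borel (S j)"
      by (rule info_indep_var[OF _ _ _ T_measurable_info S_measurable_info]) (use j in auto)
    have "(\<integral>w. f (S j w - T j w) \<partial>M) = (\<integral>w. (\<integral>w'. f (S j w' - T j w) \<partial>M) \<partial>M)"
      using indep_var_expectation(1)[OF ind hm, of K] bnd by simp
    also have "\<dots> = (\<integral>w. (\<integral>w'. f (S 1 w' - T j w) \<partial>M) \<partial>M)"
    proof (rule Bochner_Integration.integral_cong[OF refl])
      fix w
      show "(\<integral>w'. f (S j w' - T j w) \<partial>M) = (\<integral>w'. f (S 1 w' - T j w) \<partial>M)"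
        by (rule expectation_S[OF j, of "\<lambda>s. f (s - T j w)"]) (rule measurable_compose[OF _ f], measurable)
    qed
    also have "\<dots> = (\<integral>w. (\<integral>w'. f (S 1 w' - T 1 w) \<partial>M) \<partial>M)"
    proof (rule expectation_T[OF j, of "\<lambda>t. \<integral>w'. f (S 1 w' - t) \<partial>M"])
      have ind1: "indep_var borel (T 1) borel (S 1)"
        by (rule info_indep_var[OF _ _ _ T_measurable_info S_measurable_info]) auto
      show "(\<lambda>t. \<integral>w'. f (S 1 w' - t) \<partial>M) \<in> borel_measurable borel"
        using indep_var_expectation(2)[OF ind1 hm, of K] bnd by simp
    qed
    finally show ?thesis .
  qed
  show ?thesis using main[OF k] main[OF order_refl] by simp
qed

lemma alive_Suc: "w \<in> alive (Suc k) \<longleftrightarrow> w \<in> alive k \<and> l * X k w + (S (Suc k) w - T (Suc k) w) < b"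
  by (auto simp: alive_def le_Suc_eq)

text \<open>
  The Markov property of the process killed above \<open>b\<close>. The function \<open>f\<close> is bounded only below \<open>b\<close>, which is
  why the killed process and indicators are carried along.
\<close>

lemma next_position:
  fixes f :: "real \<Rightarrow> complex"
  assumes f: "f \<in> borel_measurable borel" and bnd: "\<And>y. y < b \<Longrightarrow> norm (f y) \<le> K" and K: "0 \<le> K"
  defines "N \<equiv> \<lambda>y. \<integral>w. indicator (stay y) w *\<^sub>R f (step y w) \<partial>M"
  shows "(\<integral>w. indicator (alive (Suc k)) w *\<^sub>R f (X (Suc k) w) \<partial>M) = (\<integral>w. indicator (alive k) w *\<^sub>R N (X k w) \<partial>M)"
    and "integrable M (\<lambda>w. indicator (alive k) w *\<^sub>R N (X k w))"
proof -
  let ?Z = "\<lambda>j w. S j w - T j w"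
  let ?h = "\<lambda>p. indicator {..<b} (fst p) *\<^sub>R indicator {..<b} (l * fst p + snd p) *\<^sub>R f (l * fst p + snd p)"
  have fm: "(\<lambda>p::real \<times> real. f (l * fst p + snd p)) \<in> borel_measurable (borel \<Otimes>\<^sub>M borel)"
    by (rule measurable_compose[OF _ f]) measurable
  have hm: "?h \<in> borel_measurable (borel \<Otimes>\<^sub>M borel)"
    using fm by measurable
  have hb: "norm (?h p) \<le> K" for p using bnd K by (auto simp: indicator_def)
  have Zinfo: "?Z (Suc k) \<in> borel_measurable (info {Inl (Suc k), Inr (Suc k)})"
    by (rule borel_measurable_diff[OF measurable_info_mono[OF S_measurable_info] measurable_info_mono[OF T_measurable_info]]) auto
  have ind: "indep_var borel (killed k) borel (?Z (Suc k))"
    by (rule info_indep_var[OF _ _ _ killed_measurable_info Zinfo]) auto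
  note iv = indep_var_expectation[OF ind hm hb, unfolded fst_conv snd_conv]
  have inner: "(\<integral>w'. indicator {..<b} y *\<^sub>R indicator {..<b} (l * y + ?Z (Suc k) w') *\<^sub>R f (l * y + ?Z (Suc k) w') \<partial>M) =
      indicator {..<b} y *\<^sub>R N y" for y
  proof -
    have fz: "(\<lambda>z. f (l * y + z)) \<in> borel_measurable borel" by (rule measurable_compose[OF _ f]) measurable
    have "(\<integral>w'. indicator {..<b} (l * y + ?Z (Suc k) w') *\<^sub>R f (l * y + ?Z (Suc k) w') \<partial>M) =
        (\<integral>w'. indicator {..<b} (l * y + ?Z 1 w') *\<^sub>R f (l * y + ?Z 1 w') \<partial>M)"
    proof (rule expectation_innovation[where f="\<lambda>z. indicator {..<b} (l * y + z) *\<^sub>R f (l * y + z)" and K=K])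
      show "(\<lambda>z. indicator {..<b} (l * y + z) *\<^sub>R f (l * y + z)) \<in> borel_measurable borel"
        using fz by measurable
      show "norm (indicator {..<b} (l * y + z) *\<^sub>R f (l * y + z)) \<le> K" for z
        using bnd K by (auto simp: indicator_def)
    qed simp
    also have "\<dots> = N y"
      unfolding N_def by (rule Bochner_Integration.integral_cong) (auto simp: stay_def step_def indicator_def)
    finally have e: "(\<integral>w'. indicator {..<b} (l * y + ?Z (Suc k) w') *\<^sub>R f (l * y + ?Z (Suc k) w') \<partial>M) = N y" .
    show ?thesis by (simp only: integral_scaleR_right e)
  qed
  have kil: "indicator {..<b} (killed k w) *\<^sub>R N (killed k w) = indicator (alive k) w *\<^sub>R N (X k w)" for w
    unfolding indicator_killed by (cases "w \<in> alive k") (simp_all add: killed_alive)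
  have "(\<integral>w. indicator (alive (Suc k)) w *\<^sub>R f (X (Suc k) w) \<partial>M) =
      (\<integral>w. indicator {..<b} (killed k w) *\<^sub>R indicator {..<b} (l * killed k w + ?Z (Suc k) w) *\<^sub>R f (l * killed k w + ?Z (Suc k) w) \<partial>M)"
  proof (rule Bochner_Integration.integral_cong[OF refl])
    fix w
    show "indicator (alive (Suc k)) w *\<^sub>R f (X (Suc k) w) =
      indicator {..<b} (killed k w) *\<^sub>R indicator {..<b} (l * killed k w + ?Z (Suc k) w) *\<^sub>R f (l * killed k w + ?Z (Suc k) w)"
      unfolding indicator_killed using alive_Suc[of w k]
      by (cases "w \<in> alive k") (auto simp: killed_alive indicator_def)
  qed
  also have "\<dots> = (\<integral>w. indicator (alive k) w *\<^sub>R N (X k w) \<partial>M)"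
    using iv(1) unfolding inner kil .
  finally show "(\<integral>w. indicator (alive (Suc k)) w *\<^sub>R f (X (Suc k) w) \<partial>M) = (\<integral>w. indicator (alive k) w *\<^sub>R N (X k w) \<partial>M)" .
  have "(\<lambda>w. indicator {..<b} (killed k w) *\<^sub>R N (killed k w)) \<in> borel_measurable M"
    using measurable_compose[OF measurable_info[OF killed_measurable_info hist_sources] iv(2)[unfolded inner]] .
  then have m: "(\<lambda>w. indicator (alive k) w *\<^sub>R N (X k w)) \<in> borel_measurable M" unfolding kil .
  have "norm (N y) \<le> K" for y
  proof -
    have "norm (N y) \<le> (\<integral>w. norm (indicator (stay y) w *\<^sub>R f (step y w)) \<partial>M)"
      unfolding N_def by (rule integral_norm_bound)
    also have "\<dots> \<le> (\<integral>w. K \<partial>M)"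
    proof (rule integral_mono')
      show "norm (indicator (stay y) w *\<^sub>R f (step y w)) \<le> K" for w
        using bnd K by (auto simp: indicator_def stay_def)
    qed (use K in auto)
    finally show ?thesis by (simp add: prob_space)
  qed
  then show "integrable M (\<lambda>w. indicator (alive k) w *\<^sub>R N (X k w))"
    using K by (intro integrable_const_bound[of _ K] m AE_I2) (auto simp: indicator_def)
qed

text \<open>
  The part of \<open>W n\<close> that remains below \<open>b\<close> is passed to \<open>W (n - 1)\<close> at the next position, the rest
  contributes the law of the crossing step and phase. After \<open>n\<close> steps \<open>W 0\<close>, itself a crossing
  probability, closes the recursion, so that no remainder survives.
\<close>

lemma iterate_one_step:
  fixes W :: "nat \<Rightarrow> real \<Rightarrow> complex" and d :: "nat \<Rightarrow> 'm \<Rightarrow> complex"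
  assumes meas: "\<And>n. W n \<in> borel_measurable borel"
    and bnd: "\<And>n y. y < b \<Longrightarrow> cmod (W n y) \<le> K" and K: "0 \<le> K"
    and base: "\<And>y. y < b \<Longrightarrow> W 0 y = of_real (cross y j)"
    and step: "\<And>n y. y < b \<Longrightarrow> W (Suc n) y =
      (\<integral>w. indicator (stay y) w *\<^sub>R W n (step y w) \<partial>M) + (\<Sum>i\<in>UNIV. of_real (cross y i) * d n i)"
  shows "W n x = of_real (hit_prob (Suc n) j) +
    (\<Sum>k<n. \<Sum>i\<in>UNIV. of_real (hit_prob (Suc k) i) * d (n - Suc k) i)"
proof -
  \<comment> \<open>the mean of \<open>W n\<close> over the paths that survive \<open>m\<close> steps; up to crossing terms, a step trades
    one unit of \<open>n\<close> for one of \<open>m\<close>\<close>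
  define a where "a m n = (\<integral>w. indicator (alive m) w *\<^sub>R W n (X m w) \<partial>M)" for m n
  have crossint: "integrable M (\<lambda>w. indicator (alive m) w * cross (X m w) i)" for m i
  proof (rule integrable_const_bound[of _ 1])
    have "(\<lambda>w. indicator {..<b} (killed m w) * cross (killed m w) i) \<in> borel_measurable M"
      using measurable_compose[OF measurable_info[OF killed_measurable_info hist_sources] cross_measurable] .
    moreover have "(\<lambda>w. indicator {..<b} (killed m w) * cross (killed m w) i) = (\<lambda>w. indicator (alive m) w * cross (X m w) i)"
    proof
      fix w
      show "indicator {..<b} (killed m w) * cross (killed m w) i = indicator (alive m) w * cross (X m w) i"
        unfolding indicator_killed by (cases "w \<in> alive m") (simp_all add: killed_alive)
    qed
    ultimately show "(\<lambda>w. indicator (alive m) w * cross (X m w) i) \<in> borel_measurable M" by simp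
    have "\<bar>cross y i\<bar> \<le> 1" for y
    proof -
      have "\<bar>cross y i\<bar> \<le> (\<integral>w. \<bar>phase_prob (max 0 (b - l * y + T 1 w)) i\<bar> \<partial>M)"
        unfolding cross_def by (rule integral_abs_bound)
      also have "\<dots> \<le> (\<integral>w. 1 \<partial>M)"
        by (rule integral_mono') (use phase_prob_bounds in auto)
      finally show ?thesis by (simp add: prob_space)
    qed
    then show "AE w in M. norm (indicator (alive m) w * cross (X m w) i) \<le> 1"
      by (intro AE_I2) (simp add: indicator_def)
  qed
  have hc: "(\<integral>w. indicator (alive m) w * cross (X m w) i \<partial>M) = hit_prob (Suc m) i" for m i
    using hit_prob_cross[of "Suc m" i] by simp
  have a0: "a m 0 = of_real (hit_prob (Suc m) j)" for m
  proof -
    have "a m 0 = (\<integral>w. of_real (indicator (alive m) w * cross (X m w) j) \<partial>M)"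
      unfolding a_def by (rule Bochner_Integration.integral_cong) (auto simp: indicator_def alive_def base)
    also have "\<dots> = of_real (hit_prob (Suc m) j)"
      by (simp only: integral_complex_of_real hc)
    finally show ?thesis .
  qed
  have aS: "a m (Suc n) = a (Suc m) n + (\<Sum>i\<in>UNIV. of_real (hit_prob (Suc m) i) * d n i)" for m n
  proof -
    note np = next_position[OF meas[of n] bnd[of _ n] K, where k=m]
    let ?N = "\<lambda>y. \<integral>w. indicator (stay y) w *\<^sub>R W n (step y w) \<partial>M"
    have ci: "integrable M (\<lambda>w. of_real (indicator (alive m) w * cross (X m w) i) * d n i)" for i
      by (intro integrable_mult_left integrable_of_real crossint)
    have ce: "(\<integral>w. of_real (indicator (alive m) w * cross (X m w) i) * d n i \<partial>M) = of_real (hit_prob (Suc m) i) * d n i" for i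
      by (simp only: integral_mult_left_zero integral_complex_of_real hc)
    have "a m (Suc n) = (\<integral>w. indicator (alive m) w *\<^sub>R ?N (X m w) +
        (\<Sum>i\<in>UNIV. of_real (indicator (alive m) w * cross (X m w) i) * d n i) \<partial>M)"
      unfolding a_def by (rule Bochner_Integration.integral_cong) (auto simp: indicator_def alive_def step)
    also have "\<dots> = (\<integral>w. indicator (alive m) w *\<^sub>R ?N (X m w) \<partial>M) +
        (\<Sum>i\<in>UNIV. \<integral>w. of_real (indicator (alive m) w * cross (X m w) i) * d n i \<partial>M)"
      using ci np(2) by (subst Bochner_Integration.integral_add) (auto simp: Bochner_Integration.integral_sum)
    also have "(\<integral>w. indicator (alive m) w *\<^sub>R ?N (X m w) \<partial>M) = a (Suc m) n"
      unfolding a_def using np(1) by simp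
    finally show ?thesis unfolding ce .
  qed
  have "a m n = of_real (hit_prob (Suc (m + n)) j) +
    (\<Sum>k<n. \<Sum>i\<in>UNIV. of_real (hit_prob (Suc (m + k)) i) * d (n - Suc k) i)" for m
  proof (induction n arbitrary: m)
    case 0
    show ?case by (simp add: a0)
  next
    case (Suc n)
    have "a m (Suc n) = of_real (hit_prob (Suc (Suc m + n)) j) +
      ((\<Sum>k<n. \<Sum>i\<in>UNIV. of_real (hit_prob (Suc (Suc m + k)) i) * d (n - Suc k) i) +
       (\<Sum>i\<in>UNIV. of_real (hit_prob (Suc m) i) * d n i))"
      unfolding aS Suc by simp
    then show ?case unfolding sum.lessThan_Suc_shift by (simp add: add.commute)
  qed
  from this[of 0] have "a 0 n = of_real (hit_prob (Suc n) j) +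
    (\<Sum>k<n. \<Sum>i\<in>UNIV. of_real (hit_prob (Suc k) i) * d (n - Suc k) i)" by simp
  moreover have "a 0 n = (\<integral>w. W n x \<partial>M)"
    unfolding a_def by (rule Bochner_Integration.integral_cong) (use x in \<open>auto simp: alive_def indicator_def\<close>)
  ultimately show ?thesis by (simp add: prob_space)
qed

text \<open>Multiplying the iterated relation by \<open>\<rho>\<^sup>n\<^sup>+\<^sup>1\<close> and summing over \<open>n\<close> turns the convolution into a product.\<close>

lemma discounted_identity:
  fixes W :: "nat \<Rightarrow> real \<Rightarrow> complex" and d :: "nat \<Rightarrow> 'm \<Rightarrow> complex"
  assumes meas: "\<And>n. W n \<in> borel_measurable borel"
    and bnd: "\<And>n y. y < b \<Longrightarrow> cmod (W n y) \<le> K" and K: "0 \<le> K"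
    and dbnd: "\<And>n i. cmod (d n i) \<le> K"
    and base: "\<And>y. y < b \<Longrightarrow> W 0 y = of_real (cross y j)"
    and step: "\<And>n y. y < b \<Longrightarrow> W (Suc n) y =
      (\<integral>w. indicator (stay y) w *\<^sub>R W n (step y w) \<partial>M) + (\<Sum>i\<in>UNIV. of_real (cross y i) * d n i)"
  shows "(\<lambda>n. of_real (\<rho> ^ Suc n) * W n x) sums
    (of_real (Phi M l J T \<rho> b j x) +
     (\<Sum>i\<in>UNIV. of_real (Phi M l J T \<rho> b i x) * (\<Sum>n. of_real (\<rho> ^ Suc n) * d n i)))"
proof -
  define q where "q i k = complex_of_real (\<rho> ^ Suc k * hit_prob (Suc k) i)" for i k
  define c where "c i n = of_real (\<rho> ^ Suc n) * d n i" for i n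
  have geo: "summable (\<lambda>n. \<rho> ^ Suc n)" using \<rho> by (simp add: summable_geometric summable_mult)
  have q_sums: "q i sums of_real (Phi M l J T \<rho> b i x)" for i
    unfolding q_def by (rule sums_of_real[OF Phi_sums])
  have q_norm: "summable (\<lambda>k. norm (q i k))" for i
  proof (rule summable_comparison_test'[OF geo, of 0])
    fix k
    have "hit_prob (Suc k) i \<le> 1" "0 \<le> hit_prob (Suc k) i" by (simp_all add: hit_prob_def)
    then show "norm (norm (q i k)) \<le> \<rho> ^ Suc k"
      using \<rho> by (simp add: q_def norm_mult norm_power mult_left_le)
  qed
  have c_norm: "summable (\<lambda>k. norm (c i k))" for i
  proof (rule summable_comparison_test'[OF summable_mult2[OF geo, of K], of 0])
    fix k
    have "norm (c i k) \<le> \<rho> ^ Suc k * K"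
      unfolding c_def norm_mult norm_of_real using \<rho> dbnd by (intro mult_mono) auto
    then show "norm (norm (c i k)) \<le> \<rho> ^ Suc k * K" by simp
  qed
  have conv: "(\<lambda>n. \<Sum>k<n. q i k * c i (n - Suc k)) sums (of_real (Phi M l J T \<rho> b i x) * (\<Sum>n. c i n))" for i
  proof -
    have "(\<lambda>n. \<Sum>k\<le>n. q i k * c i (n - k)) sums ((\<Sum>k. q i k) * (\<Sum>n. c i n))"
      by (rule Cauchy_product_sums[OF q_norm c_norm])
    then have "(\<lambda>n. \<Sum>k<Suc n. q i k * c i (Suc n - Suc k)) sums (of_real (Phi M l J T \<rho> b i x) * (\<Sum>n. c i n))"
      using q_sums[of i] by (simp add: lessThan_Suc_atMost sums_iff)
    then show ?thesis by (subst (asm) sums_Suc_iff) simp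
  qed
  have "of_real (\<rho> ^ Suc n) * W n x = q j n + (\<Sum>i\<in>UNIV. \<Sum>k<n. q i k * c i (n - Suc k))" for n
  proof -
    have "of_real (\<rho> ^ Suc n) * (of_real (hit_prob (Suc k) i) * d (n - Suc k) i) = q i k * c i (n - Suc k)"
      if "k < n" for k i
    proof -
      have "Suc n = Suc k + Suc (n - Suc k)" using that by simp
      then have E: "complex_of_real (\<rho> ^ Suc n) = of_real (\<rho> ^ Suc k) * of_real (\<rho> ^ Suc (n - Suc k))"
        by (metis of_real_mult power_add)
      show ?thesis unfolding E q_def c_def of_real_mult by (simp only: mult_ac)
    qed
    then have "of_real (\<rho> ^ Suc n) * (\<Sum>k<n. \<Sum>i\<in>UNIV. of_real (hit_prob (Suc k) i) * d (n - Suc k) i) =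
        (\<Sum>k<n. \<Sum>i\<in>UNIV. q i k * c i (n - Suc k))"
      unfolding sum_distrib_left by (intro sum.cong refl) simp
    also have "\<dots> = (\<Sum>i\<in>UNIV. \<Sum>k<n. q i k * c i (n - Suc k))" by (rule sum.swap)
    finally have conv_eq: "of_real (\<rho> ^ Suc n) * (\<Sum>k<n. \<Sum>i\<in>UNIV. of_real (hit_prob (Suc k) i) * d (n - Suc k) i) =
        (\<Sum>i\<in>UNIV. \<Sum>k<n. q i k * c i (n - Suc k))" .
    have it: "W n x = of_real (hit_prob (Suc n) j) +
        (\<Sum>k<n. \<Sum>i\<in>UNIV. of_real (hit_prob (Suc k) i) * d (n - Suc k) i)"
      by (rule iterate_one_step[OF meas bnd K base step])
    show ?thesis unfolding it distrib_left conv_eq by (simp add: q_def)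
  qed
  then show ?thesis
    unfolding c_def[symmetric] using q_sums[of j] conv by (simp only:) (intro sums_add sums_sum)
qed

end

section \<open>Matrix functions of the generator\<close>

lemma fun_calc_sum:
  fixes B :: "complex^'s^'s"
  assumes "finite I" "\<And>i. i \<in> I \<Longrightarrow> f i analytic_on Sp B"
  shows "fun_calc (\<lambda>u. \<Sum>i\<in>I. c i * f i u) B $ k $ j = (\<Sum>i\<in>I. c i * fun_calc (f i) B $ k $ j)"
  using assms
proof (induction I)
  case empty
  then show ?case by (simp add: fun_calc_def residue_const)
next
  case (insert a I)
  have "fun_calc (\<lambda>u. c a * f a u + (\<Sum>i\<in>I. c i * f i u)) B =
      mat (c a) ** fun_calc (f a) B + fun_calc (\<lambda>u. \<Sum>i\<in>I. c i * f i u) B"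
  proof (subst fun_calc_add)
    show "(\<lambda>u. c a * f a u) analytic_on Sp B" using insert.prems by (intro analytic_on_mult analytic_on_const) auto
    show "(\<lambda>u. \<Sum>i\<in>I. c i * f i u) analytic_on Sp B"
      using insert.prems by (intro analytic_on_sum analytic_on_mult analytic_on_const) auto
    show "fun_calc (\<lambda>z. c a * f a z) B + fun_calc (\<lambda>z. \<Sum>i\<in>I. c i * f i z) B =
      mat (c a) ** fun_calc (f a) B + fun_calc (\<lambda>u. \<Sum>i\<in>I. c i * f i u) B"
      using insert.prems by (subst fun_calc_const_mult) auto
  qed
  moreover have "(mat (c a) ** X) $ k $ j = c a * X $ k $ j" for X :: "complex^'s^'s"
    by (simp add: matrix_matrix_mult_def mat_def if_distrib[where f="\<lambda>x. x * _"] cong: if_cong)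
  ultimately show ?case using insert by simp
qed

lemma matrix_sums_entries:
  fixes f :: "nat \<Rightarrow> complex^'s^'s"
  assumes "\<And>i j. (\<lambda>n. f n $ i $ j) sums (F $ i $ j)"
  shows "f sums F"
  unfolding sums_def
proof (intro vec_tendstoI)
  fix i j
  show "(\<lambda>n. (\<Sum>k<n. f k) $ i $ j) \<longlonglongrightarrow> F $ i $ j"
    using assms[of i j] by (simp add: sums_def)
qed

lemma matrix_summable_bounded:
  fixes f :: "nat \<Rightarrow> complex^'s^'s"
  assumes bnd: "\<And>n i j. cmod (f n $ i $ j) \<le> K" and r: "0 \<le> r" "r < 1"
  shows "summable (\<lambda>n. r ^ n *\<^sub>R f n)"
proof -
  have "summable (\<lambda>n. (r ^ n *\<^sub>R f n) $ i $ j)" for i j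
  proof (rule summable_comparison_test'[OF summable_mult2[OF summable_geometric[of r], of K], of 0])
    show "norm ((r ^ n *\<^sub>R f n) $ i $ j) \<le> r ^ n * K" for n
      using bnd r by (simp add: mult_left_mono)
  qed (use r in simp)
  then have "(\<lambda>n. r ^ n *\<^sub>R f n) sums (\<chi> i j. \<Sum>n. (r ^ n *\<^sub>R f n) $ i $ j)"
    by (intro matrix_sums_entries) (simp add: summable_sums)
  then show ?thesis by (rule sums_summable)
qed

lemma bounded_linear_matrix_mult_left: "bounded_linear (\<lambda>X. B ** X)" for B :: "complex^'s^'s"
  by (intro linear_conv_bounded_linear[THEN iffD1] linearI)
    (simp_all add: vec_eq_iff matrix_matrix_mult_def distrib_left sum.distrib scaleR_sum_right)

lemma bounded_linear_matrix_mult_right: "bounded_linear (\<lambda>X. X ** B)" for B :: "complex^'s^'s"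
  by (intro linear_conv_bounded_linear[THEN iffD1] linearI)
    (simp_all add: vec_eq_iff matrix_matrix_mult_def distrib_right sum.distrib scaleR_sum_right)

lemma bounded_linear_row_entry: "bounded_linear (\<lambda>X. (v v* X) $ j)" for v :: "complex^'s" and X :: "complex^'s^'s"
  by (intro linear_conv_bounded_linear[THEN iffD1] linearI)
    (simp_all add: vector_matrix_mult_def distrib_right distrib_left sum.distrib scaleR_sum_right)

text \<open>
  A neighbourhood of the spectrum and bounds as provided by \<open>admissible_exists\<close> are fixed from here on.
\<close>

locale ar_local = ar_spectral M Q J T \<alpha> l b x \<rho>
  for M :: "'w measure" and Q :: "real^'m::finite^'m"
    and J :: "nat \<Rightarrow> real \<Rightarrow> 'w \<Rightarrow> 'm option" and T :: "nat \<Rightarrow> 'w \<Rightarrow> real" and \<alpha> :: "real^'m"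
    and l b x \<rho> :: real +
  fixes r :: real and B :: "nat \<Rightarrow> real" and C :: real
  assumes adm: "admissible r B C"
begin

abbreviation U :: "complex set" where "U \<equiv> nbhd r"

text \<open>
  Applied to \<open>A\<close>, the function \<open>\<phi>1\<close> gives \<open>exp (\<phi>(- l Q))\<close> and the partial product \<open>part n\<close> gives its quotient
  by \<open>exp (\<phi>(- l\<^sup>n\<^sup>+\<^sup>1 Q))\<close>.
\<close>

definition part :: "nat \<Rightarrow> complex \<Rightarrow> complex" where "part n u = (\<Prod>k<n. fac (Suc k) u)"
definition \<phi>1 :: "complex \<Rightarrow> complex" where "\<phi>1 u = \<phi> (of_real l * u)"
definition PB :: real where "PB = exp (\<Sum>k. B (Suc k))"

lemma r_pos: "0 < r" and B_summable: "summable B"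
  using adm by (simp_all add: admissible_def)

lemma U_facts:
  assumes "u \<in> U"
  shows "0 < Re u" "cmod u \<le> C"
    "1 \<le> k \<Longrightarrow> of_real (l ^ k) * u \<notin> Sp A" "1 \<le> k \<Longrightarrow> cmod (fac k u - 1) \<le> B k"
    "1 \<le> k \<Longrightarrow> cmod (g i (of_real (l ^ k) * u)) \<le> C"
  using adm assms unfolding admissible_def by blast+

lemma U_analytic: "f holomorphic_on U \<Longrightarrow> f analytic_on Sp A"
  by (rule analytic_on_subset[OF _ Sp_nbhd[OF r_pos]]) (simp add: analytic_on_open nbhd_open)

lemma U_cong: "(\<And>u. u \<in> U \<Longrightarrow> f u = f' u) \<Longrightarrow> fun_calc f A = fun_calc f' A"
  using Sp_nbhd[OF r_pos] by (intro fun_calc_cong eventually_nhds_in_open[OF nbhd_open, THEN eventually_mono]) auto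

lemma scaled_holomorphic:
  assumes "1 \<le> k"
  shows "f holomorphic_on (- Sp A) \<Longrightarrow> (\<lambda>u. f (of_real (l ^ k) * u)) holomorphic_on U"
    and "h holomorphic_on {u. 0 < Re u} \<Longrightarrow> (\<lambda>u. h (of_real (l ^ k) * u)) holomorphic_on U"
proof -
  have lin: "(\<lambda>u. of_real (l ^ k) * u) holomorphic_on U" by (intro holomorphic_intros)
  show "(\<lambda>u. f (of_real (l ^ k) * u)) holomorphic_on U" if "f holomorphic_on (- Sp A)"
  proof -
    have "(\<lambda>u. of_real (l ^ k) * u) ` U \<subseteq> - Sp A"
    proof (rule image_subsetI)
      fix u assume "u \<in> U"
      then show "of_real (l ^ k) * u \<in> - Sp A" using U_facts(3)[OF _ assms] by blast
    qed
    from holomorphic_on_compose_gen[OF lin that this] show ?thesis unfolding o_def .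
  qed
  show "(\<lambda>u. h (of_real (l ^ k) * u)) holomorphic_on U" if "h holomorphic_on {u. 0 < Re u}"
  proof -
    have "(\<lambda>u. of_real (l ^ k) * u) ` U \<subseteq> {u. 0 < Re u}"
    proof (rule image_subsetI)
      fix u assume "u \<in> U"
      then have "0 < l ^ k * Re u" using U_facts(1)[of u] l by simp
      then show "of_real (l ^ k) * u \<in> {u. 0 < Re u}" by (simp flip: of_real_power)
    qed
    from holomorphic_on_compose_gen[OF lin that this] show ?thesis unfolding o_def .
  qed
qed

lemma fac_holomorphic: "1 \<le> k \<Longrightarrow> fac k holomorphic_on U"
  unfolding fac_def[abs_def]
  by (intro holomorphic_on_mult scaled_holomorphic ph_holomorphic psi2_holomorphic) auto

lemma part_holomorphic: "part n holomorphic_on U"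
  unfolding part_def[abs_def] by (intro holomorphic_on_prod fac_holomorphic) auto

lemma part_bounded: "u \<in> U \<Longrightarrow> cmod (part n u) \<le> PB"
  unfolding part_def PB_def
  by (rule prod_bounded) (simp_all add: U_facts(4) B_summable summable_Suc_iff)

lemma \<phi>1_eq: "\<phi>1 u = prodinf (\<lambda>k. fac (Suc k) u)"
  unfolding \<phi>1_def \<phi>_eq using fac_shift[of _ 1 u] by simp

lemma fac_summable: "u \<in> U \<Longrightarrow> summable (\<lambda>k. cmod (fac (Suc k + n) u - 1))"
proof -
  assume u: "u \<in> U"
  have "summable (\<lambda>k. B (Suc k + n))"
    using summable_ignore_initial_segment[OF B_summable, of "Suc n"] by simp
  then show ?thesis
  proof (rule summable_comparison_test'[where N=0])
    show "norm (cmod (fac (Suc k + n) u - 1)) \<le> B (Suc k + n)" for k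
      using U_facts(4)[OF u, of "Suc k + n"] by simp
  qed
qed

lemma \<phi>1_holomorphic: "\<phi>1 holomorphic_on U"
proof (rule holomorphic_uniform_sequence[OF nbhd_open part_holomorphic])
  fix u assume "u \<in> U"
  then obtain d where d: "0 < d" "cball u d \<subseteq> U" using nbhd_open open_contains_cball by blast
  have "uniform_limit U part \<phi>1 sequentially"
    unfolding part_def[abs_def] \<phi>1_eq[abs_def]
    by (rule uniform_limit_prod_lessThan[where M="\<lambda>k. B (Suc k)"]) (simp_all add: U_facts(4) B_summable summable_Suc_iff)
  then show "\<exists>d. 0 < d \<and> cball u d \<subseteq> U \<and> uniform_limit (cball u d) part \<phi>1 sequentially"
    using d uniform_limit_on_subset by blast
qed

lemma \<phi>1_factor: "u \<in> U \<Longrightarrow> \<phi>1 u = part n u * \<phi> (of_real (l ^ Suc n) * u)"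
proof (rule LIMSEQ_unique)
  assume u: "u \<in> U"
  have "(\<lambda>m. part m u) \<longlonglongrightarrow> \<phi>1 u"
    unfolding part_def \<phi>1_eq using fac_summable[OF u, of 0] by (intro prod_limit_lessThan) simp
  then show "(\<lambda>m. part (m + n) u) \<longlonglongrightarrow> \<phi>1 u" by (rule LIMSEQ_ignore_initial_segment)
  have "(\<lambda>m. \<Prod>k<m. fac (Suc k + n) u) \<longlonglongrightarrow> prodinf (\<lambda>k. fac (Suc k + n) u)"
    by (rule prod_limit_lessThan[OF fac_summable[OF u]])
  moreover have "prodinf (\<lambda>k. fac (Suc k + n) u) = \<phi> (of_real (l ^ Suc n) * u)"
    unfolding \<phi>_eq fac_shift by simp
  moreover have "part (m + n) u = part n u * (\<Prod>k<m. fac (Suc k + n) u)" for m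
    unfolding part_def by (induction m) (simp_all add: mult.assoc add.commute)
  ultimately show "(\<lambda>m. part (m + n) u) \<longlonglongrightarrow> part n u * \<phi> (of_real (l ^ Suc n) * u)"
    by (simp add: tendsto_mult_left)
qed

lemma \<phi>1_nonzero_Sp: "\<mu> \<in> Sp A \<Longrightarrow> \<phi>1 \<mu> \<noteq> 0"
proof -
  assume "\<mu> \<in> Sp A"
  then have "of_real l * \<mu> \<in> Sp (l *\<^sub>R A)" using l Sp_scale[of l "of_real l * \<mu>" A] by simp
  moreover have "l *\<^sub>R A = - (l ^ 1 *\<^sub>R cmat Q)" by (simp add: A_def)
  ultimately show ?thesis using exp_phi_nonzero[of 1 "of_real l * \<mu>"] by (simp add: \<phi>1_def \<phi>_def)
qed

lemma open_nonzero: "open {u\<in>U. \<phi>1 u \<noteq> 0}"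
proof -
  have "open (U \<inter> \<phi>1 -` (- {0}))"
    by (rule continuous_open_preimage[OF holomorphic_on_imp_continuous_on[OF \<phi>1_holomorphic] nbhd_open]) (simp add: open_Compl)
  then show ?thesis by (simp add: vimage_def Int_def)
qed

text \<open>
  By hypothesis \<open>\<phi>1\<close> does not vanish at the eigenvalues, hence not near them, and \<open>admissible\<close> is inherited by
  smaller radii.
\<close>

lemma admissible_nonzero: "\<exists>r'. admissible r' B C \<and> (\<forall>u\<in>nbhd r'. \<phi>1 u \<noteq> 0)"
proof -
  have "\<exists>e>0. \<forall>\<mu>\<in>Sp A. \<forall>_\<in>{()}. e \<le> (SOME e. 0 < e \<and> ball \<mu> e \<subseteq> {u\<in>U. \<phi>1 u \<noteq> 0})"
  proof (rule finite_uniform_lower_bound[OF finite_Sp])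
    fix \<mu> assume \<mu>: "\<mu> \<in> Sp A"
    note open_nonzero
    moreover have "\<mu> \<in> {u\<in>U. \<phi>1 u \<noteq> 0}" using \<mu> \<phi>1_nonzero_Sp Sp_nbhd[OF r_pos] by auto
    ultimately have "\<exists>e. 0 < e \<and> ball \<mu> e \<subseteq> {u\<in>U. \<phi>1 u \<noteq> 0}" unfolding open_contains_ball by blast
    from someI_ex[OF this]
    show "\<exists>e>0. \<forall>_\<in>{()}. e \<le> (SOME e. 0 < e \<and> ball \<mu> e \<subseteq> {u\<in>U. \<phi>1 u \<noteq> 0})" by auto
  qed
  then obtain e where e: "0 < e" "\<And>\<mu>. \<mu> \<in> Sp A \<Longrightarrow> e \<le> (SOME e. 0 < e \<and> ball \<mu> e \<subseteq> {u\<in>U. \<phi>1 u \<noteq> 0})" by auto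
  have ball: "ball \<mu> e \<subseteq> {u\<in>U. \<phi>1 u \<noteq> 0}" if \<mu>: "\<mu> \<in> Sp A" for \<mu>
  proof -
    note open_nonzero
    moreover have "\<mu> \<in> {u\<in>U. \<phi>1 u \<noteq> 0}" using \<mu> \<phi>1_nonzero_Sp Sp_nbhd[OF r_pos] by auto
    ultimately have "\<exists>e. 0 < e \<and> ball \<mu> e \<subseteq> {u\<in>U. \<phi>1 u \<noteq> 0}" unfolding open_contains_ball by blast
    from someI_ex[OF this] have "ball \<mu> (SOME e. 0 < e \<and> ball \<mu> e \<subseteq> {u\<in>U. \<phi>1 u \<noteq> 0}) \<subseteq> {u\<in>U. \<phi>1 u \<noteq> 0}" by blast
    moreover have "ball \<mu> e \<subseteq> ball \<mu> (SOME e. 0 < e \<and> ball \<mu> e \<subseteq> {u\<in>U. \<phi>1 u \<noteq> 0})"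
      using e(2)[OF \<mu>] by (rule subset_ball)
    ultimately show ?thesis by blast
  qed
  let ?r = "min e r"
  have "nbhd ?r \<subseteq> U" by (rule nbhd_mono) simp
  then have "admissible ?r B C" using adm e(1) unfolding admissible_def by auto
  moreover have "\<phi>1 u \<noteq> 0" if "u \<in> nbhd ?r" for u
  proof -
    obtain \<mu> where "\<mu> \<in> Sp A" "u \<in> ball \<mu> ?r" using \<open>u \<in> nbhd ?r\<close> unfolding nbhd_def by blast
    moreover have "ball \<mu> ?r \<subseteq> ball \<mu> e" by (rule subset_ball) simp
    ultimately show ?thesis using ball by blast
  qed
  ultimately show ?thesis by blast
qed

end

locale ar_local_nonzero = ar_local M Q J T \<alpha> l b x \<rho> r B C
  for M :: "'w measure" and Q :: "real^'m::finite^'m"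
    and J :: "nat \<Rightarrow> real \<Rightarrow> 'w \<Rightarrow> 'm option" and T :: "nat \<Rightarrow> 'w \<Rightarrow> real" and \<alpha> :: "real^'m"
    and l b x \<rho> r :: real and B :: "nat \<Rightarrow> real" and C :: real +
  assumes \<phi>1_nonzero: "\<And>u. u \<in> nbhd r \<Longrightarrow> \<phi>1 u \<noteq> 0"
begin

text \<open>
  \<open>\<Xi>\<close> and \<open>\<Theta>\<close> are \<open>exp (\<phi>(- l Q))\<close> and its inverse, which cancel in \<open>h\<close> and \<open>\<eta>\<close>. The function \<open>above_fun\<close> is
  the crossing term of the one-step identity at \<open>l\<^sup>n\<^sup>+\<^sup>1 u\<close>, multiplied by the partial product; \<open>below_fun\<close> is what
  the truncated expectation in that identity averages over the next position \<open>y\<close>, multiplied likewise.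
\<close>

definition \<Xi> :: "complex^'m^'m" where "\<Xi> = fun_calc \<phi>1 A"
definition \<Theta> :: "complex^'m^'m" where "\<Theta> = fun_calc (\<lambda>u. 1 / \<phi>1 u) A"
definition L :: "complex^'m^'m" where "L = fun_calc (\<lambda>u. exp (- of_real b * u) * psi2 u) A"
definition below_fun :: "nat \<Rightarrow> real \<Rightarrow> complex \<Rightarrow> complex" where
  "below_fun n y u = exp (of_real (y * l ^ Suc n) * u) * part n u"
definition above_fun :: "nat \<Rightarrow> 'm \<Rightarrow> complex \<Rightarrow> complex" where
  "above_fun n i u = exp (of_real (b * l ^ Suc n) * u) * part n u * g i (of_real (l ^ Suc n) * u)"
definition below_mat :: "nat \<Rightarrow> real \<Rightarrow> complex^'m^'m" where "below_mat n y = fun_calc (below_fun n y) A"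
definition above_mat :: "nat \<Rightarrow> 'm \<Rightarrow> complex^'m^'m" where "above_mat n i = fun_calc (above_fun n i) A"

lemma psi2_U: "psi2 holomorphic_on U"
  by (rule holomorphic_on_subset[OF psi2_holomorphic]) (use U_facts(1) in auto)

lemma inv_\<phi>1_U: "(\<lambda>u. 1 / \<phi>1 u) holomorphic_on U"
  using \<phi>1_nonzero by (intro holomorphic_intros \<phi>1_holomorphic) auto

lemma below_fun_U: "below_fun n y holomorphic_on U"
  unfolding below_fun_def[abs_def] by (intro holomorphic_intros part_holomorphic)

lemma above_fun_U: "above_fun n i holomorphic_on U"
  unfolding above_fun_def[abs_def]
  by (intro holomorphic_on_mult part_holomorphic scaled_holomorphic(1)[OF _ g_holomorphic] holomorphic_on_exp' holomorphic_on_ident holomorphic_on_const) auto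

lemma exp_psi2_U: "(\<lambda>u. exp (- of_real b * u) * psi2 u) holomorphic_on U"
  by (intro holomorphic_intros psi2_U)

lemma \<Xi>_\<Theta>: "\<Xi> ** \<Theta> = mat 1"
proof -
  have "\<Xi> ** \<Theta> = fun_calc (\<lambda>u. \<phi>1 u * (1 / \<phi>1 u)) A"
    unfolding \<Xi>_def \<Theta>_def by (rule fun_calc_mult[symmetric]) (intro U_analytic \<phi>1_holomorphic inv_\<phi>1_U)+
  also have "\<dots> = fun_calc (\<lambda>u. 1) A" by (rule U_cong) (use \<phi>1_nonzero in auto)
  finally show ?thesis by (simp add: fun_calc_one)
qed

lemma neg_scaled: "- (c *\<^sub>R cmat Q) = c *\<^sub>R A" "- cmat Q = A"
  by (simp_all add: A_def)

lemma \<phi>_scaled: "u \<in> U \<Longrightarrow> 1 / \<phi> (of_real (l ^ Suc n) * u) = 1 / \<phi>1 u * part n u"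
  using \<phi>1_factor[of u n] \<phi>1_nonzero[of u] by (auto simp: field_simps)

lemma fun_calc_scaled_eq:
  assumes "f' holomorphic_on U" "\<And>u. u \<in> U \<Longrightarrow> f (of_real (l ^ k) * u) = f' u"
  shows "fun_calc f (l ^ k *\<^sub>R A) = fun_calc f' A"
proof -
  have "(\<lambda>u. f (of_real (l ^ k) * u)) holomorphic_on U"
    by (rule holomorphic_transform[OF assms(1)]) (rule assms(2)[symmetric])
  then have "fun_calc f (l ^ k *\<^sub>R A) = fun_calc (\<lambda>u. f (of_real (l ^ k) * u)) A"
    using l by (intro fun_calc_scale U_analytic) auto
  also have "\<dots> = fun_calc f' A" by (rule U_cong) (rule assms(2))
  finally show ?thesis .
qed

text \<open>
  The infinite product at \<open>l\<^sup>n\<^sup>+\<^sup>1 u\<close> is the one at \<open>l u\<close> divided by \<open>part n u\<close>, so that only the factor \<open>\<Theta>\<close>,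
  which does not depend on \<open>n\<close>, still contains an infinite product.
\<close>

lemma h_term_eq: "h_term M l Q \<alpha> T \<rho> y (Suc n) = \<rho> ^ n *\<^sub>R (\<Theta> ** below_mat n y)"
proof -
  have "fun_calc (\<lambda>u. exp (of_real y * u) / exp_phi M l Q \<alpha> T u) (l ^ Suc n *\<^sub>R A) =
      fun_calc (\<lambda>u. (1 / \<phi>1 u) * below_fun n y u) A"
  proof (rule fun_calc_scaled_eq)
    show "(\<lambda>u. (1 / \<phi>1 u) * below_fun n y u) holomorphic_on U"
      by (intro holomorphic_on_mult inv_\<phi>1_U below_fun_U)
    fix u assume u: "u \<in> U"
    have "exp (of_real y * (of_real (l ^ Suc n) * u)) / exp_phi M l Q \<alpha> T (of_real (l ^ Suc n) * u) =
        exp (of_real (y * l ^ Suc n) * u) * (1 / \<phi> (of_real (l ^ Suc n) * u))"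
      by (simp only: \<phi>_def of_real_mult mult.assoc times_divide_eq_right mult_1_right)
    then show "exp (of_real y * (of_real (l ^ Suc n) * u)) / exp_phi M l Q \<alpha> T (of_real (l ^ Suc n) * u) =
        (1 / \<phi>1 u) * below_fun n y u"
      unfolding \<phi>_scaled[OF u] below_fun_def by (simp only: mult_ac)
  qed
  also have "\<dots> = \<Theta> ** below_mat n y"
    unfolding \<Theta>_def below_mat_def by (intro fun_calc_mult U_analytic inv_\<phi>1_U below_fun_U)
  finally show ?thesis unfolding h_term_def neg_scaled by simp
qed

lemma eta_term_eq: "eta_term M l Q \<alpha> T \<rho> b i (Suc n) = \<rho> ^ Suc n *\<^sub>R (\<Theta> ** above_mat n i)"
proof -
  have "fun_calc (\<lambda>u. exp (of_real b * u) / exp_phi M l Q \<alpha> T u * ph_transform Q (axis i 1) u) (l ^ Suc n *\<^sub>R A) =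
      fun_calc (\<lambda>u. (1 / \<phi>1 u) * above_fun n i u) A"
  proof (rule fun_calc_scaled_eq)
    show "(\<lambda>u. (1 / \<phi>1 u) * above_fun n i u) holomorphic_on U"
      by (intro holomorphic_on_mult inv_\<phi>1_U above_fun_U)
    fix u assume u: "u \<in> U"
    have "exp (of_real b * (of_real (l ^ Suc n) * u)) / exp_phi M l Q \<alpha> T (of_real (l ^ Suc n) * u) * ph_transform Q (axis i 1) (of_real (l ^ Suc n) * u) =
        exp (of_real (b * l ^ Suc n) * u) * (1 / \<phi> (of_real (l ^ Suc n) * u)) * g i (of_real (l ^ Suc n) * u)"
      by (simp only: \<phi>_def g_def of_real_mult mult.assoc times_divide_eq_right mult_1_right)
    then show "exp (of_real b * (of_real (l ^ Suc n) * u)) / exp_phi M l Q \<alpha> T (of_real (l ^ Suc n) * u) * ph_transform Q (axis i 1) (of_real (l ^ Suc n) * u) =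
        (1 / \<phi>1 u) * above_fun n i u"
      unfolding \<phi>_scaled[OF u] above_fun_def by (simp only: mult_ac)
  qed
  also have "\<dots> = \<Theta> ** above_mat n i"
    unfolding \<Theta>_def above_mat_def by (intro fun_calc_mult U_analytic inv_\<phi>1_U above_fun_U)
  finally show ?thesis unfolding eta_term_def neg_scaled by simp
qed

lemma below_above_bounded:
  "\<exists>K\<ge>0. (\<forall>n y i j. y \<le> b \<longrightarrow> cmod (below_mat n y $ i $ j) \<le> K) \<and> (\<forall>n i k j. cmod (above_mat n i $ k $ j) \<le> K)"
proof -
  obtain c where c: "0 \<le> c" "\<forall>f B i j. f holomorphic_on (\<Union>\<mu>\<in>Sp A. ball \<mu> r) \<longrightarrow>
    (\<forall>z\<in>(\<Union>\<mu>\<in>Sp A. ball \<mu> r). cmod (f z) \<le> B) \<longrightarrow> cmod (fun_calc f A $ i $ j) \<le> c * B"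
    using fun_calc_bounded[OF r_pos, of A] by (elim exE conjE)
  have PB0: "0 \<le> PB" by (simp add: PB_def)
  have ex: "cmod (exp (of_real (y * l ^ Suc n) * u)) \<le> exp (b * C)" if "u \<in> U" "y \<le> b" for y n u
  proof -
    have L: "0 \<le> l ^ Suc n" "l ^ Suc n \<le> 1" using l by (auto simp: power_le_one mult_le_one)
    have Re: "0 < Re u" "Re u \<le> C" using U_facts(1,2)[OF that(1)] complex_Re_le_cmod[of u] by auto
    have "y * (l ^ Suc n * Re u) \<le> b * (l ^ Suc n * Re u)"
      using that(2) L Re by (intro mult_right_mono mult_nonneg_nonneg) auto
    also have "\<dots> \<le> b * (1 * C)" using b L Re by (intro mult_left_mono mult_mono) auto
    finally show ?thesis by (simp add: mult_ac)
  qed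
  have below: "cmod (below_mat n y $ i $ j) \<le> c * (exp (b * C) * PB)" if y: "y \<le> b" for n y i j
    unfolding below_mat_def
  proof (rule c(2)[rule_format, folded nbhd_def])
    show "below_fun n y holomorphic_on U" by (rule below_fun_U)
    show "cmod (below_fun n y z) \<le> exp (b * C) * PB" if "z \<in> U" for z
      unfolding below_fun_def norm_mult[of _ "part n z"]
      by (intro mult_mono ex[OF that y] part_bounded[OF that]) auto
  qed
  have above: "cmod (above_mat n i $ k $ j) \<le> c * (exp (b * C) * PB * C)" for n i k j
    unfolding above_mat_def
  proof (rule c(2)[rule_format, folded nbhd_def])
    show "above_fun n i holomorphic_on U" by (rule above_fun_U)
    show "cmod (above_fun n i z) \<le> exp (b * C) * PB * C" if "z \<in> U" for z
      unfolding above_fun_def norm_mult[of _ "part n z"] norm_mult[of _ "g i _"] using PB0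
      by (intro mult_mono ex[OF that order_refl] part_bounded[OF that] U_facts(5)[OF that] mult_nonneg_nonneg) auto
  qed
  have "c * (exp (b * C) * PB) \<ge> 0" using c(1) PB0 by (intro mult_nonneg_nonneg) auto
  then show ?thesis
    using below above
    by (intro exI[of _ "max (c * (exp (b * C) * PB)) (c * (exp (b * C) * PB * C))"]) (auto simp: le_max_iff_disj)
qed

definition \<beta> :: "complex^'m" where "\<beta> = cvec \<alpha> v* L"
definition W :: "'m \<Rightarrow> nat \<Rightarrow> real \<Rightarrow> complex" where "W j n y = (\<beta> v* below_mat n y) $ j"
definition D :: "'m \<Rightarrow> nat \<Rightarrow> 'm \<Rightarrow> complex" where "D j n i = (\<beta> v* above_mat n i) $ j"

lemma row_entry: "(v v* N) $ j = (\<Sum>k\<in>UNIV. v $ k * N $ k $ j)" for v :: "complex^'m" and N :: "complex^'m^'m"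
  by (simp add: vector_matrix_mult_def mult.commute)

lemma exp_mat: "fun_calc (\<lambda>u. exp (of_real s * u)) A $ i $ j = of_real (p (- s) i j)"
proof -
  have "fun_calc (\<lambda>u. exp (- of_real (- s) * u)) A = cmat (mat_exp ((- s) *\<^sub>R Q))"
    unfolding A_def by (rule fun_calc_exp)
  then show ?thesis by (simp add: cmat_def)
qed

lemma below_mat_split: "below_mat n y = fun_calc (\<lambda>u. exp (of_real (y * l ^ Suc n) * u)) A ** fun_calc (part n) A"
  unfolding below_mat_def below_fun_def[abs_def]
  by (intro fun_calc_mult U_analytic part_holomorphic holomorphic_intros)

lemma W_measurable: "W j n \<in> borel_measurable borel"
proof -
  have "isCont (\<lambda>y. p (- (y * l ^ Suc n)) i k) y" for i k y
    by (rule isCont_o2[OF _ p_continuous]) (intro continuous_intros)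
  then have "continuous_on UNIV (\<lambda>y. p (- (y * l ^ Suc n)) i k)" for i k
    by (simp add: continuous_at_imp_continuous_on)
  then have m: "(\<lambda>y. complex_of_real (p (- (y * l ^ Suc n)) i k)) \<in> borel_measurable borel" for i k
    by (intro borel_measurable_continuous_onI continuous_on_of_real)
  have "W j n = (\<lambda>y. \<Sum>k\<in>UNIV. \<beta> $ k * (\<Sum>i\<in>UNIV. of_real (p (- (y * l ^ Suc n)) k i) * fun_calc (part n) A $ i $ j))"
    unfolding W_def row_entry below_mat_split by (simp only: matrix_matrix_mult_def vec_lambda_beta exp_mat)
  also have "\<dots> \<in> borel_measurable borel"
    using m by (intro borel_measurable_sum borel_measurable_times borel_measurable_const)
  finally show ?thesis .
qed

text \<open>
  \<open>\<alpha> exp (- b A) e\<^sup>\<psi>\<^sup>2(A) exp (l y A)\<close> is the expectation of \<open>\<alpha> exp (Q (b - l y + T))\<close>, the law of the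
  phase in which \<open>b\<close> is crossed.
\<close>

lemma W_base:
  assumes y: "y < b"
  shows "W j 0 y = of_real (cross y j)"
proof -
  let ?Y = "\<lambda>w. - (b - l * y + T 1 w)"
  have T1: "T 1 \<in> borel_measurable M" using T_measurable[of 1] by simp
  have Ym: "?Y \<in> borel_measurable M" using T1 by measurable
  have c: "0 \<le> b - l * y" using scale_below[OF y] by simp
  have Yb: "AE w in M. w \<in> space M \<longrightarrow> ?Y w \<le> 0"
    using T_nonneg[of 1, OF order_refl] by eventually_elim (use c in auto)
  have "L ** below_mat 0 y = fun_calc (\<lambda>u. (exp (- of_real b * u) * psi2 u) * below_fun 0 y u) A"
    unfolding L_def below_mat_def by (intro fun_calc_mult[symmetric] U_analytic exp_psi2_U below_fun_U)
  also have "\<dots> = fun_calc (exp_moment M (space M) ?Y 0) A"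
  proof (rule U_cong)
    fix u assume u: "u \<in> U"
    have "exp_moment M (space M) ?Y 0 u = (\<integral>w. exp (- of_real b * u) * exp (of_real (y * l) * u) * exp (- u * of_real (T 1 w)) \<partial>M)"
      unfolding exp_moment_def
    proof (rule Bochner_Integration.integral_cong[OF refl])
      fix w assume "w \<in> space M"
      then show "indicator (space M) w *\<^sub>R (complex_of_real (?Y w) ^ 0 * exp (u * of_real (?Y w))) =
          exp (- of_real b * u) * exp (of_real (y * l) * u) * exp (- u * of_real (T 1 w))"
        unfolding exp_add[symmetric] by (simp add: algebra_simps)
    qed
    also have "\<dots> = exp (- of_real b * u) * exp (of_real (y * l) * u) * psi2 u"
      by (simp only: integral_mult_right_zero psi2_def exp_psi2_def)
    finally show "(exp (- of_real b * u) * psi2 u) * below_fun 0 y u = exp_moment M (space M) ?Y 0 u"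
      by (simp add: below_fun_def part_def)
  qed
  finally have LB: "L ** below_mat 0 y = fun_calc (exp_moment M (space M) ?Y 0) A" .
  have pint: "integrable M (\<lambda>w. complex_of_real (p (max 0 (b - l * y + T 1 w)) k j))" for k
  proof (intro integrable_of_real integrable_const_bound[of _ 1] AE_I2)
    have "(\<lambda>t. p t k j) \<in> borel_measurable borel"
      using p_continuous by (intro borel_measurable_continuous_onI) (simp add: continuous_at_imp_continuous_on)
    then show "(\<lambda>w. p (max 0 (b - l * y + T 1 w)) k j) \<in> borel_measurable M"
      by (rule measurable_compose[rotated]) (use T1 in measurable)
    show "norm (p (max 0 (b - l * y + T 1 w)) k j) \<le> 1" for w
      using p_nonneg[of "max 0 (b - l * y + T 1 w)" k j] p_le_1[of "max 0 (b - l * y + T 1 w)" k j] by simp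
  qed
  have ent: "(L ** below_mat 0 y) $ k $ j = (\<integral>w. of_real (p (max 0 (b - l * y + T 1 w)) k j) \<partial>M)" for k
  proof -
    have "(L ** below_mat 0 y) $ k $ j = (\<integral>w. indicator (space M) w *\<^sub>R fun_calc (\<lambda>u. exp (u * of_real (?Y w))) A $ k $ j \<partial>M)"
      unfolding LB by (rule fun_calc_exp_moment(2)[OF Ym sets.top Yb Sp_A_Re])
    also have "\<dots> = (\<integral>w. of_real (p (b - l * y + T 1 w) k j) \<partial>M)"
    proof (rule Bochner_Integration.integral_cong[OF refl])
      fix w assume w: "w \<in> space M"
      have "fun_calc (\<lambda>u. exp (u * of_real (?Y w))) A $ k $ j = of_real (p (b - l * y + T 1 w) k j)"
        using exp_mat[of "?Y w" k j] by (simp only: mult.commute minus_minus)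
      then show "indicator (space M) w *\<^sub>R fun_calc (\<lambda>u. exp (u * of_real (?Y w))) A $ k $ j = of_real (p (b - l * y + T 1 w) k j)"
        using w by (simp only: indicator_simps scaleR_one)
    qed
    also have "\<dots> = (\<integral>w. of_real (p (max 0 (b - l * y + T 1 w)) k j) \<partial>M)"
    proof (rule integral_cong_AE)
      have "(\<lambda>t. p t k j) \<in> borel_measurable borel"
        using p_continuous by (intro borel_measurable_continuous_onI) (simp add: continuous_at_imp_continuous_on)
      then have "(\<lambda>w. p (b - l * y + T 1 w) k j) \<in> borel_measurable M"
        by (rule measurable_compose[rotated]) (use T1 in measurable)
      then show "(\<lambda>w. complex_of_real (p (b - l * y + T 1 w) k j)) \<in> borel_measurable M"
        by (rule measurable_compose[OF _ borel_measurable_of_real])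
      show "(\<lambda>w. complex_of_real (p (max 0 (b - l * y + T 1 w)) k j)) \<in> borel_measurable M"
        by (rule borel_measurable_integrable[OF pint])
      show "AE w in M. complex_of_real (p (b - l * y + T 1 w) k j) = of_real (p (max 0 (b - l * y + T 1 w)) k j)"
        using T_nonneg[of 1, OF order_refl] by eventually_elim (use c in \<open>simp add: max_def\<close>)
    qed
    finally show ?thesis .
  qed
  have "W j 0 y = (cvec \<alpha> v* (L ** below_mat 0 y)) $ j"
    by (simp add: W_def \<beta>_def vector_matrix_mul_assoc)
  also have "\<dots> = (\<Sum>k\<in>UNIV. of_real (\<alpha> $ k) * (\<integral>w. of_real (p (max 0 (b - l * y + T 1 w)) k j) \<partial>M))"
    unfolding row_entry ent by (simp add: cvec_def)
  also have "\<dots> = (\<integral>w. (\<Sum>k\<in>UNIV. of_real (\<alpha> $ k) * of_real (p (max 0 (b - l * y + T 1 w)) k j)) \<partial>M)"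
    using pint by (subst Bochner_Integration.integral_sum) (auto simp only: integrable_mult_right integral_mult_right_zero)
  also have "\<dots> = (\<integral>w. of_real (phase_prob (max 0 (b - l * y + T 1 w)) j) \<partial>M)"
    by (simp only: phase_prob_def of_real_sum of_real_mult)
  also have "\<dots> = of_real (cross y j)" by (simp only: integral_complex_of_real cross_def)
  finally show ?thesis .
qed

text \<open>
  The one-step identity at \<open>l\<^sup>n\<^sup>+\<^sup>1 u\<close>, multiplied by \<open>part n u\<close> and read as an identity between functions of
  \<open>A\<close>; the truncated expectation is taken out of the functional calculus.
\<close>

lemma W_step:
  assumes y: "y < b"
  shows "W j (Suc n) y = (\<integral>w. indicator (stay y) w *\<^sub>R W j n (step y w) \<partial>M) + (\<Sum>i\<in>UNIV. of_real (cross y i) * D j n i)"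
proof -
  define c where "c = l ^ Suc n"
  have c: "0 < c" using l by (simp add: c_def)
  let ?Y = "\<lambda>w. c * step y w"
  have Ym: "?Y \<in> borel_measurable M" using step_measurable by (intro borel_measurable_times borel_measurable_const)
  have Yb: "AE w in M. w \<in> stay y \<longrightarrow> ?Y w \<le> c * b"
    using stay_bound by eventually_elim (use c in \<open>auto intro: mult_left_mono\<close>)
  let ?E = "exp_moment M (stay y) ?Y 0"
  have E_U: "?E holomorphic_on U"
    by (rule holomorphic_on_subset[OF exp_moment_holomorphic[OF Ym stay_events Yb]]) (use U_facts(1) in auto)
  have key: "below_fun (Suc n) y u = ?E u * part n u + (\<Sum>i\<in>UNIV. of_real (cross y i) * above_fun n i u)" if u: "u \<in> U" for u
  proof -
    let ?v = "of_real c * u"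
    have v: "0 < Re ?v" "?v \<notin> Sp A" using U_facts(1)[OF u] U_facts(3)[OF u, of "Suc n"] c by (auto simp: c_def)
    have "?E u = exp_moment M (stay y) (step y) 0 ?v"
      unfolding exp_moment_def by (simp add: mult_ac)
    also have "\<dots> = exp (?v * of_real (l * y)) * (ph ?v * psi2 ?v) - exp (?v * of_real b) * (\<Sum>i\<in>UNIV. of_real (cross y i) * g i ?v)"
      by (rule one_step_transform[OF y v])
    finally have E: "?E u = exp (?v * of_real (l * y)) * (ph ?v * psi2 ?v) - exp (?v * of_real b) * (\<Sum>i\<in>UNIV. of_real (cross y i) * g i ?v)" .
    have 1: "exp (?v * of_real (l * y)) * (ph ?v * psi2 ?v) * part n u = below_fun (Suc n) y u"
    proof -
      have "exp (?v * of_real (l * y)) = exp (of_real (y * l ^ Suc (Suc n)) * u)" by (simp add: c_def mult_ac)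
      moreover have "part (Suc n) u = part n u * (ph ?v * psi2 ?v)" by (simp add: part_def fac_def c_def)
      ultimately show ?thesis unfolding below_fun_def by (simp only: mult_ac)
    qed
    have 2: "exp (?v * of_real b) * (\<Sum>i\<in>UNIV. of_real (cross y i) * g i ?v) * part n u =
        (\<Sum>i\<in>UNIV. of_real (cross y i) * above_fun n i u)"
    proof -
      have "exp (?v * of_real b) = exp (of_real (b * l ^ Suc n) * u)" by (simp add: c_def mult_ac)
      then show ?thesis
        unfolding above_fun_def c_def[symmetric] sum_distrib_left sum_distrib_right by (simp only: mult_ac c_def)
    qed
    show ?thesis unfolding E left_diff_distrib 1 2 by simp
  qed
  have part_an: "part n analytic_on Sp A" by (rule U_analytic[OF part_holomorphic])
  have E_an: "?E analytic_on Sp A" by (rule U_analytic[OF E_U])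
  have Ep: "(\<lambda>u. ?E u * part n u) analytic_on Sp A" by (intro analytic_on_mult E_an part_an)
  have ab: "above_fun n i analytic_on Sp A" for i by (rule U_analytic[OF above_fun_U])
  have sum_an: "(\<lambda>u. \<Sum>i\<in>UNIV. of_real (cross y i) * above_fun n i u) analytic_on Sp A"
    by (intro analytic_on_sum analytic_on_mult analytic_on_const ab)
  let ?P = "fun_calc (part n) A"
  have mat: "below_mat (Suc n) y $ k $ j = (fun_calc ?E A ** ?P) $ k $ j + (\<Sum>i\<in>UNIV. of_real (cross y i) * above_mat n i $ k $ j)" for k
  proof -
    have "below_mat (Suc n) y = fun_calc (\<lambda>u. ?E u * part n u + (\<Sum>i\<in>UNIV. of_real (cross y i) * above_fun n i u)) A"
      unfolding below_mat_def by (rule U_cong) (rule key)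
    also have "\<dots> = fun_calc (\<lambda>u. ?E u * part n u) A + fun_calc (\<lambda>u. \<Sum>i\<in>UNIV. of_real (cross y i) * above_fun n i u) A"
      by (rule fun_calc_add[OF Ep sum_an])
    also have "fun_calc (\<lambda>u. ?E u * part n u) A = fun_calc ?E A ** ?P" by (rule fun_calc_mult[OF E_an part_an])
    finally show ?thesis
      by (simp add: fun_calc_sum[OF finite_class.finite_UNIV ab] above_mat_def)
  qed
  let ?x = "\<lambda>w. fun_calc (\<lambda>u. exp (u * of_real (?Y w))) A"
  have em1: "integrable M (\<lambda>w. indicator (stay y) w *\<^sub>R ?x w $ k $ m)" for k m
    by (rule fun_calc_exp_moment(1)[OF Ym stay_events Yb Sp_A_Re])
  have em2: "fun_calc ?E A $ k $ m = (\<integral>w. indicator (stay y) w *\<^sub>R ?x w $ k $ m \<partial>M)" for k m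
    by (rule fun_calc_exp_moment(2)[OF Ym stay_events Yb Sp_A_Re])
  have "(\<beta> v* (fun_calc ?E A ** ?P)) $ j = (\<Sum>k\<in>UNIV. \<beta> $ k * (\<Sum>m\<in>UNIV. fun_calc ?E A $ k $ m * ?P $ m $ j))"
    unfolding row_entry by (simp add: matrix_matrix_mult_def)
  also have "\<dots> = (\<Sum>k\<in>UNIV. \<Sum>m\<in>UNIV. (\<integral>w. indicator (stay y) w *\<^sub>R ?x w $ k $ m * (\<beta> $ k * ?P $ m $ j) \<partial>M))"
    unfolding sum_distrib_left integral_mult_left_zero em2 by (intro sum.cong refl) (simp only: mult_ac)
  also have "\<dots> = (\<integral>w. (\<Sum>k\<in>UNIV. \<Sum>m\<in>UNIV. indicator (stay y) w *\<^sub>R ?x w $ k $ m * (\<beta> $ k * ?P $ m $ j)) \<partial>M)"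
    using em1 by (simp only: Bochner_Integration.integral_sum Bochner_Integration.integrable_sum integrable_mult_left)
  also have "\<dots> = (\<integral>w. indicator (stay y) w *\<^sub>R W j n (step y w) \<partial>M)"
  proof (rule Bochner_Integration.integral_cong[OF refl])
    fix w
    have "?x w = fun_calc (\<lambda>u. exp (of_real (step y w * l ^ Suc n) * u)) A"
      by (simp add: c_def mult_ac)
    then have "W j n (step y w) = (\<Sum>k\<in>UNIV. \<beta> $ k * (\<Sum>m\<in>UNIV. ?x w $ k $ m * ?P $ m $ j))"
      unfolding W_def row_entry below_mat_split by (simp add: matrix_matrix_mult_def)
    then show "(\<Sum>k\<in>UNIV. \<Sum>m\<in>UNIV. indicator (stay y) w *\<^sub>R ?x w $ k $ m * (\<beta> $ k * ?P $ m $ j)) = indicator (stay y) w *\<^sub>R W j n (step y w)"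
      by (simp add: sum_distrib_left scaleR_sum_right mult_ac)
  qed
  finally have E1: "(\<beta> v* (fun_calc ?E A ** ?P)) $ j = (\<integral>w. indicator (stay y) w *\<^sub>R W j n (step y w) \<partial>M)" .
  have "W j (Suc n) y = (\<beta> v* (fun_calc ?E A ** ?P)) $ j + (\<Sum>i\<in>UNIV. of_real (cross y i) * D j n i)"
    unfolding W_def D_def row_entry mat
    by (simp add: distrib_left sum.distrib sum_distrib_left mult.left_commute) (rule sum.swap)
  then show ?thesis unfolding E1 .
qed

end

section \<open>Summation of the series\<close>

lemma scalar_product_linear:
  fixes v :: "'i \<Rightarrow> complex^'s" and v' w :: "complex^'s"
  shows "scalar_product (\<Sum>i\<in>I. c i *s v i) w = (\<Sum>i\<in>I. c i * scalar_product (v i) w)"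
    and "scalar_product (c' *s v') w = c' * scalar_product v' w"
proof -
  show "scalar_product (\<Sum>i\<in>I. c i *s v i) w = (\<Sum>i\<in>I. c i * scalar_product (v i) w)"
    unfolding scalar_product_def
    by (simp add: sum_distrib_left sum_distrib_right mult.assoc) (rule sum.swap)
  show "scalar_product (c' *s v') w = c' * scalar_product v' w"
    unfolding scalar_product_def by (simp add: sum_distrib_left mult.assoc)
qed

lemma vector_matrix_linear:
  fixes N :: "complex^'s^'s"
  shows "(\<Sum>i\<in>I. c i *s v i) v* N = (\<Sum>i\<in>I. c i *s (v i v* N))"
    and "(c' *s v') v* N = c' *s (v' v* N)"
    and "(r *\<^sub>R v') v* N = r *\<^sub>R (v' v* N)"
proof -
  show "(\<Sum>i\<in>I. c i *s v i) v* N = (\<Sum>i\<in>I. c i *s (v i v* N))"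
  proof (rule vec_eq_iff[THEN iffD2], rule allI)
    show "((\<Sum>i\<in>I. c i *s v i) v* N) $ j = (\<Sum>i\<in>I. c i *s (v i v* N)) $ j" for j
      by (simp add: vector_matrix_mult_def sum_distrib_left sum_distrib_right mult.assoc) (rule sum.swap)
  qed
  show "(c' *s v') v* N = c' *s (v' v* N)"
    by (simp add: vec_eq_iff vector_matrix_mult_def sum_distrib_left mult.assoc)
  show "(r *\<^sub>R v') v* N = r *\<^sub>R (v' v* N)"
    by (simp add: vec_eq_iff vector_matrix_mult_def scaleR_sum_right)
qed

lemma row_mat_mult: "v v* (mat c ** N) = c *s (v v* N)" for v :: "complex^'s" and N :: "complex^'s^'s"
proof -
  have "v v* mat c = c *s v"
    by (simp add: vec_eq_iff vector_matrix_mult_def mat_def if_distrib[where f="\<lambda>x. _ * x"] mult.commute cong: if_cong)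
  then show ?thesis by (simp add: vector_matrix_mul_assoc[symmetric] vector_matrix_linear)
qed

lemma mat_commute: "N ** mat c = mat c ** N" for N :: "complex^'s^'s"
  by (simp add: vec_eq_iff matrix_matrix_mult_def mat_def if_distrib[where f="\<lambda>x. x * _"] if_distrib[where f="\<lambda>x. _ * x"] mult.commute cong: if_cong)

context ar_local_nonzero
begin

definition below_sum :: "complex^'m^'m" where "below_sum = (\<Sum>n. \<rho> ^ n *\<^sub>R below_mat n x)"
definition above_sum :: "'m \<Rightarrow> complex^'m^'m" where "above_sum i = (\<Sum>n. \<rho> ^ Suc n *\<^sub>R above_mat n i)"

lemma below_summable: "summable (\<lambda>n. \<rho> ^ n *\<^sub>R below_mat n x)"
proof -
  obtain K where "\<And>n i j. cmod (below_mat n x $ i $ j) \<le> K" using below_above_bounded x by (meson less_imp_le)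
  then show ?thesis using \<rho> by (intro matrix_summable_bounded) auto
qed

lemma above_summable: "summable (\<lambda>n. \<rho> ^ Suc n *\<^sub>R above_mat n i)"
proof -
  obtain K where "\<And>n i k j. cmod (above_mat n i $ k $ j) \<le> K" using below_above_bounded by meson
  then have "summable (\<lambda>n. \<rho> ^ n *\<^sub>R above_mat n i)" using \<rho> by (intro matrix_summable_bounded) auto
  then show ?thesis using summable_scaleR_right[of _ \<rho>] by (simp flip: scaleR_scaleR)
qed

lemma h_term_sums: "(\<lambda>n. h_term M l Q \<alpha> T \<rho> x (Suc n)) sums (\<Theta> ** below_sum)"
  using bounded_linear.sums[OF bounded_linear_matrix_mult_left[of \<Theta>] summable_sums[OF below_summable]]
  by (simp add: h_term_eq below_sum_def linear_cmul[OF bounded_linear.linear[OF bounded_linear_matrix_mult_left]])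

lemma eta_term_sums: "(\<lambda>n. eta_term M l Q \<alpha> T \<rho> b i (Suc n)) sums (\<Theta> ** above_sum i)"
  using bounded_linear.sums[OF bounded_linear_matrix_mult_left[of \<Theta>] summable_sums[OF above_summable[of i]]]
  by (simp add: eta_term_eq above_sum_def linear_cmul[OF bounded_linear.linear[OF bounded_linear_matrix_mult_left]])

text \<open>
  The component \<open>j\<close> of this identity of row vectors is \<open>discounted_identity\<close> for \<open>W j\<close> and \<open>D j\<close>.
\<close>

lemma row_identity:
  "(\<Sum>i\<in>UNIV. complex_of_real (Phi M l J T \<rho> b i x) *s (axis i 1 + \<beta> v* above_sum i)) = \<rho> *\<^sub>R (\<beta> v* below_sum)"
proof -
  obtain K where K: "0 \<le> K" "\<And>n y i j. y \<le> b \<Longrightarrow> cmod (below_mat n y $ i $ j) \<le> K"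
    "\<And>n i k j. cmod (above_mat n i $ k $ j) \<le> K"
    using below_above_bounded by meson
  define K' where "K' = (\<Sum>k\<in>UNIV. cmod (\<beta> $ k)) * K"
  have K': "0 \<le> K'" unfolding K'_def using K(1) by (intro mult_nonneg_nonneg sum_nonneg) auto
  have row: "cmod ((\<beta> v* N) $ j) \<le> K'" if N: "\<And>k. cmod (N $ k $ j) \<le> K" for N :: "complex^'m^'m" and j
    unfolding row_entry K'_def sum_distrib_right
    using N by (intro sum_norm_le) (simp add: norm_mult mult_left_mono)
  show ?thesis
  proof (rule vec_eq_iff[THEN iffD2], rule allI)
    fix j
    have "(\<lambda>n. of_real (\<rho> ^ Suc n) * W j n x) sums
      (of_real (Phi M l J T \<rho> b j x) +
       (\<Sum>i\<in>UNIV. of_real (Phi M l J T \<rho> b i x) * (\<Sum>n. of_real (\<rho> ^ Suc n) * D j n i)))"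
    proof (rule discounted_identity)
      show "cmod (W j n y) \<le> K'" if "y < b" for n y
        unfolding W_def using that by (intro row K(2)) simp
      show "cmod (D j n i) \<le> K'" for n i
        unfolding D_def by (intro row K(3))
    qed (fact W_measurable K' W_base W_step)+
    moreover have "(\<lambda>n. of_real (\<rho> ^ Suc n) * W j n x) sums ((\<rho> *\<^sub>R (\<beta> v* below_sum)) $ j)"
    proof -
      have "(\<lambda>n. \<rho> *\<^sub>R (\<beta> v* (\<rho> ^ n *\<^sub>R below_mat n x)) $ j) sums (\<rho> *\<^sub>R (\<beta> v* below_sum) $ j)"
        unfolding below_sum_def
        by (intro sums_scaleR_right bounded_linear.sums[OF bounded_linear_row_entry] summable_sums below_summable)
      moreover have "\<rho> *\<^sub>R (\<beta> v* (\<rho> ^ n *\<^sub>R below_mat n x)) $ j = of_real (\<rho> ^ Suc n) * W j n x" for n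
        unfolding linear_cmul[OF bounded_linear.linear[OF bounded_linear_row_entry]] W_def
        by (simp add: scaleR_conv_of_real mult.assoc)
      ultimately show ?thesis by (simp only: vector_scaleR_component)
    qed
    moreover have "(\<Sum>n. of_real (\<rho> ^ Suc n) * D j n i) = (\<beta> v* above_sum i) $ j" for i
    proof -
      have "(\<lambda>n. (\<beta> v* (\<rho> ^ Suc n *\<^sub>R above_mat n i)) $ j) sums ((\<beta> v* above_sum i) $ j)"
        unfolding above_sum_def by (intro bounded_linear.sums[OF bounded_linear_row_entry] summable_sums above_summable)
      moreover have "(\<beta> v* (\<rho> ^ Suc n *\<^sub>R above_mat n i)) $ j = of_real (\<rho> ^ Suc n) * D j n i" for n
        unfolding linear_cmul[OF bounded_linear.linear[OF bounded_linear_row_entry]] D_def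
        by (simp only: scaleR_conv_of_real)
      ultimately show ?thesis by (simp only: sums_iff)
    qed
    ultimately have "(\<rho> *\<^sub>R (\<beta> v* below_sum)) $ j = of_real (Phi M l J T \<rho> b j x) +
       (\<Sum>i\<in>UNIV. of_real (Phi M l J T \<rho> b i x) * (\<beta> v* above_sum i) $ j)"
      by (simp only: sums_unique2)
    also have "\<dots> = (\<Sum>i\<in>UNIV. of_real (Phi M l J T \<rho> b i x) *s (axis i 1 + \<beta> v* above_sum i)) $ j"
    proof -
      have "(\<Sum>i\<in>UNIV. complex_of_real (Phi M l J T \<rho> b i x) * axis i 1 $ j) = of_real (Phi M l J T \<rho> b j x)"
        by (simp add: axis_def if_distrib cong: if_cong)
      then show ?thesis by (simp add: distrib_left sum.distrib)
    qed
    finally show "(\<Sum>i\<in>UNIV. complex_of_real (Phi M l J T \<rho> b i x) *s (axis i 1 + \<beta> v* above_sum i)) $ j =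
      (\<rho> *\<^sub>R (\<beta> v* below_sum)) $ j" by (rule sym)
  qed
qed

text \<open>
  \<open>\<eta>\<^sub>\<delta>\<^sub>,\<^sub>i\<close> and \<open>h\<^sub>\<delta>\<close> are obtained from the two sides of \<open>row_identity\<close> by one and the same linear
  functional \<open>v \<mapsto> exp (\<delta> b) v (- \<delta> I - Q)\<^sup>-\<^sup>1 q\<close>, once the resolvent, which stands on the left in \<open>\<alpha>\<^sub>\<delta>\<close>, has
  been moved to the right.
\<close>

lemma expansion_identity:
  assumes \<delta>: "\<delta> \<notin> Sp (- cmat Q)"
  shows "(\<Sum>i\<in>UNIV. eta M l Q \<alpha> T \<rho> b \<delta> i * complex_of_real (Phi M l J T \<rho> b i x)) = h_fun M l Q \<alpha> T \<rho> b \<delta> x"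
proof -
  let ?R = "matrix_inv (mat (- \<delta>) - cmat Q)"
  let ?c = "exp (\<delta> * of_real b)"
  let ?q = "cvec (exit_rates Q)"
  have \<delta>A: "\<delta> \<notin> Sp A" using \<delta> by (simp add: neg_scaled)
  have R_eq: "?R = fun_calc (\<lambda>z. 1 / (z - \<delta>)) A" unfolding shifted by (rule fun_calc_resolvent(1)[OF \<delta>A])
  have R_an: "(\<lambda>z. 1 / (z - \<delta>)) analytic_on Sp A" by (rule fun_calc_resolvent(2)[OF \<delta>A])
  have RL: "?R ** L = L ** ?R"
    unfolding R_eq L_def by (rule fun_calc_commute[OF R_an U_analytic[OF exp_psi2_U]])
  have Rb: "?R ** below_mat n x = below_mat n x ** ?R" for n
    unfolding R_eq below_mat_def by (rule fun_calc_commute[OF R_an U_analytic[OF below_fun_U]])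
  have RB: "?R ** below_sum = below_sum ** ?R"
  proof -
    have s: "(\<lambda>n. \<rho> ^ n *\<^sub>R below_mat n x) sums below_sum"
      unfolding below_sum_def by (rule summable_sums[OF below_summable])
    have "(\<lambda>n. ?R ** (\<rho> ^ n *\<^sub>R below_mat n x)) sums (?R ** below_sum)"
      by (rule bounded_linear.sums[OF bounded_linear_matrix_mult_left s])
    moreover have "(\<lambda>n. (\<rho> ^ n *\<^sub>R below_mat n x) ** ?R) sums (below_sum ** ?R)"
      by (rule bounded_linear.sums[OF bounded_linear_matrix_mult_right s])
    moreover have "?R ** (\<rho> ^ n *\<^sub>R below_mat n x) = (\<rho> ^ n *\<^sub>R below_mat n x) ** ?R" for n
      unfolding linear_cmul[OF bounded_linear.linear[OF bounded_linear_matrix_mult_left]]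
        linear_cmul[OF bounded_linear.linear[OF bounded_linear_matrix_mult_right]] Rb by (rule refl)
    ultimately show ?thesis by (simp only: sums_unique2)
  qed
  have \<Xi>_eq: "fun_calc (exp_phi M l Q \<alpha> T) (- (l *\<^sub>R cmat Q)) = \<Xi>"
  proof -
    have "fun_calc (exp_phi M l Q \<alpha> T) (l ^ 1 *\<^sub>R A) = fun_calc \<phi>1 A"
      by (rule fun_calc_scaled_eq[OF \<phi>1_holomorphic]) (simp add: \<phi>1_def \<phi>_def)
    then show ?thesis by (simp add: neg_scaled \<Xi>_def)
  qed
  have F_eq: "fun_calc (\<lambda>u. exp (- of_real b * u) * exp_psi2 M T u * exp_phi M l Q \<alpha> T (of_real l * u)) (- cmat Q) = L ** \<Xi>"
  proof -
    have "(\<lambda>u. exp (- of_real b * u) * exp_psi2 M T u * exp_phi M l Q \<alpha> T (of_real l * u)) =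
      (\<lambda>u. (exp (- of_real b * u) * psi2 u) * \<phi>1 u)"
      by (simp add: psi2_def \<phi>1_def \<phi>_def fun_eq_iff)
    then show ?thesis unfolding neg_scaled L_def \<Xi>_def
      by (simp only: fun_calc_mult[OF U_analytic[OF exp_psi2_U] U_analytic[OF \<phi>1_holomorphic]])
  qed
  have E_eq: "fun_calc (\<lambda>u. exp ((\<delta> - u) * of_real b) * exp_psi2 M T u) (- cmat Q) = mat ?c ** L"
  proof -
    have "(\<lambda>u. exp ((\<delta> - u) * of_real b) * exp_psi2 M T u) = (\<lambda>u. ?c * (exp (- of_real b * u) * psi2 u))"
      unfolding mult.assoc[symmetric] exp_add[symmetric] by (simp add: psi2_def algebra_simps)
    then show ?thesis unfolding neg_scaled L_def
      by (simp only: fun_calc_const_mult[OF U_analytic[OF exp_psi2_U]])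
  qed
  have cancel: "N ** \<Xi> ** (\<Theta> ** N') = N ** N'" for N N' :: "complex^'m^'m"
    using \<Xi>_\<Theta> by (metis matrix_mul_assoc matrix_mul_lid)
  have eta: "eta M l Q \<alpha> T \<rho> b \<delta> i = ?c * scalar_product ((axis i 1 + \<beta> v* above_sum i) v* ?R) ?q" for i
    unfolding eta_def F_eq sums_unique[OF eta_term_sums, symmetric]
    by (simp only: vector_matrix_mul_assoc cancel \<beta>_def)
  have "alpha_delta M Q \<alpha> T \<rho> b \<delta> v* \<Xi> v* (\<Theta> ** below_sum) = (\<rho> *\<^sub>R (?c *s (\<beta> v* below_sum))) v* ?R"
  proof -
    have "?R ** (mat ?c ** L) ** \<Xi> ** (\<Theta> ** below_sum) = mat ?c ** (L ** (below_sum ** ?R))"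
      unfolding cancel using RL RB mat_commute[of ?R ?c] by (metis matrix_mul_assoc)
    then have "cvec \<alpha> v* ?R v* (mat ?c ** L) v* \<Xi> v* (\<Theta> ** below_sum) = (?c *s (\<beta> v* below_sum)) v* ?R"
      by (simp only: vector_matrix_mul_assoc \<beta>_def row_mat_mult[symmetric] matrix_mul_assoc)
    then show ?thesis unfolding alpha_delta_def E_eq vector_matrix_linear by (simp only:)
  qed
  then have "h_fun M l Q \<alpha> T \<rho> b \<delta> x = scalar_product ((\<rho> *\<^sub>R (?c *s (\<beta> v* below_sum))) v* ?R) ?q"
    unfolding h_fun_def \<Xi>_eq sums_unique[OF h_term_sums, symmetric] using x by (simp only: not_le if_False add_0) simp
  also have "(\<rho> *\<^sub>R (?c *s (\<beta> v* below_sum))) = ?c *s (\<rho> *\<^sub>R (\<beta> v* below_sum))"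
    by (simp add: vec_eq_iff)
  also have "\<dots> v* ?R = ?c *s (\<Sum>i\<in>UNIV. complex_of_real (Phi M l J T \<rho> b i x) *s ((axis i 1 + \<beta> v* above_sum i) v* ?R))"
    unfolding row_identity[symmetric] vector_matrix_linear(1,2) by (rule refl)
  finally show ?thesis
    unfolding eta scalar_product_linear sum_distrib_left by (simp only: mult_ac)
qed

end

theorem theorem3p4:
  fixes M :: "'w measure"
    and J :: "nat \<Rightarrow> real \<Rightarrow> 'w \<Rightarrow> ('m::finite) option"
    and T :: "nat \<Rightarrow> 'w \<Rightarrow> real"
    and Q :: "real^'m^'m"
    and \<alpha> :: "real^'m"
    and l \<rho> b x :: real
    and \<delta> :: complex
  assumes "prob_space M"
    and transient: "\<And>i. transient_state (gen_hat Q) (Some i)"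
    and \<alpha>_nonneg: "\<And>i. 0 \<le> \<alpha> $ i" and \<alpha>_sum: "(\<Sum>i\<in>UNIV. \<alpha> $ i) = 1"
    and chains: "\<And>n. n \<ge> 1 \<Longrightarrow> markov_chain M (J n) (gen_hat Q) (init_hat \<alpha>)"
    and T_measurable: "\<And>n. n \<ge> 1 \<Longrightarrow> T n \<in> borel_measurable M"
    and T_nonneg: "\<And>n. n \<ge> 1 \<Longrightarrow> AE w in M. 0 \<le> T n w"
    and T_identical: "\<And>n. n \<ge> 1 \<Longrightarrow> distr M borel (T n) = distr M borel (T 1)"
    and independent: "prob_space.indep_sets M
          (case_sum (\<lambda>n. chain_events M (J n)) (\<lambda>n. rv_events M (T n)))
          (Inl ` {1..} \<union> Inr ` {1..})"
    and log_moment: "integrable M (\<lambda>w. ln (1 + \<bar>absorption_time (J 1) w - T 1 w\<bar>))"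
    and l: "0 < l" "l < 1"
    and spectra: "\<And>n. n \<ge> 1 \<Longrightarrow> Sp (l ^ n *\<^sub>R cmat Q) \<inter> Sp (cmat Q) = {}"
    and exp_phi_nonzero: "\<And>n u. n \<ge> 1 \<Longrightarrow> u \<in> Sp (- (l ^ n *\<^sub>R cmat Q)) \<Longrightarrow>
          exp_phi M l Q \<alpha> T u \<noteq> 0"
    and b: "0 \<le> b"
    and \<rho>: "0 < \<rho>" "\<rho> < 1"
    and x: "x < b"
    and \<delta>: "0 \<le> Re \<delta>" "\<delta> \<notin> Sp (- cmat Q)"
  shows "summable (\<lambda>n. h_term M l Q \<alpha> T \<rho> x (Suc n)) \<and>
         (\<forall>i. summable (\<lambda>n. eta_term M l Q \<alpha> T \<rho> b i (Suc n))) \<and>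
         (\<Sum>i\<in>UNIV. eta M l Q \<alpha> T \<rho> b \<delta> i * complex_of_real (Phi M l J T \<rho> b i x)) =
           h_fun M l Q \<alpha> T \<rho> b \<delta> x"
proof -
  interpret tr: transient_phases Q by unfold_locales (rule transient)
  interpret prob_space M by fact
  interpret spec: ar_spectral M Q J T \<alpha> l b x \<rho>
    by unfold_locales
      (fact \<alpha>_nonneg \<alpha>_sum chains T_measurable T_nonneg T_identical independent log_moment l spectra exp_phi_nonzero b \<rho> x)+
  obtain r0 B C where "spec.admissible r0 B C" using spec.admissible_exists by blast
  then interpret loc0: ar_local M Q J T \<alpha> l b x \<rho> r0 B C by unfold_locales
  \<comment> \<open>shrinking the radius makes \<open>\<phi>1\<close> zero-free on the whole neighbourhood\<close>
  obtain r where r: "spec.admissible r B C" "\<And>u. u \<in> spec.nbhd r \<Longrightarrow> loc0.\<phi>1 u \<noteq> 0"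
    using loc0.admissible_nonzero by blast
  interpret loc: ar_local M Q J T \<alpha> l b x \<rho> r B C by unfold_locales (rule r(1))
  interpret ar_local_nonzero M Q J T \<alpha> l b x \<rho> r B C by unfold_locales (rule r(2))
  show ?thesis
    using expansion_identity[OF \<delta>(2)] h_term_sums eta_term_sums sums_summable by blast
qed

end
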